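(* Let $\Bbbk$ be a field of characteristic zero, $G=\langle g\rangle$ the infinite cyclic group, and $V=\Bbbk\{x_1,x_2\}$ the Yetter–Drinfeld module over $\Bbbk G$ given by $g\cdot x_1=x_1$, $g\cdot x_2=x_2+x_1$, $\delta(x_1)=g\otimes x_1$, $\delta(x_2)=g\otimes x_2$, whose Nichols algebra $\mathfrak{B}(V)$ is the Jordan plane. Let $\mathfrak{U}^{\mathrm{jordan}}$ and $\mathfrak{U}'$ be the algebras defined in the context. Then $\mathfrak{U}'$ is a $(\mathfrak{U}^{\mathrm{jordan}},\mathfrak{B}(V)\#\Bbbk G)$-bigalois extension, and therefore $\mathfrak{U}^{\mathrm{jordan}}$ is a cocycle deformation of $\mathfrak{B}(V)\#\Bbbk G$.
   Context: The Jordan plane is $\mathfrak{B}(V)=T(V)/\langle x_1x_2-x_2x_1-\tfrac12x_1^2\rangle$, and $\mathfrak{B}(V)\#\Bbbk G$ is its bosonization, generated by $g^{\pm1}$ and (writing $z_i$ for $x_i$) $z_1,z_2$, with $gz_1=z_1g$, $gz_2=(z_2+z_1)g$, $\Delta(g)=g\otimes g$, $\Delta(z_i)=z_i\otimes1+g\otimes z_i$. The Jordanian enveloping algebra of $\mathfrak{sl}(2)$, $\mathfrak{U}^{\mathrm{jordan}}$, is the algebra generated by $g^{\pm1},x_1,x_2$ with relations $gg^{-1}=g^{-1}g=1$, $$gx_1=(x_1+1-g)g,\qquad gx_2=(x_2+x_1)g,\qquad x_1x_2-x_2x_1-\tfrac12x_1^2+x_2+\tfrac12x_1=0;$$ it is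 a Hopf algebra with $\Delta(g)=g\otimes g$ and $\Delta(x_i)=x_i\otimes1+g\otimes x_i$, $i=1,2$. $\mathfrak{U}'$ is the algebra generated by $g^{\pm1},y_1,y_2$ with relations $gg^{-1}=g^{-1}g=1$, $$gy_1=(y_1+1)g,\qquad gy_2=(y_2+y_1)g,\qquad y_1y_2-y_2y_1-\tfrac12y_1^2+y_2+\tfrac12y_1=0.$$ Its coactions are the algebra maps induced by $\rho_r(g)=g\otimes g$, $\rho_r(y_i)=y_i\otimes1+g\otimes z_i$ (right, over $\mathfrak{B}(V)\#\Bbbk G$) and $\rho_l(g)=g\otimes g$, $\rho_l(y_i)=x_i\otimes1+g\otimes y_i$ (left, over $\mathfrak{U}^{\mathrm{jordan}}$). For Hopf algebras $L$ and $B$, an $(L,B)$-bigalois extension is a nonzero $(L,B)$-bicomodule algebra $E$ that is both left $L$-Galois and right $B$-Galois with coinvariants $\Bbbk$; the Galois conditions are bijectivity of $E\otimes E\to E\otimes B$, $c\otimes d\mapsto (c\otimes1)\rho_r(d)$, and $E\otimes E\to L\otimes E$, $c\otimes d\mapsto\rho_l(c)(1\otimes d)$. A cocycle deformation of a Hopf algebra $B$ is a Hopf algebra isomorphic to $B$ with multiplication twisted by a convolution-invertible 2-cocycle. *)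

theory Defs
  imports "HOL-Algebra.QuotRing" "HOL-Algebra.Module" "HOL-Library.Poly_Mapping"
begin

section \<open>Algebras over a field\<close>

text \<open>
  The ground field is a type \<open>'k\<close> of class \<^class>\<open>field\<close>; \<open>ground\<close> is the same field as a record,
  at once the scalar ring of the library's modules and the one-dimensional algebra.  Algebras are
  \<^typ>\<open>('k, 'a) module\<close> records, whose underlying ring structure need not be commutative (the
  library's locale \<open>algebra\<close> is about commutative algebras only).
\<close>

definition ground :: "('k::field, 'k) module" where
  "ground = \<lparr>carrier = UNIV, monoid.mult = (*), one = 1, zero = 0, add = (+), smult = (*)\<rparr>"

definition k_algebra :: "('k::field, 'a, 'm) module_scheme \<Rightarrow> bool" where
  "k_algebra A \<longleftrightarrow> ring A \<and> Module.module (ground :: ('k, 'k) module) A \<and>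
    (\<forall>c. \<forall>x\<in>carrier A. \<forall>y\<in>carrier A.
        (c \<odot>\<^bsub>A\<^esub> x) \<otimes>\<^bsub>A\<^esub> y = c \<odot>\<^bsub>A\<^esub> (x \<otimes>\<^bsub>A\<^esub> y) \<and>
        x \<otimes>\<^bsub>A\<^esub> (c \<odot>\<^bsub>A\<^esub> y) = c \<odot>\<^bsub>A\<^esub> (x \<otimes>\<^bsub>A\<^esub> y))"

definition linear_maps ::
  "('k::field, 'a, 'm) module_scheme \<Rightarrow> ('k, 'b, 'n) module_scheme \<Rightarrow> ('a \<Rightarrow> 'b) set" where
  "linear_maps M N = {f. f \<in> carrier M \<rightarrow> carrier N \<and>
     (\<forall>x\<in>carrier M. \<forall>y\<in>carrier M. f (x \<oplus>\<^bsub>M\<^esub> y) = f x \<oplus>\<^bsub>N\<^esub> f y) \<and>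
     (\<forall>c. \<forall>x\<in>carrier M. f (c \<odot>\<^bsub>M\<^esub> x) = c \<odot>\<^bsub>N\<^esub> f x)}"

definition algebra_homs ::
  "('k::field, 'a, 'm) module_scheme \<Rightarrow> ('k, 'b, 'n) module_scheme \<Rightarrow> ('a \<Rightarrow> 'b) set" where
  "algebra_homs A B = ring_hom A B \<inter> linear_maps A B"

text \<open>The library's quotient ring \<open>A Quot I\<close>, with the induced scalar multiplication.\<close>

definition quotient_algebra ::
  "('k::field, 'a, 'm) module_scheme \<Rightarrow> 'a set \<Rightarrow> ('k, 'a set) module" where
  "quotient_algebra A I =
    \<lparr>carrier = carrier (A Quot I), monoid.mult = monoid.mult (A Quot I), one = \<one>\<^bsub>A Quot I\<^esub>,
     zero = \<zero>\<^bsub>A Quot I\<^esub>, add = add (A Quot I),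
     smult = (\<lambda>c X. \<Union>x\<in>X. I +>\<^bsub>A\<^esub> (c \<odot>\<^bsub>A\<^esub> x))\<rparr>"

definition monoid_algebra :: "('m, 'x) monoid_scheme \<Rightarrow> ('k::field, 'm \<Rightarrow>\<^sub>0 'k) module" where
  "monoid_algebra M =
    \<lparr>carrier = {p. Poly_Mapping.keys p \<subseteq> carrier M},
     monoid.mult = (\<lambda>p q. \<Sum>x\<in>Poly_Mapping.keys p. \<Sum>y\<in>Poly_Mapping.keys q.
        Poly_Mapping.single (x \<otimes>\<^bsub>M\<^esub> y) (Poly_Mapping.lookup p x * Poly_Mapping.lookup q y)),
     one = Poly_Mapping.single \<one>\<^bsub>M\<^esub> 1, zero = 0, add = (+),
     smult = (\<lambda>c. Poly_Mapping.map ((*) c))\<rparr>"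


section \<open>Algebras given by generators and relations\<close>

definition free_monoid :: "'s list monoid" where
  "free_monoid = \<lparr>carrier = UNIV, monoid.mult = (@), one = []\<rparr>"

definition free_algebra :: "('k::field, 's list \<Rightarrow>\<^sub>0 'k) module" where
  "free_algebra = monoid_algebra free_monoid"

definition free_gen :: "'s \<Rightarrow> 's list \<Rightarrow>\<^sub>0 'k::field" where
  "free_gen s = Poly_Mapping.single [s] 1"

definition presented_algebra ::
  "('s list \<Rightarrow>\<^sub>0 'k::field) set \<Rightarrow> ('k, ('s list \<Rightarrow>\<^sub>0 'k) set) module" where
  "presented_algebra R = quotient_algebra free_algebra (Idl\<^bsub>free_algebra\<^esub> R)"

definition gen_class :: "('s list \<Rightarrow>\<^sub>0 'k::field) set \<Rightarrow> 's \<Rightarrow> ('s list \<Rightarrow>\<^sub>0 'k) set" where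
  "gen_class R s = Idl\<^bsub>free_algebra\<^esub> R +>\<^bsub>free_algebra\<^esub> free_gen s"

definition free_eval ::
  "('k::field, 'a, 'm) module_scheme \<Rightarrow> ('s \<Rightarrow> 'a) \<Rightarrow> ('s list \<Rightarrow>\<^sub>0 'k) \<Rightarrow> 'a" where
  "free_eval A \<phi> p = (\<Oplus>\<^bsub>A\<^esub>w\<in>Poly_Mapping.keys p.
      Poly_Mapping.lookup p w \<odot>\<^bsub>A\<^esub> foldr (\<lambda>s a. \<phi> s \<otimes>\<^bsub>A\<^esub> a) w \<one>\<^bsub>A\<^esub>)"

text \<open>
  The algebra map from a presented algebra that sends the class of each generator \<open>s\<close> to \<open>\<phi> s\<close>: the
  common value of \<open>free_eval A \<phi>\<close> on a coset.  It is meaningful when \<open>\<phi>\<close> respects the relations.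
\<close>

definition induced_map ::
  "('k::field, 'a, 'm) module_scheme \<Rightarrow> ('s \<Rightarrow> 'a) \<Rightarrow> ('s list \<Rightarrow>\<^sub>0 'k) set \<Rightarrow> 'a" where
  "induced_map A \<phi> X = the_elem (free_eval A \<phi> ` X)"


section \<open>Tensor products\<close>

text \<open>
  The tensor product is the free vector space on \<open>carrier A \<times> carrier B\<close> modulo the linear span of
  the bilinearity relators.  Its product \<open>(a \<otimes> b)(c \<otimes> d) = ac \<otimes> bd\<close> comes from the monoid algebra of
  \<open>A \<times>\<times> B\<close>; the underlying vector space does not depend on the products of \<open>A\<close> and \<open>B\<close>.
\<close>

definition linear_span :: "('k::field, 'a, 'm) module_scheme \<Rightarrow> 'a set \<Rightarrow> 'a set" where
  "linear_span M S = \<Inter>{H. submodule H (ground :: ('k, 'k) module) M \<and> S \<subseteq> H}"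

definition bilinear_relators ::
  "('k::field, 'a, 'm) module_scheme \<Rightarrow> ('k, 'b, 'n) module_scheme \<Rightarrow> ('a \<times> 'b \<Rightarrow>\<^sub>0 'k) set" where
  "bilinear_relators A B =
    {Poly_Mapping.single (a \<oplus>\<^bsub>A\<^esub> a', b) 1 - Poly_Mapping.single (a, b) 1 - Poly_Mapping.single (a', b) 1
        | a a' b. a \<in> carrier A \<and> a' \<in> carrier A \<and> b \<in> carrier B} \<union>
    {Poly_Mapping.single (a, b \<oplus>\<^bsub>B\<^esub> b') 1 - Poly_Mapping.single (a, b) 1 - Poly_Mapping.single (a, b') 1
        | a b b'. a \<in> carrier A \<and> b \<in> carrier B \<and> b' \<in> carrier B} \<union>
    {Poly_Mapping.single (c \<odot>\<^bsub>A\<^esub> a, b) 1 - Poly_Mapping.single (a, b) c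
        | a b c. a \<in> carrier A \<and> b \<in> carrier B} \<union>
    {Poly_Mapping.single (a, c \<odot>\<^bsub>B\<^esub> b) 1 - Poly_Mapping.single (a, b) c
        | a b c. a \<in> carrier A \<and> b \<in> carrier B}"

definition tensor_null ::
  "('k::field, 'a, 'm) module_scheme \<Rightarrow> ('k, 'b, 'n) module_scheme \<Rightarrow> ('a \<times> 'b \<Rightarrow>\<^sub>0 'k) set" where
  "tensor_null A B = linear_span (monoid_algebra (A \<times>\<times> B)) (bilinear_relators A B)"

definition tensor ::
  "('k::field, 'a, 'm) module_scheme \<Rightarrow> ('k, 'b, 'n) module_scheme \<Rightarrow> ('k, ('a \<times> 'b \<Rightarrow>\<^sub>0 'k) set) module"
  where "tensor A B = quotient_algebra (monoid_algebra (A \<times>\<times> B)) (tensor_null A B)"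

definition pure_tensor ::
  "('k::field, 'a, 'm) module_scheme \<Rightarrow> ('k, 'b, 'n) module_scheme \<Rightarrow> 'a \<Rightarrow> 'b \<Rightarrow> ('a \<times> 'b \<Rightarrow>\<^sub>0 'k) set"
  where "pure_tensor A B a b =
    tensor_null A B +>\<^bsub>monoid_algebra (A \<times>\<times> B)\<^esub> Poly_Mapping.single (a, b) 1"

text \<open>
  The linear map \<open>A \<otimes> B \<rightarrow> N\<close> with \<open>a \<otimes> b \<mapsto> f a b\<close>, for \<open>f\<close> bilinear: the common value, on the
  coset \<open>X\<close>, of the linear extension of \<open>f\<close> to the free vector space.
\<close>

definition tensor_lift ::
  "('k::field, 'c, 'm) module_scheme \<Rightarrow> ('a \<Rightarrow> 'b \<Rightarrow> 'c) \<Rightarrow> ('a \<times> 'b \<Rightarrow>\<^sub>0 'k) set \<Rightarrow> 'c" where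
  "tensor_lift N f X = the_elem ((\<lambda>p. \<Oplus>\<^bsub>N\<^esub>u\<in>Poly_Mapping.keys p.
      Poly_Mapping.lookup p u \<odot>\<^bsub>N\<^esub> f (fst u) (snd u)) ` X)"

text \<open>\<open>tensor_map C D f g\<close> is \<open>f \<otimes> g\<close>, with values in \<open>C \<otimes> D\<close>.\<close>

definition tensor_map ::
  "('k::field, 'c, 'm) module_scheme \<Rightarrow> ('k, 'd, 'n) module_scheme \<Rightarrow> ('a \<Rightarrow> 'c) \<Rightarrow> ('b \<Rightarrow> 'd) \<Rightarrow>
    ('a \<times> 'b \<Rightarrow>\<^sub>0 'k) set \<Rightarrow> ('c \<times> 'd \<Rightarrow>\<^sub>0 'k) set" where
  "tensor_map C D f g = tensor_lift (tensor C D) (\<lambda>a b. pure_tensor C D (f a) (g b))"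

text \<open>The canonical map \<open>(A \<otimes> B) \<otimes> C \<rightarrow> A \<otimes> (B \<otimes> C)\<close>.\<close>

definition tensor_assoc ::
  "('k::field, 'a, 'l) module_scheme \<Rightarrow> ('k, 'b, 'm) module_scheme \<Rightarrow> ('k, 'c, 'n) module_scheme \<Rightarrow>
    (('a \<times> 'b \<Rightarrow>\<^sub>0 'k) set \<times> 'c \<Rightarrow>\<^sub>0 'k) set \<Rightarrow> ('a \<times> ('b \<times> 'c \<Rightarrow>\<^sub>0 'k) set \<Rightarrow>\<^sub>0 'k) set" where
  "tensor_assoc A B C = (let T = tensor A (tensor B C) in
    tensor_lift T (\<lambda>u c. tensor_lift T
      (\<lambda>a b. pure_tensor A (tensor B C) a (pure_tensor B C b c)) u))"


section \<open>Hopf algebras\<close>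

record (overloaded) ('k::field, 'a) bialgebra = "('k, 'a) module" +
  comult :: "'a \<Rightarrow> ('a \<times> 'a \<Rightarrow>\<^sub>0 'k) set"
  counit :: "'a \<Rightarrow> 'k"

definition is_bialgebra :: "('k::field, 'a, 'm) bialgebra_scheme \<Rightarrow> bool" where
  "is_bialgebra B \<longleftrightarrow> k_algebra B \<and>
    comult B \<in> algebra_homs B (tensor B B) \<and> counit B \<in> algebra_homs B ground \<and>
    (\<forall>x\<in>carrier B.
       tensor_assoc B B B (tensor_map (tensor B B) B (comult B) id (comult B x)) =
         tensor_map B (tensor B B) id (comult B) (comult B x) \<and>
       tensor_lift B (\<lambda>a b. counit B a \<odot>\<^bsub>B\<^esub> b) (comult B x) = x \<and>
       tensor_lift B (\<lambda>a b. counit B b \<odot>\<^bsub>B\<^esub> a) (comult B x) = x)"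

text \<open>
  \<open>sweedler B N f x\<close> is the Sweedler sum of \<open>f(x\<^sub>(\<^sub>1\<^sub>), x\<^sub>(\<^sub>2\<^sub>))\<close> in \<open>N\<close>, for \<open>f\<close> bilinear.
\<close>

definition sweedler ::
  "('k::field, 'a, 'm) bialgebra_scheme \<Rightarrow> ('k, 'c, 'n) module_scheme \<Rightarrow> ('a \<Rightarrow> 'a \<Rightarrow> 'c) \<Rightarrow> 'a \<Rightarrow> 'c" where
  "sweedler B N f x = tensor_lift N f (comult B x)"

text \<open>The antipode is unique when it exists, so that it need not be part of the data.\<close>

definition is_hopf_algebra :: "('k::field, 'a, 'm) bialgebra_scheme \<Rightarrow> bool" where
  "is_hopf_algebra B \<longleftrightarrow> is_bialgebra B \<and>
    (\<exists>S\<in>linear_maps B B. \<forall>x\<in>carrier B.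
       sweedler B B (\<lambda>a b. S a \<otimes>\<^bsub>B\<^esub> b) x = counit B x \<odot>\<^bsub>B\<^esub> \<one>\<^bsub>B\<^esub> \<and>
       sweedler B B (\<lambda>a b. a \<otimes>\<^bsub>B\<^esub> S b) x = counit B x \<odot>\<^bsub>B\<^esub> \<one>\<^bsub>B\<^esub>)"

text \<open>Isomorphisms of Hopf algebras; they automatically commute with the antipodes.\<close>

definition hopf_isos ::
  "('k::field, 'a, 'm) bialgebra_scheme \<Rightarrow> ('k, 'b, 'n) bialgebra_scheme \<Rightarrow> ('a \<Rightarrow> 'b) set" where
  "hopf_isos A B = {h \<in> algebra_homs A B. bij_betw h (carrier A) (carrier B) \<and>
     (\<forall>x\<in>carrier A. comult B (h x) = tensor_map B B h h (comult A x) \<and>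
        counit B (h x) = counit A x)}"


section \<open>Bigalois extensions\<close>

definition right_comodule_algebra ::
  "('k::field, 'b, 'm) bialgebra_scheme \<Rightarrow> ('k, 'e, 'n) module_scheme \<Rightarrow>
    ('e \<Rightarrow> ('e \<times> 'b \<Rightarrow>\<^sub>0 'k) set) \<Rightarrow> bool" where
  "right_comodule_algebra B E \<rho> \<longleftrightarrow> k_algebra E \<and> \<rho> \<in> algebra_homs E (tensor E B) \<and>
    (\<forall>e\<in>carrier E.
       tensor_assoc E B B (tensor_map (tensor E B) B \<rho> id (\<rho> e)) =
         tensor_map E (tensor B B) id (comult B) (\<rho> e) \<and>
       tensor_lift E (\<lambda>d b. counit B b \<odot>\<^bsub>E\<^esub> d) (\<rho> e) = e)"

definition left_comodule_algebra ::
  "('k::field, 'l, 'm) bialgebra_scheme \<Rightarrow> ('k, 'e, 'n) module_scheme \<Rightarrow>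
    ('e \<Rightarrow> ('l \<times> 'e \<Rightarrow>\<^sub>0 'k) set) \<Rightarrow> bool" where
  "left_comodule_algebra L E \<rho> \<longleftrightarrow> k_algebra E \<and> \<rho> \<in> algebra_homs E (tensor L E) \<and>
    (\<forall>e\<in>carrier E.
       tensor_assoc L L E (tensor_map (tensor L L) E (comult L) id (\<rho> e)) =
         tensor_map L (tensor L E) id \<rho> (\<rho> e) \<and>
       tensor_lift E (\<lambda>l d. counit L l \<odot>\<^bsub>E\<^esub> d) (\<rho> e) = e)"

definition bicomodule_algebra ::
  "('k::field, 'l, 'm) bialgebra_scheme \<Rightarrow> ('k, 'b, 'n) bialgebra_scheme \<Rightarrow>
    ('k, 'e, 'o) module_scheme \<Rightarrow> ('e \<Rightarrow> ('l \<times> 'e \<Rightarrow>\<^sub>0 'k) set) \<Rightarrow> ('e \<Rightarrow> ('e \<times> 'b \<Rightarrow>\<^sub>0 'k) set) \<Rightarrow> bool"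
  where "bicomodule_algebra L B E \<rho>l \<rho>r \<longleftrightarrow>
    left_comodule_algebra L E \<rho>l \<and> right_comodule_algebra B E \<rho>r \<and>
    (\<forall>e\<in>carrier E. tensor_assoc L E B (tensor_map (tensor L E) B \<rho>l id (\<rho>r e)) =
       tensor_map L (tensor E B) id \<rho>r (\<rho>l e))"

definition right_galois ::
  "('k::field, 'b, 'm) bialgebra_scheme \<Rightarrow> ('k, 'e, 'n) module_scheme \<Rightarrow>
    ('e \<Rightarrow> ('e \<times> 'b \<Rightarrow>\<^sub>0 'k) set) \<Rightarrow> bool" where
  "right_galois B E \<rho> \<longleftrightarrow>
    {e \<in> carrier E. \<rho> e = pure_tensor E B e \<one>\<^bsub>B\<^esub>} = {c \<odot>\<^bsub>E\<^esub> \<one>\<^bsub>E\<^esub> | c. True} \<and>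
    bij_betw (tensor_lift (tensor E B) (\<lambda>c d. pure_tensor E B c \<one>\<^bsub>B\<^esub> \<otimes>\<^bsub>tensor E B\<^esub> \<rho> d))
      (carrier (tensor E E)) (carrier (tensor E B))"

definition left_galois ::
  "('k::field, 'l, 'm) bialgebra_scheme \<Rightarrow> ('k, 'e, 'n) module_scheme \<Rightarrow>
    ('e \<Rightarrow> ('l \<times> 'e \<Rightarrow>\<^sub>0 'k) set) \<Rightarrow> bool" where
  "left_galois L E \<rho> \<longleftrightarrow>
    {e \<in> carrier E. \<rho> e = pure_tensor L E \<one>\<^bsub>L\<^esub> e} = {c \<odot>\<^bsub>E\<^esub> \<one>\<^bsub>E\<^esub> | c. True} \<and>
    bij_betw (tensor_lift (tensor L E) (\<lambda>c d. \<rho> c \<otimes>\<^bsub>tensor L E\<^esub> pure_tensor L E \<one>\<^bsub>L\<^esub> d))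
      (carrier (tensor E E)) (carrier (tensor L E))"

definition bigalois_extension ::
  "('k::field, 'l, 'm) bialgebra_scheme \<Rightarrow> ('k, 'b, 'n) bialgebra_scheme \<Rightarrow>
    ('k, 'e, 'o) module_scheme \<Rightarrow> ('e \<Rightarrow> ('l \<times> 'e \<Rightarrow>\<^sub>0 'k) set) \<Rightarrow> ('e \<Rightarrow> ('e \<times> 'b \<Rightarrow>\<^sub>0 'k) set) \<Rightarrow> bool"
  where "bigalois_extension L B E \<rho>l \<rho>r \<longleftrightarrow>
    is_hopf_algebra L \<and> is_hopf_algebra B \<and> bicomodule_algebra L B E \<rho>l \<rho>r \<and>
    carrier E \<noteq> {\<zero>\<^bsub>E\<^esub>} \<and> left_galois L E \<rho>l \<and> right_galois B E \<rho>r"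


section \<open>Cocycle deformations\<close>

text \<open>Linear forms on \<open>B \<otimes> B\<close> are represented by bilinear forms on \<open>B\<close>.\<close>

definition bilinear_forms :: "('k::field, 'a, 'm) module_scheme \<Rightarrow> ('a \<Rightarrow> 'a \<Rightarrow> 'k) set" where
  "bilinear_forms B = {\<sigma>. (\<forall>x\<in>carrier B. \<sigma> x \<in> linear_maps B ground) \<and>
     (\<forall>y\<in>carrier B. (\<lambda>x. \<sigma> x y) \<in> linear_maps B ground)}"

definition convolution ::
  "('k::field, 'a, 'm) bialgebra_scheme \<Rightarrow> ('a \<Rightarrow> 'a \<Rightarrow> 'k) \<Rightarrow> ('a \<Rightarrow> 'a \<Rightarrow> 'k) \<Rightarrow> 'a \<Rightarrow> 'a \<Rightarrow> 'k" where
  "convolution B \<sigma> \<tau> x y =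
    sweedler B ground (\<lambda>x1 x2. sweedler B ground (\<lambda>y1 y2. \<sigma> x1 y1 * \<tau> x2 y2) y) x"

definition convolution_inverse ::
  "('k::field, 'a, 'm) bialgebra_scheme \<Rightarrow> ('a \<Rightarrow> 'a \<Rightarrow> 'k) \<Rightarrow> ('a \<Rightarrow> 'a \<Rightarrow> 'k) \<Rightarrow> bool" where
  "convolution_inverse B \<sigma> \<tau> \<longleftrightarrow> \<tau> \<in> bilinear_forms B \<and>
    (\<forall>x\<in>carrier B. \<forall>y\<in>carrier B.
       convolution B \<sigma> \<tau> x y = counit B x * counit B y \<and>
       convolution B \<tau> \<sigma> x y = counit B x * counit B y)"

text \<open>
  Normalized (left) 2-cocycles:
  \<open>\<sigma>(x\<^sub>(\<^sub>1\<^sub>), y\<^sub>(\<^sub>1\<^sub>)) \<sigma>(x\<^sub>(\<^sub>2\<^sub>) y\<^sub>(\<^sub>2\<^sub>), z) = \<sigma>(y\<^sub>(\<^sub>1\<^sub>), z\<^sub>(\<^sub>1\<^sub>)) \<sigma>(x, y\<^sub>(\<^sub>2\<^sub>) z\<^sub>(\<^sub>2\<^sub>))\<close>.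
\<close>

definition two_cocycle ::
  "('k::field, 'a, 'm) bialgebra_scheme \<Rightarrow> ('a \<Rightarrow> 'a \<Rightarrow> 'k) \<Rightarrow> bool" where
  "two_cocycle B \<sigma> \<longleftrightarrow> \<sigma> \<in> bilinear_forms B \<and>
    (\<forall>x\<in>carrier B. \<sigma> x \<one>\<^bsub>B\<^esub> = counit B x \<and> \<sigma> \<one>\<^bsub>B\<^esub> x = counit B x) \<and>
    (\<forall>x\<in>carrier B. \<forall>y\<in>carrier B. \<forall>z\<in>carrier B.
       sweedler B ground (\<lambda>x1 x2. sweedler B ground
         (\<lambda>y1 y2. \<sigma> x1 y1 * \<sigma> (x2 \<otimes>\<^bsub>B\<^esub> y2) z) y) x =
       sweedler B ground (\<lambda>y1 y2. sweedler B ground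
         (\<lambda>z1 z2. \<sigma> y1 z1 * \<sigma> x (y2 \<otimes>\<^bsub>B\<^esub> z2)) z) y)"

text \<open>
  The product \<open>x \<cdot> y = \<sigma>(x\<^sub>(\<^sub>1\<^sub>), y\<^sub>(\<^sub>1\<^sub>)) x\<^sub>(\<^sub>2\<^sub>) y\<^sub>(\<^sub>2\<^sub>) \<tau>(x\<^sub>(\<^sub>3\<^sub>), y\<^sub>(\<^sub>3\<^sub>))\<close>, where \<open>\<tau>\<close> is the convolution inverse of
  \<open>\<sigma>\<close>; \<open>x'\<close> and \<open>y'\<close> below carry the factors 2 and 3.  Unit, comultiplication and counit are those of \<open>B\<close>.
\<close>

definition cocycle_twist ::
  "('k::field, 'a) bialgebra \<Rightarrow> ('a \<Rightarrow> 'a \<Rightarrow> 'k) \<Rightarrow> ('a \<Rightarrow> 'a \<Rightarrow> 'k) \<Rightarrow> ('k, 'a) bialgebra" where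
  "cocycle_twist B \<sigma> \<tau> = B\<lparr>monoid.mult := (\<lambda>x y.
     sweedler B B (\<lambda>x1 x'. sweedler B B (\<lambda>x2 x3.
       sweedler B B (\<lambda>y1 y'. sweedler B B (\<lambda>y2 y3.
         (\<sigma> x1 y1 * \<tau> x3 y3) \<odot>\<^bsub>B\<^esub> (x2 \<otimes>\<^bsub>B\<^esub> y2)) y') y) x') x)\<rparr>"

definition cocycle_deformation ::
  "('k::field, 'l, 'm) bialgebra_scheme \<Rightarrow> ('k, 'a) bialgebra \<Rightarrow> bool" where
  "cocycle_deformation L B \<longleftrightarrow> is_hopf_algebra L \<and> is_hopf_algebra B \<and>
    (\<exists>\<sigma> \<tau>. two_cocycle B \<sigma> \<and> convolution_inverse B \<sigma> \<tau> \<and>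
       hopf_isos L (cocycle_twist B \<sigma> \<tau>) \<noteq> {})"


section \<open>The Jordan plane, its bosonization and the Jordanian enveloping algebra\<close>

text \<open>Generators \<open>g\<close>, \<open>g\<^sup>-\<^sup>1\<close>, and \<open>x\<^sub>1, x\<^sub>2\<close> (also called \<open>z\<^sub>1, z\<^sub>2\<close> or \<open>y\<^sub>1, y\<^sub>2\<close>).\<close>

datatype gen = Gen_g | Gen_g_inv | Gen_x1 | Gen_x2

context
  fixes A :: "('k::field_char_0, 'a, 'm) module_scheme" (structure)
    and g g' x1 x2 :: 'a
begin

definition group_relators :: "'a set" where
  "group_relators = {g \<otimes> g' \<ominus> \<one>, g' \<otimes> g \<ominus> \<one>}"

text \<open>The element defining the Jordan plane as a quotient of the tensor algebra of \<open>V\<close>.\<close>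

definition jordan_plane_relator :: "'a" where
  "jordan_plane_relator = x1 \<otimes> x2 \<ominus> x2 \<otimes> x1 \<ominus> (1/2) \<odot> (x1 \<otimes> x1)"

text \<open>
  In the bosonization, \<open>g v = (g \<cdot> v) g\<close> for \<open>v\<close> in \<open>V\<close>, where \<open>g \<cdot> x\<^sub>1 = x\<^sub>1\<close> and \<open>g \<cdot> x\<^sub>2 = x\<^sub>2 + x\<^sub>1\<close>.
\<close>

definition jordan_bosonization_relators :: "'a set" where
  "jordan_bosonization_relators = group_relators \<union>
    {g \<otimes> x1 \<ominus> x1 \<otimes> g, g \<otimes> x2 \<ominus> (x2 \<oplus> x1) \<otimes> g, jordan_plane_relator}"

definition U_jordan_relators :: "'a set" where
  "U_jordan_relators = group_relators \<union>
    {g \<otimes> x1 \<ominus> (x1 \<oplus> \<one> \<ominus> g) \<otimes> g, g \<otimes> x2 \<ominus> (x2 \<oplus> x1) \<otimes> g,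
     x1 \<otimes> x2 \<ominus> x2 \<otimes> x1 \<ominus> (1/2) \<odot> (x1 \<otimes> x1) \<oplus> x2 \<oplus> (1/2) \<odot> x1}"

definition U'_relators :: "'a set" where
  "U'_relators = group_relators \<union>
    {g \<otimes> x1 \<ominus> (x1 \<oplus> \<one>) \<otimes> g, g \<otimes> x2 \<ominus> (x2 \<oplus> x1) \<otimes> g,
     x1 \<otimes> x2 \<ominus> x2 \<otimes> x1 \<ominus> (1/2) \<odot> (x1 \<otimes> x1) \<oplus> x2 \<oplus> (1/2) \<odot> x1}"

end

type_synonym 'k word_poly = "gen list \<Rightarrow>\<^sub>0 'k"

definition bosonization_ideal_gens :: "'k::field_char_0 word_poly set" where
  "bosonization_ideal_gens = jordan_bosonization_relators free_algebra
     (free_gen Gen_g) (free_gen Gen_g_inv) (free_gen Gen_x1) (free_gen Gen_x2)"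

definition U_jordan_ideal_gens :: "'k::field_char_0 word_poly set" where
  "U_jordan_ideal_gens = U_jordan_relators free_algebra
     (free_gen Gen_g) (free_gen Gen_g_inv) (free_gen Gen_x1) (free_gen Gen_x2)"

definition U'_ideal_gens :: "'k::field_char_0 word_poly set" where
  "U'_ideal_gens = U'_relators free_algebra
     (free_gen Gen_g) (free_gen Gen_g_inv) (free_gen Gen_x1) (free_gen Gen_x2)"

text \<open>
  The assignment \<open>g\<^sup>\<plusminus>\<^sup>1 \<mapsto> g\<^sup>\<plusminus>\<^sup>1 \<otimes> g\<^sup>\<plusminus>\<^sup>1\<close>, \<open>x\<^sub>i \<mapsto> u\<^sub>i \<otimes> 1 + g \<otimes> v\<^sub>i\<close> into \<open>P \<otimes> Q\<close>, where \<open>u\<close> and \<open>v\<close> are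
  the families of generators of \<open>P\<close> and \<open>Q\<close>.  It yields the comultiplications and both coactions.
\<close>

definition coaction_on_gens ::
  "('k::field, 'a, 'm) module_scheme \<Rightarrow> (gen \<Rightarrow> 'a) \<Rightarrow> ('k, 'b, 'n) module_scheme \<Rightarrow> (gen \<Rightarrow> 'b) \<Rightarrow>
    gen \<Rightarrow> ('a \<times> 'b \<Rightarrow>\<^sub>0 'k) set" where
  "coaction_on_gens P u Q v s =
    (if s = Gen_g \<or> s = Gen_g_inv then pure_tensor P Q (u s) (v s)
     else pure_tensor P Q (u s) \<one>\<^bsub>Q\<^esub> \<oplus>\<^bsub>tensor P Q\<^esub> pure_tensor P Q (u Gen_g) (v s))"

text \<open>The presented algebra with this comultiplication, and the counit that it forces.\<close>

definition presented_bialgebra ::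
  "'k::field word_poly set \<Rightarrow> ('k, 'k word_poly set) bialgebra" where
  "presented_bialgebra R = (let P = presented_algebra R; u = gen_class R in
    \<lparr>carrier = carrier P, monoid.mult = monoid.mult P, one = \<one>\<^bsub>P\<^esub>, zero = \<zero>\<^bsub>P\<^esub>,
     add = add P, smult = smult P,
     comult = induced_map (tensor P P) (coaction_on_gens P u P u),
     counit = induced_map ground (\<lambda>s. if s = Gen_g \<or> s = Gen_g_inv then 1 else 0)\<rparr>)"

definition jordan_bosonization :: "('k::field_char_0, 'k word_poly set) bialgebra" where
  "jordan_bosonization = presented_bialgebra bosonization_ideal_gens"

definition U_jordan :: "('k::field_char_0, 'k word_poly set) bialgebra" where
  "U_jordan = presented_bialgebra U_jordan_ideal_gens"

definition U' :: "('k::field_char_0, 'k word_poly set) module" where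
  "U' = presented_algebra U'_ideal_gens"

definition U'_right_coaction ::
  "'k::field_char_0 word_poly set \<Rightarrow> ('k word_poly set \<times> 'k word_poly set \<Rightarrow>\<^sub>0 'k) set" where
  "U'_right_coaction = induced_map (tensor U' jordan_bosonization)
     (coaction_on_gens U' (gen_class U'_ideal_gens)
        jordan_bosonization (gen_class bosonization_ideal_gens))"

definition U'_left_coaction ::
  "'k::field_char_0 word_poly set \<Rightarrow> ('k word_poly set \<times> 'k word_poly set \<Rightarrow>\<^sub>0 'k) set" where
  "U'_left_coaction = induced_map (tensor U_jordan U')
     (coaction_on_gens U_jordan (gen_class U_jordan_ideal_gens)
        U' (gen_class U'_ideal_gens))"

end

theory Submission
  imports Defs
begin

text \<open>
  The algebra \<open>A(s, t)\<close> generated by \<open>g\<^sup>\<plusminus>\<^sup>1, x\<^sub>1, x\<^sub>2\<close> with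
  \<open>g x\<^sub>1 = (x\<^sub>1 + s - t g) g\<close>, \<open>g x\<^sub>2 = (x\<^sub>2 + x\<^sub>1) g\<close> and
  \<open>x\<^sub>1 x\<^sub>2 - x\<^sub>2 x\<^sub>1 - x\<^sub>1\<^sup>2/2 + s (x\<^sub>2 + x\<^sub>1/2) = 0\<close> is the bosonization, \<open>U'\<close> and \<open>U_jordan\<close> for \<open>(s, t)\<close> equal to
  \<open>(0, 0)\<close>, \<open>(1, 0)\<close> and \<open>(1, 1)\<close>.  The formula \<open>x\<^sub>i \<mapsto> x\<^sub>i \<otimes> 1 + g \<otimes> x\<^sub>i\<close> defines algebra maps
  \<open>A(s, t) \<rightarrow> A(s, u) \<otimes> A(u, t)\<close>, and \<open>x\<^sub>i \<mapsto> - g\<^sup>-\<^sup>1 x\<^sub>i\<close> anti-homomorphisms \<open>A(s, t) \<rightarrow> A(t, s)\<close>: the algebras form a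
  cogroupoid.  As in a Hopf algebra, the antipodes invert the canonical maps, so that \<open>A(1, 0)\<close> is bigalois
  once it is not zero.  For the cocycle it suffices to have functionals \<open>\<alpha>\<close> on \<open>A(1, 0)\<close> and \<open>\<beta>\<close> on \<open>A(0, 1)\<close> with
  \<open>\<alpha> * \<beta> = \<epsilon>\<close> and \<open>\<beta> * \<alpha> = \<epsilon>\<close>.  They are matrix coefficients of explicit representations on functions of an integer
  variable, in which \<open>g\<close> acts as a shift; these also show that \<open>A(1, 0)\<close> is not zero, without a PBW basis.
\<close>

section \<open>Vector spaces\<close>

text \<open>No algebra map from A(1, 0) to the ground field exists: g x1 = (x1 + 1) g would force g
  to 0, although g is invertible. So \<alpha> and \<beta> cannot be characters and are sought among
  matrix coefficients. They still give a cocycle: x \<mapsto> \<beta>(x(1)) x(2) is an isomorphism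
  of right comodules from A(0, 0) to A(1, 0), with inverse e \<mapsto> \<alpha>(e(1)) e(2). The
  product of A(1, 0), pulled back along it, is \<sigma>(x(1), y(1)) x(2) y(2), and the cocycle
  identity is the associativity of A(1, 0).

  The shape of the proof is dictated by the encoding of tensors as cosets of formal sums. A Sweedler
  sum has no chosen summands; it is the value of a linear map at a coset, and every rearrangement
  (exchange of sums, coassociativity, moving a map inside) requires the inner expression to be
  linear in each of its variables. The calculations are therefore written with convolution products
  wherever possible: the bookkeeping is then concentrated in the associativity of convolution in one
  and in two variables, and the remaining arguments are cancellations of inverse factors.\<close>

abbreviation k_module :: "('k::field, 'a, 'm) module_scheme \<Rightarrow> bool" where
  "k_module M \<equiv> Module.module (ground :: ('k, 'k) module) M"

lemma ground_simps [simp]: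
  "carrier ground = UNIV" "x \<otimes>\<^bsub>ground\<^esub> y = x * y" "\<one>\<^bsub>ground\<^esub> = 1" "\<zero>\<^bsub>ground\<^esub> = 0"
  "x \<oplus>\<^bsub>ground\<^esub> y = x + y" "c \<odot>\<^bsub>ground\<^esub> x = c * x"
  by (simp_all add: ground_def)

lemma cring_ground: "cring (ground :: ('k::field, 'k) module)"
  by (rule cringI, rule abelian_groupI) (auto intro!: comm_monoidI exI[of _ "- x" for x] simp: algebra_simps)

lemma k_module_ground: "k_module (ground :: ('k::field, 'k) module)"
  by (rule moduleI) (auto simp: cring_ground cring.axioms(1) ring.is_abelian_group algebra_simps)

context
  fixes M :: "('k::field, 'a, 'm) module_scheme" (structure)
  assumes M: "k_module M"
begin

interpretation Module.module ground M by (rule M)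

lemma km_abelian_group: "abelian_group M" ..

lemma km_add_closed: "x \<in> carrier M \<Longrightarrow> y \<in> carrier M \<Longrightarrow> x \<oplus> y \<in> carrier M" by simp
lemma km_zero_closed: "\<zero> \<in> carrier M" by simp
lemma km_smult_closed: "x \<in> carrier M \<Longrightarrow> c \<odot> x \<in> carrier M" by simp
lemma km_l_zero: "x \<in> carrier M \<Longrightarrow> \<zero> \<oplus> x = x" by simp
lemma km_r_zero: "x \<in> carrier M \<Longrightarrow> x \<oplus> \<zero> = x" by simp
lemma km_a_assoc: "x \<in> carrier M \<Longrightarrow> y \<in> carrier M \<Longrightarrow> z \<in> carrier M \<Longrightarrow> (x \<oplus> y) \<oplus> z = x \<oplus> (y \<oplus> z)"
  by (rule M.a_assoc)
lemma km_a_comm: "x \<in> carrier M \<Longrightarrow> y \<in> carrier M \<Longrightarrow> x \<oplus> y = y \<oplus> x" by (rule M.a_comm)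
lemma km_a_lcomm: "x \<in> carrier M \<Longrightarrow> y \<in> carrier M \<Longrightarrow> z \<in> carrier M \<Longrightarrow> x \<oplus> (y \<oplus> z) = y \<oplus> (x \<oplus> z)"
  by (rule M.a_lcomm)
lemma km_smult_l_distr: "x \<in> carrier M \<Longrightarrow> (c + d) \<odot> x = c \<odot> x \<oplus> d \<odot> x"
  using smult_l_distr[of c d x] by simp
lemma km_smult_r_distr: "x \<in> carrier M \<Longrightarrow> y \<in> carrier M \<Longrightarrow> c \<odot> (x \<oplus> y) = c \<odot> x \<oplus> c \<odot> y"
  using smult_r_distr[of c x y] by simp
lemma km_smult_assoc: "x \<in> carrier M \<Longrightarrow> c \<odot> (d \<odot> x) = (c * d) \<odot> x"
  using smult_assoc1[of c d x] by simp
lemma km_smult_one: "x \<in> carrier M \<Longrightarrow> 1 \<odot> x = x"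
  using smult_one[of x] by simp
lemma km_smult_zero: "c \<odot> \<zero> = \<zero>" by simp
lemma km_zero_smult: "x \<in> carrier M \<Longrightarrow> 0 \<odot> x = \<zero>"
  using smult_l_null[of x] by simp
lemma km_neg: "x \<in> carrier M \<Longrightarrow> \<ominus> x = (- 1) \<odot> x"
  by (metis M.minus_equality add.left_inverse km_smult_closed km_smult_l_distr km_smult_one km_zero_smult)
lemma km_minus: "x \<in> carrier M \<Longrightarrow> y \<in> carrier M \<Longrightarrow> x \<ominus> y = x \<oplus> (- 1) \<odot> y"
  by (simp add: a_minus_def km_neg)
lemma km_minus_closed: "x \<in> carrier M \<Longrightarrow> y \<in> carrier M \<Longrightarrow> x \<ominus> y \<in> carrier M" by simp
lemma km_eq_iff: "x \<in> carrier M \<Longrightarrow> y \<in> carrier M \<Longrightarrow> x = y \<longleftrightarrow> x \<ominus> y = \<zero>"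
proof
  assume x: "x \<in> carrier M" "y \<in> carrier M" and eq: "x \<ominus> y = \<zero>"
  have "x = x \<oplus> (- 1 + 1) \<odot> y" using x km_zero_smult by simp
  also have "\<dots> = (x \<ominus> y) \<oplus> y"
    using x by (simp only: km_smult_l_distr km_minus km_smult_one km_a_assoc km_smult_closed)
  finally show "x = y" using x eq by simp
qed (simp add: a_minus_def M.r_neg)

end

lemmas km_closed [simp] = km_add_closed km_zero_closed km_smult_closed km_minus_closed
lemmas km_simps [simp] = km_l_zero km_r_zero km_smult_zero km_zero_smult km_smult_one km_smult_assoc

text \<open>Additive inverses are supplied by the scalar -1, so the axioms to check are those of
  addition, zero and scaling only.\<close>

lemma k_moduleI:
  fixes M :: "('k::field, 'a, 'm) module_scheme" (structure)
  assumes "\<And>x y. x \<in> carrier M \<Longrightarrow> y \<in> carrier M \<Longrightarrow> x \<oplus> y \<in> carrier M"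
    and "\<zero> \<in> carrier M"
    and "\<And>x y z. x \<in> carrier M \<Longrightarrow> y \<in> carrier M \<Longrightarrow> z \<in> carrier M \<Longrightarrow> (x \<oplus> y) \<oplus> z = x \<oplus> (y \<oplus> z)"
    and "\<And>x y. x \<in> carrier M \<Longrightarrow> y \<in> carrier M \<Longrightarrow> x \<oplus> y = y \<oplus> x"
    and "\<And>x. x \<in> carrier M \<Longrightarrow> \<zero> \<oplus> x = x"
    and "\<And>c x. x \<in> carrier M \<Longrightarrow> c \<odot> x \<in> carrier M"
    and "\<And>c d x. x \<in> carrier M \<Longrightarrow> (c + d) \<odot> x = c \<odot> x \<oplus> d \<odot> x"
    and "\<And>c x y. x \<in> carrier M \<Longrightarrow> y \<in> carrier M \<Longrightarrow> c \<odot> (x \<oplus> y) = c \<odot> x \<oplus> c \<odot> y"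
    and "\<And>c d x. x \<in> carrier M \<Longrightarrow> (c * d) \<odot> x = c \<odot> (d \<odot> x)"
    and "\<And>x. x \<in> carrier M \<Longrightarrow> 1 \<odot> x = x"
    and "\<And>x. x \<in> carrier M \<Longrightarrow> 0 \<odot> x = \<zero>"
  shows "k_module M"
proof (rule moduleI)
  show "abelian_group M"
  proof (rule abelian_groupI)
    show "\<exists>y\<in>carrier M. y \<oplus> x = \<zero>" if "x \<in> carrier M" for x
    proof
      show "(- 1) \<odot> x \<oplus> x = \<zero>"
        using assms(7)[of x "- 1" 1] assms(10,11)[of x] that by simp
    qed (use assms that in auto)
  qed (use assms in auto)
qed (use assms in \<open>auto simp: cring_ground\<close>)

lemma linear_mapsI:
  assumes "\<And>x. x \<in> carrier M \<Longrightarrow> f x \<in> carrier N"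
    and "\<And>x y. x \<in> carrier M \<Longrightarrow> y \<in> carrier M \<Longrightarrow> f (x \<oplus>\<^bsub>M\<^esub> y) = f x \<oplus>\<^bsub>N\<^esub> f y"
    and "\<And>c x. x \<in> carrier M \<Longrightarrow> f (c \<odot>\<^bsub>M\<^esub> x) = c \<odot>\<^bsub>N\<^esub> f x"
  shows "f \<in> linear_maps M N"
  using assms by (auto simp: linear_maps_def)

lemma linear_closed [simp]: "f \<in> linear_maps M N \<Longrightarrow> x \<in> carrier M \<Longrightarrow> f x \<in> carrier N"
  and linear_add: "f \<in> linear_maps M N \<Longrightarrow> x \<in> carrier M \<Longrightarrow> y \<in> carrier M \<Longrightarrow> f (x \<oplus>\<^bsub>M\<^esub> y) = f x \<oplus>\<^bsub>N\<^esub> f y"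
  and linear_smult: "f \<in> linear_maps M N \<Longrightarrow> x \<in> carrier M \<Longrightarrow> f (c \<odot>\<^bsub>M\<^esub> x) = c \<odot>\<^bsub>N\<^esub> f x"
  by (auto simp: linear_maps_def)

lemma linear_zero:
  assumes "k_module M" "k_module N" "f \<in> linear_maps M N"
  shows "f \<zero>\<^bsub>M\<^esub> = \<zero>\<^bsub>N\<^esub>"
  using linear_smult[OF assms(3), of "\<zero>\<^bsub>M\<^esub>" 0] assms by simp

lemma linear_minus:
  assumes "k_module M" "k_module N" "f \<in> linear_maps M N" "x \<in> carrier M" "y \<in> carrier M"
  shows "f (x \<ominus>\<^bsub>M\<^esub> y) = f x \<ominus>\<^bsub>N\<^esub> f y"
  using assms by (simp add: km_minus linear_add linear_smult)

lemma linear_cong: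
  assumes "f \<in> linear_maps M N" "k_module M" "\<And>x. x \<in> carrier M \<Longrightarrow> f x = f' x"
  shows "f' \<in> linear_maps M N"
proof (rule linear_mapsI)
  fix x y c assume x: "x \<in> carrier M" "y \<in> carrier M"
  then show "f' (x \<oplus>\<^bsub>M\<^esub> y) = f' x \<oplus>\<^bsub>N\<^esub> f' y"
    using linear_add[OF assms(1) x] assms(2,3) by simp
next
  fix x c assume x: "x \<in> carrier M"
  then show "f' (c \<odot>\<^bsub>M\<^esub> x) = c \<odot>\<^bsub>N\<^esub> f' x"
    using linear_smult[OF assms(1) x, of c] assms(2,3) by simp
qed (use assms in \<open>auto simp flip: assms(3)\<close>)

section \<open>Free vector spaces\<close>

text \<open>The common core of \<open>free_eval\<close> and \<open>tensor_lift\<close>: both are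
  values of such an extension, on words and on pairs respectively, so linearity is proved once for
  both.\<close>

definition lin_ext :: "('k::field, 'a, 'm) module_scheme \<Rightarrow> ('s \<Rightarrow> 'a) \<Rightarrow> ('s \<Rightarrow>\<^sub>0 'k) \<Rightarrow> 'a" where
  "lin_ext N f p = (\<Oplus>\<^bsub>N\<^esub>u\<in>Poly_Mapping.keys p. Poly_Mapping.lookup p u \<odot>\<^bsub>N\<^esub> f u)"

lemma lookup_scale [simp]: "Poly_Mapping.lookup (Poly_Mapping.map ((*) c) p) x = (c::'k::field) *
    Poly_Mapping.lookup p x"
  by (simp add: Poly_Mapping.map.rep_eq when_def)

lemma keys_scale: "Poly_Mapping.keys (Poly_Mapping.map ((*) (c::'k::field)) p) \<subseteq> Poly_Mapping.keys p"
  by (auto simp: in_keys_iff)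

lemma scale_single [simp]: "Poly_Mapping.map ((*) c) (Poly_Mapping.single x d) = Poly_Mapping.single x
    ((c::'k::field) * d)"
  by (rule poly_mapping_eqI) (simp add: lookup_single when_def)

lemma keys_add_subset: "Poly_Mapping.keys p \<subseteq> S \<Longrightarrow> Poly_Mapping.keys q \<subseteq> S \<Longrightarrow> Poly_Mapping.keys (p + q) \<subseteq> S"
  using Poly_Mapping.keys_add[of p q] by blast

text \<open>Induction on the size of the support: one term is split off and the rest has one key
  fewer. The restriction to keys in \<open>S\<close> is what later gives membership in a
  carrier.\<close>

lemma poly_mapping_single_induct [consumes 1, case_names zero add]:
  fixes p :: "'s \<Rightarrow>\<^sub>0 'k::field"
  assumes "Poly_Mapping.keys p \<subseteq> S" "P 0"
    and "\<And>x c p. x \<in> S \<Longrightarrow> Poly_Mapping.keys p \<subseteq> S \<Longrightarrow> P p \<Longrightarrow> P (Poly_Mapping.single x c + p)"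
  shows "P p"
  using assms(1)
proof (induction "card (Poly_Mapping.keys p)" arbitrary: p)
  case 0
  then have "p = 0" by (metis card_0_eq finite_keys keys_eq_empty)
  then show ?case using assms(2) by simp
next
  case (Suc n)
  then obtain x where x: "x \<in> Poly_Mapping.keys p" by fastforce
  define q where "q = p - Poly_Mapping.single x (Poly_Mapping.lookup p x)"
  have "Poly_Mapping.keys q = Poly_Mapping.keys p - {x}"
    by (auto simp: q_def in_keys_iff lookup_minus lookup_single when_def split: if_splits)
  moreover from this have "card (Poly_Mapping.keys q) = n" using Suc(2) x by simp
  ultimately have "P q" using Suc x by blast
  moreover have "p = Poly_Mapping.single x (Poly_Mapping.lookup p x) + q" by (simp add: q_def)
  ultimately show ?case using assms(3) \<open>Poly_Mapping.keys q = _\<close> x Suc.prems by (metis Diff_subset subset_eq)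
qed

context
  fixes N :: "('k::field, 'a, 'm) module_scheme" (structure) and f :: "'s \<Rightarrow> 'a" and S :: "'s set"
  assumes N: "k_module N" and f: "f \<in> S \<rightarrow> carrier N"
begin

interpretation Module.module ground N by (rule N)

lemma lin_ext_closed: "Poly_Mapping.keys p \<subseteq> S \<Longrightarrow> lin_ext N f p \<in> carrier N"
  unfolding lin_ext_def using f by (intro M.finsum_closed) (auto simp: Pi_iff intro!: km_smult_closed[OF N])

text \<open>Cancellation can make the support of a sum smaller than the union of the supports. To
  compare sums over different supports they are enlarged to a common finite index set, where the new
  terms vanish.\<close>

lemma lin_ext_superset:
  assumes "finite U" "Poly_Mapping.keys p \<subseteq> U" "U \<subseteq> S"
  shows "lin_ext N f p = (\<Oplus>u\<in>U. Poly_Mapping.lookup p u \<odot> f u)"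
  unfolding lin_ext_def
proof (rule M.add.finprod_mono_neutral_cong)
  show "\<And>i. i \<in> U - Poly_Mapping.keys p \<Longrightarrow> Poly_Mapping.lookup p i \<odot> f i = \<zero>"
    using N f assms by (auto simp: in_keys_iff Pi_iff)
qed (use assms f N in \<open>auto simp: Pi_iff\<close>)

lemma lin_ext_add:
  assumes p: "Poly_Mapping.keys p \<subseteq> S" and q: "Poly_Mapping.keys q \<subseteq> S"
  shows "lin_ext N f (p + q) = lin_ext N f p \<oplus> lin_ext N f q"
proof -
  let ?U = "Poly_Mapping.keys p \<union> Poly_Mapping.keys q"
  have fc: "f u \<in> carrier N" if "u \<in> ?U" for u using f p q that by auto
  have "lin_ext N f (p + q) = (\<Oplus>u\<in>?U. Poly_Mapping.lookup (p + q) u \<odot> f u)"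
    using p q by (intro lin_ext_superset Poly_Mapping.keys_add) auto
  also have "\<dots> = (\<Oplus>u\<in>?U. Poly_Mapping.lookup p u \<odot> f u \<oplus> Poly_Mapping.lookup q u \<odot> f u)"
    using fc N by (intro M.finsum_cong') (auto simp: lookup_add km_smult_l_distr)
  also have "\<dots> = (\<Oplus>u\<in>?U. Poly_Mapping.lookup p u \<odot> f u) \<oplus> (\<Oplus>u\<in>?U. Poly_Mapping.lookup q u \<odot> f u)"
    using fc by (intro M.finsum_addf) auto
  also have "\<dots> = lin_ext N f p \<oplus> lin_ext N f q"
    using p q by (simp add: lin_ext_superset[of ?U])
  finally show ?thesis .
qed

lemma lin_ext_scale:
  assumes p: "Poly_Mapping.keys p \<subseteq> S"
  shows "lin_ext N f (Poly_Mapping.map ((*) c) p) = c \<odot> lin_ext N f p"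
proof -
  have fc: "f u \<in> carrier N" if "u \<in> Poly_Mapping.keys p" for u using f p that by auto
  have "lin_ext N f (Poly_Mapping.map ((*) c) p) = (\<Oplus>u\<in>Poly_Mapping.keys p. (c * Poly_Mapping.lookup p u) \<odot> f u)"
    using lin_ext_superset[OF finite_keys keys_scale p, of c] by simp
  also have "\<dots> = (\<Oplus>u\<in>Poly_Mapping.keys p. c \<odot> (Poly_Mapping.lookup p u \<odot> f u))"
    using fc N by (intro M.finsum_cong') auto
  also have "\<dots> = c \<odot> lin_ext N f p"
    unfolding lin_ext_def using fc by (subst finsum_smult_ldistr) auto
  finally show ?thesis .
qed

lemma lin_ext_single: "x \<in> S \<Longrightarrow> lin_ext N f (Poly_Mapping.single x c) = c \<odot> f x"
  using lin_ext_superset[of "{x}" "Poly_Mapping.single x c"] f N by (auto simp: Pi_iff)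

end

lemma monoid_algebra_simps:
  "carrier (monoid_algebra M) = {p. Poly_Mapping.keys p \<subseteq> carrier M}"
  "\<zero>\<^bsub>monoid_algebra M\<^esub> = 0" "p \<oplus>\<^bsub>monoid_algebra M\<^esub> q = p + q"
  "c \<odot>\<^bsub>monoid_algebra M\<^esub> p = Poly_Mapping.map ((*) c) p"
  "\<one>\<^bsub>monoid_algebra M\<^esub> = Poly_Mapping.single \<one>\<^bsub>M\<^esub> 1"
  by (simp_all add: monoid_algebra_def)

lemma k_module_monoid_algebra: "k_module (monoid_algebra M :: ('k::field, 'a \<Rightarrow>\<^sub>0 'k) module)"
proof (rule k_moduleI)
qed (auto simp: monoid_algebra_simps keys_add_subset subset_trans[OF keys_scale] lookup_add algebra_simps
    intro!: poly_mapping_eqI)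

lemma monoid_algebra_minus:
  "p \<in> carrier (monoid_algebra M) \<Longrightarrow> q \<in> carrier (monoid_algebra M) \<Longrightarrow>
    p \<ominus>\<^bsub>monoid_algebra M\<^esub> q = p - (q :: 'a \<Rightarrow>\<^sub>0 'k::field)"
  by (rule poly_mapping_eqI)
    (simp add: km_minus k_module_monoid_algebra monoid_algebra_simps lookup_add lookup_minus)

lemma lin_ext_linear:
  assumes "k_module N" "f \<in> carrier M \<rightarrow> carrier N"
  shows "lin_ext N f \<in> linear_maps (monoid_algebra M) N"
  by (rule linear_mapsI)
    (auto simp: monoid_algebra_simps lin_ext_closed[OF assms] lin_ext_add[OF assms] lin_ext_scale[OF assms])

text \<open>The singles with coefficient 1 form a basis; other coefficients are recovered by
  scaling.\<close>

lemma linear_eq_on_monoid_algebra: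
  assumes N: "k_module N" and f: "f \<in> linear_maps (monoid_algebra M) N" and f': "f' \<in> linear_maps (monoid_algebra
      M) N"
    and eq: "\<And>x. x \<in> carrier M \<Longrightarrow> f (Poly_Mapping.single x 1) = f' (Poly_Mapping.single x 1)"
    and p: "p \<in> carrier (monoid_algebra M)"
  shows "f p = f' p"
proof -
  have "Poly_Mapping.keys p \<subseteq> carrier M" using p by (simp add: monoid_algebra_simps)
  then show ?thesis
  proof (induction rule: poly_mapping_single_induct)
    case zero
    show ?case using linear_zero[OF k_module_monoid_algebra N f] linear_zero[OF k_module_monoid_algebra N f']
      by (simp add: monoid_algebra_simps)
  next
    case (add x c p)
    have 1: "Poly_Mapping.single x 1 \<in> carrier (monoid_algebra M)"
      using add by (simp add: monoid_algebra_simps)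
    have 2: "Poly_Mapping.single x c \<in> carrier (monoid_algebra M)" "p \<in> carrier (monoid_algebra M)"
      using add by (auto simp: monoid_algebra_simps)
    show ?case
      using linear_add[OF f 2] linear_add[OF f' 2] add linear_smult[OF f 1, of c] linear_smult[OF f' 1, of c]
          eq[OF add(1)]
      by (simp add: monoid_algebra_simps)
  qed
qed

text \<open>Recasts the double sum that defines the product as an iterated linear extension.
  Bilinearity of the product then follows from general facts about \<open>lin_ext\<close>, without
  further manipulation of sums.\<close>

lemma monoid_algebra_mult_lin_ext:
  fixes p q :: "'a \<Rightarrow>\<^sub>0 'k::field"
  assumes "\<And>x y. x \<in> carrier M \<Longrightarrow> y \<in> carrier M \<Longrightarrow> x \<otimes>\<^bsub>M\<^esub> y \<in> carrier M"
    and "p \<in> carrier (monoid_algebra M)" "q \<in> carrier (monoid_algebra M)"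
  shows "p \<otimes>\<^bsub>monoid_algebra M\<^esub> q = lin_ext (monoid_algebra M) (\<lambda>x. lin_ext (monoid_algebra M)
     (\<lambda>y. Poly_Mapping.single (x \<otimes>\<^bsub>M\<^esub> y) 1) q) p"
proof -
  have fs: "(\<Oplus>\<^bsub>monoid_algebra M\<^esub>u\<in>U. f u) = (\<Sum>u\<in>U. f u)"
    if "finite U" "\<And>u. u \<in> U \<Longrightarrow> f u \<in> carrier (monoid_algebra M)" for U :: "'x set" and f :: "'x \<Rightarrow> 'a \<Rightarrow>\<^sub>0 'k"
  proof -
    interpret Module.module ground "monoid_algebra M :: ('k, 'a \<Rightarrow>\<^sub>0 'k) module" by (rule k_module_monoid_algebra)
    show ?thesis using that
      by (induction U rule: finite_induct) (auto simp: Pi_iff monoid_algebra_simps)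
  qed
  have scale_sum: "Poly_Mapping.map ((*) c) (\<Sum>u\<in>U. f u) = (\<Sum>u\<in>U. Poly_Mapping.map ((*) c) (f u))"
    for c and U :: "'x set" and f :: "'x \<Rightarrow> 'a \<Rightarrow>\<^sub>0 'k"
    by (rule poly_mapping_eqI) (simp add: lookup_sum sum_distrib_left)
  have k: "Poly_Mapping.keys p \<subseteq> carrier M" "Poly_Mapping.keys q \<subseteq> carrier M" using assms by (auto simp:
      monoid_algebra_simps)
  have single_c: "Poly_Mapping.single (x \<otimes>\<^bsub>M\<^esub> y) (c::'k) \<in> carrier (monoid_algebra M)"
    if "x \<in> Poly_Mapping.keys p" "y \<in> Poly_Mapping.keys q" for x y c
    using k that assms(1) by (auto simp: monoid_algebra_simps)
  have inner: "lin_ext (monoid_algebra M) (\<lambda>y. Poly_Mapping.single (x \<otimes>\<^bsub>M\<^esub> y) 1) q =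
     (\<Sum>y\<in>Poly_Mapping.keys q. Poly_Mapping.single (x \<otimes>\<^bsub>M\<^esub> y) (Poly_Mapping.lookup q y))"
    if x: "x \<in> Poly_Mapping.keys p" for x
  proof -
    have "\<And>u. u \<in> Poly_Mapping.keys q \<Longrightarrow> Poly_Mapping.lookup q u \<odot>\<^bsub>monoid_algebra M\<^esub> Poly_Mapping.single (x \<otimes>\<^bsub>M\<^esub> u)
        (1::'k) \<in> carrier (monoid_algebra M)"
      by (intro km_smult_closed k_module_monoid_algebra single_c x)
    from fs[OF finite_keys this] show ?thesis
      unfolding lin_ext_def by (simp add: monoid_algebra_simps)
  qed
  have inner_c: "lin_ext (monoid_algebra M) (\<lambda>y. Poly_Mapping.single (x \<otimes>\<^bsub>M\<^esub> y) 1) q \<in> carrier (monoid_algebra M)"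
    if x: "x \<in> carrier M" for x
    using k x assms(1) by (intro lin_ext_closed[where S = "carrier M"] k_module_monoid_algebra) (auto simp:
        monoid_algebra_simps)
  have "\<And>u. u \<in> Poly_Mapping.keys p \<Longrightarrow> Poly_Mapping.lookup p u \<odot>\<^bsub>monoid_algebra M\<^esub> lin_ext (monoid_algebra M) (\<lambda>y.
      Poly_Mapping.single (u \<otimes>\<^bsub>M\<^esub> y) 1) q \<in> carrier (monoid_algebra M)"
    using inner_c k k_module_monoid_algebra by (auto intro!: km_smult_closed)
  from fs[OF finite_keys this] have "lin_ext (monoid_algebra M) (\<lambda>x. lin_ext (monoid_algebra M)
     (\<lambda>y. Poly_Mapping.single (x \<otimes>\<^bsub>M\<^esub> y) 1) q) p =
     (\<Sum>x\<in>Poly_Mapping.keys p. Poly_Mapping.lookup p x \<odot>\<^bsub>monoid_algebra M\<^esub> lin_ext (monoid_algebra M) (\<lambda>y.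
         Poly_Mapping.single (x \<otimes>\<^bsub>M\<^esub> y) 1) q)"
    unfolding lin_ext_def[of _ _ p] .
  also have "\<dots> = p \<otimes>\<^bsub>monoid_algebra M\<^esub> q"
    by (simp add: inner monoid_algebra_simps scale_sum) (simp add: monoid_algebra_def)
  finally show ?thesis by simp
qed

section \<open>Algebras\<close>

context
  fixes A :: "('k::field, 'a, 'm) module_scheme" (structure)
  assumes A: "k_algebra A"
begin

interpretation ring A using A by (simp add: k_algebra_def)

lemma ka_module: "k_module A" using A by (simp add: k_algebra_def)
lemma ka_ring: "ring A" ..
lemma ka_mult_closed: "x \<in> carrier A \<Longrightarrow> y \<in> carrier A \<Longrightarrow> x \<otimes> y \<in> carrier A" by simp
lemma ka_one_closed: "\<one> \<in> carrier A" by simp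
lemma ka_assoc: "x \<in> carrier A \<Longrightarrow> y \<in> carrier A \<Longrightarrow> z \<in> carrier A \<Longrightarrow> (x \<otimes> y) \<otimes> z = x \<otimes> (y \<otimes> z)"
  by (rule m_assoc)
lemma ka_l_one: "x \<in> carrier A \<Longrightarrow> \<one> \<otimes> x = x" by simp
lemma ka_r_one: "x \<in> carrier A \<Longrightarrow> x \<otimes> \<one> = x" by simp
lemma ka_l_null: "x \<in> carrier A \<Longrightarrow> \<zero> \<otimes> x = \<zero>" by simp
lemma ka_r_null: "x \<in> carrier A \<Longrightarrow> x \<otimes> \<zero> = \<zero>" by simp
lemma ka_l_distr: "x \<in> carrier A \<Longrightarrow> y \<in> carrier A \<Longrightarrow> z \<in> carrier A \<Longrightarrow> (x \<oplus> y) \<otimes> z = x \<otimes> z \<oplus> y \<otimes> z"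
  by (rule l_distr)
lemma ka_r_distr: "x \<in> carrier A \<Longrightarrow> y \<in> carrier A \<Longrightarrow> z \<in> carrier A \<Longrightarrow> z \<otimes> (x \<oplus> y) = z \<otimes> x \<oplus> z \<otimes> y"
  by (rule r_distr)
lemma ka_smult_l: "x \<in> carrier A \<Longrightarrow> y \<in> carrier A \<Longrightarrow> (c \<odot> x) \<otimes> y = c \<odot> (x \<otimes> y)"
  using A by (simp add: k_algebra_def)
lemma ka_smult_r: "x \<in> carrier A \<Longrightarrow> y \<in> carrier A \<Longrightarrow> x \<otimes> (c \<odot> y) = c \<odot> (x \<otimes> y)"
  using A by (simp add: k_algebra_def)

end

lemmas ka_closed [simp] = ka_mult_closed ka_one_closed
lemmas ka_simps [simp] = ka_l_one ka_r_one ka_l_null ka_r_null ka_smult_l ka_smult_r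
declare ka_module [simp]

lemma k_algebraI:
  fixes A :: "('k::field, 'a, 'm) module_scheme" (structure)
  assumes "k_module A"
    and "\<And>x y. x \<in> carrier A \<Longrightarrow> y \<in> carrier A \<Longrightarrow> x \<otimes> y \<in> carrier A"
    and "\<one> \<in> carrier A"
    and "\<And>x y z. x \<in> carrier A \<Longrightarrow> y \<in> carrier A \<Longrightarrow> z \<in> carrier A \<Longrightarrow> (x \<otimes> y) \<otimes> z = x \<otimes> (y \<otimes> z)"
    and "\<And>x. x \<in> carrier A \<Longrightarrow> \<one> \<otimes> x = x"
    and "\<And>x. x \<in> carrier A \<Longrightarrow> x \<otimes> \<one> = x"
    and "\<And>x y z. x \<in> carrier A \<Longrightarrow> y \<in> carrier A \<Longrightarrow> z \<in> carrier A \<Longrightarrow> (x \<oplus> y) \<otimes> z = x \<otimes> z \<oplus> y \<otimes> z"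
    and "\<And>x y z. x \<in> carrier A \<Longrightarrow> y \<in> carrier A \<Longrightarrow> z \<in> carrier A \<Longrightarrow> z \<otimes> (x \<oplus> y) = z \<otimes> x \<oplus> z \<otimes> y"
    and "\<And>c x y. x \<in> carrier A \<Longrightarrow> y \<in> carrier A \<Longrightarrow> (c \<odot> x) \<otimes> y = c \<odot> (x \<otimes> y)"
    and "\<And>c x y. x \<in> carrier A \<Longrightarrow> y \<in> carrier A \<Longrightarrow> x \<otimes> (c \<odot> y) = c \<odot> (x \<otimes> y)"
  shows "k_algebra A"
  unfolding k_algebra_def
  by (intro conjI ringI km_abelian_group monoidI) (use assms in auto)

lemma k_algebra_ground: "k_algebra (ground :: ('k::field, 'k) module)"
  by (rule k_algebraI) (auto simp: k_module_ground algebra_simps)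

section \<open>Bilinear maps, and the monoid algebra as an algebra\<close>

definition bilinear_maps ::
  "('k::field, 'a, 'l) module_scheme \<Rightarrow> ('k, 'b, 'm) module_scheme \<Rightarrow> ('k, 'c, 'n) module_scheme \<Rightarrow>
    ('a \<Rightarrow> 'b \<Rightarrow> 'c) set" where
  "bilinear_maps A B N = {f. (\<forall>a\<in>carrier A. f a \<in> linear_maps B N) \<and>
    (\<forall>b\<in>carrier B. (\<lambda>a. f a b) \<in> linear_maps A N)}"

lemma bilinear_mapsI:
  "(\<And>a. a \<in> carrier A \<Longrightarrow> (\<lambda>b. f a b) \<in> linear_maps B N) \<Longrightarrow>
   (\<And>b. b \<in> carrier B \<Longrightarrow> (\<lambda>a. f a b) \<in> linear_maps A N) \<Longrightarrow> f \<in> bilinear_maps A B N"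
  by (simp add: bilinear_maps_def)

lemma bilinear_left: "f \<in> bilinear_maps A B N \<Longrightarrow> b \<in> carrier B \<Longrightarrow> (\<lambda>a. f a b) \<in> linear_maps A N"
  and bilinear_right: "f \<in> bilinear_maps A B N \<Longrightarrow> a \<in> carrier A \<Longrightarrow> (\<lambda>b. f a b) \<in> linear_maps B N"
  by (simp_all add: bilinear_maps_def)

lemma bilinear_closed [simp]:
  "f \<in> bilinear_maps A B N \<Longrightarrow> a \<in> carrier A \<Longrightarrow> b \<in> carrier B \<Longrightarrow> f a b \<in> carrier N"
  by (rule linear_closed[OF bilinear_right])

lemma linear_comp: "f \<in> linear_maps M N \<Longrightarrow> g \<in> linear_maps N K \<Longrightarrow> (\<lambda>x. g (f x)) \<in> linear_maps M K"
  by (rule linear_mapsI) (simp_all add: linear_add linear_smult)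

lemma linear_id: "(\<lambda>x. x) \<in> linear_maps M M"
  by (rule linear_mapsI) simp_all

lemma linear_comp_left:
  "f \<in> linear_maps M A \<Longrightarrow> g \<in> bilinear_maps A B N \<Longrightarrow> b \<in> carrier B \<Longrightarrow> (\<lambda>x. g (f x) b) \<in> linear_maps M N"
  by (rule linear_comp[OF _ bilinear_left])

lemma linear_comp_right:
  "f \<in> linear_maps M B \<Longrightarrow> g \<in> bilinear_maps A B N \<Longrightarrow> a \<in> carrier A \<Longrightarrow> (\<lambda>x. g a (f x)) \<in> linear_maps M N"
  by (rule linear_comp[OF _ bilinear_right])

lemma bilinear_mult: "k_algebra A \<Longrightarrow> (\<lambda>x y. x \<otimes>\<^bsub>A\<^esub> y) \<in> bilinear_maps A A A"
  by (rule bilinear_mapsI; rule linear_mapsI) (simp_all add: ka_l_distr ka_r_distr)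

lemma bilinear_smult: "k_module N \<Longrightarrow> (\<lambda>c x. c \<odot>\<^bsub>N\<^esub> x) \<in> bilinear_maps ground N N"
  by (rule bilinear_mapsI; rule linear_mapsI) (simp_all add: km_smult_l_distr km_smult_r_distr mult.commute)

text \<open>Here the coefficients \<open>p\<close> are fixed and the function being extended varies:
  a fixed linear combination of linear maps is linear. It is the source of every statement below
  that a sum depends linearly on a parameter.\<close>

lemma lin_ext_param:
  assumes M: "k_module M" and N: "k_module N" and h: "\<And>x. x \<in> S \<Longrightarrow> (\<lambda>q. h x q) \<in> linear_maps M N"
    and p: "Poly_Mapping.keys p \<subseteq> S"
  shows "(\<lambda>q. lin_ext N (\<lambda>x. h x q) p) \<in> linear_maps M N"
  using p
proof (induction rule: poly_mapping_single_induct)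
  case zero
  show ?case by (rule linear_mapsI) (auto simp: lin_ext_def N
    abelian_monoid.finsum_empty[OF abelian_group.axioms(1)[OF km_abelian_group[OF N]]])
next
  case (add x c p)
  have hc: "(\<lambda>x. h x q) \<in> S \<rightarrow> carrier N" if "q \<in> carrier M" for q
    using linear_closed[OF h that] by simp
  have "(\<lambda>q. c \<odot>\<^bsub>N\<^esub> h x q \<oplus>\<^bsub>N\<^esub> lin_ext N (\<lambda>x. h x q) p) \<in> linear_maps M N"
    using linear_closed[OF h[OF add(1)]] linear_closed[OF add(3)] N
    by (intro linear_mapsI) (simp_all add: linear_add[OF add(3)] linear_smult[OF add(3)]
      linear_add[OF h[OF add(1)]] linear_smult[OF h[OF add(1)]] km_smult_r_distr km_a_assoc km_a_lcomm mult.commute)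
  then show ?case
  proof (rule linear_cong[OF _ M])
    fix q assume q: "q \<in> carrier M"
    have "Poly_Mapping.keys (Poly_Mapping.single x c) \<subseteq> S" using add(1) by simp
    then show "c \<odot>\<^bsub>N\<^esub> h x q \<oplus>\<^bsub>N\<^esub> lin_ext N (\<lambda>x. h x q) p = lin_ext N (\<lambda>x. h x q) (Poly_Mapping.single x c + p)"
      using lin_ext_add[OF N hc[OF q] _ add(2)] lin_ext_single[OF N hc[OF q] add(1), of c] by simp
  qed
qed

text \<open>The left factor is the outer argument of the iterated extension, so linearity there is
  \<open>lin_ext_linear\<close>; in the right factor it is \<open>lin_ext_param\<close>.\<close>

lemma bilinear_mult_monoid_algebra:
  assumes "\<And>x y. x \<in> carrier M \<Longrightarrow> y \<in> carrier M \<Longrightarrow> x \<otimes>\<^bsub>M\<^esub> y \<in> carrier M"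
  shows "(\<lambda>p q. p \<otimes>\<^bsub>monoid_algebra M\<^esub> q) \<in>
    bilinear_maps (monoid_algebra M) (monoid_algebra M) (monoid_algebra M :: ('k::field, 'a \<Rightarrow>\<^sub>0 'k) module)"
proof -
  let ?P = "monoid_algebra M :: ('k, 'a \<Rightarrow>\<^sub>0 'k) module"
  note P = k_module_monoid_algebra
  have s: "(\<lambda>y. Poly_Mapping.single (x \<otimes>\<^bsub>M\<^esub> y) 1) \<in> carrier M \<rightarrow> carrier ?P" if "x \<in> carrier M" for x
    using that assms by (auto simp: monoid_algebra_simps)
  show ?thesis
  proof (rule bilinear_mapsI)
    fix p :: "'a \<Rightarrow>\<^sub>0 'k" assume p: "p \<in> carrier ?P"
    show "(\<lambda>q. p \<otimes>\<^bsub>?P\<^esub> q) \<in> linear_maps ?P ?P"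
    proof (rule linear_cong[OF lin_ext_param[OF P P, of "carrier M"] P])
      show "\<And>x. x \<in> carrier M \<Longrightarrow> (\<lambda>q. lin_ext ?P (\<lambda>y. Poly_Mapping.single (x \<otimes>\<^bsub>M\<^esub> y) 1) q) \<in> linear_maps ?P ?P"
        by (rule lin_ext_linear[OF P s])
      show "Poly_Mapping.keys p \<subseteq> carrier M" using p by (simp add: monoid_algebra_simps)
    qed (use monoid_algebra_mult_lin_ext[OF assms p] in simp)
  next
    fix q :: "'a \<Rightarrow>\<^sub>0 'k" assume q: "q \<in> carrier ?P"
    show "(\<lambda>p. p \<otimes>\<^bsub>?P\<^esub> q) \<in> linear_maps ?P ?P"
    proof (rule linear_cong[OF lin_ext_linear[OF P] P])
      show "(\<lambda>x. lin_ext ?P (\<lambda>y. Poly_Mapping.single (x \<otimes>\<^bsub>M\<^esub> y) 1) q) \<in> carrier M \<rightarrow> carrier ?P"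
        using linear_closed[OF lin_ext_linear[OF P s] q] by simp
    qed (use monoid_algebra_mult_lin_ext[OF assms _ q] in simp)
  qed
qed

lemma monoid_algebra_mult_single:
  "Poly_Mapping.single x c \<otimes>\<^bsub>monoid_algebra M\<^esub> Poly_Mapping.single y d = Poly_Mapping.single (x \<otimes>\<^bsub>M\<^esub> y) (c * d)"
  by (simp add: monoid_algebra_def)

text \<open>Associativity and the unit laws are linear in each argument, so each argument in turn
  may be replaced by a single monoid element; what remains is the law of the monoid.\<close>

lemma k_algebra_monoid_algebra:
  assumes "monoid M"
  shows "k_algebra (monoid_algebra M :: ('k::field, 'a \<Rightarrow>\<^sub>0 'k) module)"
proof -
  interpret Group.monoid M by (rule assms)
  let ?P = "monoid_algebra M :: ('k, 'a \<Rightarrow>\<^sub>0 'k) module"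
  note P = k_module_monoid_algebra[of M, where 'k='k]
  have bil: "(\<lambda>p q. p \<otimes>\<^bsub>?P\<^esub> q) \<in> bilinear_maps ?P ?P ?P"
    by (rule bilinear_mult_monoid_algebra) (rule m_closed)
  note ll = linear_comp_left[OF _ bil] and lr = linear_comp_right[OF _ bil] and cl = bilinear_closed[OF bil]
  have s: "Poly_Mapping.single x 1 \<in> carrier ?P" if "x \<in> carrier M" for x
    using that by (simp add: monoid_algebra_simps)
  have one: "\<one>\<^bsub>?P\<^esub> \<in> carrier ?P" by (simp add: monoid_algebra_simps)
  show ?thesis
  proof (rule k_algebraI)
    fix p q r :: "'a \<Rightarrow>\<^sub>0 'k" assume p: "p \<in> carrier ?P" and q: "q \<in> carrier ?P" and r: "r \<in> carrier ?P"
    show "(p \<otimes>\<^bsub>?P\<^esub> q) \<otimes>\<^bsub>?P\<^esub> r = p \<otimes>\<^bsub>?P\<^esub> (q \<otimes>\<^bsub>?P\<^esub> r)"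
    proof (rule linear_eq_on_monoid_algebra[OF P, where f = "\<lambda>p. (p \<otimes>\<^bsub>?P\<^esub> q) \<otimes>\<^bsub>?P\<^esub> r" and f' = "\<lambda>p. p \<otimes>\<^bsub>?P\<^esub> (q \<otimes>\<^bsub>?P\<^esub> r)"
        and M = M])
      fix x assume x: "x \<in> carrier M"
      let ?x = "Poly_Mapping.single x (1::'k)"
      show "(?x \<otimes>\<^bsub>?P\<^esub> q) \<otimes>\<^bsub>?P\<^esub> r = ?x \<otimes>\<^bsub>?P\<^esub> (q \<otimes>\<^bsub>?P\<^esub> r)"
      proof (rule linear_eq_on_monoid_algebra[OF P, where f = "\<lambda>q. (?x \<otimes>\<^bsub>?P\<^esub> q) \<otimes>\<^bsub>?P\<^esub> r" and f' = "\<lambda>q. ?x \<otimes>\<^bsub>?P\<^esub> (q \<otimes>\<^bsub>?P\<^esub>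
          r)" and M = M])
        fix y assume y: "y \<in> carrier M"
        let ?y = "Poly_Mapping.single y (1::'k)"
        show "(?x \<otimes>\<^bsub>?P\<^esub> ?y) \<otimes>\<^bsub>?P\<^esub> r = ?x \<otimes>\<^bsub>?P\<^esub> (?y \<otimes>\<^bsub>?P\<^esub> r)"
        proof (rule linear_eq_on_monoid_algebra[OF P, where f = "\<lambda>r. (?x \<otimes>\<^bsub>?P\<^esub> ?y) \<otimes>\<^bsub>?P\<^esub> r" and f' = "\<lambda>r. ?x \<otimes>\<^bsub>?P\<^esub> (?y
            \<otimes>\<^bsub>?P\<^esub> r)" and M = M])
          fix z assume z: "z \<in> carrier M"
          then show "(?x \<otimes>\<^bsub>?P\<^esub> ?y) \<otimes>\<^bsub>?P\<^esub> Poly_Mapping.single z 1 = ?x \<otimes>\<^bsub>?P\<^esub> (?y \<otimes>\<^bsub>?P\<^esub> Poly_Mapping.single z 1)"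
            using x y by (simp add: monoid_algebra_mult_single m_assoc)
        qed ((rule r ll lr linear_id cl s x y)+)
      qed ((rule q r ll lr linear_id cl s x)+)
    qed ((rule p q r ll lr linear_id cl)+)
    show "\<one>\<^bsub>?P\<^esub> \<otimes>\<^bsub>?P\<^esub> p = p"
    proof (rule linear_eq_on_monoid_algebra[OF P, where f = "\<lambda>p. \<one>\<^bsub>?P\<^esub> \<otimes>\<^bsub>?P\<^esub> p" and f' = "\<lambda>p. p" and M = M])
      show "\<And>x. x \<in> carrier M \<Longrightarrow> \<one>\<^bsub>?P\<^esub> \<otimes>\<^bsub>?P\<^esub> Poly_Mapping.single x 1 = Poly_Mapping.single x 1"
        by (simp add: monoid_algebra_mult_single monoid_algebra_simps)
    qed ((rule p one lr linear_id)+)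
    show "p \<otimes>\<^bsub>?P\<^esub> \<one>\<^bsub>?P\<^esub> = p"
    proof (rule linear_eq_on_monoid_algebra[OF P, where f = "\<lambda>p. p \<otimes>\<^bsub>?P\<^esub> \<one>\<^bsub>?P\<^esub>" and f' = "\<lambda>p. p" and M = M])
      show "\<And>x. x \<in> carrier M \<Longrightarrow> Poly_Mapping.single x 1 \<otimes>\<^bsub>?P\<^esub> \<one>\<^bsub>?P\<^esub> = Poly_Mapping.single x 1"
        by (simp add: monoid_algebra_mult_single monoid_algebra_simps)
    qed ((rule p one ll linear_id)+)
  next
    fix p q r :: "'a \<Rightarrow>\<^sub>0 'k" assume p: "p \<in> carrier ?P" and q: "q \<in> carrier ?P" and r: "r \<in> carrier ?P"
    show "p \<otimes>\<^bsub>?P\<^esub> q \<in> carrier ?P" by (intro cl p q)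
    show "(p \<oplus>\<^bsub>?P\<^esub> q) \<otimes>\<^bsub>?P\<^esub> r = p \<otimes>\<^bsub>?P\<^esub> r \<oplus>\<^bsub>?P\<^esub> q \<otimes>\<^bsub>?P\<^esub> r"
      by (rule linear_add[OF bilinear_left[OF bil r] p q])
    show "r \<otimes>\<^bsub>?P\<^esub> (p \<oplus>\<^bsub>?P\<^esub> q) = r \<otimes>\<^bsub>?P\<^esub> p \<oplus>\<^bsub>?P\<^esub> r \<otimes>\<^bsub>?P\<^esub> q"
      by (rule linear_add[OF bilinear_right[OF bil r] p q])
    show "(c \<odot>\<^bsub>?P\<^esub> p) \<otimes>\<^bsub>?P\<^esub> q = c \<odot>\<^bsub>?P\<^esub> (p \<otimes>\<^bsub>?P\<^esub> q)" "p \<otimes>\<^bsub>?P\<^esub> (c \<odot>\<^bsub>?P\<^esub> q) = c \<odot>\<^bsub>?P\<^esub> (p \<otimes>\<^bsub>?P\<^esub> q)" for c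
      by (rule linear_smult[OF bilinear_left[OF bil q] p] linear_smult[OF bilinear_right[OF bil p] q])+
  qed (use P one in auto)
qed

section \<open>Quotients\<close>

lemma quotient_algebra_simps:
  "carrier (quotient_algebra P I) = a_rcosets\<^bsub>P\<^esub> I"
  "\<zero>\<^bsub>quotient_algebra P I\<^esub> = I"
  "\<one>\<^bsub>quotient_algebra P I\<^esub> = I +>\<^bsub>P\<^esub> \<one>\<^bsub>P\<^esub>"
  "X \<oplus>\<^bsub>quotient_algebra P I\<^esub> Y = X <+>\<^bsub>P\<^esub> Y"
  "X \<otimes>\<^bsub>quotient_algebra P I\<^esub> Y = rcoset_mult P I X Y"
  "c \<odot>\<^bsub>quotient_algebra P I\<^esub> X = (\<Union>x\<in>X. I +>\<^bsub>P\<^esub> (c \<odot>\<^bsub>P\<^esub> x))"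
  by (simp_all add: quotient_algebra_def FactRing_def)

context
  fixes P :: "('k::field, 'a, 'm) module_scheme" (structure) and I :: "'a set"
  assumes P: "k_module P" and I: "submodule I (ground :: ('k, 'k) module) P"
begin

interpretation Module.module ground P by (rule P)
interpretation abelian_subgroup I P
  by (rule abelian_subgroupI3[OF additive_subgroupI km_abelian_group[OF P]])
    (rule submodule.axioms(1)[OF I])

lemma quotient_carrier: "carrier (quotient_algebra P I) = (\<lambda>p. I +> p) ` carrier P"
  by (auto simp: quotient_algebra_simps A_RCOSETS_def' a_r_coset_def')

lemma rcos_iff: "x \<in> carrier P \<Longrightarrow> y \<in> carrier P \<Longrightarrow> y \<in> I +> x \<longleftrightarrow> y \<ominus> x \<in> I"
  by (simp add: a_rcos_module a_minus_def)

lemma quotient_eq_iff: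
  assumes "x \<in> carrier P" "y \<in> carrier P"
  shows "I +> x = I +> y \<longleftrightarrow> x \<ominus> y \<in> I"
proof
  assume "I +> x = I +> y"
  then have "x \<in> I +> y" using a_rcos_self[OF assms(1)] by simp
  then show "x \<ominus> y \<in> I" using rcos_iff[OF assms(2,1)] by simp
next
  assume "x \<ominus> y \<in> I"
  then have "x \<in> I +> y" using rcos_iff[OF assms(2,1)] by simp
  then show "I +> x = I +> y" using a_repr_independence'[OF _ assms(2)] by simp
qed

lemma quotient_add: "x \<in> carrier P \<Longrightarrow> y \<in> carrier P \<Longrightarrow>
    (I +> x) \<oplus>\<^bsub>quotient_algebra P I\<^esub> (I +> y) = I +> (x \<oplus> y)"
  by (simp add: quotient_algebra_simps a_rcos_sum)

text \<open>The scalar multiple is defined as a union over all representatives. Since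
  \<open>I\<close> is closed under scaling, all members of that union are the same coset.\<close>

lemma quotient_smult:
  assumes "x \<in> carrier P"
  shows "c \<odot>\<^bsub>quotient_algebra P I\<^esub> (I +> x) = I +> (c \<odot> x)"
proof -
  have "I +> (c \<odot> y) = I +> (c \<odot> x)" if y: "y \<in> I +> x" for y
  proof -
    have yc: "y \<in> carrier P" using a_elemrcos_carrier[OF assms y] .
    have "y \<ominus> x \<in> I" using rcos_iff[OF assms yc] y by simp
    then have "c \<odot> (y \<ominus> x) \<in> I" using submodule.smult_closed[OF I] by simp
    moreover have "c \<odot> (y \<ominus> x) = c \<odot> y \<ominus> c \<odot> x"
      using yc assms P by (simp add: km_minus km_smult_r_distr mult.commute)
    ultimately show ?thesis using quotient_eq_iff[of "c \<odot> y" "c \<odot> x"] yc assms P by simp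
  qed
  moreover have "x \<in> I +> x" by (rule a_rcos_self[OF assms])
  ultimately show ?thesis unfolding quotient_algebra_simps by blast
qed

lemma quotient_zero: "I +> \<zero> = \<zero>\<^bsub>quotient_algebra P I\<^esub>"
  by (simp add: quotient_algebra_simps a_subset)

lemma quotient_eq_zero_iff: "x \<in> carrier P \<Longrightarrow> I +> x = \<zero>\<^bsub>quotient_algebra P I\<^esub> \<longleftrightarrow> x \<in> I"
  using quotient_eq_iff[of x \<zero>] P by (simp add: quotient_zero[symmetric] km_minus)

lemma k_module_quotient: "k_module (quotient_algebra P I)"
  by (rule k_moduleI; (unfold quotient_carrier)?; (elim imageE)?)
    (simp_all add: P quotient_add quotient_smult quotient_zero[symmetric]
      km_a_assoc km_a_comm km_a_lcomm km_smult_l_distr km_smult_r_distr)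

lemma quotient_proj_linear: "(\<lambda>p. I +> p) \<in> linear_maps P (quotient_algebra P I)"
  by (rule linear_mapsI) (auto simp: quotient_carrier quotient_add quotient_smult)

text \<open>A map that vanishes on \<open>I\<close> is constant on each coset, so its image there is
  a singleton. This is what gives the \<open>the_elem\<close> in \<open>induced_map\<close> and
  \<open>tensor_lift\<close> its meaning.\<close>

lemma the_elem_quotient:
  assumes "f \<in> linear_maps P N" "k_module N" "\<And>x. x \<in> I \<Longrightarrow> f x = \<zero>\<^bsub>N\<^esub>" "x \<in> carrier P"
  shows "the_elem (f ` (I +> x)) = f x"
proof -
  have "f y = f x" if y: "y \<in> I +> x" for y
  proof -
    have yc: "y \<in> carrier P" using a_elemrcos_carrier[OF assms(4) y] .
    have "y \<ominus> x \<in> I" using rcos_iff[OF assms(4) yc] y by simp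
    then have "f y \<ominus>\<^bsub>N\<^esub> f x = \<zero>\<^bsub>N\<^esub>" using linear_minus[OF P assms(2,1) yc assms(4)] assms(3) by simp
    then show ?thesis using km_eq_iff[OF assms(2), of "f y" "f x"] yc assms by simp
  qed
  then have "f ` (I +> x) = {f x}" using a_rcos_self[OF assms(4)] by blast
  then show ?thesis by simp
qed

lemma the_elem_quotient_linear:
  assumes "f \<in> linear_maps P N" "k_module N" "\<And>x. x \<in> I \<Longrightarrow> f x = \<zero>\<^bsub>N\<^esub>"
  shows "(\<lambda>X. the_elem (f ` X)) \<in> linear_maps (quotient_algebra P I) N"
proof (rule linear_mapsI)
  fix X Y assume "X \<in> carrier (quotient_algebra P I)" "Y \<in> carrier (quotient_algebra P I)"
  then obtain x y where "X = I +> x" "Y = I +> y" "x \<in> carrier P" "y \<in> carrier P"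
    unfolding quotient_carrier by auto
  then show "the_elem (f ` (X \<oplus>\<^bsub>quotient_algebra P I\<^esub> Y)) = the_elem (f ` X) \<oplus>\<^bsub>N\<^esub> the_elem (f ` Y)"
    using P by (simp add: the_elem_quotient[OF assms] quotient_add linear_add[OF assms(1)])
qed (use P in \<open>auto simp: quotient_carrier the_elem_quotient[OF assms] quotient_smult linear_smult[OF assms(1)]
  intro: linear_closed[OF assms(1)]\<close>)

end

text \<open>Scaling by c is multiplication by the element c 1, under which an ideal is
  closed.\<close>

lemma ideal_submodule:
  assumes A: "k_algebra A" and I: "ideal I A"
  shows "submodule I ground A"
proof -
  interpret ideal I A by (rule I)
  show ?thesis
  proof (rule submodule.intro)
    show "subgroup I (add_monoid A)" by (rule a_subgroup)
    show "submodule_axioms I ground A"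
    proof
      fix c x assume x: "x \<in> I"
      then have "(c \<odot>\<^bsub>A\<^esub> \<one>\<^bsub>A\<^esub>) \<otimes>\<^bsub>A\<^esub> x \<in> I" using A by (intro I_l_closed) simp_all
      then show "c \<odot>\<^bsub>A\<^esub> x \<in> I" using A x by simp
    qed
  qed
qed

lemma quotient_mult:
  assumes "ideal I A" "x \<in> carrier A" "y \<in> carrier A"
  shows "(I +>\<^bsub>A\<^esub> x) \<otimes>\<^bsub>quotient_algebra A I\<^esub> (I +>\<^bsub>A\<^esub> y) = I +>\<^bsub>A\<^esub> (x \<otimes>\<^bsub>A\<^esub> y)"
  using assms by (simp add: quotient_algebra_simps ideal.rcoset_mult_add)

lemma k_algebra_quotient:
  assumes A: "k_algebra A" and I: "ideal I A"
  shows "k_algebra (quotient_algebra A I)"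
proof -
  note sub = ideal_submodule[OF A I]
  note qs = quotient_add[OF ka_module[OF A] sub] quotient_smult[OF ka_module[OF A] sub] quotient_mult[OF I]
  show ?thesis
    by (rule k_algebraI; (unfold quotient_carrier[OF ka_module[OF A] sub] quotient_algebra_simps(3))?; (elim imageE)?)
      (simp_all add: k_module_quotient[OF ka_module[OF A] sub] qs A ka_assoc ka_l_distr ka_r_distr)
qed

section \<open>Tensor products\<close>

lemma linear_span_subset: "S \<subseteq> linear_span M S"
  by (auto simp: linear_span_def)

lemma linear_span_minimal: "submodule H ground M \<Longrightarrow> S \<subseteq> H \<Longrightarrow> linear_span M S \<subseteq> H"
  by (auto simp: linear_span_def)

lemma linear_span_submodule:
  assumes M: "k_module M" and S: "S \<subseteq> carrier M"
  shows "submodule (linear_span M S) ground M"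
proof -
  interpret Module.module ground M by (rule M)
  have "submodule (carrier M) ground M" using carrier_is_submodule .
  then have sub: "linear_span M S \<subseteq> carrier M" using S by (rule linear_span_minimal)
  have H: "x \<in> H" if "x \<in> linear_span M S" "submodule H ground M" "S \<subseteq> H" for x H
    using linear_span_minimal that by blast
  show ?thesis
  proof (rule submoduleI[OF sub])
    show "\<zero>\<^bsub>M\<^esub> \<in> linear_span M S"
      using submodule.axioms(1) subgroup.one_closed unfolding linear_span_def by fastforce
    show "\<ominus>\<^bsub>M\<^esub> a \<in> linear_span M S" if "a \<in> linear_span M S" for a
      using H[OF that] submoduleE(3) unfolding linear_span_def by blast
    show "a \<oplus>\<^bsub>M\<^esub> b \<in> linear_span M S" if "a \<in> linear_span M S" "b \<in> linear_span M S" for a b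
      using H[OF that(1)] H[OF that(2)] submoduleE(5) unfolding linear_span_def by blast
    show "a \<odot>\<^bsub>M\<^esub> x \<in> linear_span M S" if "a \<in> carrier ground" "x \<in> linear_span M S" for a x
      using H[OF that(2)] that(1) submoduleE(4) unfolding linear_span_def by blast
  qed
qed

lemma linear_kernel_submodule:
  assumes M: "k_module M" and N: "k_module N" and f: "f \<in> linear_maps M N"
  shows "submodule {x \<in> carrier M. f x = \<zero>\<^bsub>N\<^esub>} ground M"
proof -
  interpret Module.module ground M by (rule M)
  show ?thesis
    by (rule submoduleI) (use M N f in \<open>auto simp: linear_zero linear_add linear_smult km_neg\<close>)
qed

lemma linear_zero_on_span:
  assumes M: "k_module M" and N: "k_module N" and f: "f \<in> linear_maps M N" and S: "S \<subseteq> carrier M"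
    and "\<And>x. x \<in> S \<Longrightarrow> f x = \<zero>\<^bsub>N\<^esub>" and x: "x \<in> linear_span M S"
  shows "f x = \<zero>\<^bsub>N\<^esub>"
  using linear_span_minimal[OF linear_kernel_submodule[OF M N f]] assms by blast

lemma linear_zero_map: "k_module N \<Longrightarrow> (\<lambda>x. \<zero>\<^bsub>N\<^esub>) \<in> linear_maps M N"
  by (rule linear_mapsI) simp_all

lemma bilinear_cong:
  assumes f: "f \<in> bilinear_maps A B N" and A: "k_module A" and B: "k_module B"
    and eq: "\<And>a b. a \<in> carrier A \<Longrightarrow> b \<in> carrier B \<Longrightarrow> f a b = f' a b"
  shows "f' \<in> bilinear_maps A B N"
proof (rule bilinear_mapsI)
  show "f' a \<in> linear_maps B N" if "a \<in> carrier A" for a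
    by (rule linear_cong[OF bilinear_right[OF f that] B]) (rule eq[OF that])
  show "(\<lambda>a. f' a b) \<in> linear_maps A N" if "b \<in> carrier B" for b
    by (rule linear_cong[OF bilinear_left[OF f that] A]) (rule eq[OF _ that])
qed

lemma bilinear_add_left:
  "f \<in> bilinear_maps A B N \<Longrightarrow> a \<in> carrier A \<Longrightarrow> a' \<in> carrier A \<Longrightarrow> b \<in> carrier B \<Longrightarrow>
    f (a \<oplus>\<^bsub>A\<^esub> a') b = f a b \<oplus>\<^bsub>N\<^esub> f a' b"
  and bilinear_add_right: "f \<in> bilinear_maps A B N \<Longrightarrow> a \<in> carrier A \<Longrightarrow> b \<in> carrier B \<Longrightarrow> b' \<in> carrier B \<Longrightarrow>
    f a (b \<oplus>\<^bsub>B\<^esub> b') = f a b \<oplus>\<^bsub>N\<^esub> f a b'"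
  and bilinear_smult_left: "f \<in> bilinear_maps A B N \<Longrightarrow> a \<in> carrier A \<Longrightarrow> b \<in> carrier B \<Longrightarrow>
    f (c \<odot>\<^bsub>A\<^esub> a) b = c \<odot>\<^bsub>N\<^esub> f a b"
  and bilinear_smult_right: "f \<in> bilinear_maps A B N \<Longrightarrow> a \<in> carrier A \<Longrightarrow> b \<in> carrier B \<Longrightarrow>
    f a (c \<odot>\<^bsub>B\<^esub> b) = c \<odot>\<^bsub>N\<^esub> f a b"
  using linear_add[OF bilinear_left, of f A B N b a a'] linear_add[OF bilinear_right, of f A B N a b b']
    linear_smult[OF bilinear_left, of f A B N b a c] linear_smult[OF bilinear_right, of f A B N a b c] by auto

lemma tensor_lift_lin_ext:
  "tensor_lift N f X = the_elem (lin_ext N (\<lambda>u. f (fst u) (snd u)) ` X)"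
  by (simp add: tensor_lift_def lin_ext_def)

section \<open>The tensor product of vector spaces and its universal property\<close>

context
  fixes A :: "('k::field, 'a, 'l) module_scheme" and B :: "('k, 'b, 'm) module_scheme"
  assumes A: "k_module A" and B: "k_module B"
begin

abbreviation (input) "free_pairs \<equiv> monoid_algebra (A \<times>\<times> B) :: ('k, 'a \<times> 'b \<Rightarrow>\<^sub>0 'k) module"

lemma single_pair_closed: "a \<in> carrier A \<Longrightarrow> b \<in> carrier B \<Longrightarrow> Poly_Mapping.single (a, b) c \<in> carrier free_pairs"
  by (auto simp: monoid_algebra_simps DirProd_def)

lemma bilinear_relators_closed: "bilinear_relators A B \<subseteq> carrier free_pairs"
proof -
  have m: "p - q \<in> carrier free_pairs" if "p \<in> carrier free_pairs" "q \<in> carrier free_pairs" for p q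
    using that km_minus_closed[OF k_module_monoid_algebra that] by (simp add: monoid_algebra_minus)
  show ?thesis
    unfolding bilinear_relators_def by (auto intro!: m single_pair_closed simp: A B)
qed

lemma tensor_null_submodule: "submodule (tensor_null A B) ground free_pairs"
  unfolding tensor_null_def by (rule linear_span_submodule[OF k_module_monoid_algebra bilinear_relators_closed])

text \<open>One half of the universal property: bilinearity on pairs says exactly that each of the
  four kinds of relators is sent to zero, and a linear map that kills the relators kills their
  span.\<close>

lemma linear_zero_on_tensor_null:
  assumes N: "k_module N" and f: "f \<in> linear_maps free_pairs N"
    and bil: "(\<lambda>a b. f (Poly_Mapping.single (a, b) 1)) \<in> bilinear_maps A B N"
    and x: "x \<in> tensor_null A B"
  shows "f x = \<zero>\<^bsub>N\<^esub>"
proof (rule linear_zero_on_span[OF k_module_monoid_algebra N f bilinear_relators_closed _ x[unfolded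
    tensor_null_def]])
  fix x assume "x \<in> bilinear_relators A B"
  note s = single_pair_closed
  have sm: "Poly_Mapping.single (a, b) c = c \<odot>\<^bsub>free_pairs\<^esub> Poly_Mapping.single (a, b) 1" for a b c
    by (simp add: monoid_algebra_simps)
  have m: "f (p - q) = f p \<ominus>\<^bsub>N\<^esub> f q" if "p \<in> carrier free_pairs" "q \<in> carrier free_pairs" for p q
    using linear_minus[OF k_module_monoid_algebra N f that] that by (simp add: monoid_algebra_minus)
  have m2: "f (p - q - r) = f p \<ominus>\<^bsub>N\<^esub> f q \<ominus>\<^bsub>N\<^esub> f r"
    if "p \<in> carrier free_pairs" "q \<in> carrier free_pairs" "r \<in> carrier free_pairs" for p q r
    using m[of "p - q" r] that m[of p q] km_minus_closed[OF k_module_monoid_algebra that(1,2)] by (simp add: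
        monoid_algebra_minus)
  note fs = linear_closed[OF f s]
  have cancel2: "u \<ominus>\<^bsub>N\<^esub> u = \<zero>\<^bsub>N\<^esub>" if "u \<in> carrier N" for u
    using km_eq_iff[OF N that that] by simp
  have cancel: "(u \<oplus>\<^bsub>N\<^esub> v) \<ominus>\<^bsub>N\<^esub> u \<ominus>\<^bsub>N\<^esub> v = \<zero>\<^bsub>N\<^esub>"
    if uv: "u \<in> carrier N" "v \<in> carrier N" for u v
  proof -
    have *: "u \<oplus>\<^bsub>N\<^esub> (- 1) \<odot>\<^bsub>N\<^esub> u = \<zero>\<^bsub>N\<^esub>" if "u \<in> carrier N" for u
      using km_smult_l_distr[OF N that, of 1 "- 1"] N that by simp
    have "(u \<oplus>\<^bsub>N\<^esub> v) \<ominus>\<^bsub>N\<^esub> u \<ominus>\<^bsub>N\<^esub> v = (u \<oplus>\<^bsub>N\<^esub> (- 1) \<odot>\<^bsub>N\<^esub> u) \<oplus>\<^bsub>N\<^esub> (v \<oplus>\<^bsub>N\<^esub> (- 1) \<odot>\<^bsub>N\<^esub> v)"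
      using N uv by (simp add: km_minus km_a_assoc km_a_lcomm)
    then show "(u \<oplus>\<^bsub>N\<^esub> v) \<ominus>\<^bsub>N\<^esub> u \<ominus>\<^bsub>N\<^esub> v = \<zero>\<^bsub>N\<^esub>" using * uv N by simp
  qed
  show "f x = \<zero>\<^bsub>N\<^esub>"
    using \<open>x \<in> bilinear_relators A B\<close> unfolding bilinear_relators_def
  proof (elim UnE CollectE exE conjE)
    fix a a' b assume *: "x = Poly_Mapping.single (a \<oplus>\<^bsub>A\<^esub> a', b) 1 - Poly_Mapping.single (a, b) 1 -
        Poly_Mapping.single (a', b) 1"
      and c: "a \<in> carrier A" "a' \<in> carrier A" "b \<in> carrier B"
    show ?thesis unfolding * using c A B by (simp add: m2 s fs bilinear_add_left[OF bil] cancel)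
  next
    fix a b b' assume *: "x = Poly_Mapping.single (a, b \<oplus>\<^bsub>B\<^esub> b') 1 - Poly_Mapping.single (a, b) 1 -
        Poly_Mapping.single (a, b') 1"
      and c: "a \<in> carrier A" "b \<in> carrier B" "b' \<in> carrier B"
    show ?thesis unfolding * using c A B by (simp add: m2 s fs bilinear_add_right[OF bil] cancel)
  next
    fix a b c assume *: "x = Poly_Mapping.single (c \<odot>\<^bsub>A\<^esub> a, b) 1 - Poly_Mapping.single (a, b) c"
      and c: "a \<in> carrier A" "b \<in> carrier B"
    have "f x = f (Poly_Mapping.single (c \<odot>\<^bsub>A\<^esub> a, b) 1) \<ominus>\<^bsub>N\<^esub> c \<odot>\<^bsub>N\<^esub> f (Poly_Mapping.single (a, b) 1)"
      unfolding * using c A B by (subst sm[of a b c]) (simp add: m s k_module_monoid_algebra linear_smult[OF f])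
    then show ?thesis using c N by (simp add: bilinear_smult_left[OF bil] cancel2 fs)
  next
    fix a b c assume *: "x = Poly_Mapping.single (a, c \<odot>\<^bsub>B\<^esub> b) 1 - Poly_Mapping.single (a, b) c"
      and c: "a \<in> carrier A" "b \<in> carrier B"
    have "f x = f (Poly_Mapping.single (a, c \<odot>\<^bsub>B\<^esub> b) 1) \<ominus>\<^bsub>N\<^esub> c \<odot>\<^bsub>N\<^esub> f (Poly_Mapping.single (a, b) 1)"
      unfolding * using c A B by (subst sm[of a b c]) (simp add: m s k_module_monoid_algebra linear_smult[OF f])
    then show ?thesis using c N by (simp add: bilinear_smult_right[OF bil] cancel2 fs)
  qed
qed

lemma k_module_tensor: "k_module (tensor A B)"
  unfolding tensor_def by (rule k_module_quotient[OF k_module_monoid_algebra tensor_null_submodule])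

lemma tensor_proj_linear: "(\<lambda>p. tensor_null A B +>\<^bsub>free_pairs\<^esub> p) \<in> linear_maps free_pairs (tensor A B)"
  unfolding tensor_def by (rule quotient_proj_linear[OF k_module_monoid_algebra tensor_null_submodule])

lemma tensor_carrier: "carrier (tensor A B) = (\<lambda>p. tensor_null A B +>\<^bsub>free_pairs\<^esub> p) ` carrier free_pairs"
  unfolding tensor_def by (rule quotient_carrier[OF k_module_monoid_algebra tensor_null_submodule])

lemma pure_tensor_closed: "a \<in> carrier A \<Longrightarrow> b \<in> carrier B \<Longrightarrow> pure_tensor A B a b \<in> carrier (tensor A B)"
  unfolding tensor_carrier pure_tensor_def using single_pair_closed by blast

text \<open>The other half: in each clause of bilinearity the two sides are cosets of formal sums
  that differ by a relator.\<close>

lemma bilinear_pure_tensor: "(\<lambda>a b. pure_tensor A B a b) \<in> bilinear_maps A B (tensor A B)"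
proof -
  let ?\<pi> = "\<lambda>p. tensor_null A B +>\<^bsub>free_pairs\<^esub> p"
  note s = single_pair_closed
  have add: "p + q \<in> carrier free_pairs" "p - q \<in> carrier free_pairs"
    if "p \<in> carrier free_pairs" "q \<in> carrier free_pairs" for p q
    using km_add_closed[OF k_module_monoid_algebra that] km_minus_closed[OF k_module_monoid_algebra that] that
    by (simp_all add: monoid_algebra_minus monoid_algebra_simps(3))
  have eq: "?\<pi> p = ?\<pi> q" if "p \<in> carrier free_pairs" "q \<in> carrier free_pairs" "p - q \<in> bilinear_relators A B" for p q
    using that linear_span_subset[of "bilinear_relators A B" free_pairs]
      quotient_eq_iff[OF k_module_monoid_algebra tensor_null_submodule that(1,2)]
    unfolding monoid_algebra_minus[OF that(1,2)] tensor_null_def by blast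
  have rel:
    "a \<in> carrier A \<Longrightarrow> a' \<in> carrier A \<Longrightarrow> b \<in> carrier B \<Longrightarrow> Poly_Mapping.single (a \<oplus>\<^bsub>A\<^esub> a', b) 1 -
      Poly_Mapping.single (a, b) 1 - Poly_Mapping.single (a', b) 1 \<in> bilinear_relators A B"
    "a \<in> carrier A \<Longrightarrow> b \<in> carrier B \<Longrightarrow> b' \<in> carrier B \<Longrightarrow> Poly_Mapping.single (a, b \<oplus>\<^bsub>B\<^esub> b') 1 -
      Poly_Mapping.single (a, b) 1 - Poly_Mapping.single (a, b') 1 \<in> bilinear_relators A B"
    "a \<in> carrier A \<Longrightarrow> b \<in> carrier B \<Longrightarrow> Poly_Mapping.single (c \<odot>\<^bsub>A\<^esub> a, b) 1 - Poly_Mapping.single (a, b) c \<in>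
        bilinear_relators A B"
    "a \<in> carrier A \<Longrightarrow> b \<in> carrier B \<Longrightarrow> Poly_Mapping.single (a, c \<odot>\<^bsub>B\<^esub> b) 1 - Poly_Mapping.single (a, b) c \<in>
        bilinear_relators A B"
    for a a' b b' c
    unfolding bilinear_relators_def by blast+
  have padd: "?\<pi> (p + q) = ?\<pi> p \<oplus>\<^bsub>tensor A B\<^esub> ?\<pi> q" if "p \<in> carrier free_pairs" "q \<in> carrier free_pairs" for p q
    using linear_add[OF tensor_proj_linear that] by (simp add: monoid_algebra_simps)
  have psm: "?\<pi> (Poly_Mapping.single (a, b) c) = c \<odot>\<^bsub>tensor A B\<^esub> ?\<pi> (Poly_Mapping.single (a, b) 1)"
    if "a \<in> carrier A" "b \<in> carrier B" for a b c
    using linear_smult[OF tensor_proj_linear s[OF that], of c 1] by (simp add: monoid_algebra_simps)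
  show ?thesis
  proof (rule bilinear_mapsI; rule linear_mapsI)
    fix a b b' assume c: "a \<in> carrier A" "b \<in> carrier B" "b' \<in> carrier B"
    show "pure_tensor A B a (b \<oplus>\<^bsub>B\<^esub> b') = pure_tensor A B a b \<oplus>\<^bsub>tensor A B\<^esub> pure_tensor A B a b'"
      unfolding pure_tensor_def padd[OF s[OF c(1,2)] s[OF c(1,3)], symmetric]
      by (rule eq) (use rel(2)[OF c] c B in \<open>auto intro!: s add simp: diff_diff_eq[symmetric]\<close>)
  next
    fix a c b assume c: "a \<in> carrier A" "b \<in> carrier B"
    show "pure_tensor A B a (c \<odot>\<^bsub>B\<^esub> b) = c \<odot>\<^bsub>tensor A B\<^esub> pure_tensor A B a b"
      unfolding pure_tensor_def psm[OF c, symmetric]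
      by (rule eq) (use rel(4)[OF c] c B in \<open>auto intro!: s\<close>)
    show "pure_tensor A B (c \<odot>\<^bsub>A\<^esub> a) b = c \<odot>\<^bsub>tensor A B\<^esub> pure_tensor A B a b"
      unfolding pure_tensor_def psm[OF c, symmetric]
      by (rule eq) (use rel(3)[OF c] c A in \<open>auto intro!: s\<close>)
  next
    fix a a' b assume c: "b \<in> carrier B" "a \<in> carrier A" "a' \<in> carrier A"
    show "pure_tensor A B (a \<oplus>\<^bsub>A\<^esub> a') b = pure_tensor A B a b \<oplus>\<^bsub>tensor A B\<^esub> pure_tensor A B a' b"
      unfolding pure_tensor_def padd[OF s[OF c(2,1)] s[OF c(3,1)], symmetric]
      by (rule eq) (use rel(1)[OF c(2,3,1)] c A in \<open>auto intro!: s add simp: diff_diff_eq[symmetric]\<close>)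
  qed (simp_all add: pure_tensor_closed)
qed

lemma lin_ext_pairs_linear:
  assumes N: "k_module N" and f: "f \<in> bilinear_maps A B N"
  shows "lin_ext N (\<lambda>u. f (fst u) (snd u)) \<in> linear_maps free_pairs N"
  by (rule lin_ext_linear[OF N]) (use f in \<open>auto simp: DirProd_def\<close>)

lemma lin_ext_pairs_single:
  assumes N: "k_module N" and f: "f \<in> bilinear_maps A B N" and c: "a \<in> carrier A" "b \<in> carrier B"
  shows "lin_ext N (\<lambda>u. f (fst u) (snd u)) (Poly_Mapping.single (a, b) 1) = f a b"
  using lin_ext_single[OF N, of "\<lambda>u. f (fst u) (snd u)" "carrier A \<times> carrier B" "(a, b)" 1]
    bilinear_closed[OF f] c N by (auto simp: Pi_iff)

lemma lin_ext_pairs_null: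
  assumes N: "k_module N" and f: "f \<in> bilinear_maps A B N" and x: "x \<in> tensor_null A B"
  shows "lin_ext N (\<lambda>u. f (fst u) (snd u)) x = \<zero>\<^bsub>N\<^esub>"
  by (rule linear_zero_on_tensor_null[OF N lin_ext_pairs_linear[OF N f] bilinear_cong[OF f A B] x])
    (simp add: lin_ext_pairs_single[OF N f])

lemma tensor_lift_linear:
  assumes N: "k_module N" and f: "f \<in> bilinear_maps A B N"
  shows "(\<lambda>X. tensor_lift N f X) \<in> linear_maps (tensor A B) N"
  unfolding tensor_lift_lin_ext tensor_def
  by (rule the_elem_quotient_linear[OF k_module_monoid_algebra tensor_null_submodule
        lin_ext_pairs_linear[OF N f] N lin_ext_pairs_null[OF N f]])

lemma tensor_lift_proj:
  assumes N: "k_module N" and f: "f \<in> bilinear_maps A B N" and p: "p \<in> carrier free_pairs"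
  shows "tensor_lift N f (tensor_null A B +>\<^bsub>free_pairs\<^esub> p) = lin_ext N (\<lambda>u. f (fst u) (snd u)) p"
  unfolding tensor_lift_lin_ext
  by (rule the_elem_quotient[OF k_module_monoid_algebra tensor_null_submodule
        lin_ext_pairs_linear[OF N f] N lin_ext_pairs_null[OF N f] p])

lemma tensor_lift_pure:
  assumes N: "k_module N" and f: "f \<in> bilinear_maps A B N" and c: "a \<in> carrier A" "b \<in> carrier B"
  shows "tensor_lift N f (pure_tensor A B a b) = f a b"
  unfolding pure_tensor_def
  using tensor_lift_proj[OF N f single_pair_closed[OF c]] lin_ext_pairs_single[OF N f c] by simp

text \<open>The main tool for identities between tensors. It replaces the decomposition of a tensor
  into pure ones, and is applied once for each tensor argument of an identity.\<close>

lemma tensor_linear_eq: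
  assumes N: "k_module N" and f: "f \<in> linear_maps (tensor A B) N" and f': "f' \<in> linear_maps (tensor A B) N"
    and eq: "\<And>a b. a \<in> carrier A \<Longrightarrow> b \<in> carrier B \<Longrightarrow> f (pure_tensor A B a b) = f' (pure_tensor A B a b)"
    and X: "X \<in> carrier (tensor A B)"
  shows "f X = f' X"
proof -
  obtain p where p: "p \<in> carrier free_pairs" "X = tensor_null A B +>\<^bsub>free_pairs\<^esub> p"
    using X unfolding tensor_carrier by auto
  show ?thesis unfolding p(2)
    by (rule linear_eq_on_monoid_algebra[OF N linear_comp[OF tensor_proj_linear f] linear_comp[OF
        tensor_proj_linear f'] _ p(1)])
      (use eq in \<open>auto simp: DirProd_def pure_tensor_def\<close>)
qed

lemma tensor_lift_cong:
  assumes N: "k_module N" and f: "f \<in> bilinear_maps A B N" and X: "X \<in> carrier (tensor A B)"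
    and eq: "\<And>a b. a \<in> carrier A \<Longrightarrow> b \<in> carrier B \<Longrightarrow> f a b = f' a b"
  shows "tensor_lift N f X = tensor_lift N f' X"
  by (rule tensor_linear_eq[OF N tensor_lift_linear[OF N f] tensor_lift_linear[OF N bilinear_cong[OF f A B eq]] _ X])
    (simp_all add: tensor_lift_pure[OF N f] tensor_lift_pure[OF N bilinear_cong[OF f A B eq]] eq)

text \<open>The tensor is held fixed and the bilinear map varies. With a representative of the coset
  chosen, this is \<open>lin_ext_param\<close>. Nested Sweedler sums depend on it, because the outer
  sum is meaningful only if the inner one is linear in the outer variables.\<close>

lemma linear_tensor_lift:
  assumes N: "k_module N" and M: "k_module M"
    and F: "\<And>x. x \<in> carrier M \<Longrightarrow> (\<lambda>a b. F x a b) \<in> bilinear_maps A B N"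
    and lin: "\<And>a b. a \<in> carrier A \<Longrightarrow> b \<in> carrier B \<Longrightarrow> (\<lambda>x. F x a b) \<in> linear_maps M N"
    and X: "X \<in> carrier (tensor A B)"
  shows "(\<lambda>x. tensor_lift N (\<lambda>a b. F x a b) X) \<in> linear_maps M N"
proof -
  obtain p where p: "p \<in> carrier free_pairs" "X = tensor_null A B +>\<^bsub>free_pairs\<^esub> p"
    using X unfolding tensor_carrier by auto
  have k: "Poly_Mapping.keys p \<subseteq> carrier A \<times> carrier B"
    using p by (simp add: monoid_algebra_simps DirProd_def)
  have "(\<lambda>x. lin_ext N (\<lambda>u. F x (fst u) (snd u)) p) \<in> linear_maps M N"
    by (rule lin_ext_param[OF M N _ k]) (use lin in auto)
  then show ?thesis
    by (rule linear_cong[OF _ M]) (use tensor_lift_proj[OF N F p(1)] p(2) in simp)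
qed

lemma linear_comp_tensor_lift:
  assumes N: "k_module N" and K: "k_module K" and f: "f \<in> bilinear_maps A B N" and g: "g \<in> linear_maps N K"
    and X: "X \<in> carrier (tensor A B)"
  shows "g (tensor_lift N f X) = tensor_lift K (\<lambda>a b. g (f a b)) X"
proof (rule tensor_linear_eq[OF K linear_comp[OF tensor_lift_linear[OF N f] g] tensor_lift_linear[OF K] _ X])
  show gf: "(\<lambda>a b. g (f a b)) \<in> bilinear_maps A B K"
    by (rule bilinear_mapsI) (rule linear_comp[OF bilinear_right[OF f] g] linear_comp[OF bilinear_left[OF f] g],
        assumption)+
  show "g (tensor_lift N f (pure_tensor A B a b)) = tensor_lift K (\<lambda>a b. g (f a b)) (pure_tensor A B a b)"
    if "a \<in> carrier A" "b \<in> carrier B" for a b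
    using that by (simp add: tensor_lift_pure[OF N f] tensor_lift_pure[OF K gf])
qed

end

text \<open>Fubini for sums over two independent tensors. Both sides are linear in \<open>X\<close>,
  and for a pure \<open>X\<close> the lifts over it are simply values of \<open>F\<close>.\<close>

lemma tensor_lift_swap:
  assumes mod: "k_module A" "k_module B" "k_module C" "k_module D" and N: "k_module N"
    and X: "X \<in> carrier (tensor A B)" and Y: "Y \<in> carrier (tensor C D)"
    and F1: "\<And>a b. a \<in> carrier A \<Longrightarrow> b \<in> carrier B \<Longrightarrow> (\<lambda>c d. F a b c d) \<in> bilinear_maps C D N"
    and F2: "\<And>c d. c \<in> carrier C \<Longrightarrow> d \<in> carrier D \<Longrightarrow> (\<lambda>a b. F a b c d) \<in> bilinear_maps A B N"
  shows "tensor_lift N (\<lambda>a b. tensor_lift N (\<lambda>c d. F a b c d) Y) X =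
         tensor_lift N (\<lambda>c d. tensor_lift N (\<lambda>a b. F a b c d) X) Y"
proof -
  note T = k_module_tensor[OF mod(1,2)]
  have bil: "(\<lambda>a b. tensor_lift N (\<lambda>c d. F a b c d) Y) \<in> bilinear_maps A B N"
    by (rule bilinear_mapsI; rule linear_tensor_lift[OF mod(3,4) N _ F1 _ Y])
      (simp_all add: mod bilinear_left[OF F2] bilinear_right[OF F2])
  have bil2: "(\<lambda>c d. tensor_lift N (\<lambda>a b. F a b c d) X) \<in> bilinear_maps C D N" if X: "X \<in> carrier (tensor A B)" for X
    by (rule bilinear_mapsI; rule linear_tensor_lift[OF mod(1,2) N _ F2 _ X])
      (simp_all add: mod bilinear_left[OF F1] bilinear_right[OF F1])
  have lin: "(\<lambda>X. tensor_lift N (\<lambda>c d. tensor_lift N (\<lambda>a b. F a b c d) X) Y) \<in> linear_maps (tensor A B) N"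
    by (rule linear_tensor_lift[OF mod(3,4) N T bil2 tensor_lift_linear[OF mod(1,2) N F2] Y])
  show ?thesis
  proof (rule tensor_linear_eq[OF mod(1,2) N tensor_lift_linear[OF mod(1,2) N bil] lin _ X])
    fix a b assume c: "a \<in> carrier A" "b \<in> carrier B"
    show "tensor_lift N (\<lambda>a b. tensor_lift N (\<lambda>c d. F a b c d) Y) (pure_tensor A B a b) =
      tensor_lift N (\<lambda>c d. tensor_lift N (\<lambda>a b. F a b c d) (pure_tensor A B a b)) Y"
      unfolding tensor_lift_pure[OF mod(1,2) N bil c]
      by (rule tensor_lift_cong[OF mod(3,4) N F1[OF c] Y])
        (simp add: tensor_lift_pure[OF mod(1,2) N F2 c])
  qed
qed

section \<open>The product on a tensor product of algebras\<close>

context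
  fixes A :: "('k::field, 'a, 'l) module_scheme" and B :: "('k, 'b, 'm) module_scheme"
  assumes A: "k_algebra A" and B: "k_algebra B"
begin

lemma k_algebra_free_pairs: "k_algebra (monoid_algebra (A \<times>\<times> B) :: ('k, 'a \<times> 'b \<Rightarrow>\<^sub>0 'k) module)"
  by (intro k_algebra_monoid_algebra DirProd_monoid) (use A B in \<open>auto simp: ring.is_monoid ka_ring\<close>)

lemma single_pair_mult:
  "Poly_Mapping.single (a, b) c \<otimes>\<^bsub>monoid_algebra (A \<times>\<times> B)\<^esub> Poly_Mapping.single (a', b') c' =
    Poly_Mapping.single (a \<otimes>\<^bsub>A\<^esub> a', b \<otimes>\<^bsub>B\<^esub> b') (c * c')"
  by (simp add: monoid_algebra_mult_single DirProd_def)

text \<open>\<open>tensor_null\<close> is only a linear span, while \<open>tensor\<close> forms a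
  quotient ring by it, so it has to be an ideal. By linearity the outer factor is a single pair of
  elements a0 and b0. Then (a, b) \<mapsto> a0 a \<otimes> b0 b is again bilinear, hence kills the
  span; likewise on the right.\<close>

lemma tensor_null_ideal: "ideal (tensor_null A B) (monoid_algebra (A \<times>\<times> B))"
proof -
  let ?P = "monoid_algebra (A \<times>\<times> B) :: ('k, 'a \<times> 'b \<Rightarrow>\<^sub>0 'k) module"
  let ?\<pi> = "\<lambda>p. tensor_null A B +>\<^bsub>?P\<^esub> p"
  note P = k_algebra_free_pairs and Am = ka_module[OF A] and Bm = ka_module[OF B]
  note T = k_module_tensor[OF Am Bm] and s = single_pair_closed[OF Am Bm]
  note proj = tensor_proj_linear[OF Am Bm] and bp = bilinear_pure_tensor[OF Am Bm]
  note bm = bilinear_mult[OF P] and sub = tensor_null_submodule[OF Am Bm]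
  have null_c: "x \<in> carrier ?P" if "x \<in> tensor_null A B" for x
    using Module.module.submoduleE(1)[OF ka_module[OF P] sub] that by blast
  have null_iff: "x \<in> tensor_null A B \<longleftrightarrow> ?\<pi> x = \<zero>\<^bsub>tensor A B\<^esub>" if "x \<in> carrier ?P" for x
    using quotient_eq_zero_iff[OF ka_module[OF P] sub that] by (simp add: tensor_def)
  have bil_l: "(\<lambda>a b. pure_tensor A B (a0 \<otimes>\<^bsub>A\<^esub> a) (b0 \<otimes>\<^bsub>B\<^esub> b)) \<in> bilinear_maps A B (tensor A B)"
    and bil_r: "(\<lambda>a b. pure_tensor A B (a \<otimes>\<^bsub>A\<^esub> a0) (b \<otimes>\<^bsub>B\<^esub> b0)) \<in> bilinear_maps A B (tensor A B)"
    if "a0 \<in> carrier A" "b0 \<in> carrier B" for a0 b0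
    using that A B
    by (auto intro!: bilinear_mapsI linear_comp_left[OF _ bp] linear_comp_right[OF _ bp]
        intro: bilinear_left[OF bilinear_mult] bilinear_right[OF bilinear_mult])
  have l: "?\<pi> (r \<otimes>\<^bsub>?P\<^esub> x) = \<zero>\<^bsub>tensor A B\<^esub>" and r: "?\<pi> (x \<otimes>\<^bsub>?P\<^esub> r) = \<zero>\<^bsub>tensor A B\<^esub>"
    if r: "r \<in> carrier ?P" and x: "x \<in> tensor_null A B" for r x
  proof -
    show "?\<pi> (r \<otimes>\<^bsub>?P\<^esub> x) = \<zero>\<^bsub>tensor A B\<^esub>"
    proof (rule linear_eq_on_monoid_algebra[OF T linear_comp[OF bilinear_left[OF bm null_c[OF x]] proj]
            linear_zero_map[OF T] _ r])
      fix u assume "u \<in> carrier (A \<times>\<times> B)"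
      then obtain a0 b0 where u: "u = (a0, b0)" "a0 \<in> carrier A" "b0 \<in> carrier B" by (auto simp: DirProd_def)
      have pr: "?\<pi> (Poly_Mapping.single u 1 \<otimes>\<^bsub>?P\<^esub> Poly_Mapping.single (a, b) 1) =
          pure_tensor A B (a0 \<otimes>\<^bsub>A\<^esub> a) (b0 \<otimes>\<^bsub>B\<^esub> b)" for a b
        by (simp add: u single_pair_mult pure_tensor_def)
      show "?\<pi> (Poly_Mapping.single u 1 \<otimes>\<^bsub>?P\<^esub> x) = \<zero>\<^bsub>tensor A B\<^esub>"
      proof (rule linear_zero_on_tensor_null[OF Am Bm T linear_comp[OF bilinear_right[OF bm] proj] _ x], unfold pr)
        show "Poly_Mapping.single u 1 \<in> carrier ?P" using u s by simp
      qed (rule bil_l[OF u(2,3)])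
    qed
    show "?\<pi> (x \<otimes>\<^bsub>?P\<^esub> r) = \<zero>\<^bsub>tensor A B\<^esub>"
    proof (rule linear_eq_on_monoid_algebra[OF T linear_comp[OF bilinear_right[OF bm null_c[OF x]] proj]
            linear_zero_map[OF T] _ r])
      fix u assume "u \<in> carrier (A \<times>\<times> B)"
      then obtain a0 b0 where u: "u = (a0, b0)" "a0 \<in> carrier A" "b0 \<in> carrier B" by (auto simp: DirProd_def)
      have pr: "?\<pi> (Poly_Mapping.single (a, b) 1 \<otimes>\<^bsub>?P\<^esub> Poly_Mapping.single u 1) =
          pure_tensor A B (a \<otimes>\<^bsub>A\<^esub> a0) (b \<otimes>\<^bsub>B\<^esub> b0)" for a b
        by (simp add: u single_pair_mult pure_tensor_def)
      show "?\<pi> (x \<otimes>\<^bsub>?P\<^esub> Poly_Mapping.single u 1) = \<zero>\<^bsub>tensor A B\<^esub>"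
      proof (rule linear_zero_on_tensor_null[OF Am Bm T linear_comp[OF bilinear_left[OF bm] proj] _ x], unfold pr)
        show "Poly_Mapping.single u 1 \<in> carrier ?P" using u s by simp
      qed (rule bil_r[OF u(2,3)])
    qed
  qed
  show ?thesis
    by (rule idealI[OF ka_ring[OF P] submodule.axioms(1)[OF sub]])
      (use null_iff l r null_c P in simp_all)
qed

lemma k_algebra_tensor: "k_algebra (tensor A B)"
  unfolding tensor_def by (rule k_algebra_quotient[OF k_algebra_free_pairs tensor_null_ideal])

lemma pure_tensor_mult:
  assumes "a \<in> carrier A" "b \<in> carrier B" "a' \<in> carrier A" "b' \<in> carrier B"
  shows "pure_tensor A B a b \<otimes>\<^bsub>tensor A B\<^esub> pure_tensor A B a' b' =
    pure_tensor A B (a \<otimes>\<^bsub>A\<^esub> a') (b \<otimes>\<^bsub>B\<^esub> b')"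
  unfolding pure_tensor_def tensor_def
  using quotient_mult[OF tensor_null_ideal single_pair_closed[OF ka_module[OF A] ka_module[OF B] assms(1,2)]
      single_pair_closed[OF ka_module[OF A] ka_module[OF B] assms(3,4)], of 1 1]
  by (simp add: single_pair_mult)

lemma tensor_one: "\<one>\<^bsub>tensor A B\<^esub> = pure_tensor A B \<one>\<^bsub>A\<^esub> \<one>\<^bsub>B\<^esub>"
  by (simp add: tensor_def quotient_algebra_simps monoid_algebra_simps pure_tensor_def DirProd_def)

end

section \<open>Algebra homomorphisms and presented algebras\<close>

lemma algebra_homsI:
  assumes "f \<in> linear_maps A B" "f \<one>\<^bsub>A\<^esub> = \<one>\<^bsub>B\<^esub>"
    and "\<And>x y. x \<in> carrier A \<Longrightarrow> y \<in> carrier A \<Longrightarrow> f (x \<otimes>\<^bsub>A\<^esub> y) = f x \<otimes>\<^bsub>B\<^esub> f y"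
  shows "f \<in> algebra_homs A B"
  using assms by (auto simp: algebra_homs_def ring_hom_def linear_add)

lemma algebra_hom_linear: "f \<in> algebra_homs A B \<Longrightarrow> f \<in> linear_maps A B"
  and algebra_hom_one: "f \<in> algebra_homs A B \<Longrightarrow> f \<one>\<^bsub>A\<^esub> = \<one>\<^bsub>B\<^esub>"
  and algebra_hom_mult: "f \<in> algebra_homs A B \<Longrightarrow> x \<in> carrier A \<Longrightarrow> y \<in> carrier A \<Longrightarrow> f (x \<otimes>\<^bsub>A\<^esub> y) = f x \<otimes>\<^bsub>B\<^esub> f y"
  by (auto simp: algebra_homs_def ring_hom_def)

lemma algebra_hom_closed: "f \<in> algebra_homs A B \<Longrightarrow> x \<in> carrier A \<Longrightarrow> f x \<in> carrier B"
  by (rule linear_closed[OF algebra_hom_linear])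

lemma algebra_hom_comp:
  assumes A: "k_algebra A" and f: "f \<in> algebra_homs A B" and g: "g \<in> algebra_homs B C"
  shows "(\<lambda>x. g (f x)) \<in> algebra_homs A C"
  by (rule algebra_homsI[OF linear_comp[OF algebra_hom_linear[OF f] algebra_hom_linear[OF g]]])
    (simp_all add: algebra_hom_one[OF f] algebra_hom_one[OF g] algebra_hom_mult[OF f] algebra_hom_mult[OF g]
      algebra_hom_closed[OF f])

lemma algebra_hom_id: "(\<lambda>x. x) \<in> algebra_homs A A"
  by (rule algebra_homsI) (auto intro: linear_id)

section \<open>Free algebras and evaluation at elements of an algebra\<close>

definition word_prod :: "('k::field, 'a, 'm) module_scheme \<Rightarrow> ('s \<Rightarrow> 'a) \<Rightarrow> 's list \<Rightarrow> 'a" where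
  "word_prod A \<phi> w = foldr (\<lambda>s a. \<phi> s \<otimes>\<^bsub>A\<^esub> a) w \<one>\<^bsub>A\<^esub>"

lemma word_prod_closed:
  "k_algebra A \<Longrightarrow> (\<And>s. \<phi> s \<in> carrier A) \<Longrightarrow> word_prod A \<phi> w \<in> carrier A"
  by (induction w) (simp_all add: word_prod_def)

lemma word_prod_append:
  assumes "k_algebra A" "\<And>s. \<phi> s \<in> carrier A"
  shows "word_prod A \<phi> (v @ w) = word_prod A \<phi> v \<otimes>\<^bsub>A\<^esub> word_prod A \<phi> w"
proof -
  have W: "word_prod A \<phi> u \<in> carrier A" for u by (rule word_prod_closed[OF assms])
  show ?thesis
  proof (induction v)
    case Nil
    show ?case using assms(1) W by (simp add: word_prod_def[of _ _ "[]"])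
  next
    case (Cons s v)
    have *: "word_prod A \<phi> (s # u) = \<phi> s \<otimes>\<^bsub>A\<^esub> word_prod A \<phi> u" for u
      by (simp add: word_prod_def)
    show ?case using assms W Cons by (simp add: * ka_assoc)
  qed
qed

lemma free_eval_lin_ext: "free_eval A \<phi> p = lin_ext A (word_prod A \<phi>) p"
  by (simp add: free_eval_def lin_ext_def word_prod_def)

lemma monoid_free_monoid: "monoid free_monoid"
  by (rule monoidI) (simp_all add: free_monoid_def)

lemma k_algebra_free_algebra: "k_algebra free_algebra"
  unfolding free_algebra_def by (rule k_algebra_monoid_algebra[OF monoid_free_monoid])

lemma free_algebra_carrier: "carrier free_algebra = UNIV"
  by (simp add: free_algebra_def monoid_algebra_simps free_monoid_def)

lemma free_algebra_closed [simp]: "x \<in> carrier free_algebra"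
  by (simp add: free_algebra_carrier)

context
  fixes A :: "('k::field, 'a, 'm) module_scheme" and \<phi> :: "'s \<Rightarrow> 'a"
  assumes A: "k_algebra A" and \<phi>: "\<And>s. \<phi> s \<in> carrier A"
begin

lemma free_eval_linear: "free_eval A \<phi> \<in> linear_maps free_algebra A"
proof -
  have "lin_ext A (word_prod A \<phi>) \<in> linear_maps free_algebra A"
    unfolding free_algebra_def
    by (rule lin_ext_linear[OF ka_module[OF A]]) (use word_prod_closed[of A \<phi>, OF A \<phi>] in blast)
  then show ?thesis by (simp add: free_eval_lin_ext[abs_def])
qed

lemma free_eval_single: "free_eval A \<phi> (Poly_Mapping.single w c) = c \<odot>\<^bsub>A\<^esub> word_prod A \<phi> w"
  unfolding free_eval_lin_ext
  by (rule lin_ext_single[OF ka_module[OF A], of _ UNIV]) (use word_prod_closed[of A \<phi>, OF A \<phi>] in auto)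

lemma free_eval_hom: "free_eval A \<phi> \<in> algebra_homs free_algebra A"
proof (rule algebra_homsI[OF free_eval_linear])
  show "free_eval A \<phi> \<one>\<^bsub>free_algebra\<^esub> = \<one>\<^bsub>A\<^esub>"
    using A by (simp add: free_algebra_def monoid_algebra_simps free_monoid_def free_eval_single word_prod_def)
  note W = word_prod_closed[of A \<phi>, OF A \<phi>]
  note lin = free_eval_linear[unfolded free_algebra_def]
  note F = k_algebra_free_algebra[unfolded free_algebra_def]
  have c: "x \<in> carrier (monoid_algebra free_monoid)" for x :: "'s list \<Rightarrow>\<^sub>0 'k"
    using free_algebra_closed[of x] by (simp add: free_algebra_def)
  fix p q :: "'s list \<Rightarrow>\<^sub>0 'k"
  show "free_eval A \<phi> (p \<otimes>\<^bsub>free_algebra\<^esub> q) = free_eval A \<phi> p \<otimes>\<^bsub>A\<^esub> free_eval A \<phi> q"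
    unfolding free_algebra_def
  proof (rule linear_eq_on_monoid_algebra[OF ka_module[OF A] linear_comp[OF bilinear_left[OF bilinear_mult[OF F]
      c] lin]
        linear_comp_left[OF lin bilinear_mult[OF A] linear_closed[OF lin c]] _ c])
    fix v :: "'s list"
    show "free_eval A \<phi> (Poly_Mapping.single v 1 \<otimes>\<^bsub>monoid_algebra free_monoid\<^esub> q) =
        free_eval A \<phi> (Poly_Mapping.single v 1) \<otimes>\<^bsub>A\<^esub> free_eval A \<phi> q"
    proof (rule linear_eq_on_monoid_algebra[OF ka_module[OF A] linear_comp[OF bilinear_right[OF bilinear_mult[OF
        F] c] lin]
        linear_comp_right[OF lin bilinear_mult[OF A] linear_closed[OF lin c]] _ c])
      fix w :: "'s list"
      show "free_eval A \<phi> (Poly_Mapping.single v 1 \<otimes>\<^bsub>monoid_algebra free_monoid\<^esub> Poly_Mapping.single w 1) =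
          free_eval A \<phi> (Poly_Mapping.single v 1) \<otimes>\<^bsub>A\<^esub> free_eval A \<phi> (Poly_Mapping.single w 1)"
        using W A \<phi> by (simp add: monoid_algebra_mult_single free_eval_single free_monoid_def word_prod_append)
    qed
  qed
qed

lemma free_eval_gen: "free_eval A \<phi> (free_gen s) = \<phi> s"
  using A \<phi> by (simp add: free_gen_def free_eval_single word_prod_def)

lemma free_eval_unique:
  assumes f: "f \<in> algebra_homs free_algebra A" and gen: "\<And>s. f (free_gen s) = \<phi> s"
  shows "f p = free_eval A \<phi> p"
proof (rule linear_eq_on_monoid_algebra[OF ka_module[OF A], of _ free_monoid])
  show "f \<in> linear_maps (monoid_algebra free_monoid) A"
    using algebra_hom_linear[OF f] by (simp add: free_algebra_def)
  show "free_eval A \<phi> \<in> linear_maps (monoid_algebra free_monoid) A"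
    using free_eval_linear by (simp add: free_algebra_def)
  show "p \<in> carrier (monoid_algebra free_monoid)"
    using free_algebra_closed[of p] by (simp add: free_algebra_def)
  fix w :: "'s list"
  have "f (Poly_Mapping.single w 1) = word_prod A \<phi> w"
  proof (induction w)
    case Nil
    have "\<one>\<^bsub>free_algebra\<^esub> = Poly_Mapping.single ([]::'s list) (1::'k)"
      by (simp add: free_algebra_def monoid_algebra_simps free_monoid_def)
    then show ?case using algebra_hom_one[OF f] by (simp add: word_prod_def)
  next
    case (Cons s w)
    have "Poly_Mapping.single (s # w) 1 = free_gen s \<otimes>\<^bsub>free_algebra\<^esub> Poly_Mapping.single w (1::'k)"
      by (simp add: free_algebra_def free_gen_def monoid_algebra_mult_single free_monoid_def)
    then show ?case using algebra_hom_mult[OF f, of "free_gen s" "Poly_Mapping.single w 1"] Cons gen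
      by (simp add: word_prod_def)
  qed
  then show "f (Poly_Mapping.single w 1) = free_eval A \<phi> (Poly_Mapping.single w 1)"
    using A word_prod_closed[of A \<phi>, OF A \<phi>] by (simp add: free_eval_single)
qed

end

section \<open>Presented algebras\<close>

context
  fixes R :: "('s list \<Rightarrow>\<^sub>0 'k::field) set"
begin

lemma presented_ideal: "ideal (Idl\<^bsub>free_algebra\<^esub> R) free_algebra"
  by (rule ring.genideal_ideal[OF ka_ring[OF k_algebra_free_algebra]]) (simp add: free_algebra_carrier)

lemma k_algebra_presented: "k_algebra (presented_algebra R)"
  unfolding presented_algebra_def by (rule k_algebra_quotient[OF k_algebra_free_algebra presented_ideal])

lemma presented_proj_hom: "(\<lambda>p. Idl\<^bsub>free_algebra\<^esub> R +>\<^bsub>free_algebra\<^esub> p) \<in> algebra_homs free_algebra (presented_algebra R)"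
proof (rule algebra_homsI)
  show "(\<lambda>p. Idl\<^bsub>free_algebra\<^esub> R +>\<^bsub>free_algebra\<^esub> p) \<in> linear_maps free_algebra (presented_algebra R)"
    unfolding presented_algebra_def
    by (rule quotient_proj_linear[OF ka_module[OF k_algebra_free_algebra] ideal_submodule[OF
        k_algebra_free_algebra presented_ideal]])
qed (simp_all add: presented_algebra_def quotient_algebra_simps(3) quotient_mult[OF presented_ideal])

lemma gen_class_closed: "gen_class R s \<in> carrier (presented_algebra R)"
  unfolding gen_class_def by (rule algebra_hom_closed[OF presented_proj_hom]) simp

text \<open>The projection is an algebra map, and algebra maps out of the free algebra are
  determined on generators. Thus each element of the quotient is a polynomial in the classes of the
  generators, which is the basis of the induction principle below.\<close>

lemma presented_proj_eval: "Idl\<^bsub>free_algebra\<^esub> R +>\<^bsub>free_algebra\<^esub> p = free_eval (presented_algebra R) (gen_class R) p"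
  by (rule free_eval_unique[OF k_algebra_presented gen_class_closed presented_proj_hom]) (simp add: gen_class_def)

lemma presented_carrier: "carrier (presented_algebra R) = range (free_eval (presented_algebra R) (gen_class R))"
proof -
  have "carrier (presented_algebra R) = range (\<lambda>p. Idl\<^bsub>free_algebra\<^esub> R +>\<^bsub>free_algebra\<^esub> p)"
    unfolding presented_algebra_def
    using quotient_carrier[OF ka_module[OF k_algebra_free_algebra] ideal_submodule[OF k_algebra_free_algebra
        presented_ideal]]
    by (simp add: free_algebra_carrier)
  then show ?thesis by (simp add: presented_proj_eval)
qed

lemma presented_relation: "r \<in> R \<Longrightarrow> free_eval (presented_algebra R) (gen_class R) r = \<zero>\<^bsub>presented_algebra R\<^esub>"
proof -
  assume "r \<in> R"
  then have "r \<in> Idl\<^bsub>free_algebra\<^esub> R"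
    using ring.genideal_self[OF ka_ring[OF k_algebra_free_algebra], of R] by (auto simp: free_algebra_carrier)
  then have "Idl\<^bsub>free_algebra\<^esub> R +>\<^bsub>free_algebra\<^esub> r = \<zero>\<^bsub>presented_algebra R\<^esub>"
    unfolding presented_algebra_def
    using quotient_eq_zero_iff[OF ka_module[OF k_algebra_free_algebra] ideal_submodule[OF k_algebra_free_algebra
        presented_ideal]]
    by simp
  then show ?thesis by (simp add: presented_proj_eval)
qed

text \<open>The kernel of the evaluation is an ideal that contains the relators, hence the ideal
  they generate; so the evaluation is constant on cosets.\<close>

lemma
  assumes A: "k_algebra A" and \<phi>: "\<And>s. \<phi> s \<in> carrier A"
    and rel: "\<And>r. r \<in> R \<Longrightarrow> free_eval A \<phi> r = \<zero>\<^bsub>A\<^esub>"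
  shows induced_map_hom: "induced_map A \<phi> \<in> algebra_homs (presented_algebra R) A"
    and induced_map_gen: "induced_map A \<phi> (gen_class R s) = \<phi> s"
proof -
  note F = k_algebra_free_algebra and hom = free_eval_hom[of A \<phi>, OF A \<phi>]
  note sub = ideal_submodule[OF k_algebra_free_algebra presented_ideal]
  interpret ring A by (rule ka_ring[OF A])
  interpret F: ring free_algebra by (rule ka_ring[OF F])
  have "ideal {p. free_eval A \<phi> p = \<zero>\<^bsub>A\<^esub>} free_algebra"
  proof (rule idealI[OF ka_ring[OF F]])
    show "subgroup {p. free_eval A \<phi> p = \<zero>\<^bsub>A\<^esub>} (add_monoid free_algebra)"
      using submodule.axioms(1)[OF linear_kernel_submodule[OF ka_module[OF F] ka_module[OF A]
          algebra_hom_linear[OF hom]]] by simp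
  qed (simp_all add: algebra_hom_mult[OF hom] algebra_hom_closed[OF hom])
  then have "Idl\<^bsub>free_algebra\<^esub> R \<subseteq> {p. free_eval A \<phi> p = \<zero>\<^bsub>A\<^esub>}"
    by (rule F.genideal_minimal) (use rel in auto)
  then have z: "free_eval A \<phi> x = \<zero>\<^bsub>A\<^esub>" if "x \<in> Idl\<^bsub>free_algebra\<^esub> R" for x using that by blast
  have im: "induced_map A \<phi> = (\<lambda>X. the_elem (free_eval A \<phi> ` X))" by (simp add: induced_map_def fun_eq_iff)
  have val: "induced_map A \<phi> (Idl\<^bsub>free_algebra\<^esub> R +>\<^bsub>free_algebra\<^esub> p) = free_eval A \<phi> p" for p
    unfolding im by (rule the_elem_quotient[OF ka_module[OF F] sub algebra_hom_linear[OF hom] ka_module[OF A] z])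
        simp_all
  show "induced_map A \<phi> (gen_class R s) = \<phi> s"
    by (simp add: gen_class_def val free_eval_gen[of A \<phi>, OF A \<phi>])
  show "induced_map A \<phi> \<in> algebra_homs (presented_algebra R) A"
  proof (rule algebra_homsI)
    show "induced_map A \<phi> \<in> linear_maps (presented_algebra R) A"
      unfolding im presented_algebra_def
      by (rule the_elem_quotient_linear[OF ka_module[OF F] sub algebra_hom_linear[OF hom] ka_module[OF A] z])
    show "induced_map A \<phi> \<one>\<^bsub>presented_algebra R\<^esub> = \<one>\<^bsub>A\<^esub>"
      by (simp add: presented_algebra_def quotient_algebra_simps(3) val algebra_hom_one[OF hom])
    fix x y assume "x \<in> carrier (presented_algebra R)" "y \<in> carrier (presented_algebra R)"
    then obtain p q where "x = Idl\<^bsub>free_algebra\<^esub> R +>\<^bsub>free_algebra\<^esub> p" "y = Idl\<^bsub>free_algebra\<^esub> R +>\<^bsub>free_algebra\<^esub> q"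
      by (auto simp: presented_carrier presented_proj_eval[symmetric])
    then show "induced_map A \<phi> (x \<otimes>\<^bsub>presented_algebra R\<^esub> y) = induced_map A \<phi> x \<otimes>\<^bsub>A\<^esub> induced_map A \<phi> y"
      using algebra_hom_mult[OF presented_proj_hom, of p q] by (simp add: val[symmetric] algebra_hom_mult[OF hom]
          flip: val)
        (simp add: val algebra_hom_mult[OF hom] flip: algebra_hom_mult[OF presented_proj_hom])
  qed
qed

text \<open>Words are folded from the right, so a generator always enters as a left factor. This
  one-sidedness determines how the inductions over comultiplied elements have to be
  arranged.\<close>

lemma presented_induct [consumes 1, case_names one add smult gen]:
  assumes x: "x \<in> carrier (presented_algebra R)"
    and one: "P \<one>\<^bsub>presented_algebra R\<^esub>"
    and add: "\<And>x y. x \<in> carrier (presented_algebra R) \<Longrightarrow> y \<in> carrier (presented_algebra R) \<Longrightarrow> P x \<Longrightarrow> P y \<Longrightarrow> P (x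
        \<oplus>\<^bsub>presented_algebra R\<^esub> y)"
    and smult: "\<And>c x. x \<in> carrier (presented_algebra R) \<Longrightarrow> P x \<Longrightarrow> P (c \<odot>\<^bsub>presented_algebra R\<^esub> x)"
    and gen: "\<And>s x. x \<in> carrier (presented_algebra R) \<Longrightarrow> P x \<Longrightarrow> P (gen_class R s \<otimes>\<^bsub>presented_algebra R\<^esub> x)"
  shows "P x"
proof -
  note PA = k_algebra_presented and hom = free_eval_hom[of "presented_algebra R" "gen_class R", OF
      k_algebra_presented gen_class_closed]
  have word: "P (word_prod (presented_algebra R) (gen_class R) w)" for w
    by (induction w) (simp_all add: word_prod_def one gen[unfolded word_prod_def]
      word_prod_closed[OF PA gen_class_closed, unfolded word_prod_def])
  have z: "P \<zero>\<^bsub>presented_algebra R\<^esub>"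
    using smult[OF _ one, of 0] PA by simp
  obtain p where "x = free_eval (presented_algebra R) (gen_class R) p" using x presented_carrier by auto
  moreover have "P (free_eval (presented_algebra R) (gen_class R) p)"
  proof (rule poly_mapping_single_induct[of p UNIV "\<lambda>p. P (free_eval (presented_algebra R) (gen_class R) p)"])
    show "P (free_eval (presented_algebra R) (gen_class R) 0)"
      using z linear_zero[OF ka_module[OF k_algebra_free_algebra] ka_module[OF PA] algebra_hom_linear[OF hom]]
      by (simp add: free_algebra_def monoid_algebra_simps)
    fix w c q assume q: "P (free_eval (presented_algebra R) (gen_class R) q)"
    have "Poly_Mapping.single w c + q = Poly_Mapping.single w c \<oplus>\<^bsub>free_algebra\<^esub> q"
      by (simp add: free_algebra_def monoid_algebra_simps)
    then show "P (free_eval (presented_algebra R) (gen_class R) (Poly_Mapping.single w c + q))"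
      using q by (simp add: linear_add[OF algebra_hom_linear[OF hom]] free_eval_single[of "presented_algebra R"
          "gen_class R", OF PA gen_class_closed]
        add smult word word_prod_closed[OF PA gen_class_closed] PA algebra_hom_closed[OF hom])
  qed simp
  ultimately show ?thesis by simp
qed

lemma presented_linear_eqI:
  assumes N: "k_module N" and f: "f \<in> linear_maps (presented_algebra R) N" and f': "f' \<in> linear_maps
      (presented_algebra R) N"
    and one: "f \<one>\<^bsub>presented_algebra R\<^esub> = f' \<one>\<^bsub>presented_algebra R\<^esub>"
    and gen: "\<And>s x. x \<in> carrier (presented_algebra R) \<Longrightarrow> f x = f' x \<Longrightarrow>
       f (gen_class R s \<otimes>\<^bsub>presented_algebra R\<^esub> x) = f' (gen_class R s \<otimes>\<^bsub>presented_algebra R\<^esub> x)"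
    and x: "x \<in> carrier (presented_algebra R)"
  shows "f x = f' x"
  using x by (induction rule: presented_induct)
    (simp_all add: one gen linear_add[OF f] linear_add[OF f'] linear_smult[OF f] linear_smult[OF f'])

lemma presented_hom_eqI:
  assumes A: "k_algebra A" and f: "f \<in> algebra_homs (presented_algebra R) A" and f': "f' \<in> algebra_homs
      (presented_algebra R) A"
    and gen: "\<And>s. f (gen_class R s) = f' (gen_class R s)" and x: "x \<in> carrier (presented_algebra R)"
  shows "f x = f' x"
  by (rule presented_linear_eqI[OF ka_module[OF A] algebra_hom_linear[OF f] algebra_hom_linear[OF f'] _ _ x])
    (simp_all add: algebra_hom_one[OF f] algebra_hom_one[OF f'] algebra_hom_mult[OF f] algebra_hom_mult[OF f']
        gen_class_closed gen)

end

section \<open>Homomorphisms between tensor products\<close>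

text \<open>The two sides of multiplicativity are linear in each factor, which reduces both factors
  to pure tensors.\<close>

lemma tensor_algebra_homI:
  assumes A: "k_algebra A" and B: "k_algebra B" and N: "k_algebra N"
    and f: "f \<in> linear_maps (tensor A B) N"
    and one: "f (pure_tensor A B \<one>\<^bsub>A\<^esub> \<one>\<^bsub>B\<^esub>) = \<one>\<^bsub>N\<^esub>"
    and mult: "\<And>a b a' b'. a \<in> carrier A \<Longrightarrow> b \<in> carrier B \<Longrightarrow> a' \<in> carrier A \<Longrightarrow> b' \<in> carrier B \<Longrightarrow>
      f (pure_tensor A B (a \<otimes>\<^bsub>A\<^esub> a') (b \<otimes>\<^bsub>B\<^esub> b')) = f (pure_tensor A B a b) \<otimes>\<^bsub>N\<^esub> f (pure_tensor A B a' b')"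
  shows "f \<in> algebra_homs (tensor A B) N"
proof (rule algebra_homsI[OF f])
  show "f \<one>\<^bsub>tensor A B\<^esub> = \<one>\<^bsub>N\<^esub>" using one by (simp add: tensor_one[OF A B])
  let ?T = "tensor A B"
  note T = k_algebra_tensor[OF A B] and Am = ka_module[OF A] and Bm = ka_module[OF B] and Nm = ka_module[OF N]
  fix X Y assume X: "X \<in> carrier ?T" and Y: "Y \<in> carrier ?T"
  show "f (X \<otimes>\<^bsub>?T\<^esub> Y) = f X \<otimes>\<^bsub>N\<^esub> f Y"
  proof (rule tensor_linear_eq[OF Am Bm Nm linear_comp[OF bilinear_left[OF bilinear_mult[OF T] Y] f]
        linear_comp_left[OF f bilinear_mult[OF N] linear_closed[OF f Y]] _ X])
    fix a b assume a: "a \<in> carrier A" "b \<in> carrier B"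
    note p = pure_tensor_closed[OF Am Bm a]
    show "f (pure_tensor A B a b \<otimes>\<^bsub>?T\<^esub> Y) = f (pure_tensor A B a b) \<otimes>\<^bsub>N\<^esub> f Y"
      by (rule tensor_linear_eq[OF Am Bm Nm linear_comp[OF bilinear_right[OF bilinear_mult[OF T] p] f]
        linear_comp_right[OF f bilinear_mult[OF N] linear_closed[OF f p]] _ Y])
       (use a in \<open>simp add: pure_tensor_mult[OF A B] mult\<close>)
  qed
qed

lemma bilinear_comp_linear:
  assumes "h \<in> bilinear_maps C D N" "f \<in> linear_maps A C" "g \<in> linear_maps B D"
  shows "(\<lambda>a b. h (f a) (g b)) \<in> bilinear_maps A B N"
  by (rule bilinear_mapsI; rule linear_comp_left[OF _ assms(1)] linear_comp_right[OF _ assms(1)])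
    (use assms in auto)

context
  fixes A :: "('k::field, 'a, 'l) module_scheme" and B :: "('k, 'b, 'm) module_scheme"
    and C :: "('k, 'c, 'n) module_scheme" and D :: "('k, 'd, 'o) module_scheme" and f g
  assumes mod: "k_module A" "k_module B" "k_module C" "k_module D"
    and f: "f \<in> linear_maps A C" and g: "g \<in> linear_maps B D"
begin

lemma tensor_map_linear: "tensor_map C D f g \<in> linear_maps (tensor A B) (tensor C D)"
  using tensor_lift_linear[OF mod(1,2) k_module_tensor[OF mod(3,4)] bilinear_comp_linear[OF
      bilinear_pure_tensor[OF mod(3,4)] f g]]
  by (simp add: tensor_map_def[abs_def])

lemma tensor_map_pure: "a \<in> carrier A \<Longrightarrow> b \<in> carrier B \<Longrightarrow>
    tensor_map C D f g (pure_tensor A B a b) = pure_tensor C D (f a) (g b)"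
  unfolding tensor_map_def
  by (rule tensor_lift_pure[OF mod(1,2) k_module_tensor[OF mod(3,4)] bilinear_comp_linear[OF
      bilinear_pure_tensor[OF mod(3,4)] f g]])

lemma tensor_lift_tensor_map:
  assumes N: "k_module N" and h: "h \<in> bilinear_maps C D N" and X: "X \<in> carrier (tensor A B)"
  shows "tensor_lift N h (tensor_map C D f g X) = tensor_lift N (\<lambda>a b. h (f a) (g b)) X"
  by (rule tensor_linear_eq[OF mod(1,2) N linear_comp[OF tensor_map_linear tensor_lift_linear[OF mod(3,4) N h]]
        tensor_lift_linear[OF mod(1,2) N bilinear_comp_linear[OF h f g]] _ X])
    (simp add: tensor_map_pure tensor_lift_pure[OF mod(3,4) N h]
      tensor_lift_pure[OF mod(1,2) N bilinear_comp_linear[OF h f g]] linear_closed[OF f] linear_closed[OF g])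

end

lemma tensor_map_hom:
  assumes alg: "k_algebra A" "k_algebra B" "k_algebra C" "k_algebra D"
    and f: "f \<in> algebra_homs A C" and g: "g \<in> algebra_homs B D"
  shows "tensor_map C D f g \<in> algebra_homs (tensor A B) (tensor C D)"
proof -
  note m = alg[THEN ka_module] and l = algebra_hom_linear[OF f] algebra_hom_linear[OF g]
  show ?thesis
    by (rule tensor_algebra_homI[OF alg(1,2) k_algebra_tensor[OF alg(3,4)] tensor_map_linear[OF m l]])
      (simp_all add: tensor_map_pure[OF m l] alg algebra_hom_one[OF f] algebra_hom_one[OF g] tensor_one
        algebra_hom_mult[OF f] algebra_hom_mult[OF g] pure_tensor_mult algebra_hom_closed[OF f]
            algebra_hom_closed[OF g])
qed

context
  fixes A :: "('k::field, 'a, 'l) module_scheme" and B :: "('k, 'b, 'm) module_scheme"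
    and C :: "('k, 'c, 'n) module_scheme"
  assumes A: "k_module A" and B: "k_module B" and C: "k_module C"
begin

lemma bilinear_tensor_assoc_inner:
  assumes N: "k_module N"
    and F: "\<And>c. c \<in> carrier C \<Longrightarrow> (\<lambda>a b. F a b c) \<in> bilinear_maps A B N"
    and L: "\<And>a b. a \<in> carrier A \<Longrightarrow> b \<in> carrier B \<Longrightarrow> (\<lambda>c. F a b c) \<in> linear_maps C N"
  shows "(\<lambda>u c. tensor_lift N (\<lambda>a b. F a b c) u) \<in> bilinear_maps (tensor A B) C N"
  by (rule bilinear_mapsI) (rule linear_tensor_lift[OF A B N C F L] tensor_lift_linear[OF A B N F], assumption+)+

lemma bilinear_tensor_assoc_outer:
  assumes N: "k_module N"
    and F: "\<And>a. a \<in> carrier A \<Longrightarrow> (\<lambda>b c. F a b c) \<in> bilinear_maps B C N"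
    and L: "\<And>b c. b \<in> carrier B \<Longrightarrow> c \<in> carrier C \<Longrightarrow> (\<lambda>a. F a b c) \<in> linear_maps A N"
  shows "(\<lambda>a u. tensor_lift N (\<lambda>b c. F a b c) u) \<in> bilinear_maps A (tensor B C) N"
  by (rule bilinear_mapsI) (rule linear_tensor_lift[OF B C N A F L] tensor_lift_linear[OF B C N F], assumption+)+

lemma pure3_multilinear:
  shows "c \<in> carrier C \<Longrightarrow> (\<lambda>a b. pure_tensor A (tensor B C) a (pure_tensor B C b c)) \<in> bilinear_maps A B (tensor A
      (tensor B C))"
    and "a \<in> carrier A \<Longrightarrow> b \<in> carrier B \<Longrightarrow> (\<lambda>c. pure_tensor A (tensor B C) a (pure_tensor B C b c)) \<in> linear_maps C
        (tensor A (tensor B C))"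
  using linear_comp[OF bilinear_right[OF bilinear_pure_tensor[OF B C]] bilinear_right[OF bilinear_pure_tensor[OF A
      k_module_tensor[OF B C]]]]
   bilinear_comp_linear[OF bilinear_pure_tensor[OF A k_module_tensor[OF B C]] linear_id bilinear_left[OF
       bilinear_pure_tensor[OF B C]]]
  by auto

lemma tensor_assoc_linear: "tensor_assoc A B C \<in> linear_maps (tensor (tensor A B) C) (tensor A (tensor B C))"
proof -
  note T = k_module_tensor[OF A k_module_tensor[OF B C]]
  have "(\<lambda>X. tensor_assoc A B C X) \<in> linear_maps (tensor (tensor A B) C) (tensor A (tensor B C))"
    unfolding tensor_assoc_def Let_def
    by (rule tensor_lift_linear[OF k_module_tensor[OF A B] C T bilinear_tensor_assoc_inner[OF T pure3_multilinear]])
  then show ?thesis by simp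
qed

lemma tensor_assoc_pure:
  assumes c: "c \<in> carrier C"
  shows "u \<in> carrier (tensor A B) \<Longrightarrow> tensor_assoc A B C (pure_tensor (tensor A B) C u c) =
      tensor_lift (tensor A (tensor B C)) (\<lambda>a b. pure_tensor A (tensor B C) a (pure_tensor B C b c)) u"
    and "a \<in> carrier A \<Longrightarrow> b \<in> carrier B \<Longrightarrow> tensor_assoc A B C (pure_tensor (tensor A B) C (pure_tensor A B a b) c) =
      pure_tensor A (tensor B C) a (pure_tensor B C b c)"
proof -
  note T = k_module_tensor[OF A k_module_tensor[OF B C]]
  show *: "tensor_assoc A B C (pure_tensor (tensor A B) C u c) =
      tensor_lift (tensor A (tensor B C)) (\<lambda>a b. pure_tensor A (tensor B C) a (pure_tensor B C b c)) u"
    if u: "u \<in> carrier (tensor A B)" for u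
    unfolding tensor_assoc_def Let_def
    by (rule tensor_lift_pure[OF k_module_tensor[OF A B] C T bilinear_tensor_assoc_inner[OF T pure3_multilinear] u c])
  show "a \<in> carrier A \<Longrightarrow> b \<in> carrier B \<Longrightarrow> tensor_assoc A B C (pure_tensor (tensor A B) C (pure_tensor A B a b) c) =
      pure_tensor A (tensor B C) a (pure_tensor B C b c)"
    using *[OF pure_tensor_closed[OF A B]] tensor_lift_pure[OF A B T pure3_multilinear(1)[OF c]] by simp
qed

text \<open>A trilinear sum may be bracketed in either way. Together with coassociativity it yields
  the exchange of brackets in double Sweedler sums.\<close>

lemma tensor_lift_tensor_assoc:
  assumes N: "k_module N"
    and F: "\<And>c. c \<in> carrier C \<Longrightarrow> (\<lambda>a b. F a b c) \<in> bilinear_maps A B N"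
    and G: "\<And>a. a \<in> carrier A \<Longrightarrow> (\<lambda>b c. F a b c) \<in> bilinear_maps B C N"
    and X: "X \<in> carrier (tensor (tensor A B) C)"
  shows "tensor_lift N (\<lambda>a u. tensor_lift N (\<lambda>b c. F a b c) u) (tensor_assoc A B C X) =
    tensor_lift N (\<lambda>u c. tensor_lift N (\<lambda>a b. F a b c) u) X"
proof -
  note AB = k_module_tensor[OF A B] and BC = k_module_tensor[OF B C]
  note b1 = bilinear_tensor_assoc_inner[OF N F bilinear_right[OF G]]
  note b2 = bilinear_tensor_assoc_outer[OF N G bilinear_left[OF F]]
  note l1 = linear_comp[OF tensor_assoc_linear tensor_lift_linear[OF A BC N b2]]
  show ?thesis
  proof (rule tensor_linear_eq[OF AB C N l1 tensor_lift_linear[OF AB C N b1] _ X])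
    fix u c assume u: "u \<in> carrier (tensor A B)" and c: "c \<in> carrier C"
    show "tensor_lift N (\<lambda>a u. tensor_lift N (\<lambda>b c. F a b c) u) (tensor_assoc A B C (pure_tensor (tensor A B) C u
        c)) =
      tensor_lift N (\<lambda>u c. tensor_lift N (\<lambda>a b. F a b c) u) (pure_tensor (tensor A B) C u c)"
    proof (rule tensor_linear_eq[OF A B N linear_comp[OF bilinear_left[OF bilinear_pure_tensor[OF AB C] c] l1]
          linear_comp[OF bilinear_left[OF bilinear_pure_tensor[OF AB C] c] tensor_lift_linear[OF AB C N b1]] _ u])
      fix a b assume "a \<in> carrier A" "b \<in> carrier B"
      then show "tensor_lift N (\<lambda>a u. tensor_lift N (\<lambda>b c. F a b c) u) (tensor_assoc A B C (pure_tensor (tensor A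
          B) C (pure_tensor A B a b) c)) =
        tensor_lift N (\<lambda>u c. tensor_lift N (\<lambda>a b. F a b c) u) (pure_tensor (tensor A B) C (pure_tensor A B a b) c)"
        using c by (simp add: tensor_assoc_pure(2) tensor_lift_pure[OF A BC N b2] tensor_lift_pure[OF AB C N b1]
          pure_tensor_closed[OF A B] pure_tensor_closed[OF B C] tensor_lift_pure[OF A B N F] tensor_lift_pure[OF B
              C N G])
    qed
  qed
qed

end

text \<open>Multiplicativity of the rebracketing map is what allows coassociativity of the
  comultiplications to be checked on generators.\<close>

lemma tensor_assoc_hom:
  assumes A: "k_algebra A" and B: "k_algebra B" and C: "k_algebra C"
  shows "tensor_assoc A B C \<in> algebra_homs (tensor (tensor A B) C) (tensor A (tensor B C))"
proof -
  note m = ka_module[OF A] ka_module[OF B] ka_module[OF C]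
  note AB = k_algebra_tensor[OF A B] and BC = k_algebra_tensor[OF B C]
  note T = k_algebra_tensor[OF A BC]
  show ?thesis
  proof (rule tensor_algebra_homI[OF AB C T tensor_assoc_linear[OF m]])
    show "tensor_assoc A B C (pure_tensor (tensor A B) C \<one>\<^bsub>tensor A B\<^esub> \<one>\<^bsub>C\<^esub>) = \<one>\<^bsub>tensor A (tensor B C)\<^esub>"
      using A B C BC by (simp add: tensor_one tensor_assoc_pure(2))
  next
    fix u c u' c' assume u: "u \<in> carrier (tensor A B)" "u' \<in> carrier (tensor A B)" and c: "c \<in> carrier C" "c' \<in>
        carrier C"
    let ?L = "\<lambda>c u. tensor_lift (tensor A (tensor B C)) (\<lambda>a b. pure_tensor A (tensor B C) a (pure_tensor B C b c)) u"
    have lin: "?L c \<in> linear_maps (tensor A B) (tensor A (tensor B C))" if "c \<in> carrier C" for c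
      by (rule tensor_lift_linear[OF m(1,2) ka_module[OF T] pure3_multilinear(1)[OF m that]])
    have L: "?L (c \<otimes>\<^bsub>C\<^esub> c') (u \<otimes>\<^bsub>tensor A B\<^esub> u') = ?L c u \<otimes>\<^bsub>tensor A (tensor B C)\<^esub> ?L c' u'"
    proof (rule tensor_linear_eq[OF m(1,2) ka_module[OF T] linear_comp[OF bilinear_left[OF bilinear_mult[OF AB]
        u(2)] lin]
        linear_comp_left[OF lin bilinear_mult[OF T] linear_closed[OF lin u(2)]] _ u(1)])
      fix a b assume a: "a \<in> carrier A" "b \<in> carrier B"
      note p = pure_tensor_closed[OF m(1,2) a]
      show "?L (c \<otimes>\<^bsub>C\<^esub> c') (pure_tensor A B a b \<otimes>\<^bsub>tensor A B\<^esub> u') = ?L c (pure_tensor A B a b) \<otimes>\<^bsub>tensor A (tensor B C)\<^esub>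
          ?L c' u'"
      proof (rule tensor_linear_eq[OF m(1,2) ka_module[OF T] linear_comp[OF bilinear_right[OF bilinear_mult[OF AB]
          p] lin]
          linear_comp_right[OF lin bilinear_mult[OF T] linear_closed[OF lin p]] _ u(2)])
        fix a' b' assume a': "a' \<in> carrier A" "b' \<in> carrier B"
        show "?L (c \<otimes>\<^bsub>C\<^esub> c') (pure_tensor A B a b \<otimes>\<^bsub>tensor A B\<^esub> pure_tensor A B a' b') =
            ?L c (pure_tensor A B a b) \<otimes>\<^bsub>tensor A (tensor B C)\<^esub> ?L c' (pure_tensor A B a' b')"
          using a a' c A B C BC
          by (simp add: pure_tensor_mult tensor_lift_pure[OF m(1,2) ka_module[OF T] pure3_multilinear(1)[OF m]]
              pure_tensor_closed)
      qed (use c C in simp_all)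
    qed (use c C in simp_all)
    then show "tensor_assoc A B C (pure_tensor (tensor A B) C (u \<otimes>\<^bsub>tensor A B\<^esub> u') (c \<otimes>\<^bsub>C\<^esub> c')) =
       tensor_assoc A B C (pure_tensor (tensor A B) C u c) \<otimes>\<^bsub>tensor A (tensor B C)\<^esub>
       tensor_assoc A B C (pure_tensor (tensor A B) C u' c')"
      using u c AB C by (simp add: tensor_assoc_pure(1)[OF m])
  qed
qed

section \<open>Cogroupoids\<close>

lemma linear_id_fun: "id \<in> linear_maps M M"
  by (rule linear_mapsI) simp_all

lemma tensor_lift_pure_id:
  assumes A: "k_module A" and B: "k_module B" and X: "X \<in> carrier (tensor A B)"
  shows "tensor_lift (tensor A B) (\<lambda>a b. pure_tensor A B a b) X = X"
  by (rule tensor_linear_eq[OF A B k_module_tensor[OF A B]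
        tensor_lift_linear[OF A B k_module_tensor[OF A B] bilinear_pure_tensor[OF A B]] linear_id _ X])
    (rule tensor_lift_pure[OF A B k_module_tensor[OF A B] bilinear_pure_tensor[OF A B]])

context
  fixes A :: "('k::field, 'a, 'l) module_scheme" and B :: "('k, 'b, 'm) module_scheme"
  assumes A: "k_algebra A" and B: "k_algebra B"
begin

lemma pure_left_hom: "(\<lambda>a. pure_tensor A B a \<one>\<^bsub>B\<^esub>) \<in> algebra_homs A (tensor A B)"
  by (rule algebra_homsI)
    (simp_all add: A B bilinear_left[OF bilinear_pure_tensor] tensor_one pure_tensor_mult)

lemma pure_right_hom: "(\<lambda>b. pure_tensor A B \<one>\<^bsub>A\<^esub> b) \<in> algebra_homs B (tensor A B)"
  by (rule algebra_homsI)
    (simp_all add: A B bilinear_right[OF bilinear_pure_tensor] tensor_one pure_tensor_mult)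

lemma pure_left_right: "a \<in> carrier A \<Longrightarrow> b \<in> carrier B \<Longrightarrow>
    pure_tensor A B a \<one>\<^bsub>B\<^esub> \<otimes>\<^bsub>tensor A B\<^esub> pure_tensor A B \<one>\<^bsub>A\<^esub> b = pure_tensor A B a b"
  by (simp add: A B pure_tensor_mult)

end

lemma bilinear_mult_comp:
  "k_algebra N \<Longrightarrow> F \<in> linear_maps A N \<Longrightarrow> G \<in> linear_maps B N \<Longrightarrow>
    (\<lambda>a b. F a \<otimes>\<^bsub>N\<^esub> G b) \<in> bilinear_maps A B N"
  by (rule bilinear_comp_linear[OF bilinear_mult])

lemma bilinear_smult_comp:
  "k_module N \<Longrightarrow> F \<in> linear_maps A ground \<Longrightarrow> G \<in> linear_maps B N \<Longrightarrow>
    (\<lambda>a b. F a \<odot>\<^bsub>N\<^esub> G b) \<in> bilinear_maps A B N"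
  by (rule bilinear_comp_linear[OF bilinear_smult])

lemma bilinear_flip: "f \<in> bilinear_maps A B N \<Longrightarrow> (\<lambda>b a. f a b) \<in> bilinear_maps B A N"
  by (simp add: bilinear_maps_def)

definition unit_map :: "('k::field, 'a, 'm) module_scheme \<Rightarrow> 'k \<Rightarrow> 'a" where
  "unit_map N c = c \<odot>\<^bsub>N\<^esub> \<one>\<^bsub>N\<^esub>"

lemma unit_map_hom: "k_algebra N \<Longrightarrow> unit_map N \<in> algebra_homs ground N"
  by (rule algebra_homsI; (rule linear_mapsI)?)
    (simp_all add: unit_map_def km_smult_l_distr mult.commute)

text \<open>The dual of a category: \<open>\<Delta> s u t\<close> plays the part of composition
  through the middle object \<open>u\<close>, and \<open>\<epsilon> s\<close> that of the identity
  of \<open>s\<close>. With a single object it is a bialgebra. Both coactions on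
  \<open>A s t\<close> are instances of \<open>\<Delta>\<close>, with the middle object at one of
  the two ends.\<close>

locale cocategory =
  fixes A :: "'i \<Rightarrow> 'i \<Rightarrow> ('k::field, 'a) module"
    and \<Delta> :: "'i \<Rightarrow> 'i \<Rightarrow> 'i \<Rightarrow> 'a \<Rightarrow> ('a \<times> 'a \<Rightarrow>\<^sub>0 'k) set"
    and \<epsilon> :: "'i \<Rightarrow> 'a \<Rightarrow> 'k"
  assumes alg: "k_algebra (A s t)"
    and comult_hom: "\<Delta> s u t \<in> algebra_homs (A s t) (tensor (A s u) (A u t))"
    and counit_hom: "\<epsilon> s \<in> algebra_homs (A s s) ground"
    and comult_assoc: "x \<in> carrier (A s t) \<Longrightarrow>
      tensor_assoc (A s u) (A u v) (A v t) (tensor_map (tensor (A s u) (A u v)) (A v t) (\<Delta> s u v) id (\<Delta> s v t x)) =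
      tensor_map (A s u) (tensor (A u v) (A v t)) id (\<Delta> u v t) (\<Delta> s u t x)"
    and counit_left: "x \<in> carrier (A s t) \<Longrightarrow> tensor_lift (A s t) (\<lambda>a b. \<epsilon> s a \<odot>\<^bsub>A s t\<^esub> b) (\<Delta> s s t x) = x"
    and counit_right: "x \<in> carrier (A s t) \<Longrightarrow> tensor_lift (A s t) (\<lambda>a b. \<epsilon> t b \<odot>\<^bsub>A s t\<^esub> a) (\<Delta> s t t x) = x"
begin

lemma mod [simp]: "k_module (A s t)" by (rule ka_module[OF alg])
declare alg [simp]

lemma comult_closed [simp]: "x \<in> carrier (A s t) \<Longrightarrow> \<Delta> s u t x \<in> carrier (tensor (A s u) (A u t))"
  by (rule algebra_hom_closed[OF comult_hom])

lemmas counit_linear = algebra_hom_linear[OF counit_hom]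

text \<open>
  \<open>sw s u t N f x\<close> is the Sweedler sum of \<open>f(x\<^sub>(\<^sub>1\<^sub>), x\<^sub>(\<^sub>2\<^sub>))\<close>, with \<open>x\<close> in \<open>A s t\<close>, \<open>x\<^sub>(\<^sub>1\<^sub>)\<close> in \<open>A s u\<close> and
      \<open>x\<^sub>(\<^sub>2\<^sub>)\<close> in \<open>A u t\<close>.
\<close>

definition sw where "sw s u t N f x = tensor_lift N f (\<Delta> s u t x)"

lemma sw_linear: "k_module N \<Longrightarrow> f \<in> bilinear_maps (A s u) (A u t) N \<Longrightarrow> (\<lambda>x. sw s u t N f x) \<in> linear_maps (A s t) N"
  unfolding sw_def by (rule linear_comp[OF algebra_hom_linear[OF comult_hom] tensor_lift_linear[OF mod mod]])

lemma sw_closed: "k_module N \<Longrightarrow> f \<in> bilinear_maps (A s u) (A u t) N \<Longrightarrow> x \<in> carrier (A s t) \<Longrightarrow> sw s u t N f x \<in> carrier N"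
  by (rule linear_closed[OF sw_linear])

lemma sw_linear_param:
  assumes "k_module N" "k_module M" "\<And>x. x \<in> carrier M \<Longrightarrow> (\<lambda>a b. F x a b) \<in> bilinear_maps (A s u) (A u t) N"
    and "\<And>a b. a \<in> carrier (A s u) \<Longrightarrow> b \<in> carrier (A u t) \<Longrightarrow> (\<lambda>x. F x a b) \<in> linear_maps M N"
    and "y \<in> carrier (A s t)"
  shows "(\<lambda>x. sw s u t N (\<lambda>a b. F x a b) y) \<in> linear_maps M N"
  unfolding sw_def using assms by (intro linear_tensor_lift[OF mod mod]) auto

lemma sw_cong:
  assumes "k_module N" "f \<in> bilinear_maps (A s u) (A u t) N" "x \<in> carrier (A s t)"
    and "\<And>a b. a \<in> carrier (A s u) \<Longrightarrow> b \<in> carrier (A u t) \<Longrightarrow> f a b = f' a b"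
  shows "sw s u t N f x = sw s u t N f' x"
  unfolding sw_def using assms by (intro tensor_lift_cong[OF mod mod]) auto

lemma linear_sw:
  assumes "k_module N" "k_module K" "f \<in> bilinear_maps (A s u) (A u t) N" "g \<in> linear_maps N K" "x \<in> carrier (A s t)"
  shows "g (sw s u t N f x) = sw s u t K (\<lambda>a b. g (f a b)) x"
  unfolding sw_def using assms by (intro linear_comp_tensor_lift[OF mod mod]) auto

lemma sw_swap:
  assumes "k_module N" "x \<in> carrier (A s t)" "y \<in> carrier (A s' t')"
    and "\<And>a b. a \<in> carrier (A s u) \<Longrightarrow> b \<in> carrier (A u t) \<Longrightarrow> (\<lambda>c d. F a b c d) \<in> bilinear_maps (A s' u') (A u' t') N"
    and "\<And>c d. c \<in> carrier (A s' u') \<Longrightarrow> d \<in> carrier (A u' t') \<Longrightarrow> (\<lambda>a b. F a b c d) \<in> bilinear_maps (A s u) (A u t) N"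
  shows "sw s u t N (\<lambda>a b. sw s' u' t' N (\<lambda>c d. F a b c d) y) x =
         sw s' u' t' N (\<lambda>c d. sw s u t N (\<lambda>a b. F a b c d) x) y"
  unfolding sw_def using assms by (intro tensor_lift_swap[OF mod mod mod mod]) auto

text \<open>The coassociativity axiom is an equation between triple tensors; a trilinear
  \<open>F\<close> is evaluated on both sides, by \<open>tensor_lift_tensor_map\<close> for the map
  applied to one leg and \<open>tensor_lift_tensor_assoc\<close> for the brackets.\<close>

lemma sw_coassoc:
  assumes N: "k_module N" and x: "x \<in> carrier (A s t)"
    and F: "\<And>c. c \<in> carrier (A v t) \<Longrightarrow> (\<lambda>a b. F a b c) \<in> bilinear_maps (A s u) (A u v) N"
    and G: "\<And>a. a \<in> carrier (A s u) \<Longrightarrow> (\<lambda>b c. F a b c) \<in> bilinear_maps (A u v) (A v t) N"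
  shows "sw s v t N (\<lambda>p c. sw s u v N (\<lambda>a b. F a b c) p) x = sw s u t N (\<lambda>a p. sw u v t N (\<lambda>b c. F a b c) p) x"
proof -
  note T = k_module_tensor[OF mod mod]
  note b1 = bilinear_tensor_assoc_inner[OF mod mod mod N F bilinear_right[OF G]]
  note b2 = bilinear_tensor_assoc_outer[OF mod mod mod N G bilinear_left[OF F]]
  note D = algebra_hom_linear[OF comult_hom]
  have dx: "\<Delta> s v t x \<in> carrier (tensor (A s v) (A v t))" "\<Delta> s u t x \<in> carrier (tensor (A s u) (A u t))" using x
      by simp_all
  have "sw s v t N (\<lambda>p c. sw s u v N (\<lambda>a b. F a b c) p) x =
      tensor_lift N (\<lambda>u c. tensor_lift N (\<lambda>a b. F a b c) u) (tensor_map (tensor (A s u) (A u v)) (A v t) (\<Delta> s u v)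
          id (\<Delta> s v t x))"
    unfolding sw_def
    by (subst tensor_lift_tensor_map[OF mod mod T mod D linear_id_fun N b1 dx(1)]) simp_all
  also have "\<dots> = tensor_lift N (\<lambda>a u. tensor_lift N (\<lambda>b c. F a b c) u)
      (tensor_map (A s u) (tensor (A u v) (A v t)) id (\<Delta> u v t) (\<Delta> s u t x))"
    unfolding comult_assoc[OF x, symmetric]
    by (rule tensor_lift_tensor_assoc[OF mod mod mod N F G, symmetric])
      (simp_all add: linear_closed[OF tensor_map_linear[OF mod mod T mod D linear_id_fun] dx(1)])
  also have "\<dots> = sw s u t N (\<lambda>a p. sw u v t N (\<lambda>b c. F a b c) p) x"
    unfolding sw_def
    by (subst tensor_lift_tensor_map[OF mod mod mod T linear_id_fun D N b2 dx(2)]) simp_all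
  finally show ?thesis .
qed

lemma sw_counit_left:
  assumes N: "k_module N" and f: "f \<in> linear_maps (A s t) N" and x: "x \<in> carrier (A s t)"
  shows "sw s s t N (\<lambda>a b. \<epsilon> s a \<odot>\<^bsub>N\<^esub> f b) x = f x"
proof -
  note bil = bilinear_smult_comp[OF mod counit_linear linear_id]
  have "f x = f (sw s s t (A s t) (\<lambda>a b. \<epsilon> s a \<odot>\<^bsub>A s t\<^esub> b) x)"
    using counit_left[OF x] by (simp add: sw_def)
  also have "\<dots> = sw s s t N (\<lambda>a b. f (\<epsilon> s a \<odot>\<^bsub>A s t\<^esub> b)) x"
    by (rule linear_sw[OF mod N bil f x])
  also have "\<dots> = sw s s t N (\<lambda>a b. \<epsilon> s a \<odot>\<^bsub>N\<^esub> f b) x"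
    by (rule sym, rule sw_cong[OF N bilinear_smult_comp[OF N counit_linear f] x])
      (simp add: linear_smult[OF f])
  finally show ?thesis by simp
qed

lemma sw_counit_right:
  assumes N: "k_module N" and f: "f \<in> linear_maps (A s t) N" and x: "x \<in> carrier (A s t)"
  shows "sw s t t N (\<lambda>a b. \<epsilon> t b \<odot>\<^bsub>N\<^esub> f a) x = f x"
proof -
  note bil = bilinear_flip[OF bilinear_smult_comp[OF mod counit_linear linear_id]]
  have "f x = f (sw s t t (A s t) (\<lambda>a b. \<epsilon> t b \<odot>\<^bsub>A s t\<^esub> a) x)"
    using counit_right[OF x] by (simp add: sw_def)
  also have "\<dots> = sw s t t N (\<lambda>a b. f (\<epsilon> t b \<odot>\<^bsub>A s t\<^esub> a)) x"
    by (rule linear_sw[OF mod N bil f x])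
  also have "\<dots> = sw s t t N (\<lambda>a b. \<epsilon> t b \<odot>\<^bsub>N\<^esub> f a) x"
    by (rule sym, rule sw_cong[OF N bilinear_flip[OF bilinear_smult_comp[OF N counit_linear f]] x])
      (simp add: linear_smult[OF f])
  finally show ?thesis by simp
qed

lemma sw_one:
  assumes "k_module N" "f \<in> bilinear_maps (A s u) (A u t) N"
  shows "sw s u t N f \<one>\<^bsub>A s t\<^esub> = f \<one>\<^bsub>A s u\<^esub> \<one>\<^bsub>A u t\<^esub>"
  unfolding sw_def algebra_hom_one[OF comult_hom] tensor_one[OF alg alg]
  by (rule tensor_lift_pure[OF mod mod assms]) simp_all

text \<open>Convolutions are cut off outside the carriers, so that identities between them are equations of functions.\<close>

definition conv where
  "conv s u t N F G = (\<lambda>x\<in>carrier (A s t). sw s u t N (\<lambda>a b. F a \<otimes>\<^bsub>N\<^esub> G b) x)"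

definition conv_unit where
  "conv_unit s N = (\<lambda>x\<in>carrier (A s s). unit_map N (\<epsilon> s x))"

lemma linear_restrict: "k_module M \<Longrightarrow> f \<in> linear_maps M N \<Longrightarrow> restrict f (carrier M) \<in> linear_maps M N"
  by (rule linear_cong) simp_all

lemma conv_linear:
  "k_algebra N \<Longrightarrow> F \<in> linear_maps (A s u) N \<Longrightarrow> G \<in> linear_maps (A u t) N \<Longrightarrow> conv s u t N F G \<in> linear_maps (A s t) N"
  unfolding conv_def by (intro linear_restrict sw_linear bilinear_mult_comp) simp_all

lemma conv_cong:
  assumes "k_algebra N" "F \<in> linear_maps (A s u) N" "G \<in> linear_maps (A u t) N"
    and "\<And>a. a \<in> carrier (A s u) \<Longrightarrow> F a = F' a" "\<And>b. b \<in> carrier (A u t) \<Longrightarrow> G b = G' b"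
  shows "conv s u t N F G = conv s u t N F' G'"
  unfolding conv_def
  by (rule restrict_ext, rule sw_cong[OF _ bilinear_mult_comp]) (use assms in auto)

lemma conv_assoc:
  assumes N: "k_algebra N" and F: "F \<in> linear_maps (A s u) N" and G: "G \<in> linear_maps (A u v) N" and H: "H \<in>
      linear_maps (A v t) N"
  shows "conv s v t N (conv s u v N F G) H = conv s u t N F (conv u v t N G H)"
  unfolding conv_def[of s v t] conv_def[of s u t]
proof (rule restrict_ext)
  fix x assume x: "x \<in> carrier (A s t)"
  note Nm = ka_module[OF N]
  note FG = conv_linear[OF N F G] and GH = conv_linear[OF N G H]
  have "sw s v t N (\<lambda>a b. conv s u v N F G a \<otimes>\<^bsub>N\<^esub> H b) x =
      sw s v t N (\<lambda>p c. sw s u v N (\<lambda>a b. (F a \<otimes>\<^bsub>N\<^esub> G b) \<otimes>\<^bsub>N\<^esub> H c) p) x"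
    by (rule sw_cong[OF Nm bilinear_mult_comp[OF N FG H] x])
      (simp add: conv_def linear_sw[OF Nm Nm bilinear_mult_comp[OF N F G] bilinear_left[OF bilinear_mult[OF N]
          linear_closed[OF H]]])
  also have "\<dots> = sw s u t N (\<lambda>a p. sw u v t N (\<lambda>b c. (F a \<otimes>\<^bsub>N\<^esub> G b) \<otimes>\<^bsub>N\<^esub> H c) p) x"
    by (rule sw_coassoc[OF Nm x])
      (intro bilinear_mapsI linear_comp_left[OF _ bilinear_mult[OF N]] linear_comp_right[OF _ bilinear_mult[OF N]]
          F G H
        ka_mult_closed[OF N] linear_closed[OF F] linear_closed[OF G] linear_closed[OF H]; assumption)+
  also have "\<dots> = sw s u t N (\<lambda>a b. F a \<otimes>\<^bsub>N\<^esub> conv u v t N G H b) x"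
  proof (rule sym, rule sw_cong[OF Nm bilinear_mult_comp[OF N F GH] x])
    fix a p assume a: "a \<in> carrier (A s u)" and p: "p \<in> carrier (A u t)"
    have "F a \<otimes>\<^bsub>N\<^esub> conv u v t N G H p = sw u v t N (\<lambda>b c. F a \<otimes>\<^bsub>N\<^esub> (G b \<otimes>\<^bsub>N\<^esub> H c)) p"
      using p a by (simp add: conv_def linear_sw[OF Nm Nm bilinear_mult_comp[OF N G H] bilinear_right[OF
          bilinear_mult[OF N] linear_closed[OF F]]])
    also have "\<dots> = sw u v t N (\<lambda>b c. (F a \<otimes>\<^bsub>N\<^esub> G b) \<otimes>\<^bsub>N\<^esub> H c) p"
      by (rule sw_cong[OF Nm _ p])
        (use a N F G H in \<open>simp_all add: ka_assoc bilinear_comp_linear[OF bilinear_mult[OF N]]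
          bilinear_mapsI linear_comp_left[OF _ bilinear_mult[OF N]] linear_comp_right[OF _ bilinear_mult[OF N]]\<close>)
    finally show "F a \<otimes>\<^bsub>N\<^esub> conv u v t N G H p = sw u v t N (\<lambda>b c. (F a \<otimes>\<^bsub>N\<^esub> G b) \<otimes>\<^bsub>N\<^esub> H c) p" .
  qed
  finally show "sw s v t N (\<lambda>a b. conv s u v N F G a \<otimes>\<^bsub>N\<^esub> H b) x = sw s u t N (\<lambda>a b. F a \<otimes>\<^bsub>N\<^esub> conv u v t N G H b) x" .
qed

lemma conv_unit_linear: "k_algebra N \<Longrightarrow> conv_unit s N \<in> linear_maps (A s s) N"
  unfolding conv_unit_def
  by (rule linear_restrict[OF mod linear_comp[OF counit_linear algebra_hom_linear[OF unit_map_hom]]])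

lemma conv_unit_left:
  assumes N: "k_algebra N" and F: "F \<in> linear_maps (A s t) N"
  shows "conv s s t N (conv_unit s N) F = restrict F (carrier (A s t))"
  unfolding conv_def
proof (rule restrict_ext)
  fix x assume x: "x \<in> carrier (A s t)"
  have "sw s s t N (\<lambda>a b. conv_unit s N a \<otimes>\<^bsub>N\<^esub> F b) x = sw s s t N (\<lambda>a b. \<epsilon> s a \<odot>\<^bsub>N\<^esub> F b) x"
    by (rule sw_cong[OF _ bilinear_mult_comp[OF N conv_unit_linear F] x])
      (use N F in \<open>simp_all add: conv_unit_def unit_map_def\<close>)
  then show "sw s s t N (\<lambda>a b. conv_unit s N a \<otimes>\<^bsub>N\<^esub> F b) x = F x"
    using sw_counit_left[OF ka_module[OF N] F x] by simp
qed

lemma conv_unit_right: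
  assumes N: "k_algebra N" and F: "F \<in> linear_maps (A s t) N"
  shows "conv s t t N F (conv_unit t N) = restrict F (carrier (A s t))"
  unfolding conv_def
proof (rule restrict_ext)
  fix x assume x: "x \<in> carrier (A s t)"
  have "sw s t t N (\<lambda>a b. F a \<otimes>\<^bsub>N\<^esub> conv_unit t N b) x = sw s t t N (\<lambda>a b. \<epsilon> t b \<odot>\<^bsub>N\<^esub> F a) x"
    by (rule sw_cong[OF _ bilinear_mult_comp[OF N F conv_unit_linear] x])
      (use N F in \<open>simp_all add: conv_unit_def unit_map_def\<close>)
  then show "sw s t t N (\<lambda>a b. F a \<otimes>\<^bsub>N\<^esub> conv_unit t N b) x = F x"
    using sw_counit_right[OF ka_module[OF N] F x] by simp
qed

text \<open>Intended for maps \<open>g\<close> that are not multiplicative, such as the canonical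
  maps and their inverses: it is enough that \<open>g\<close> turns the particular products F(a)
  G(b) into products F'(a) G'(b).\<close>

lemma linear_conv:
  assumes N: "k_algebra N" and K: "k_algebra K"
    and F: "F \<in> linear_maps (A s u) N" and G: "G \<in> linear_maps (A u t) N"
    and F': "F' \<in> linear_maps (A s u) K" and G': "G' \<in> linear_maps (A u t) K"
    and g: "g \<in> linear_maps N K" and x: "x \<in> carrier (A s t)"
    and eq: "\<And>a b. a \<in> carrier (A s u) \<Longrightarrow> b \<in> carrier (A u t) \<Longrightarrow> g (F a \<otimes>\<^bsub>N\<^esub> G b) = F' a \<otimes>\<^bsub>K\<^esub> G' b"
  shows "g (conv s u t N F G x) = conv s u t K F' G' x"
proof -
  have "g (conv s u t N F G x) = sw s u t K (\<lambda>a b. g (F a \<otimes>\<^bsub>N\<^esub> G b)) x"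
    using x by (simp add: conv_def linear_sw[OF ka_module[OF N] ka_module[OF K] bilinear_mult_comp[OF N F G] g])
  also have "\<dots> = sw s u t K (\<lambda>a b. F' a \<otimes>\<^bsub>K\<^esub> G' b) x"
    by (rule sym, rule sw_cong[OF ka_module[OF K] bilinear_mult_comp[OF K F' G'] x]) (simp add: eq)
  also have "\<dots> = conv s u t K F' G' x"
    using x by (simp add: conv_def)
  finally show ?thesis .
qed

lemma hom_conv:
  assumes N: "k_algebra N" and K: "k_algebra K"
    and F: "F \<in> linear_maps (A s u) N" and G: "G \<in> linear_maps (A u t) N"
    and g: "g \<in> algebra_homs N K" and x: "x \<in> carrier (A s t)"
  shows "g (conv s u t N F G x) = conv s u t K (\<lambda>a. g (F a)) (\<lambda>b. g (G b)) x"
  by (rule linear_conv[OF N K F G linear_comp[OF F algebra_hom_linear[OF g]] linear_comp[OF G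
      algebra_hom_linear[OF g]]
        algebra_hom_linear[OF g] x])
    (simp add: algebra_hom_mult[OF g] linear_closed[OF F] linear_closed[OF G])

text \<open>The comultiplication is itself a convolution product, of the embeddings a \<mapsto> a
  \<otimes> 1 and b \<mapsto> 1 \<otimes> b. Identities that involve \<open>\<Delta>\<close> thereby
  become applications of \<open>conv_assoc\<close>.\<close>

lemma comult_conv:
  "conv s u t (tensor (A s u) (A u t)) (\<lambda>a. pure_tensor (A s u) (A u t) a \<one>\<^bsub>A u t\<^esub>)
     (\<lambda>b. pure_tensor (A s u) (A u t) \<one>\<^bsub>A s u\<^esub> b) = restrict (\<Delta> s u t) (carrier (A s t))"
  unfolding conv_def
proof (rule restrict_ext)
  fix x assume x: "x \<in> carrier (A s t)"
  note Nm = k_module_tensor[OF mod mod]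
  have "\<Delta> s u t x = sw s u t (tensor (A s u) (A u t)) (\<lambda>a b. pure_tensor (A s u) (A u t) a b) x"
    using tensor_lift_pure_id[OF mod mod comult_closed[OF x]] by (simp add: sw_def)
  also have "\<dots> = sw s u t (tensor (A s u) (A u t)) (\<lambda>a b. pure_tensor (A s u) (A u t) a \<one>\<^bsub>A u t\<^esub>
       \<otimes>\<^bsub>tensor (A s u) (A u t)\<^esub> pure_tensor (A s u) (A u t) \<one>\<^bsub>A s u\<^esub> b) x"
    by (rule sw_cong[OF Nm bilinear_pure_tensor[OF mod mod] x]) (simp add: pure_left_right)
  finally show "sw s u t (tensor (A s u) (A u t)) (\<lambda>a b. pure_tensor (A s u) (A u t) a \<one>\<^bsub>A u t\<^esub>
       \<otimes>\<^bsub>tensor (A s u) (A u t)\<^esub> pure_tensor (A s u) (A u t) \<one>\<^bsub>A s u\<^esub> b) x = \<Delta> s u t x" by simp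
qed

end

section \<open>Antipodes, canonical maps and coinvariants\<close>

locale cogroupoid = cocategory A \<Delta> \<epsilon>
  for A :: "'i \<Rightarrow> 'i \<Rightarrow> ('k::field, 'a) module" and \<Delta> \<epsilon> +
  fixes S :: "'i \<Rightarrow> 'i \<Rightarrow> 'a \<Rightarrow> 'a"
  assumes antipode_linear: "S s t \<in> linear_maps (A s t) (A t s)"
    and antipode_left: "x \<in> carrier (A s s) \<Longrightarrow>
      tensor_lift (A t s) (\<lambda>a b. S s t a \<otimes>\<^bsub>A t s\<^esub> b) (\<Delta> s t s x) = \<epsilon> s x \<odot>\<^bsub>A t s\<^esub> \<one>\<^bsub>A t s\<^esub>"
    and antipode_right: "x \<in> carrier (A s s) \<Longrightarrow>
      tensor_lift (A s t) (\<lambda>a b. a \<otimes>\<^bsub>A s t\<^esub> S t s b) (\<Delta> s t s x) = \<epsilon> s x \<odot>\<^bsub>A s t\<^esub> \<one>\<^bsub>A s t\<^esub>"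
begin

text \<open>The antipode axiom is an identity inside \<open>A t s\<close>; an algebra map
  \<open>f\<close> carries it to \<open>N\<close>. It is used with \<open>f\<close> an embedding
  into a tensor product.\<close>

lemma conv_antipode_left:
  assumes N: "k_algebra N" and f: "f \<in> algebra_homs (A t s) N"
  shows "conv s t s N (\<lambda>a. f (S s t a)) f = conv_unit s N"
proof (rule ext)
  fix x
  show "conv s t s N (\<lambda>a. f (S s t a)) f x = conv_unit s N x"
  proof (cases "x \<in> carrier (A s s)")
    case True
    have "conv s t s N (\<lambda>a. f (S s t a)) f x = f (conv s t s (A t s) (S s t) (\<lambda>b. b) x)"
      by (rule hom_conv[OF alg N antipode_linear linear_id f True, symmetric])
    then show ?thesis using antipode_left[OF True, of t] True N
      by (simp add: conv_def sw_def conv_unit_def unit_map_def linear_smult[OF algebra_hom_linear[OF f]]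
          algebra_hom_one[OF f])
  qed (simp add: conv_def conv_unit_def)
qed

lemma conv_antipode_right:
  assumes N: "k_algebra N" and f: "f \<in> algebra_homs (A s t) N"
  shows "conv s t s N f (\<lambda>a. f (S t s a)) = conv_unit s N"
proof (rule ext)
  fix x
  show "conv s t s N f (\<lambda>a. f (S t s a)) x = conv_unit s N x"
  proof (cases "x \<in> carrier (A s s)")
    case True
    have "conv s t s N f (\<lambda>a. f (S t s a)) x = f (conv s t s (A s t) (\<lambda>b. b) (S t s) x)"
      by (rule hom_conv[OF alg N linear_id antipode_linear f True, symmetric])
    then show ?thesis using antipode_right[OF True, of t] True N
      by (simp add: conv_def sw_def conv_unit_def unit_map_def linear_smult[OF algebra_hom_linear[OF f]]
          algebra_hom_one[OF f])
  qed (simp add: conv_def conv_unit_def)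
qed

text \<open>The inverse is c \<otimes> b \<mapsto> c S(b(1)) \<otimes> b(2), with b in
  \<open>A t t\<close> split through \<open>s\<close>, so that S(b(1)) and b(2) both lie in
  \<open>A s t\<close>. Both maps are linear for multiplication by \<open>A s t\<close> on the left
  leg, which reduces the two composites to their values on 1 \<otimes> d and 1 \<otimes> b.\<close>

lemma right_canonical_bij:
  "bij_betw (tensor_lift (tensor (A s t) (A t t)) (\<lambda>c d. pure_tensor (A s t) (A t t) c \<one>\<^bsub>A t t\<^esub>
      \<otimes>\<^bsub>tensor (A s t) (A t t)\<^esub> \<Delta> s t t d))
    (carrier (tensor (A s t) (A s t))) (carrier (tensor (A s t) (A t t)))"
proof -
  let ?E = "A s t" let ?B = "A t t"
  let ?N = "tensor ?E ?B" let ?M = "tensor ?E ?E"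
  note N = k_algebra_tensor[OF alg alg, of s t t t] and M = k_algebra_tensor[OF alg alg, of s t s t]
  note Nm = ka_module[OF N] and Mm = ka_module[OF M]
  let ?il = "\<lambda>a. pure_tensor ?E ?B a \<one>\<^bsub>?B\<^esub>" let ?ir = "\<lambda>b. pure_tensor ?E ?B \<one>\<^bsub>?E\<^esub> b"
  let ?jl = "\<lambda>a. pure_tensor ?E ?E a \<one>\<^bsub>?E\<^esub>" let ?jr = "\<lambda>b. pure_tensor ?E ?E \<one>\<^bsub>?E\<^esub> b"
  note il = pure_left_hom[OF alg alg, of s t t t] and ir = pure_right_hom[OF alg alg, of s t t t]
  note jl = pure_left_hom[OF alg alg, of s t s t] and jr = pure_right_hom[OF alg alg, of s t s t]
  note ill = algebra_hom_linear[OF il] and irl = algebra_hom_linear[OF ir]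
  note jll = algebra_hom_linear[OF jl] and jrl = algebra_hom_linear[OF jr]
  note rho = algebra_hom_linear[OF comult_hom, of s t t]
  \<comment> \<open>\<open>K\<close> is b \<mapsto> S(b(1)) \<otimes> b(2), the inverse restricted
    to 1 \<otimes> b.\<close>
  define K where "K = conv t s t ?M (\<lambda>a. ?jl (S t s a)) ?jr"
  have jS: "(\<lambda>a. ?jl (S t s a)) \<in> linear_maps (A t s) ?M" and iS: "(\<lambda>a. ?il (S t s a)) \<in> linear_maps (A t s) ?N"
    by (rule linear_comp[OF antipode_linear jll] linear_comp[OF antipode_linear ill])+
  have K: "K \<in> linear_maps ?B ?M" unfolding K_def by (rule conv_linear[OF M jS jrl])
  let ?can = "tensor_lift ?N (\<lambda>c d. ?il c \<otimes>\<^bsub>?N\<^esub> \<Delta> s t t d)"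
  let ?inv = "tensor_lift ?M (\<lambda>c b. ?jl c \<otimes>\<^bsub>?M\<^esub> K b)"
  note bcan = bilinear_mult_comp[OF N ill rho] and binv = bilinear_mult_comp[OF M jll K]
  note can = tensor_lift_linear[OF mod mod Nm bcan] and inv = tensor_lift_linear[OF mod mod Mm binv]
  note can_pure = tensor_lift_pure[OF mod mod Nm bcan] and inv_pure = tensor_lift_pure[OF mod mod Mm binv]
  have can_mult: "?can (?jl c \<otimes>\<^bsub>?M\<^esub> X) = ?il c \<otimes>\<^bsub>?N\<^esub> ?can X" if c: "c \<in> carrier ?E" and X: "X \<in> carrier ?M" for c X
    by (rule tensor_linear_eq[OF mod mod Nm linear_comp[OF bilinear_right[OF bilinear_mult[OF M] linear_closed[OF
        jll c]] can]
          linear_comp[OF can bilinear_right[OF bilinear_mult[OF N] linear_closed[OF ill c]]] _ X])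
      (use c in \<open>simp add: pure_tensor_mult can_pure ka_assoc[OF N, symmetric] linear_closed[OF ill]
          linear_closed[OF rho]\<close>)
  have inv_mult: "?inv (?il c \<otimes>\<^bsub>?N\<^esub> X) = ?jl c \<otimes>\<^bsub>?M\<^esub> ?inv X" if c: "c \<in> carrier ?E" and X: "X \<in> carrier ?N" for c X
    by (rule tensor_linear_eq[OF mod mod Mm linear_comp[OF bilinear_right[OF bilinear_mult[OF N] linear_closed[OF
        ill c]] inv]
          linear_comp[OF inv bilinear_right[OF bilinear_mult[OF M] linear_closed[OF jll c]]] _ X])
      (use c in \<open>simp add: pure_tensor_mult inv_pure ka_assoc[OF M, symmetric] linear_closed[OF jll]
          linear_closed[OF K]\<close>)
  \<comment> \<open>In Sweedler notation: d(1) S(d(2)) \<otimes> d(3) = 1 \<otimes> d.\<close>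
  have inv_rho: "?inv (\<Delta> s t t d) = ?jr d" if d: "d \<in> carrier ?E" for d
  proof -
    have "\<Delta> s t t d = conv s t t ?N ?il ?ir d" using d by (simp add: comult_conv)
    then have "?inv (\<Delta> s t t d) = conv s t t ?M ?jl K d"
      by (simp only:) (rule linear_conv[OF N M ill irl jll K inv d], simp add: pure_left_right inv_pure)
    also have "\<dots> = conv s s t ?M (conv s t s ?M ?jl (\<lambda>a. ?jl (S t s a))) ?jr d"
      unfolding K_def by (simp add: conv_assoc[OF M jll jS jrl])
    also have "\<dots> = ?jr d"
      unfolding conv_antipode_right[OF M jl] conv_unit_left[OF M jrl] using d by simp
    finally show ?thesis .
  qed
  \<comment> \<open>In Sweedler notation: S(b(1)) b(2) \<otimes> b(3) = 1 \<otimes> b.\<close>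
  have can_K: "?can (K b) = ?ir b" if b: "b \<in> carrier ?B" for b
  proof -
    have "?can (K b) = conv t s t ?N (\<lambda>a. ?il (S t s a)) (restrict (\<Delta> s t t) (carrier ?E)) b"
      unfolding K_def
      by (rule linear_conv[OF M N jS jrl iS linear_restrict[OF mod rho] can b])
        (simp add: pure_left_right can_pure linear_closed[OF antipode_linear])
    also have "\<dots> = conv t t t ?N (conv t s t ?N (\<lambda>a. ?il (S t s a)) ?il) ?ir b"
      unfolding comult_conv[symmetric] by (simp add: conv_assoc[OF N iS ill irl])
    also have "\<dots> = ?ir b"
      unfolding conv_antipode_left[OF N il] conv_unit_left[OF N irl] using b by simp
    finally show ?thesis .
  qed
  have ic: "?inv (?can X) = X" if X: "X \<in> carrier ?M" for X
    by (rule tensor_linear_eq[OF mod mod Mm linear_comp[OF can inv] linear_id _ X])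
      (simp add: can_pure inv_mult inv_rho pure_left_right)
  have ci: "?can (?inv X) = X" if X: "X \<in> carrier ?N" for X
    by (rule tensor_linear_eq[OF mod mod Nm linear_comp[OF inv can] linear_id _ X])
      (simp add: inv_pure can_mult can_K pure_left_right linear_closed[OF K])
  show ?thesis
    by (rule bij_betw_byWitness[where f' = ?inv]) (use ic ci linear_closed[OF can] linear_closed[OF inv] in auto)
qed

text \<open>The mirror image: the inverse is l \<otimes> d \<mapsto> l(1) \<otimes> S(l(2)) d, with
  l in \<open>A s s\<close> split through \<open>t\<close>, and linearity is now for multiplication
  on the right leg.\<close>

lemma left_canonical_bij:
  "bij_betw (tensor_lift (tensor (A s s) (A s t)) (\<lambda>c d. \<Delta> s s t c \<otimes>\<^bsub>tensor (A s s) (A s t)\<^esub> pure_tensor (A s s) (A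
      s t) \<one>\<^bsub>A s s\<^esub> d))
    (carrier (tensor (A s t) (A s t))) (carrier (tensor (A s s) (A s t)))"
proof -
  let ?E = "A s t" let ?L = "A s s"
  let ?N = "tensor ?L ?E" let ?M = "tensor ?E ?E"
  note N = k_algebra_tensor[OF alg alg, of s s s t] and M = k_algebra_tensor[OF alg alg, of s t s t]
  note Nm = ka_module[OF N] and Mm = ka_module[OF M]
  let ?il = "\<lambda>a. pure_tensor ?L ?E a \<one>\<^bsub>?E\<^esub>" let ?ir = "\<lambda>b. pure_tensor ?L ?E \<one>\<^bsub>?L\<^esub> b"
  let ?jl = "\<lambda>a. pure_tensor ?E ?E a \<one>\<^bsub>?E\<^esub>" let ?jr = "\<lambda>b. pure_tensor ?E ?E \<one>\<^bsub>?E\<^esub> b"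
  note il = pure_left_hom[OF alg alg, of s s s t] and ir = pure_right_hom[OF alg alg, of s s s t]
  note jl = pure_left_hom[OF alg alg, of s t s t] and jr = pure_right_hom[OF alg alg, of s t s t]
  note ill = algebra_hom_linear[OF il] and irl = algebra_hom_linear[OF ir]
  note jll = algebra_hom_linear[OF jl] and jrl = algebra_hom_linear[OF jr]
  note rho = algebra_hom_linear[OF comult_hom, of s s t]
  \<comment> \<open>\<open>K\<close> is l \<mapsto> l(1) \<otimes> S(l(2)).\<close>
  define K where "K = conv s t s ?M ?jl (\<lambda>a. ?jr (S t s a))"
  have jS: "(\<lambda>a. ?jr (S t s a)) \<in> linear_maps (A t s) ?M" and iS: "(\<lambda>a. ?ir (S t s a)) \<in> linear_maps (A t s) ?N"
    by (rule linear_comp[OF antipode_linear jrl] linear_comp[OF antipode_linear irl])+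
  have K: "K \<in> linear_maps ?L ?M" unfolding K_def by (rule conv_linear[OF M jll jS])
  let ?can = "tensor_lift ?N (\<lambda>c d. \<Delta> s s t c \<otimes>\<^bsub>?N\<^esub> ?ir d)"
  let ?inv = "tensor_lift ?M (\<lambda>l d. K l \<otimes>\<^bsub>?M\<^esub> ?jr d)"
  note bcan = bilinear_mult_comp[OF N rho irl] and binv = bilinear_mult_comp[OF M K jrl]
  note can = tensor_lift_linear[OF mod mod Nm bcan] and inv = tensor_lift_linear[OF mod mod Mm binv]
  note can_pure = tensor_lift_pure[OF mod mod Nm bcan] and inv_pure = tensor_lift_pure[OF mod mod Mm binv]
  have can_mult: "?can (X \<otimes>\<^bsub>?M\<^esub> ?jr c) = ?can X \<otimes>\<^bsub>?N\<^esub> ?ir c" if c: "c \<in> carrier ?E" and X: "X \<in> carrier ?M" for c X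
    by (rule tensor_linear_eq[OF mod mod Nm linear_comp[OF bilinear_left[OF bilinear_mult[OF M] linear_closed[OF
        jrl c]] can]
          linear_comp[OF can bilinear_left[OF bilinear_mult[OF N] linear_closed[OF irl c]]] _ X])
      (use c in \<open>simp add: pure_tensor_mult can_pure ka_assoc[OF N] linear_closed[OF irl] linear_closed[OF rho]\<close>)
  have inv_mult: "?inv (X \<otimes>\<^bsub>?N\<^esub> ?ir c) = ?inv X \<otimes>\<^bsub>?M\<^esub> ?jr c" if c: "c \<in> carrier ?E" and X: "X \<in> carrier ?N" for c X
    by (rule tensor_linear_eq[OF mod mod Mm linear_comp[OF bilinear_left[OF bilinear_mult[OF N] linear_closed[OF
        irl c]] inv]
          linear_comp[OF inv bilinear_left[OF bilinear_mult[OF M] linear_closed[OF jrl c]]] _ X])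
      (use c in \<open>simp add: pure_tensor_mult inv_pure ka_assoc[OF M] linear_closed[OF jrl] linear_closed[OF K]\<close>)
  have inv_rho: "?inv (\<Delta> s s t d) = ?jl d" if d: "d \<in> carrier ?E" for d
  proof -
    have "\<Delta> s s t d = conv s s t ?N ?il ?ir d" using d by (simp add: comult_conv)
    then have "?inv (\<Delta> s s t d) = conv s s t ?M K ?jr d"
      by (simp only:) (rule linear_conv[OF N M ill irl K jrl inv d], simp add: pure_left_right inv_pure)
    also have "\<dots> = conv s t t ?M ?jl (conv t s t ?M (\<lambda>a. ?jr (S t s a)) ?jr) d"
      unfolding K_def by (simp add: conv_assoc[OF M jll jS jrl])
    also have "\<dots> = ?jl d"
      unfolding conv_antipode_left[OF M jr] conv_unit_right[OF M jll] using d by simp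
    finally show ?thesis .
  qed
  have can_K: "?can (K b) = ?il b" if b: "b \<in> carrier ?L" for b
  proof -
    have "?can (K b) = conv s t s ?N (restrict (\<Delta> s s t) (carrier ?E)) (\<lambda>a. ?ir (S t s a)) b"
      unfolding K_def
      by (rule linear_conv[OF M N jll jS linear_restrict[OF mod rho] iS can b])
        (simp add: pure_left_right can_pure linear_closed[OF antipode_linear])
    also have "\<dots> = conv s s s ?N ?il (conv s t s ?N ?ir (\<lambda>a. ?ir (S t s a))) b"
      unfolding comult_conv[symmetric] by (simp add: conv_assoc[OF N ill irl iS])
    also have "\<dots> = ?il b"
      unfolding conv_antipode_right[OF N ir] conv_unit_right[OF N ill] using b by simp
    finally show ?thesis .
  qed
  have ic: "?inv (?can X) = X" if X: "X \<in> carrier ?M" for X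
    by (rule tensor_linear_eq[OF mod mod Mm linear_comp[OF can inv] linear_id _ X])
      (simp add: can_pure inv_mult inv_rho pure_left_right)
  have ci: "?can (?inv X) = X" if X: "X \<in> carrier ?N" for X
    by (rule tensor_linear_eq[OF mod mod Nm linear_comp[OF inv can] linear_id _ X])
      (simp add: inv_pure can_mult can_K pure_left_right linear_closed[OF K])
  show ?thesis
    by (rule bij_betw_byWitness[where f' = ?inv]) (use ic ci linear_closed[OF can] linear_closed[OF inv] in auto)
qed

text \<open>Applying \<phi> to the first leg of 1 \<otimes> e = e \<otimes> 1 gives \<phi>(1) e =
  \<phi>(e) 1.\<close>

lemma pure_one_commute_scalar:
  assumes \<phi>: "\<phi> \<in> linear_maps (A s t) ground" and one: "\<phi> \<one>\<^bsub>A s t\<^esub> = 1" and e: "e \<in> carrier (A s t)"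
    and eq: "pure_tensor (A s t) (A s t) \<one>\<^bsub>A s t\<^esub> e = pure_tensor (A s t) (A s t) e \<one>\<^bsub>A s t\<^esub>"
  shows "e = \<phi> e \<odot>\<^bsub>A s t\<^esub> \<one>\<^bsub>A s t\<^esub>"
proof -
  note p = tensor_lift_pure[OF mod mod mod bilinear_smult_comp[OF mod \<phi> linear_id]]
  show ?thesis using arg_cong[OF eq, of "tensor_lift (A s t) (\<lambda>a b. \<phi> a \<odot>\<^bsub>A s t\<^esub> b)"] e by (simp add: p one)
qed

text \<open>For a coinvariant e the canonical map sends 1 \<otimes> e and e \<otimes> 1 to the same
  tensor e \<otimes> 1. It is injective, so the two agree, and e is a scalar. Thus no basis of
  \<open>A s t\<close> enters.\<close>

lemma right_coinvariants:
  assumes \<phi>: "\<phi> \<in> linear_maps (A s t) ground" and one: "\<phi> \<one>\<^bsub>A s t\<^esub> = 1"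
  shows "{e \<in> carrier (A s t). \<Delta> s t t e = pure_tensor (A s t) (A t t) e \<one>\<^bsub>A t t\<^esub>} = {c \<odot>\<^bsub>A s t\<^esub> \<one>\<^bsub>A s t\<^esub> | c. True}"
proof (intro equalityI subsetI)
  fix e assume "e \<in> {e \<in> carrier (A s t). \<Delta> s t t e = pure_tensor (A s t) (A t t) e \<one>\<^bsub>A t t\<^esub>}"
  then have e: "e \<in> carrier (A s t)" and eq: "\<Delta> s t t e = pure_tensor (A s t) (A t t) e \<one>\<^bsub>A t t\<^esub>" by auto
  note N = k_algebra_tensor[OF alg alg, of s t t t]
  note bcan = bilinear_mult_comp[OF N algebra_hom_linear[OF pure_left_hom[OF alg alg]] algebra_hom_linear[OF
      comult_hom]]
  have "pure_tensor (A s t) (A s t) \<one>\<^bsub>A s t\<^esub> e = pure_tensor (A s t) (A s t) e \<one>\<^bsub>A s t\<^esub>"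
    by (rule inj_onD[OF bij_betw_imp_inj_on[OF right_canonical_bij[of s t]]])
      (use e eq in \<open>simp_all add: tensor_lift_pure[OF mod mod ka_module[OF N] bcan] pure_tensor_closed
          pure_tensor_mult
        algebra_hom_one[OF comult_hom] tensor_one\<close>)
  then show "e \<in> {c \<odot>\<^bsub>A s t\<^esub> \<one>\<^bsub>A s t\<^esub> | c. True}" using pure_one_commute_scalar[OF \<phi> one e] by blast
next
  fix e assume "e \<in> {c \<odot>\<^bsub>A s t\<^esub> \<one>\<^bsub>A s t\<^esub> | c. True}"
  then show "e \<in> {e \<in> carrier (A s t). \<Delta> s t t e = pure_tensor (A s t) (A t t) e \<one>\<^bsub>A t t\<^esub>}"
    by (auto simp: linear_smult[OF algebra_hom_linear[OF comult_hom]] algebra_hom_one[OF comult_hom] tensor_one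
      bilinear_smult_left[OF bilinear_pure_tensor])
qed

lemma left_coinvariants:
  assumes \<phi>: "\<phi> \<in> linear_maps (A s t) ground" and one: "\<phi> \<one>\<^bsub>A s t\<^esub> = 1"
  shows "{e \<in> carrier (A s t). \<Delta> s s t e = pure_tensor (A s s) (A s t) \<one>\<^bsub>A s s\<^esub> e} = {c \<odot>\<^bsub>A s t\<^esub> \<one>\<^bsub>A s t\<^esub> | c. True}"
proof (intro equalityI subsetI)
  fix e assume "e \<in> {e \<in> carrier (A s t). \<Delta> s s t e = pure_tensor (A s s) (A s t) \<one>\<^bsub>A s s\<^esub> e}"
  then have e: "e \<in> carrier (A s t)" and eq: "\<Delta> s s t e = pure_tensor (A s s) (A s t) \<one>\<^bsub>A s s\<^esub> e" by auto
  note N = k_algebra_tensor[OF alg alg, of s s s t]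
  note bcan = bilinear_mult_comp[OF N algebra_hom_linear[OF comult_hom] algebra_hom_linear[OF pure_right_hom[OF
      alg alg]]]
  have "pure_tensor (A s t) (A s t) \<one>\<^bsub>A s t\<^esub> e = pure_tensor (A s t) (A s t) e \<one>\<^bsub>A s t\<^esub>"
    by (rule inj_onD[OF bij_betw_imp_inj_on[OF left_canonical_bij[of s t]]])
      (use e eq in \<open>simp_all add: tensor_lift_pure[OF mod mod ka_module[OF N] bcan] pure_tensor_closed
          pure_tensor_mult
        algebra_hom_one[OF comult_hom] tensor_one\<close>)
  then show "e \<in> {c \<odot>\<^bsub>A s t\<^esub> \<one>\<^bsub>A s t\<^esub> | c. True}" using pure_one_commute_scalar[OF \<phi> one e] by blast
next
  fix e assume "e \<in> {c \<odot>\<^bsub>A s t\<^esub> \<one>\<^bsub>A s t\<^esub> | c. True}"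
  then show "e \<in> {e \<in> carrier (A s t). \<Delta> s s t e = pure_tensor (A s s) (A s t) \<one>\<^bsub>A s s\<^esub> e}"
    by (auto simp: linear_smult[OF algebra_hom_linear[OF comult_hom]] algebra_hom_one[OF comult_hom] tensor_one
      bilinear_smult_right[OF bilinear_pure_tensor])
qed

end

section \<open>Cocycles from invertible functionals\<close>

lemma tensor_lift_mult:
  assumes A: "k_algebra A" and B: "k_algebra B" and N: "k_module N" and f: "f \<in> bilinear_maps A B N"
    and X: "X \<in> carrier (tensor A B)" and Y: "Y \<in> carrier (tensor A B)"
  shows "tensor_lift N f (X \<otimes>\<^bsub>tensor A B\<^esub> Y) =
    tensor_lift N (\<lambda>a b. tensor_lift N (\<lambda>c d. f (a \<otimes>\<^bsub>A\<^esub> c) (b \<otimes>\<^bsub>B\<^esub> d)) Y) X"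
proof -
  note Am = ka_module[OF A] and Bm = ka_module[OF B] and T = k_algebra_tensor[OF A B]
  note lf = tensor_lift_linear[OF Am Bm N f] and pf = tensor_lift_pure[OF Am Bm N f]
  have b1: "(\<lambda>c d. f (a \<otimes>\<^bsub>A\<^esub> c) (b \<otimes>\<^bsub>B\<^esub> d)) \<in> bilinear_maps A B N" if "a \<in> carrier A" "b \<in> carrier B" for a b
    by (rule bilinear_comp_linear[OF f bilinear_right[OF bilinear_mult[OF A] that(1)] bilinear_right[OF
        bilinear_mult[OF B] that(2)]])
  have b2: "(\<lambda>a b. f (a \<otimes>\<^bsub>A\<^esub> c) (b \<otimes>\<^bsub>B\<^esub> d)) \<in> bilinear_maps A B N" if "c \<in> carrier A" "d \<in> carrier B" for c d
    by (rule bilinear_comp_linear[OF f bilinear_left[OF bilinear_mult[OF A] that(1)] bilinear_left[OF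
        bilinear_mult[OF B] that(2)]])
  have b3: "(\<lambda>a b. tensor_lift N (\<lambda>c d. f (a \<otimes>\<^bsub>A\<^esub> c) (b \<otimes>\<^bsub>B\<^esub> d)) Y) \<in> bilinear_maps A B N"
    by (rule bilinear_mapsI; rule linear_tensor_lift[OF Am Bm N _ b1 _ Y])
      (simp_all add: Am Bm bilinear_left[OF b2] bilinear_right[OF b2])
  show ?thesis
  proof (rule tensor_linear_eq[OF Am Bm N linear_comp[OF bilinear_left[OF bilinear_mult[OF T] Y] lf]
        tensor_lift_linear[OF Am Bm N b3] _ X])
    fix a b assume ab: "a \<in> carrier A" "b \<in> carrier B"
    note p = pure_tensor_closed[OF Am Bm ab]
    have "tensor_lift N f (pure_tensor A B a b \<otimes>\<^bsub>tensor A B\<^esub> Y) = tensor_lift N (\<lambda>c d. f (a \<otimes>\<^bsub>A\<^esub> c) (b \<otimes>\<^bsub>B\<^esub> d)) Y"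
      by (rule tensor_linear_eq[OF Am Bm N linear_comp[OF bilinear_right[OF bilinear_mult[OF T] p] lf]
            tensor_lift_linear[OF Am Bm N b1[OF ab]] _ Y])
        (simp add: pure_tensor_mult A B ab pf tensor_lift_pure[OF Am Bm N b1[OF ab]])
    then show "tensor_lift N f (pure_tensor A B a b \<otimes>\<^bsub>tensor A B\<^esub> Y) =
        tensor_lift N (\<lambda>a b. tensor_lift N (\<lambda>c d. f (a \<otimes>\<^bsub>A\<^esub> c) (b \<otimes>\<^bsub>B\<^esub> d)) Y) (pure_tensor A B a b)"
      by (simp add: tensor_lift_pure[OF Am Bm N b3] ab)
  qed
qed

section \<open>Convolution of maps in two variables\<close>

context cocategory
begin

lemma sw_mult:
  assumes "k_module N" "f \<in> bilinear_maps (A s u) (A u t) N" "x \<in> carrier (A s t)" "y \<in> carrier (A s t)"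
  shows "sw s u t N f (x \<otimes>\<^bsub>A s t\<^esub> y) =
    sw s u t N (\<lambda>a b. sw s u t N (\<lambda>c d. f (a \<otimes>\<^bsub>A s u\<^esub> c) (b \<otimes>\<^bsub>A u t\<^esub> d)) y) x"
  unfolding sw_def using assms by (simp add: algebra_hom_mult[OF comult_hom] tensor_lift_mult)

text \<open>Discharges the side condition of an outer Sweedler sum whose summand is an inner
  one.\<close>

lemma sw_bilinear_param:
  assumes N: "k_module N" and P: "k_module P" and Q: "k_module Q" and y: "y \<in> carrier (A s t)"
    and F1: "\<And>p q. p \<in> carrier P \<Longrightarrow> q \<in> carrier Q \<Longrightarrow> (\<lambda>a b. F p q a b) \<in> bilinear_maps (A s u) (A u t) N"
    and F2: "\<And>a b. a \<in> carrier (A s u) \<Longrightarrow> b \<in> carrier (A u t) \<Longrightarrow> (\<lambda>p q. F p q a b) \<in> bilinear_maps P Q N"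
  shows "(\<lambda>p q. sw s u t N (\<lambda>a b. F p q a b) y) \<in> bilinear_maps P Q N"
  by (rule bilinear_mapsI; rule sw_linear_param[OF N _ F1 _ y])
    (simp_all add: P Q bilinear_left[OF F2] bilinear_right[OF F2])

lemma sw_bilinear_comp:
  assumes N: "k_module N" and C: "k_module C" and D: "k_module D" and h: "h \<in> bilinear_maps C D N"
    and f: "f \<in> bilinear_maps (A s u) (A u t) C" and g: "g \<in> bilinear_maps (A s' u') (A u' t') D"
    and x: "x \<in> carrier (A s t)" and y: "y \<in> carrier (A s' t')"
  shows "h (sw s u t C f x) (sw s' u' t' D g y) = sw s u t N (\<lambda>a b. sw s' u' t' N (\<lambda>c d. h (f a b) (g c d)) y) x"
proof -
  have gy: "sw s' u' t' D g y \<in> carrier D" by (rule sw_closed[OF D g y])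
  have b: "(\<lambda>a b. h (f a b) z) \<in> bilinear_maps (A s u) (A u t) N" if z: "z \<in> carrier D" for z
    by (rule bilinear_mapsI) (rule linear_comp[OF bilinear_right[OF f] bilinear_left[OF h z]]
        linear_comp[OF bilinear_left[OF f] bilinear_left[OF h z]], assumption)+
  have "h (sw s u t C f x) (sw s' u' t' D g y) = sw s u t N (\<lambda>a b. h (f a b) (sw s' u' t' D g y)) x"
    by (rule linear_sw[OF C N f bilinear_left[OF h gy] x])
  also have "\<dots> = sw s u t N (\<lambda>a b. sw s' u' t' N (\<lambda>c d. h (f a b) (g c d)) y) x"
    by (rule sw_cong[OF N b[OF gy] x], rule linear_sw[OF D N g bilinear_right[OF h] y]) (rule gy
        bilinear_closed[OF f], assumption?)+
  finally show ?thesis .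
qed

lemma bilinear_mult_map: "f \<in> linear_maps (A s t) N \<Longrightarrow> (\<lambda>x y. f (x \<otimes>\<^bsub>A s t\<^esub> y)) \<in> bilinear_maps (A s t) (A s t) N"
  by (rule bilinear_mapsI) (rule linear_comp[OF bilinear_right[OF bilinear_mult[OF alg]]] linear_comp[OF
      bilinear_left[OF bilinear_mult[OF alg]]], assumption+)+

text \<open>Convolution over the tensor square of the coalgebras. Maps on that square are
  represented by bilinear maps, as in \<open>bilinear_forms\<close>, which avoids tensor products of
  tensor products. The cut-off makes associativity an equation of functions.\<close>

definition conv2 where
  "conv2 s u t N F G = (\<lambda>x y. if x \<in> carrier (A s t) \<and> y \<in> carrier (A s t)
     then sw s u t N (\<lambda>x1 x2. sw s u t N (\<lambda>y1 y2. F x1 y1 \<otimes>\<^bsub>N\<^esub> G x2 y2) y) x else undefined)"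

abbreviation restrict2 where
  "restrict2 s t F \<equiv> (\<lambda>x y. if x \<in> carrier (A s t) \<and> y \<in> carrier (A s t) then F x y else undefined)"

definition conv2_unit where
  "conv2_unit s N = restrict2 s s (\<lambda>x y. unit_map N (\<epsilon> s x * \<epsilon> s y))"

abbreviation bil where "bil s t N \<equiv> bilinear_maps (A s t) (A s t) N"

lemma restrict2_bilinear: "F \<in> bil s t N \<Longrightarrow> restrict2 s t F \<in> bil s t N"
  by (rule bilinear_cong) simp_all

context
  fixes N :: "('k, 'n, 'p) module_scheme" and F G s u t
  assumes N: "k_algebra N" and F: "F \<in> bil s u N" and G: "G \<in> bil u t N"
begin

lemma conv2_inner1: "x1 \<in> carrier (A s u) \<Longrightarrow> x2 \<in> carrier (A u t) \<Longrightarrow>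
    (\<lambda>y1 y2. F x1 y1 \<otimes>\<^bsub>N\<^esub> G x2 y2) \<in> bilinear_maps (A s u) (A u t) N"
  by (rule bilinear_mult_comp[OF N bilinear_right[OF F] bilinear_right[OF G]])

lemma conv2_inner2: "y1 \<in> carrier (A s u) \<Longrightarrow> y2 \<in> carrier (A u t) \<Longrightarrow>
    (\<lambda>x1 x2. F x1 y1 \<otimes>\<^bsub>N\<^esub> G x2 y2) \<in> bilinear_maps (A s u) (A u t) N"
  by (rule bilinear_mult_comp[OF N bilinear_left[OF F] bilinear_left[OF G]])

lemma conv2_inner3: "y \<in> carrier (A s t) \<Longrightarrow>
    (\<lambda>x1 x2. sw s u t N (\<lambda>y1 y2. F x1 y1 \<otimes>\<^bsub>N\<^esub> G x2 y2) y) \<in> bilinear_maps (A s u) (A u t) N"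
  by (rule sw_bilinear_param[OF ka_module[OF N] mod mod _ conv2_inner1 conv2_inner2])

lemma conv2_bilinear: "conv2 s u t N F G \<in> bil s t N"
  unfolding conv2_def
proof (rule restrict2_bilinear, rule bilinear_mapsI)
  show "(\<lambda>y. sw s u t N (\<lambda>x1 x2. sw s u t N (\<lambda>y1 y2. F x1 y1 \<otimes>\<^bsub>N\<^esub> G x2 y2) y) x) \<in> linear_maps (A s t) N"
    if "x \<in> carrier (A s t)" for x
    by (rule sw_linear_param[OF ka_module[OF N] mod conv2_inner3 sw_linear[OF ka_module[OF N] conv2_inner1] that])
  show "(\<lambda>x. sw s u t N (\<lambda>x1 x2. sw s u t N (\<lambda>y1 y2. F x1 y1 \<otimes>\<^bsub>N\<^esub> G x2 y2) y) x) \<in> linear_maps (A s t) N"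
    if "y \<in> carrier (A s t)" for y
    by (rule sw_linear[OF ka_module[OF N] conv2_inner3[OF that]])
qed

lemma conv2_apply: "x \<in> carrier (A s t) \<Longrightarrow> y \<in> carrier (A s t) \<Longrightarrow>
    conv2 s u t N F G x y = sw s u t N (\<lambda>x1 x2. sw s u t N (\<lambda>y1 y2. F x1 y1 \<otimes>\<^bsub>N\<^esub> G x2 y2) y) x"
  by (simp add: conv2_def)

lemma sw2_cong:
  assumes xy: "x \<in> carrier (A s t)" "y \<in> carrier (A s t)"
    and eq: "\<And>x1 x2 y1 y2. x1 \<in> carrier (A s u) \<Longrightarrow> x2 \<in> carrier (A u t) \<Longrightarrow> y1 \<in> carrier (A s u) \<Longrightarrow> y2 \<in> carrier (A u t) \<Longrightarrow>
      F x1 y1 \<otimes>\<^bsub>N\<^esub> G x2 y2 = H x1 x2 y1 y2"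
  shows "conv2 s u t N F G x y = sw s u t N (\<lambda>x1 x2. sw s u t N (\<lambda>y1 y2. H x1 x2 y1 y2) y) x"
  unfolding conv2_apply[OF xy]
  by (rule sw_cong[OF ka_module[OF N] conv2_inner3[OF xy(2)] xy(1)],
      rule sw_cong[OF ka_module[OF N] conv2_inner1 xy(2)]) (simp_all add: eq)

lemma conv2_cong:
  assumes "\<And>a b. a \<in> carrier (A s u) \<Longrightarrow> b \<in> carrier (A s u) \<Longrightarrow> F a b = F' a b"
    "\<And>a b. a \<in> carrier (A u t) \<Longrightarrow> b \<in> carrier (A u t) \<Longrightarrow> G a b = G' a b"
  shows "conv2 s u t N F G = conv2 s u t N F' G'"
proof (intro ext)
  fix x y
  show "conv2 s u t N F G x y = conv2 s u t N F' G' x y"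
  proof (cases "x \<in> carrier (A s t) \<and> y \<in> carrier (A s t)")
    case True
    then show ?thesis
      using sw2_cong[of x y "\<lambda>x1 x2 y1 y2. F' x1 y1 \<otimes>\<^bsub>N\<^esub> G' x2 y2"] assms by (simp add: conv2_def)
  qed (auto simp: conv2_def)
qed

lemma conv2_restrict_right: "conv2 s u t N F (restrict2 u t G) = conv2 s u t N F G"
  by (rule sym, rule conv2_cong) simp_all

lemma conv2_hom:
  assumes K: "k_algebra K" and g: "g \<in> algebra_homs N K" and xy: "x \<in> carrier (A s t)" "y \<in> carrier (A s t)"
  shows "g (conv2 s u t N F G x y) = conv2 s u t K (\<lambda>a b. g (F a b)) (\<lambda>a b. g (G a b)) x y"
proof -
  note Nm = ka_module[OF N] and Km = ka_module[OF K] and gl = algebra_hom_linear[OF g]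
  have b: "(\<lambda>x1 x2. g (sw s u t N (\<lambda>y1 y2. F x1 y1 \<otimes>\<^bsub>N\<^esub> G x2 y2) y)) \<in> bilinear_maps (A s u) (A u t) K"
    by (rule bilinear_mapsI) (rule linear_comp[OF bilinear_right[OF conv2_inner3[OF xy(2)]] gl]
        linear_comp[OF bilinear_left[OF conv2_inner3[OF xy(2)]] gl], assumption)+
  have b2: "(\<lambda>y1 y2. g (F x1 y1 \<otimes>\<^bsub>N\<^esub> G x2 y2)) \<in> bilinear_maps (A s u) (A u t) K"
    if "x1 \<in> carrier (A s u)" "x2 \<in> carrier (A u t)" for x1 x2
    by (rule bilinear_mapsI) (rule linear_comp[OF bilinear_right[OF conv2_inner1[OF that]] gl]
        linear_comp[OF bilinear_left[OF conv2_inner1[OF that]] gl], assumption)+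
  have "g (conv2 s u t N F G x y) = sw s u t K (\<lambda>x1 x2. g (sw s u t N (\<lambda>y1 y2. F x1 y1 \<otimes>\<^bsub>N\<^esub> G x2 y2) y)) x"
    unfolding conv2_apply[OF xy] by (rule linear_sw[OF Nm Km conv2_inner3[OF xy(2)] gl xy(1)])
  also have "\<dots> = sw s u t K (\<lambda>x1 x2. sw s u t K (\<lambda>y1 y2. g (F x1 y1 \<otimes>\<^bsub>N\<^esub> G x2 y2)) y) x"
    by (rule sw_cong[OF Km b xy(1)], rule linear_sw[OF Nm Km conv2_inner1 gl xy(2)])
  also have "\<dots> = sw s u t K (\<lambda>x1 x2. sw s u t K (\<lambda>y1 y2. g (F x1 y1) \<otimes>\<^bsub>K\<^esub> g (G x2 y2)) y) x"
  proof (rule sw_cong[OF Km _ xy(1)])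
    fix x1 x2 assume x: "x1 \<in> carrier (A s u)" "x2 \<in> carrier (A u t)"
    show "sw s u t K (\<lambda>y1 y2. g (F x1 y1 \<otimes>\<^bsub>N\<^esub> G x2 y2)) y = sw s u t K (\<lambda>y1 y2. g (F x1 y1) \<otimes>\<^bsub>K\<^esub> g (G x2 y2)) y"
      by (rule sw_cong[OF Km b2[OF x] xy(2)]) (simp add: algebra_hom_mult[OF g] x bilinear_closed[OF F]
          bilinear_closed[OF G])
  next
    show "(\<lambda>x1 x2. sw s u t K (\<lambda>y1 y2. g (F x1 y1 \<otimes>\<^bsub>N\<^esub> G x2 y2)) y) \<in> bilinear_maps (A s u) (A u t) K"
      by (rule bilinear_cong[OF b mod mod]) (rule linear_sw[OF Nm Km conv2_inner1 gl xy(2)])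
  qed
  also have "\<dots> = conv2 s u t K (\<lambda>a b. g (F a b)) (\<lambda>a b. g (G a b)) x y"
    using xy by (simp add: conv2_def)
  finally show ?thesis .
qed

end

text \<open>Coassociativity is needed in x and in y separately, but the two families of sums are
  interleaved. So the sums are exchanged until all those over y stand inside, coassociativity is
  applied to each variable, and the sums are exchanged back.\<close>

lemma conv2_assoc:
  assumes N: "k_algebra N" and F: "F \<in> bil s u N" and G: "G \<in> bil u v N" and H: "H \<in> bil v t N"
  shows "conv2 s v t N (conv2 s u v N F G) H = conv2 s u t N F (conv2 u v t N G H)"
proof (intro ext)
  fix x y
  show "conv2 s v t N (conv2 s u v N F G) H x y = conv2 s u t N F (conv2 u v t N G H) x y"
  proof (cases "x \<in> carrier (A s t) \<and> y \<in> carrier (A s t)")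
    case False
    then show ?thesis by (auto simp: conv2_def)
  next
    case True
    then have x: "x \<in> carrier (A s t)" and y: "y \<in> carrier (A s t)" by auto
    note Nm = ka_module[OF N]
    note FG = conv2_bilinear[OF N F G] and GH = conv2_bilinear[OF N G H]
    \<comment> \<open>The summand of the sixfold sum; T1 to T6 record that it is linear in each
      variable, on which all exchanges rest.\<close>
    define T where "T x1 x2 x3 y1 y2 y3 = F x1 y1 \<otimes>\<^bsub>N\<^esub> (G x2 y2 \<otimes>\<^bsub>N\<^esub> H x3 y3)" for x1 x2 x3 y1 y2 y3
    note m = bilinear_mult[OF N]
    note l = linear_comp_left[OF _ m] and r = linear_comp_right[OF _ m] and c = ka_mult_closed[OF N]
    note Fc = bilinear_closed[OF F] and Gc = bilinear_closed[OF G] and Hc = bilinear_closed[OF H]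
    have T1: "(\<lambda>x1. T x1 x2 x3 y1 y2 y3) \<in> linear_maps (A s u) N"
      if "x2 \<in> carrier (A u v)" "x3 \<in> carrier (A v t)" "y1 \<in> carrier (A s u)" "y2 \<in> carrier (A u v)" "y3 \<in> carrier
          (A v t)"
      for x2 x3 y1 y2 y3
      unfolding T_def by (intro l bilinear_left[OF F] c Gc Hc that)
    have T2: "(\<lambda>x2. T x1 x2 x3 y1 y2 y3) \<in> linear_maps (A u v) N"
      if "x1 \<in> carrier (A s u)" "x3 \<in> carrier (A v t)" "y1 \<in> carrier (A s u)" "y2 \<in> carrier (A u v)" "y3 \<in> carrier
          (A v t)"
      for x1 x3 y1 y2 y3
      unfolding T_def by (intro r l bilinear_left[OF G] c Fc Hc that)
    have T3: "(\<lambda>x3. T x1 x2 x3 y1 y2 y3) \<in> linear_maps (A v t) N"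
      if "x1 \<in> carrier (A s u)" "x2 \<in> carrier (A u v)" "y1 \<in> carrier (A s u)" "y2 \<in> carrier (A u v)" "y3 \<in> carrier
          (A v t)"
      for x1 x2 y1 y2 y3
      unfolding T_def by (intro r bilinear_left[OF H] c Fc Gc that)
    have T4: "(\<lambda>y1. T x1 x2 x3 y1 y2 y3) \<in> linear_maps (A s u) N"
      if "x1 \<in> carrier (A s u)" "x2 \<in> carrier (A u v)" "x3 \<in> carrier (A v t)" "y2 \<in> carrier (A u v)" "y3 \<in> carrier
          (A v t)"
      for x1 x2 x3 y2 y3
      unfolding T_def by (rule l[OF bilinear_right[OF F]]) (intro c Gc Hc that)+
    have T5: "(\<lambda>y2. T x1 x2 x3 y1 y2 y3) \<in> linear_maps (A u v) N"
      if "x1 \<in> carrier (A s u)" "x2 \<in> carrier (A u v)" "x3 \<in> carrier (A v t)" "y1 \<in> carrier (A s u)" "y3 \<in> carrier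
          (A v t)"
      for x1 x2 x3 y1 y3
      unfolding T_def by (rule r[OF l[OF bilinear_right[OF G]]]) (intro c Fc Hc that)+
    have T6: "(\<lambda>y3. T x1 x2 x3 y1 y2 y3) \<in> linear_maps (A v t) N"
      if "x1 \<in> carrier (A s u)" "x2 \<in> carrier (A u v)" "x3 \<in> carrier (A v t)" "y1 \<in> carrier (A s u)" "y2 \<in> carrier
          (A u v)"
      for x1 x2 x3 y1 y2
      unfolding T_def by (rule r[OF r[OF bilinear_right[OF H]]]) (intro c Fc Gc that)+
    \<comment> \<open>y is split as y(1) and r, and r as y(2) and y(3): the bracketing that belongs
      to the right-hand side.\<close>
    define I where "I x1 x2 x3 y1 r = sw u v t N (\<lambda>y2 y3. T x1 x2 x3 y1 y2 y3) r" for x1 x2 x3 y1 r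
    have bI: "(\<lambda>y2 y3. T x1 x2 x3 y1 y2 y3) \<in> bilinear_maps (A u v) (A v t) N"
      if "x1 \<in> carrier (A s u)" "x2 \<in> carrier (A u v)" "x3 \<in> carrier (A v t)" "y1 \<in> carrier (A s u)" for x1 x2 x3 y1
      using that by (intro bilinear_mapsI T5 T6)
    have I1: "(\<lambda>x1. I x1 x2 x3 y1 r) \<in> linear_maps (A s u) N"
      if "x2 \<in> carrier (A u v)" "x3 \<in> carrier (A v t)" "y1 \<in> carrier (A s u)" "r \<in> carrier (A u t)" for x2 x3 y1 r
      unfolding I_def using that by (intro sw_linear_param Nm mod bI T1)
    have I2: "(\<lambda>x2. I x1 x2 x3 y1 r) \<in> linear_maps (A u v) N"
      if "x1 \<in> carrier (A s u)" "x3 \<in> carrier (A v t)" "y1 \<in> carrier (A s u)" "r \<in> carrier (A u t)" for x1 x3 y1 r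
      unfolding I_def using that by (intro sw_linear_param Nm mod bI T2)
    have I3: "(\<lambda>x3. I x1 x2 x3 y1 r) \<in> linear_maps (A v t) N"
      if "x1 \<in> carrier (A s u)" "x2 \<in> carrier (A u v)" "y1 \<in> carrier (A s u)" "r \<in> carrier (A u t)" for x1 x2 y1 r
      unfolding I_def using that by (intro sw_linear_param Nm mod bI T3)
    have I4: "(\<lambda>y1. I x1 x2 x3 y1 r) \<in> linear_maps (A s u) N"
      if "x1 \<in> carrier (A s u)" "x2 \<in> carrier (A u v)" "x3 \<in> carrier (A v t)" "r \<in> carrier (A u t)" for x1 x2 x3 r
      unfolding I_def using that by (intro sw_linear_param Nm mod bI T4)
    have I5: "(\<lambda>r. I x1 x2 x3 y1 r) \<in> linear_maps (A u t) N"
      if "x1 \<in> carrier (A s u)" "x2 \<in> carrier (A u v)" "x3 \<in> carrier (A v t)" "y1 \<in> carrier (A s u)" for x1 x2 x3 y1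
      unfolding I_def using that by (intro sw_linear Nm bI)
    have bI': "(\<lambda>y1 r. I x1 x2 x3 y1 r) \<in> bilinear_maps (A s u) (A u t) N"
      if "x1 \<in> carrier (A s u)" "x2 \<in> carrier (A u v)" "x3 \<in> carrier (A v t)" for x1 x2 x3
      using that by (intro bilinear_mapsI I4 I5)
    \<comment> \<open>All sums over y are carried out; \<open>M\<close> is a trilinear function of
      the three legs of x and is neutral between the two bracketings.\<close>
    define M where "M x1 x2 x3 = sw s u t N (\<lambda>y1 r. I x1 x2 x3 y1 r) y" for x1 x2 x3
    have M1: "(\<lambda>x1. M x1 x2 x3) \<in> linear_maps (A s u) N"
      if "x2 \<in> carrier (A u v)" "x3 \<in> carrier (A v t)" for x2 x3
      unfolding M_def using that y by (intro sw_linear_param Nm mod bI' I1)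
    have M2: "(\<lambda>x2. M x1 x2 x3) \<in> linear_maps (A u v) N"
      if "x1 \<in> carrier (A s u)" "x3 \<in> carrier (A v t)" for x1 x3
      unfolding M_def using that y by (intro sw_linear_param Nm mod bI' I2)
    have M3: "(\<lambda>x3. M x1 x2 x3) \<in> linear_maps (A v t) N"
      if "x1 \<in> carrier (A s u)" "x2 \<in> carrier (A u v)" for x1 x2
      unfolding M_def using that y by (intro sw_linear_param Nm mod bI' I3)
    have M12: "(\<lambda>x1 x2. M x1 x2 x3) \<in> bilinear_maps (A s u) (A u v) N" if "x3 \<in> carrier (A v t)" for x3
      using that by (intro bilinear_mapsI M1 M2)
    have M23: "(\<lambda>x2 x3. M x1 x2 x3) \<in> bilinear_maps (A u v) (A v t) N" if "x1 \<in> carrier (A s u)" for x1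
      using that by (intro bilinear_mapsI M2 M3)
    \<comment> \<open>y is split as q and y(3), and q as y(1) and y(2): the bracketing that belongs
      to the left-hand side.\<close>
    define J where "J x1 x2 x3 q y3 = sw s u v N (\<lambda>y1 y2. T x1 x2 x3 y1 y2 y3) q" for x1 x2 x3 q y3
    have bJ: "(\<lambda>y1 y2. T x1 x2 x3 y1 y2 y3) \<in> bilinear_maps (A s u) (A u v) N"
      if "x1 \<in> carrier (A s u)" "x2 \<in> carrier (A u v)" "x3 \<in> carrier (A v t)" "y3 \<in> carrier (A v t)" for x1 x2 x3 y3
      using that by (intro bilinear_mapsI T4 T5)
    have J12: "(\<lambda>x1 x2. J x1 x2 x3 q y3) \<in> bilinear_maps (A s u) (A u v) N"
      if "x3 \<in> carrier (A v t)" "q \<in> carrier (A s v)" "y3 \<in> carrier (A v t)" for x3 q y3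
      unfolding J_def using that by (intro sw_bilinear_param Nm mod bJ bilinear_mapsI T1 T2)
    have J45: "(\<lambda>q y3. J x1 x2 x3 q y3) \<in> bilinear_maps (A s v) (A v t) N"
      if "x1 \<in> carrier (A s u)" "x2 \<in> carrier (A u v)" "x3 \<in> carrier (A v t)" for x1 x2 x3
      unfolding J_def using that by (intro bilinear_mapsI sw_linear_param sw_linear Nm mod bJ T6)
    have "conv2 s v t N (conv2 s u v N F G) H x y = sw s v t N (\<lambda>p x3. sw s v t N (\<lambda>q y3. conv2 s u v N F G p q \<otimes>\<^bsub>N\<^esub>
        H x3 y3) y) x"
      by (rule conv2_apply[OF N FG H x y])
    also have "\<dots> = sw s v t N (\<lambda>p x3. sw s u v N (\<lambda>x1 x2. M x1 x2 x3) p) x"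
    proof (rule sw_cong[OF Nm conv2_inner3[OF N FG H y] x])
      fix p x3 assume p: "p \<in> carrier (A s v)" and x3: "x3 \<in> carrier (A v t)"
      have "sw s v t N (\<lambda>q y3. conv2 s u v N F G p q \<otimes>\<^bsub>N\<^esub> H x3 y3) y =
          sw s v t N (\<lambda>q y3. sw s u v N (\<lambda>x1 x2. J x1 x2 x3 q y3) p) y"
      proof (rule sw_cong[OF Nm conv2_inner1[OF N FG H p x3] y])
        fix q y3 assume q: "q \<in> carrier (A s v)" and y3: "y3 \<in> carrier (A v t)"
        let ?R = "\<lambda>z. z \<otimes>\<^bsub>N\<^esub> H x3 y3"
        have R: "?R \<in> linear_maps N N" by (rule bilinear_left[OF m Hc[OF x3 y3]])
        have "conv2 s u v N F G p q \<otimes>\<^bsub>N\<^esub> H x3 y3 =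
            sw s u v N (\<lambda>x1 x2. sw s u v N (\<lambda>y1 y2. F x1 y1 \<otimes>\<^bsub>N\<^esub> G x2 y2) q \<otimes>\<^bsub>N\<^esub> H x3 y3) p"
          unfolding conv2_apply[OF N F G p q] by (rule linear_sw[OF Nm Nm conv2_inner3[OF N F G q] R p])
        also have "\<dots> = sw s u v N (\<lambda>x1 x2. J x1 x2 x3 q y3) p"
        proof (rule sym, rule sw_cong[OF Nm J12[OF x3 q y3] p])
          fix x1 x2 assume x12: "x1 \<in> carrier (A s u)" "x2 \<in> carrier (A u v)"
          have "J x1 x2 x3 q y3 = sw s u v N (\<lambda>y1 y2. (F x1 y1 \<otimes>\<^bsub>N\<^esub> G x2 y2) \<otimes>\<^bsub>N\<^esub> H x3 y3) q"
            unfolding J_def by (rule sw_cong[OF Nm bJ[OF x12 x3 y3] q]) (simp add: T_def ka_assoc[OF N] Fc Gc Hc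
                x12 x3 y3)
          then show "J x1 x2 x3 q y3 = sw s u v N (\<lambda>y1 y2. F x1 y1 \<otimes>\<^bsub>N\<^esub> G x2 y2) q \<otimes>\<^bsub>N\<^esub> H x3 y3"
            using linear_sw[OF Nm Nm conv2_inner1[OF N F G x12] R q] by simp
        qed
        finally show "conv2 s u v N F G p q \<otimes>\<^bsub>N\<^esub> H x3 y3 = sw s u v N (\<lambda>x1 x2. J x1 x2 x3 q y3) p" .
      qed
      also have "\<dots> = sw s u v N (\<lambda>x1 x2. sw s v t N (\<lambda>q y3. J x1 x2 x3 q y3) y) p"
        by (rule sw_swap[OF Nm y p]) (intro J12 J45 x3; assumption)+
      \<comment> \<open>Coassociativity in y turns the sum of \<open>J\<close> over q and y(3) into
        \<open>M\<close>.\<close>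
      also have "\<dots> = sw s u v N (\<lambda>x1 x2. M x1 x2 x3) p"
        by (rule sym, rule sw_cong[OF Nm M12[OF x3] p], unfold M_def I_def J_def,
            rule sw_coassoc[OF Nm y, symmetric]) (intro bI bJ x3; assumption)+
      finally show "sw s v t N (\<lambda>q y3. conv2 s u v N F G p q \<otimes>\<^bsub>N\<^esub> H x3 y3) y = sw s u v N (\<lambda>x1 x2. M x1 x2 x3) p" .
    qed
    \<comment> \<open>With y summed away, this is coassociativity in x alone.\<close>
    also have "\<dots> = sw s u t N (\<lambda>x1 w. sw u v t N (\<lambda>x2 x3. M x1 x2 x3) w) x"
      by (rule sw_coassoc[OF Nm x M12 M23])
    also have "\<dots> = sw s u t N (\<lambda>x1 w. sw s u t N (\<lambda>y1 r. F x1 y1 \<otimes>\<^bsub>N\<^esub> conv2 u v t N G H w r) y) x"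
    proof (rule sym, rule sw_cong[OF Nm conv2_inner3[OF N F GH y] x])
      fix x1 w assume x1: "x1 \<in> carrier (A s u)" and w: "w \<in> carrier (A u t)"
      have "sw s u t N (\<lambda>y1 r. F x1 y1 \<otimes>\<^bsub>N\<^esub> conv2 u v t N G H w r) y =
          sw s u t N (\<lambda>y1 r. sw u v t N (\<lambda>x2 x3. I x1 x2 x3 y1 r) w) y"
      proof (rule sw_cong[OF Nm conv2_inner1[OF N F GH x1 w] y])
        fix y1 r assume y1: "y1 \<in> carrier (A s u)" and r: "r \<in> carrier (A u t)"
        note R = bilinear_right[OF m Fc[OF x1 y1]]
        have "F x1 y1 \<otimes>\<^bsub>N\<^esub> conv2 u v t N G H w r =
            sw u v t N (\<lambda>x2 x3. F x1 y1 \<otimes>\<^bsub>N\<^esub> sw u v t N (\<lambda>y2 y3. G x2 y2 \<otimes>\<^bsub>N\<^esub> H x3 y3) r) w"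
          unfolding conv2_apply[OF N G H w r] by (rule linear_sw[OF Nm Nm conv2_inner3[OF N G H r] R w])
        also have "\<dots> = sw u v t N (\<lambda>x2 x3. I x1 x2 x3 y1 r) w"
        proof (rule sym, rule sw_cong[OF Nm _ w])
          show "(\<lambda>x2 x3. I x1 x2 x3 y1 r) \<in> bilinear_maps (A u v) (A v t) N"
            by (intro bilinear_mapsI I2 I3 x1 y1 r; assumption)
          show "I x1 x2 x3 y1 r = F x1 y1 \<otimes>\<^bsub>N\<^esub> sw u v t N (\<lambda>y2 y3. G x2 y2 \<otimes>\<^bsub>N\<^esub> H x3 y3) r"
            if "x2 \<in> carrier (A u v)" "x3 \<in> carrier (A v t)" for x2 x3
            unfolding I_def T_def by (rule linear_sw[OF Nm Nm conv2_inner1[OF N G H that] R r, symmetric])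
        qed
        finally show "F x1 y1 \<otimes>\<^bsub>N\<^esub> conv2 u v t N G H w r = sw u v t N (\<lambda>x2 x3. I x1 x2 x3 y1 r) w" .
      qed
      also have "\<dots> = sw u v t N (\<lambda>x2 x3. sw s u t N (\<lambda>y1 r. I x1 x2 x3 y1 r) y) w"
        by (rule sw_swap[OF Nm y w]) (intro bI' bilinear_mapsI I2 I3 x1; assumption)+
      finally show "sw s u t N (\<lambda>y1 r. F x1 y1 \<otimes>\<^bsub>N\<^esub> conv2 u v t N G H w r) y = sw u v t N (\<lambda>x2 x3. M x1 x2 x3) w"
        by (simp add: M_def)
    qed
    also have "\<dots> = conv2 s u t N F (conv2 u v t N G H) x y"
      by (rule conv2_apply[OF N F GH x y, symmetric])
    finally show ?thesis .
  qed
qed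

lemma conv2_unit_bilinear: "k_algebra N \<Longrightarrow> conv2_unit s N \<in> bil s s N"
  unfolding conv2_unit_def
  by (rule restrict2_bilinear, rule bilinear_mapsI; rule linear_comp[OF _ algebra_hom_linear[OF unit_map_hom]])
    (rule bilinear_right[OF bilinear_mult_comp[OF k_algebra_ground counit_linear counit_linear], simplified]
      bilinear_left[OF bilinear_mult_comp[OF k_algebra_ground counit_linear counit_linear], simplified], assumption+)+

lemma conv2_unit_left:
  assumes N: "k_algebra N" and F: "F \<in> bil s t N"
  shows "conv2 s s t N (conv2_unit s N) F = restrict2 s t F"
proof (intro ext)
  fix x y
  show "conv2 s s t N (conv2_unit s N) F x y = restrict2 s t F x y"
  proof (cases "x \<in> carrier (A s t) \<and> y \<in> carrier (A s t)")
    case True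
    then have x: "x \<in> carrier (A s t)" and y: "y \<in> carrier (A s t)" by auto
    note Nm = ka_module[OF N] and U = conv2_unit_bilinear[OF N]
    have lin: "(\<lambda>b. \<epsilon> s x1 \<odot>\<^bsub>N\<^esub> F x2 b) \<in> linear_maps (A s t) N" if "x1 \<in> carrier (A s s)" "x2 \<in> carrier (A s t)"
        for x1 x2
      by (rule linear_comp_right[OF bilinear_right[OF F that(2)] bilinear_smult[OF Nm]]) simp
    have "conv2 s s t N (conv2_unit s N) F x y = sw s s t N (\<lambda>x1 x2. sw s s t N (\<lambda>y1 y2. \<epsilon> s y1 \<odot>\<^bsub>N\<^esub> (\<epsilon> s x1 \<odot>\<^bsub>N\<^esub> F x2
        y2)) y) x"
      by (rule sw2_cong[OF N U F x y]) (use N F in \<open>simp add: conv2_unit_def unit_map_def mult.commute\<close>)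
    also have "\<dots> = sw s s t N (\<lambda>x1 x2. \<epsilon> s x1 \<odot>\<^bsub>N\<^esub> F x2 y) x"
      by (rule sym, rule sw_cong[OF Nm bilinear_smult_comp[OF Nm counit_linear bilinear_left[OF F y]] x],
          rule sw_counit_left[OF Nm lin y, symmetric])
    also have "\<dots> = F x y"
      by (rule sw_counit_left[OF Nm bilinear_left[OF F y] x])
    finally show ?thesis using True by simp
  qed (auto simp: conv2_def)
qed

lemma conv2_unit_right:
  assumes N: "k_algebra N" and F: "F \<in> bil s t N"
  shows "conv2 s t t N F (conv2_unit t N) = restrict2 s t F"
proof (intro ext)
  fix x y
  show "conv2 s t t N F (conv2_unit t N) x y = restrict2 s t F x y"
  proof (cases "x \<in> carrier (A s t) \<and> y \<in> carrier (A s t)")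
    case True
    then have x: "x \<in> carrier (A s t)" and y: "y \<in> carrier (A s t)" by auto
    note Nm = ka_module[OF N] and U = conv2_unit_bilinear[OF N]
    have lin: "(\<lambda>b. \<epsilon> t x1 \<odot>\<^bsub>N\<^esub> F x2 b) \<in> linear_maps (A s t) N" if "x1 \<in> carrier (A t t)" "x2 \<in> carrier (A s t)"
        for x1 x2
      by (rule linear_comp_right[OF bilinear_right[OF F that(2)] bilinear_smult[OF Nm]]) simp
    have "conv2 s t t N F (conv2_unit t N) x y = sw s t t N (\<lambda>x1 x2. sw s t t N (\<lambda>y1 y2. \<epsilon> t y2 \<odot>\<^bsub>N\<^esub> (\<epsilon> t x2 \<odot>\<^bsub>N\<^esub> F x1
        y1)) y) x"
      by (rule sw2_cong[OF N F U x y]) (use N F in \<open>simp add: conv2_unit_def unit_map_def mult.commute\<close>)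
    also have "\<dots> = sw s t t N (\<lambda>x1 x2. \<epsilon> t x2 \<odot>\<^bsub>N\<^esub> F x1 y) x"
      by (rule sym, rule sw_cong[OF Nm bilinear_flip[OF bilinear_smult_comp[OF Nm counit_linear bilinear_left[OF F
          y]]] x],
          rule sw_counit_right[OF Nm lin y, symmetric])
    also have "\<dots> = F x y"
      by (rule sw_counit_right[OF Nm bilinear_left[OF F y] x])
    finally show ?thesis using True by simp
  qed (auto simp: conv2_def)
qed

text \<open>The comultiplication is multiplicative: a convolution evaluated at a product xy is the
  two-variable convolution of the maps precomposed with multiplication. This is the bridge between
  the two kinds of convolution.\<close>

lemma conv_mult:
  assumes N: "k_algebra N" and F: "F \<in> linear_maps (A s u) N" and G: "G \<in> linear_maps (A u t) N"
    and x: "x \<in> carrier (A s t)" and y: "y \<in> carrier (A s t)"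
  shows "conv s u t N F G (x \<otimes>\<^bsub>A s t\<^esub> y) =
    conv2 s u t N (\<lambda>a b. F (a \<otimes>\<^bsub>A s u\<^esub> b)) (\<lambda>a b. G (a \<otimes>\<^bsub>A u t\<^esub> b)) x y"
  using x y by (simp add: conv_def conv2_def sw_mult[OF ka_module[OF N] bilinear_mult_comp[OF N F G]])

end

lemma linear_unit_map: "k_algebra N \<Longrightarrow> f \<in> linear_maps M ground \<Longrightarrow> (\<lambda>x. unit_map N (f x)) \<in> linear_maps M N"
  by (rule linear_comp[OF _ algebra_hom_linear[OF unit_map_hom]])

lemma unit_map_mult: "k_algebra N \<Longrightarrow> unit_map N c \<otimes>\<^bsub>N\<^esub> unit_map N d = unit_map N (c * d)"
  using algebra_hom_mult[OF unit_map_hom, of N c d] by simp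

lemma unit_map_left: "k_algebra N \<Longrightarrow> x \<in> carrier N \<Longrightarrow> unit_map N c \<otimes>\<^bsub>N\<^esub> x = c \<odot>\<^bsub>N\<^esub> x"
  and unit_map_right: "k_algebra N \<Longrightarrow> x \<in> carrier N \<Longrightarrow> x \<otimes>\<^bsub>N\<^esub> unit_map N c = c \<odot>\<^bsub>N\<^esub> x"
  by (simp_all add: unit_map_def)

lemma unit_map_ground [simp]: "unit_map ground c = c"
  by (simp add: unit_map_def)

section \<open>Convolution-inverse functionals and the maps built from them\<close>

context cocategory
begin

text \<open>An invertible arrow of the dual category: the two composites are functionals on
  \<open>A s s\<close> and \<open>A t t\<close>, and both must be counits. The values at 1 make the
  cocycle normalized.\<close>

definition inverse_pair where
  "inverse_pair s t \<alpha> \<beta> \<longleftrightarrow> \<alpha> \<in> linear_maps (A s t) ground \<and> \<beta> \<in> linear_maps (A t s) ground \<and>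
    \<alpha> \<one>\<^bsub>A s t\<^esub> = 1 \<and> \<beta> \<one>\<^bsub>A t s\<^esub> = 1 \<and>
    (\<forall>x\<in>carrier (A s s). sw s t s ground (\<lambda>a b. \<alpha> a * \<beta> b) x = \<epsilon> s x) \<and>
    (\<forall>x\<in>carrier (A t t). sw t s t ground (\<lambda>a b. \<beta> a * \<alpha> b) x = \<epsilon> t x)"

lemma inverse_pair_sym: "inverse_pair s t \<alpha> \<beta> \<Longrightarrow> inverse_pair t s \<beta> \<alpha>"
  by (auto simp: inverse_pair_def)

lemma
  assumes inv: "inverse_pair s t \<alpha> \<beta>"
  shows inv_left: "\<alpha> \<in> linear_maps (A s t) ground" and inv_right: "\<beta> \<in> linear_maps (A t s) ground"
    and inv_one: "\<alpha> \<one>\<^bsub>A s t\<^esub> = 1" "\<beta> \<one>\<^bsub>A t s\<^esub> = 1"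
    and inv_sw: "\<And>x. x \<in> carrier (A s s) \<Longrightarrow> sw s t s ground (\<lambda>a b. \<alpha> a * \<beta> b) x = \<epsilon> s x"
  using inv by (auto simp: inverse_pair_def)

definition scal where "scal N \<alpha> x = unit_map N (\<alpha> x)"
text \<open>\<open>scal_tensor\<close> and \<open>scal_mult\<close> agree exactly when \<alpha> is
  multiplicative. The cocycle is their quotient for convolution, so it measures how far \<alpha> is
  from a character.\<close>

definition scal_tensor where "scal_tensor N \<alpha> x y = unit_map N (\<alpha> x * \<alpha> y)"
definition scal_mult where "scal_mult s t N \<alpha> x y = unit_map N (\<alpha> (x \<otimes>\<^bsub>A s t\<^esub> y))"

context
  fixes s t \<alpha> \<beta> and N :: "('k, 'n, 'p) module_scheme"
  assumes inv: "inverse_pair s t \<alpha> \<beta>" and N: "k_algebra N"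
begin

lemma scal_linear: "scal N \<alpha> \<in> linear_maps (A s t) N"
  using linear_unit_map[OF N inv_left[OF inv]] by (simp add: scal_def[abs_def])

lemma scal_tensor_bilinear: "scal_tensor N \<alpha> \<in> bil s t N"
  unfolding scal_tensor_def[abs_def]
  by (rule bilinear_mapsI; rule linear_unit_map[OF N])
    (rule bilinear_right[OF bilinear_mult_comp[OF k_algebra_ground inv_left[OF inv] inv_left[OF inv]], simplified]
      bilinear_left[OF bilinear_mult_comp[OF k_algebra_ground inv_left[OF inv] inv_left[OF inv]], simplified],
          assumption+)+

lemma scal_mult_bilinear: "scal_mult s t N \<alpha> \<in> bil s t N"
  using bilinear_mult_map[OF linear_unit_map[OF N inv_left[OF inv]]] by (simp add: scal_mult_def[abs_def])

end

context
  fixes s t \<alpha> \<beta> and N :: "('k, 'n, 'p) module_scheme"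
  assumes inv: "inverse_pair s t \<alpha> \<beta>" and N: "k_algebra N"
begin

lemma conv_scal: "conv s t s N (scal N \<alpha>) (scal N \<beta>) = conv_unit s N"
  unfolding conv_def conv_unit_def
proof (rule restrict_ext)
  fix x assume x: "x \<in> carrier (A s s)"
  note a = inv_left[OF inv] and b = inv_right[OF inv] and u = algebra_hom_linear[OF unit_map_hom[OF N]]
  note bl = bilinear_mult_comp[OF k_algebra_ground a b, simplified]
  have "sw s t s N (\<lambda>a b. scal N \<alpha> a \<otimes>\<^bsub>N\<^esub> scal N \<beta> b) x = sw s t s N (\<lambda>a b. unit_map N (\<alpha> a * \<beta> b)) x"
    by (simp add: scal_def unit_map_mult[OF N])
  also have "\<dots> = unit_map N (sw s t s ground (\<lambda>a b. \<alpha> a * \<beta> b) x)"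
    by (rule linear_sw[OF k_module_ground ka_module[OF N] bl u x, symmetric])
  also have "\<dots> = unit_map N (\<epsilon> s x)" by (simp add: inv_sw[OF inv x])
  finally show "sw s t s N (\<lambda>a b. scal N \<alpha> a \<otimes>\<^bsub>N\<^esub> scal N \<beta> b) x = unit_map N (\<epsilon> s x)" .
qed

text \<open>By \<open>conv_mult\<close> the left side at (x, y) is the convolution of \<alpha> and
  \<beta> at xy, which is \<epsilon>(xy) = \<epsilon>(x) \<epsilon>(y).\<close>

lemma conv2_scal_mult: "conv2 s t s N (scal_mult s t N \<alpha>) (scal_mult t s N \<beta>) = conv2_unit s N"
proof (intro ext)
  fix x y
  note a = scal_linear[OF inv N] and b = scal_linear[OF inverse_pair_sym[OF inv] N]
  show "conv2 s t s N (scal_mult s t N \<alpha>) (scal_mult t s N \<beta>) x y = conv2_unit s N x y"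
  proof (cases "x \<in> carrier (A s s) \<and> y \<in> carrier (A s s)")
    case True
    then show ?thesis
      using conv_mult[OF N a b, of x y] algebra_hom_mult[OF counit_hom, of x s y]
      by (simp add: conv_scal) (simp add: scal_mult_def[abs_def] scal_def conv_unit_def conv2_unit_def)
  qed (auto simp: conv2_def conv2_unit_def)
qed

text \<open>The summand is a product of a factor in x and a factor in y, so the double sum splits
  into two sums, each of which is a counit.\<close>

lemma conv2_scal_tensor: "conv2 s t s N (scal_tensor N \<alpha>) (scal_tensor N \<beta>) = conv2_unit s N"
proof (intro ext)
  fix x y
  note a = inv_left[OF inv] and b = inv_right[OF inv]
  note bl = bilinear_mult_comp[OF k_algebra_ground a b, simplified]
  have lin: "(\<lambda>z. unit_map N (c * z)) \<in> linear_maps ground N" "(\<lambda>z. unit_map N (z * c)) \<in> linear_maps ground N" for c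
    by (rule linear_unit_map[OF N], rule linear_mapsI, simp_all add: algebra_simps)+
  show "conv2 s t s N (scal_tensor N \<alpha>) (scal_tensor N \<beta>) x y = conv2_unit s N x y"
  proof (cases "x \<in> carrier (A s s) \<and> y \<in> carrier (A s s)")
    case True
    then have x: "x \<in> carrier (A s s)" and y: "y \<in> carrier (A s s)" by auto
    have "conv2 s t s N (scal_tensor N \<alpha>) (scal_tensor N \<beta>) x y =
        sw s t s N (\<lambda>x1 x2. sw s t s N (\<lambda>y1 y2. unit_map N ((\<alpha> x1 * \<beta> x2) * (\<alpha> y1 * \<beta> y2))) y) x"
      by (rule sw2_cong[OF N scal_tensor_bilinear[OF inv N] scal_tensor_bilinear[OF inverse_pair_sym[OF inv] N] x y])
        (simp add: scal_tensor_def unit_map_mult[OF N] algebra_simps)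
    also have "\<dots> = sw s t s N (\<lambda>x1 x2. unit_map N ((\<alpha> x1 * \<beta> x2) * \<epsilon> s y)) x"
      using linear_sw[OF k_module_ground ka_module[OF N] bl lin(1) y] by (simp add: inv_sw[OF inv y])
    also have "\<dots> = unit_map N (\<epsilon> s x * \<epsilon> s y)"
      using linear_sw[OF k_module_ground ka_module[OF N] bl lin(2) x] by (simp add: inv_sw[OF inv x])
    finally show ?thesis using True by (simp add: conv2_unit_def)
  qed (auto simp: conv2_def conv2_unit_def)
qed

lemma conv2_scal_tensor_cancel:
  assumes F: "F \<in> bil s r N"
  shows "conv2 s t r N (scal_tensor N \<alpha>) (conv2 t s r N (scal_tensor N \<beta>) F) = restrict2 s r F"
  using conv2_assoc[OF N scal_tensor_bilinear[OF inv N] scal_tensor_bilinear[OF inverse_pair_sym[OF inv] N] F]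
  by (simp add: conv2_scal_tensor conv2_unit_left[OF N F])

lemma conv2_scal_mult_cancel:
  assumes F: "F \<in> bil s r N"
  shows "conv2 s t r N (scal_mult s t N \<alpha>) (conv2 t s r N (scal_mult t s N \<beta>) F) = restrict2 s r F"
  using conv2_assoc[OF N scal_mult_bilinear[OF inv N] scal_mult_bilinear[OF inverse_pair_sym[OF inv] N] F]
  by (simp add: conv2_scal_mult conv2_unit_left[OF N F])

lemma conv_scal_cancel:
  assumes F: "F \<in> linear_maps (A s r) N"
  shows "conv s t r N (scal N \<alpha>) (conv t s r N (scal N \<beta>) F) = restrict F (carrier (A s r))"
  using conv_assoc[OF N scal_linear[OF inv N] scal_linear[OF inverse_pair_sym[OF inv] N] F]
  by (simp add: conv_scal conv_unit_left[OF N F])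

end

lemma conv_restrict:
  assumes "k_algebra N" "F \<in> linear_maps (A s u) N" "G \<in> linear_maps (A u t) N"
  shows "conv s u t N (restrict F (carrier (A s u))) G = conv s u t N F G"
    and "conv s u t N F (restrict G (carrier (A u t))) = conv s u t N F G"
  by (rule sym, rule conv_cong, use assms in simp_all)+

text \<open>
  The cocycle is \<open>\<sigma>(x, y) = \<beta>(x\<^sub>(\<^sub>1\<^sub>)) \<beta>(y\<^sub>(\<^sub>1\<^sub>)) \<alpha>(x\<^sub>(\<^sub>2\<^sub>) y\<^sub>(\<^sub>2\<^sub>))\<close>, and \<open>transport\<close> is the coalgebra isomorphism
  \<open>x \<mapsto> \<alpha>(x\<^sub>(\<^sub>1\<^sub>)) x\<^sub>(\<^sub>2\<^sub>) \<beta>(x\<^sub>(\<^sub>3\<^sub>))\<close> that carries the product of \<open>A s s\<close> to the product of \<open>A t t\<close> twisted by \<open>\<sigma>\<close>.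
  Functionals are composed with the unit map of an algebra \<open>N\<close>, so that scalars convolve with maps into \<open>N\<close>.
\<close>

definition twist_cocycle where
  "twist_cocycle t s \<alpha> \<beta> N = conv2 t s t N (scal_tensor N \<beta>) (scal_mult s t N \<alpha>)"

definition twist_inverse where
  "twist_inverse t s \<alpha> \<beta> N = conv2 t s t N (scal_mult t s N \<beta>) (scal_tensor N \<alpha>)"

definition transport where
  "transport s t \<alpha> \<beta> = conv s t s (A t t) (scal (A t t) \<alpha>) (conv t t s (A t t) (\<lambda>x. x) (scal (A t t) \<beta>))"

context
  fixes s t \<alpha> \<beta>
  assumes inv: "inverse_pair s t \<alpha> \<beta>"
begin

context
  fixes N :: "('k, 'n, 'p) module_scheme"
  assumes N: "k_algebra N"
begin

private lemmas sl = scal_linear[OF inv N] scal_linear[OF inverse_pair_sym[OF inv] N]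
private lemmas st = scal_tensor_bilinear[OF inv N] scal_tensor_bilinear[OF inverse_pair_sym[OF inv] N]
private lemmas sm = scal_mult_bilinear[OF inv N] scal_mult_bilinear[OF inverse_pair_sym[OF inv] N]

lemma twist_cocycle_bilinear: "twist_cocycle t s \<alpha> \<beta> N \<in> bil t t N"
  unfolding twist_cocycle_def by (rule conv2_bilinear[OF N st(2) sm(1)])

lemma twist_inverse_bilinear: "twist_inverse t s \<alpha> \<beta> N \<in> bil t t N"
  unfolding twist_inverse_def by (rule conv2_bilinear[OF N sm(2) st(1)])

text \<open>With m the product, \<sigma> = (\<beta> \<otimes> \<beta>) * (\<alpha> m) and \<tau> =
  (\<beta> m) * (\<alpha> \<otimes> \<alpha>). In either composite the two middle factors cancel,
  and then the two outer ones.\<close>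

lemma twist_cocycle_inverse:
  "conv2 t t t N (twist_cocycle t s \<alpha> \<beta> N) (twist_inverse t s \<alpha> \<beta> N) = conv2_unit t N"
  "conv2 t t t N (twist_inverse t s \<alpha> \<beta> N) (twist_cocycle t s \<alpha> \<beta> N) = conv2_unit t N"
proof -
  have "conv2 t t t N (twist_cocycle t s \<alpha> \<beta> N) (twist_inverse t s \<alpha> \<beta> N) =
      conv2 t s t N (scal_tensor N \<beta>) (conv2 s t t N (scal_mult s t N \<alpha>) (conv2 t s t N (scal_mult t s N \<beta>)
          (scal_tensor N \<alpha>)))"
    unfolding twist_cocycle_def twist_inverse_def
    by (rule conv2_assoc[OF N st(2) sm(1) conv2_bilinear[OF N sm(2) st(1)]])
  then show "conv2 t t t N (twist_cocycle t s \<alpha> \<beta> N) (twist_inverse t s \<alpha> \<beta> N) = conv2_unit t N"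
    by (simp add: conv2_scal_mult_cancel[OF inv N st(1)] conv2_restrict_right[OF N st(2,1)]
      conv2_scal_tensor[OF inverse_pair_sym[OF inv] N])
  have "conv2 t t t N (twist_inverse t s \<alpha> \<beta> N) (twist_cocycle t s \<alpha> \<beta> N) =
      conv2 t s t N (scal_mult t s N \<beta>) (conv2 s t t N (scal_tensor N \<alpha>) (conv2 t s t N (scal_tensor N \<beta>)
          (scal_mult s t N \<alpha>)))"
    unfolding twist_cocycle_def twist_inverse_def
    by (rule conv2_assoc[OF N sm(2) st(1) conv2_bilinear[OF N st(2) sm(1)]])
  then show "conv2 t t t N (twist_inverse t s \<alpha> \<beta> N) (twist_cocycle t s \<alpha> \<beta> N) = conv2_unit t N"
    by (simp add: conv2_scal_tensor_cancel[OF inv N sm(1)] conv2_restrict_right[OF N sm(2,1)]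
      conv2_scal_mult[OF inverse_pair_sym[OF inv] N])
qed

text \<open>Composition with \<open>transport\<close> is conjugation: F \<mapsto> \<alpha> * F *
  \<beta>. The properties of \<open>transport\<close> are obtained by choosing F: the inverse
  transport, the counit, the comultiplication.\<close>

lemma linear_transport:
  assumes F: "F \<in> linear_maps (A t t) N" and x: "x \<in> carrier (A s s)"
  shows "F (transport s t \<alpha> \<beta> x) = conv s t s N (scal N \<alpha>) (conv t t s N F (scal N \<beta>)) x"
proof -
  note H = alg[of t t]
  note slH = scal_linear[OF inv H] scal_linear[OF inverse_pair_sym[OF inv] H]
  note K = conv_linear[OF H linear_id slH(2)]
  have FK: "F (conv t t s (A t t) (\<lambda>x. x) (scal (A t t) \<beta>) w) = conv t t s N F (scal N \<beta>) w" if w: "w \<in> carrier (A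
      t s)" for w
    by (rule linear_conv[OF H N linear_id slH(2) F sl(2) F w])
      (simp add: scal_def unit_map_right N linear_smult[OF F] linear_closed[OF F])
  show ?thesis
    unfolding transport_def
    by (rule linear_conv[OF H N slH(1) K sl(1) conv_linear[OF N F sl(2)] F x])
      (simp add: scal_def[of _ \<alpha>] unit_map_left N linear_smult[OF F] linear_closed[OF F] FK linear_closed[OF K]
        linear_closed[OF conv_linear[OF N F sl(2)]])
qed

text \<open>The same conjugation over the tensor square, by \<alpha> \<otimes> \<alpha> and \<beta>
  \<otimes> \<beta>.\<close>

lemma bilinear_transport:
  assumes F: "F \<in> bil t t N" and u: "u \<in> carrier (A s s)" and v: "v \<in> carrier (A s s)"
  shows "F (transport s t \<alpha> \<beta> u) (transport s t \<alpha> \<beta> v) =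
    conv2 s t s N (scal_tensor N \<alpha>) (conv2 t t s N F (scal_tensor N \<beta>)) u v"
proof -
  note H = alg[of t t]
  note slH = scal_linear[OF inv H] scal_linear[OF inverse_pair_sym[OF inv] H]
  let ?\<eta> = "conv t t s (A t t) (\<lambda>x. x) (scal (A t t) \<beta>)"
  note K = conv_linear[OF H linear_id slH(2)]
  note b1 = bilinear_mult_comp[OF H slH(1) K] and b2 = bilinear_mult_comp[OF H linear_id slH(2)]
  note Nm = ka_module[OF N]
  note FB = conv2_bilinear[OF N F st(2)]
  have eta: "F (?\<eta> w) (?\<eta> z) = conv2 t t s N F (scal_tensor N \<beta>) w z" if w: "w \<in> carrier (A t s)" and z: "z \<in>
      carrier (A t s)" for w z
  proof -
    have "F (?\<eta> w) (?\<eta> z) = sw t t s N (\<lambda>a b. sw t t s N (\<lambda>c d. F (a \<otimes>\<^bsub>A t t\<^esub> scal (A t t) \<beta> b) (c \<otimes>\<^bsub>A t t\<^esub> scal (A t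
        t) \<beta> d)) z) w"
      using sw_bilinear_comp[OF Nm mod mod F b2 b2 w z] w z by (simp add: conv_def)
    also have "\<dots> = conv2 t t s N F (scal_tensor N \<beta>) w z"
    proof (rule sw2_cong[OF N F st(2) w z, symmetric])
      fix x1 x2 y1 y2 assume *: "x1 \<in> carrier (A t t)" "x2 \<in> carrier (A t s)" "y1 \<in> carrier (A t t)" "y2 \<in> carrier
          (A t s)"
      then show "F x1 y1 \<otimes>\<^bsub>N\<^esub> scal_tensor N \<beta> x2 y2 = F (x1 \<otimes>\<^bsub>A t t\<^esub> scal (A t t) \<beta> x2) (y1 \<otimes>\<^bsub>A t t\<^esub> scal (A t t) \<beta> y2)"
        by (simp add: scal_def scal_tensor_def unit_map_right N bilinear_smult_left[OF F] bilinear_smult_right[OF F]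
          bilinear_closed[OF F] mult.commute)
    qed
    finally show ?thesis .
  qed
  have "F (transport s t \<alpha> \<beta> u) (transport s t \<alpha> \<beta> v) =
      sw s t s N (\<lambda>a b. sw s t s N (\<lambda>c d. F (scal (A t t) \<alpha> a \<otimes>\<^bsub>A t t\<^esub> ?\<eta> b) (scal (A t t) \<alpha> c \<otimes>\<^bsub>A t t\<^esub> ?\<eta> d)) v) u"
    using sw_bilinear_comp[OF Nm mod mod F b1 b1 u v] u v by (simp add: transport_def conv_def[of s t s])
  also have "\<dots> = conv2 s t s N (scal_tensor N \<alpha>) (conv2 t t s N F (scal_tensor N \<beta>)) u v"
  proof (rule sw2_cong[OF N st(1) FB u v, symmetric])
    fix x1 x2 y1 y2 assume *: "x1 \<in> carrier (A s t)" "x2 \<in> carrier (A t s)" "y1 \<in> carrier (A s t)" "y2 \<in> carrier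
        (A t s)"
    then show "scal_tensor N \<alpha> x1 y1 \<otimes>\<^bsub>N\<^esub> conv2 t t s N F (scal_tensor N \<beta>) x2 y2 =
        F (scal (A t t) \<alpha> x1 \<otimes>\<^bsub>A t t\<^esub> ?\<eta> x2) (scal (A t t) \<alpha> y1 \<otimes>\<^bsub>A t t\<^esub> ?\<eta> y2)"
      by (simp add: scal_def[of _ \<alpha>] scal_tensor_def[of _ \<alpha>] unit_map_left N bilinear_smult_left[OF F]
          bilinear_smult_right[OF F]
        bilinear_closed[OF F] linear_closed[OF K] bilinear_closed[OF FB] eta[symmetric] mult.commute)
  qed
  finally show ?thesis .
qed

end

lemma transport_linear: "transport s t \<alpha> \<beta> \<in> linear_maps (A s s) (A t t)"
  unfolding transport_def
  by (intro conv_linear alg linear_id scal_linear[OF inv] scal_linear[OF inverse_pair_sym[OF inv]])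

lemma transport_one: "transport s t \<alpha> \<beta> \<one>\<^bsub>A s s\<^esub> = \<one>\<^bsub>A t t\<^esub>"
proof -
  note slH = scal_linear[OF inv alg[of t t]] scal_linear[OF inverse_pair_sym[OF inv] alg[of t t]]
  note K = conv_linear[OF alg linear_id slH(2)]
  note b1 = bilinear_mult_comp[OF alg slH(1) K] and b2 = bilinear_mult_comp[OF alg linear_id slH(2)]
  show ?thesis unfolding transport_def conv_def
    using sw_one[OF mod b1] sw_one[OF mod b2] inv_one[OF inv] by (simp add: conv_def scal_def unit_map_def)
qed

text \<open>As conjugations, \<alpha> * (\<beta> * id * \<alpha>) * \<beta> = id.\<close>

lemma transport_transport:
  assumes x: "x \<in> carrier (A s s)"
  shows "transport t s \<beta> \<alpha> (transport s t \<alpha> \<beta> x) = x"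
proof -
  note inv' = inverse_pair_sym[OF inv]
  let ?L = "A s s"
  note sl = scal_linear[OF inv alg[of s s]] scal_linear[OF inv' alg[of s s]]
  note f = conv_linear[OF alg linear_id sl(1)]
  have "transport t s \<beta> \<alpha> \<in> linear_maps (A t t) ?L"
    unfolding transport_def by (intro conv_linear alg linear_id sl)
  from linear_transport[OF alg this x]
  have "transport t s \<beta> \<alpha> (transport s t \<alpha> \<beta> x) =
      conv s t s ?L (scal ?L \<alpha>) (conv t t s ?L (conv t s t ?L (scal ?L \<beta>) (conv s s t ?L (\<lambda>x. x) (scal ?L \<alpha>)))
          (scal ?L \<beta>)) x"
    by (simp add: transport_def[of t s])
  also have "\<dots> = conv s t s ?L (scal ?L \<alpha>) (conv t s s ?L (scal ?L \<beta>) (conv s s s ?L (\<lambda>x. x) (conv s t s ?L (scal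
      ?L \<alpha>) (scal ?L \<beta>)))) x"
    by (simp add: conv_assoc[OF alg sl(2) f sl(2)] conv_assoc[OF alg linear_id sl])
  also have "\<dots> = x"
    unfolding conv_scal[OF inv alg] conv_unit_right[OF alg linear_id] conv_restrict(2)[OF alg sl(2) linear_id]
      conv_scal_cancel[OF inv alg linear_id] using x by simp
  finally show ?thesis .
qed

text \<open>Conjugating the counit gives \<alpha> * \<epsilon> * \<beta> = \<alpha> * \<beta> =
  \<epsilon>.\<close>

lemma counit_transport: "x \<in> carrier (A s s) \<Longrightarrow> \<epsilon> t (transport s t \<alpha> \<beta> x) = \<epsilon> s x"
proof -
  assume x: "x \<in> carrier (A s s)"
  let ?k = "ground :: ('k, 'k) module"
  note sl = scal_linear[OF inverse_pair_sym[OF inv] k_algebra_ground]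
  have u: "conv_unit t ?k = restrict (\<epsilon> t) (carrier (A t t))" by (simp add: conv_unit_def)
  have "conv t t s ?k (\<epsilon> t) (scal ?k \<beta>) = conv t t s ?k (conv_unit t ?k) (scal ?k \<beta>)"
    unfolding u by (rule conv_restrict(1)[OF k_algebra_ground counit_linear sl, symmetric])
  then have "conv s t s ?k (scal ?k \<alpha>) (conv t t s ?k (\<epsilon> t) (scal ?k \<beta>)) = conv s t s ?k (scal ?k \<alpha>) (scal ?k \<beta>)"
    by (simp add: conv_unit_left[OF k_algebra_ground sl] conv_restrict[OF k_algebra_ground scal_linear[OF inv
        k_algebra_ground] sl])
  then show ?thesis
    using linear_transport[OF k_algebra_ground counit_linear x] x by (simp add: conv_scal[OF inv k_algebra_ground]
        conv_unit_def)
qed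

text \<open>The comultiplication is the product of the two embeddings, and conjugation distributes
  over a product because \<beta> * \<alpha> = \<epsilon> may be inserted between its
  factors.\<close>

lemma comult_transport:
  assumes x: "x \<in> carrier (A s s)"
  shows "\<Delta> t t t (transport s t \<alpha> \<beta> x) =
    tensor_map (A t t) (A t t) (transport s t \<alpha> \<beta>) (transport s t \<alpha> \<beta>) (\<Delta> s s s x)"
proof -
  note inv' = inverse_pair_sym[OF inv]
  let ?H = "A t t" and ?L = "A s s" and ?h = "transport s t \<alpha> \<beta>"
  let ?T = "tensor ?H ?H"
  note T = k_algebra_tensor[OF alg alg, of t t t t] and LL = k_algebra_tensor[OF alg alg, of s s s s]
  let ?a = "scal ?T \<alpha>" and ?b = "scal ?T \<beta>"
  note sl = scal_linear[OF inv T] scal_linear[OF inv' T]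
  let ?il = "\<lambda>a. pure_tensor ?H ?H a \<one>\<^bsub>?H\<^esub>" and ?ir = "\<lambda>a. pure_tensor ?H ?H \<one>\<^bsub>?H\<^esub> a"
  let ?jl = "\<lambda>a. pure_tensor ?L ?L a \<one>\<^bsub>?L\<^esub>" and ?jr = "\<lambda>a. pure_tensor ?L ?L \<one>\<^bsub>?L\<^esub> a"
  note il = algebra_hom_linear[OF pure_left_hom[OF alg alg, of t t t t]] and ir = algebra_hom_linear[OF
      pure_right_hom[OF alg alg, of t t t t]]
  note jl = algebra_hom_linear[OF pure_left_hom[OF alg alg, of s s s s]] and jr = algebra_hom_linear[OF
      pure_right_hom[OF alg alg, of s s s s]]
  note h = transport_linear
  note ilb = conv_linear[OF T il sl(2)] and irb = conv_linear[OF T ir sl(2)]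
  have hl: "(\<lambda>a. ?il (?h a)) \<in> linear_maps ?L ?T" and hr: "(\<lambda>a. ?ir (?h a)) \<in> linear_maps ?L ?T"
    by (rule linear_comp[OF h il] linear_comp[OF h ir])+
  have "\<Delta> t t t (?h x) = conv s t s ?T ?a (conv t t s ?T (\<Delta> t t t) ?b) x"
    by (rule linear_transport[OF T algebra_hom_linear[OF comult_hom] x])
  also have "conv t t s ?T (\<Delta> t t t) ?b = conv t t s ?T (conv t t t ?T ?il ?ir) ?b"
    unfolding comult_conv by (rule conv_restrict(1)[OF T algebra_hom_linear[OF comult_hom] sl(2), symmetric])
  also have "\<dots> = conv t t s ?T ?il (conv t t s ?T ?ir ?b)"
    by (rule conv_assoc[OF T il ir sl(2)])
  \<comment> \<open>Here \<beta> * \<alpha> is inserted between the two embeddings; the equation is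
    proved from right to left, by cancelling it.\<close>
  also have "conv s t s ?T ?a \<dots> = conv s s s ?T (conv s t s ?T ?a (conv t t s ?T ?il ?b)) (conv s t s ?T ?a (conv
      t t s ?T ?ir ?b))"
  proof -
    have "conv s s s ?T (conv s t s ?T ?a (conv t t s ?T ?il ?b)) (conv s t s ?T ?a (conv t t s ?T ?ir ?b)) =
        conv s t s ?T ?a (conv t t s ?T ?il (conv t s s ?T ?b (conv s t s ?T ?a (conv t t s ?T ?ir ?b))))"
      by (simp add: conv_assoc[OF T sl(1) ilb conv_linear[OF T sl(1) irb]] conv_assoc[OF T il sl(2) conv_linear[OF
          T sl(1) irb]])
    then show ?thesis
      by (simp add: conv_scal_cancel[OF inv' T irb] conv_restrict(2)[OF T il irb])
  qed
  also have "\<dots> = conv s s s ?T (\<lambda>a. ?il (?h a)) (\<lambda>a. ?ir (?h a))"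
    by (rule sym, rule conv_cong[OF T hl hr]) (rule linear_transport[OF T il] linear_transport[OF T ir], assumption)+
  also have "\<dots> x = tensor_map ?H ?H ?h ?h (conv s s s (tensor ?L ?L) ?jl ?jr x)"
    by (rule linear_conv[OF LL T jl jr hl hr tensor_map_linear[OF mod mod mod mod h h] x, symmetric])
      (simp add: pure_left_right tensor_map_pure[OF mod mod mod mod h h] linear_closed[OF h])
  also have "conv s s s (tensor ?L ?L) ?jl ?jr x = \<Delta> s s s x"
    using x by (simp add: comult_conv)
  finally show ?thesis .
qed

text \<open>The product of \<open>cocycle_twist\<close> as a convolution \<sigma> * m * \<tau>, the
  form in which factors can be cancelled. Its agreement with the nested Sweedler sums is
  \<open>twist_mult_sw\<close>.\<close>

definition twist_mult where
  "twist_mult = conv2 t t t (A t t) (twist_cocycle t s \<alpha> \<beta> (A t t))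
     (conv2 t t t (A t t) (\<lambda>x y. x \<otimes>\<^bsub>A t t\<^esub> y) (twist_inverse t s \<alpha> \<beta> (A t t)))"

text \<open>Conjugating \<sigma> * m * \<tau> by \<alpha> \<otimes> \<alpha> and \<beta> \<otimes>
  \<beta> cancels the outer tensor factors of \<sigma> and \<tau> and leaves (\<alpha> m) * m *
  (\<beta> m). By \<open>conv_mult\<close> this is \<alpha> * id * \<beta> at a product, that is,
  \<open>transport\<close> of the product.\<close>

lemma transport_mult:
  assumes u: "u \<in> carrier (A s s)" and v: "v \<in> carrier (A s s)"
  shows "transport s t \<alpha> \<beta> (u \<otimes>\<^bsub>A s s\<^esub> v) = twist_mult (transport s t \<alpha> \<beta> u) (transport s t \<alpha> \<beta> v)"
proof -
  note inv' = inverse_pair_sym[OF inv]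
  let ?H = "A t t" and ?h = "transport s t \<alpha> \<beta>"
  note H = alg[of t t]
  let ?m = "\<lambda>x y. x \<otimes>\<^bsub>?H\<^esub> y"
  let ?aa = "scal_tensor ?H \<alpha>" and ?bb = "scal_tensor ?H \<beta>" and ?am = "scal_mult s t ?H \<alpha>" and ?bm = "scal_mult t
      s ?H \<beta>"
  note sl = scal_linear[OF inv H] scal_linear[OF inv' H]
  note st = scal_tensor_bilinear[OF inv H] scal_tensor_bilinear[OF inv' H]
  note sm = scal_mult_bilinear[OF inv H] scal_mult_bilinear[OF inv' H]
  note m = bilinear_mult[OF H] and ti = twist_inverse_bilinear[OF H] and tc = twist_cocycle_bilinear[OF H]
  note mti = conv2_bilinear[OF H m ti]
  have tw: "twist_mult \<in> bil t t ?H" unfolding twist_mult_def by (rule conv2_bilinear[OF H tc mti])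
  \<comment> \<open>\<open>Z\<close> is m * (\<beta> m): what remains of m * \<tau> once its factor
    \<alpha> \<otimes> \<alpha> has been cancelled against \<beta> \<otimes> \<beta>.\<close>
  define Z where "Z = conv2 t t s ?H ?m ?bm"
  have Z: "Z \<in> bil t s ?H" unfolding Z_def by (rule conv2_bilinear[OF H m sm(2)])
  have "conv2 t t s ?H (twist_inverse t s \<alpha> \<beta> ?H) ?bb = conv2 t s s ?H ?bm (conv2_unit s ?H)"
    unfolding twist_inverse_def by (simp add: conv2_assoc[OF H sm(2) st] conv2_scal_tensor[OF inv H])
  then have Zeq: "conv2 t t s ?H (conv2 t t t ?H ?m (twist_inverse t s \<alpha> \<beta> ?H)) ?bb = Z"
    unfolding Z_def
    by (simp add: conv2_assoc[OF H m ti st(2)] conv2_unit_right[OF H sm(2)] conv2_restrict_right[OF H m sm(2)])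
  have "conv2 t t s ?H twist_mult ?bb = conv2 t t s ?H (conv2 t s t ?H ?bb ?am) Z"
    unfolding twist_mult_def conv2_assoc[OF H tc mti st(2)] Zeq by (simp add: twist_cocycle_def)
  also have "\<dots> = conv2 t s s ?H ?bb (conv2 s t s ?H ?am Z)"
    by (rule conv2_assoc[OF H st(2) sm(1) Z])
  finally have "conv2 s t s ?H ?aa (conv2 t t s ?H twist_mult ?bb) = restrict2 s s (conv2 s t s ?H ?am Z)"
    by (simp add: conv2_scal_tensor_cancel[OF inv H conv2_bilinear[OF H sm(1) Z]])
  then have "twist_mult (?h u) (?h v) = conv2 s t s ?H ?am Z u v"
    using bilinear_transport[OF H tw u v] u v by simp
  also have "\<dots> = conv2 s t s ?H ?am (\<lambda>p q. conv t t s ?H (\<lambda>x. x) (scal ?H \<beta>) (p \<otimes>\<^bsub>A t s\<^esub> q)) u v"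
  proof -
    have "conv2 s t s ?H ?am Z = conv2 s t s ?H ?am (\<lambda>p q. conv t t s ?H (\<lambda>x. x) (scal ?H \<beta>) (p \<otimes>\<^bsub>A t s\<^esub> q))"
      by (rule conv2_cong[OF H sm(1) Z])
        (simp_all add: conv_mult[OF H linear_id sl(2)] Z_def scal_mult_def[abs_def] scal_def)
    then show ?thesis by simp
  qed
  also have "\<dots> = ?h (u \<otimes>\<^bsub>A s s\<^esub> v)"
    unfolding transport_def conv_mult[OF H sl(1) conv_linear[OF H linear_id sl(2)] u v]
    by (simp add: scal_mult_def[abs_def] scal_def)
  finally show ?thesis by simp
qed

end

lemma transport_bij:
  assumes inv: "inverse_pair s t \<alpha> \<beta>"
  shows "bij_betw (transport s t \<alpha> \<beta>) (carrier (A s s)) (carrier (A t t))"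
  by (rule bij_betw_byWitness[where f' = "transport t s \<beta> \<alpha>"])
    (use transport_transport[OF inv] transport_transport[OF inverse_pair_sym[OF inv]]
      linear_closed[OF transport_linear[OF inv]] linear_closed[OF transport_linear[OF inverse_pair_sym[OF inv]]]
          in auto)

end

section \<open>The cocycle identity and the twisted product\<close>

context cocategory
begin

context
  fixes s t \<alpha> \<beta>
  assumes inv: "inverse_pair s t \<alpha> \<beta>"
begin

private abbreviation "K \<equiv> (ground :: ('k, 'k) module)"
private lemmas ab = inv_left[OF inv] inv_right[OF inv]
private lemmas inv' = inverse_pair_sym[OF inv]
private lemmas Kg = k_algebra_ground k_module_ground

text \<open>Cocycle and inverse were formed in an arbitrary algebra so that they can be convolved
  with the product; here they are identified with the images of their scalar-valued
  versions.\<close>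

lemma twist_cocycle_unit_map:
  assumes "k_algebra N" "x \<in> carrier (A t t)" "y \<in> carrier (A t t)"
  shows "unit_map N (twist_cocycle t s \<alpha> \<beta> K x y) = twist_cocycle t s \<alpha> \<beta> N x y"
    and "unit_map N (twist_inverse t s \<alpha> \<beta> K x y) = twist_inverse t s \<alpha> \<beta> N x y"
  using conv2_hom[OF Kg(1) scal_tensor_bilinear[OF inv' Kg(1)] scal_mult_bilinear[OF inv Kg(1)] assms(1)
      unit_map_hom[OF assms(1)] assms(2,3)]
    conv2_hom[OF Kg(1) scal_mult_bilinear[OF inv' Kg(1)] scal_tensor_bilinear[OF inv Kg(1)] assms(1)
        unit_map_hom[OF assms(1)] assms(2,3)]
  by (simp_all add: twist_cocycle_def twist_inverse_def scal_tensor_def[abs_def] scal_mult_def[abs_def])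

lemma twist_cocycle_sw:
  assumes x: "x \<in> carrier (A t t)" and y: "y \<in> carrier (A t t)"
  shows "twist_cocycle t s \<alpha> \<beta> K x y =
    sw t s t K (\<lambda>x1 x2. sw t s t K (\<lambda>y1 y2. \<beta> x1 * \<beta> y1 * \<alpha> (x2 \<otimes>\<^bsub>A s t\<^esub> y2)) y) x"
  unfolding twist_cocycle_def
  by (rule sw2_cong[OF Kg(1) scal_tensor_bilinear[OF inv' Kg(1)] scal_mult_bilinear[OF inv Kg(1)] x y])
    (simp add: scal_tensor_def scal_mult_def)

text \<open>When one argument is 1, what remains of \<sigma> is \<beta> * \<alpha>, the counit of
  \<open>A t t\<close>.\<close>

lemma twist_cocycle_one:
  assumes x: "x \<in> carrier (A t t)"
  shows "twist_cocycle t s \<alpha> \<beta> K x \<one>\<^bsub>A t t\<^esub> = \<epsilon> t x" "twist_cocycle t s \<alpha> \<beta> K \<one>\<^bsub>A t t\<^esub> x = \<epsilon> t x"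
proof -
  note b1 = conv2_inner1[OF Kg(1) scal_tensor_bilinear[OF inv' Kg(1)] scal_mult_bilinear[OF inv Kg(1)],
      simplified, unfolded scal_tensor_def scal_mult_def unit_map_ground]
  note b3 = conv2_inner3[OF Kg(1) scal_tensor_bilinear[OF inv' Kg(1)] scal_mult_bilinear[OF inv Kg(1)],
      simplified, unfolded scal_tensor_def scal_mult_def unit_map_ground]
  note bl = bilinear_mult_comp[OF Kg(1) ab(2,1), simplified]
  have "twist_cocycle t s \<alpha> \<beta> K x \<one>\<^bsub>A t t\<^esub> = sw t s t K (\<lambda>a b. \<beta> a * \<alpha> b) x"
    unfolding twist_cocycle_sw[OF x ka_one_closed[OF alg]]
    by (rule sym, rule sw_cong[OF Kg(2) bl x]) (simp add: sw_one[OF Kg(2) b1] inv_one[OF inv])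
  then show "twist_cocycle t s \<alpha> \<beta> K x \<one>\<^bsub>A t t\<^esub> = \<epsilon> t x" using inv_sw[OF inv' x] by simp
  have "twist_cocycle t s \<alpha> \<beta> K \<one>\<^bsub>A t t\<^esub> x = sw t s t K (\<lambda>a b. \<beta> a * \<alpha> b) x"
    unfolding twist_cocycle_sw[OF ka_one_closed[OF alg] x] sw_one[OF Kg(2) b3[OF x]]
    by (rule sym, rule sw_cong[OF Kg(2) bl x]) (simp add: inv_one[OF inv])
  then show "twist_cocycle t s \<alpha> \<beta> K \<one>\<^bsub>A t t\<^esub> x = \<epsilon> t x" using inv_sw[OF inv' x] by simp
qed

text \<open>By \<open>conv_mult\<close>, (\<beta> * \<gamma>) m = (\<beta> m) * (\<gamma> m). Its
  factor \<beta> m cancels the factor \<alpha> m of \<sigma>, leaving (\<beta> \<otimes> \<beta>) *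
  (\<gamma> m).\<close>

lemma twist_cocycle_reduce:
  assumes \<gamma>: "\<gamma> \<in> linear_maps (A s t) K" and x: "x \<in> carrier (A t t)" and y: "y \<in> carrier (A t t)"
  shows "sw t t t K (\<lambda>x1 x2. sw t t t K (\<lambda>y1 y2. twist_cocycle t s \<alpha> \<beta> K x1 y1 * conv t s t K \<beta> \<gamma> (x2 \<otimes>\<^bsub>A t t\<^esub> y2))
      y) x =
    sw t s t K (\<lambda>x1 x2. sw t s t K (\<lambda>y1 y2. \<beta> x1 * \<beta> y1 * \<gamma> (x2 \<otimes>\<^bsub>A s t\<^esub> y2)) y) x"
proof -
  note st = scal_tensor_bilinear[OF inv' Kg(1)] and sm = scal_mult_bilinear[OF inv Kg(1)] scal_mult_bilinear[OF
      inv' Kg(1)]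
  note \<Gamma> = bilinear_mult_map[OF \<gamma>] and C = conv_linear[OF Kg(1) ab(2) \<gamma>]
  have eq: "conv t s t K \<beta> \<gamma> (p \<otimes>\<^bsub>A t t\<^esub> q) = conv2 t s t K (scal_mult t s K \<beta>) (\<lambda>a b. \<gamma> (a \<otimes>\<^bsub>A s t\<^esub> b)) p q"
    if "p \<in> carrier (A t t)" "q \<in> carrier (A t t)" for p q
    using conv_mult[OF Kg(1) ab(2) \<gamma> that] by (simp add: scal_mult_def[abs_def])
  have "conv2 t t t K (twist_cocycle t s \<alpha> \<beta> K) (\<lambda>p q. conv t s t K \<beta> \<gamma> (p \<otimes>\<^bsub>A t t\<^esub> q)) =
     conv2 t t t K (twist_cocycle t s \<alpha> \<beta> K) (conv2 t s t K (scal_mult t s K \<beta>) (\<lambda>a b. \<gamma> (a \<otimes>\<^bsub>A s t\<^esub> b)))"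
    by (rule conv2_cong[OF Kg(1) twist_cocycle_bilinear[OF inv Kg(1)] bilinear_mult_map[OF C]]) (simp_all add: eq)
  also have "\<dots> = conv2 t s t K (scal_tensor K \<beta>) (\<lambda>a b. \<gamma> (a \<otimes>\<^bsub>A s t\<^esub> b))"
    unfolding twist_cocycle_def
    by (simp add: conv2_assoc[OF Kg(1) st sm(1) conv2_bilinear[OF Kg(1) sm(2) \<Gamma>]] conv2_scal_mult_cancel[OF inv
        Kg(1) \<Gamma>]
      conv2_restrict_right[OF Kg(1) st \<Gamma>])
  finally have "conv2 t t t K (twist_cocycle t s \<alpha> \<beta> K) (\<lambda>p q. conv t s t K \<beta> \<gamma> (p \<otimes>\<^bsub>A t t\<^esub> q)) x y =
    conv2 t s t K (scal_tensor K \<beta>) (\<lambda>a b. \<gamma> (a \<otimes>\<^bsub>A s t\<^esub> b)) x y" by simp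
  then show ?thesis using x y by (simp add: conv2_def scal_tensor_def)
qed

text \<open>Both sides are equal to the sum of \<beta>(x(1)) \<beta>(y(1)) \<beta>(z(1))
  \<alpha>(x(2) y(2) z(2)), in which associativity of \<open>A s t\<close> removes the difference.
  To reach it, \<sigma> with one argument fixed is written as \<beta> * \<gamma> or \<beta> *
  \<delta>, so that \<open>twist_cocycle_reduce\<close> applies.\<close>

lemma twist_cocycle_condition:
  assumes x: "x \<in> carrier (A t t)" and y: "y \<in> carrier (A t t)" and z: "z \<in> carrier (A t t)"
  defines "c \<equiv> twist_cocycle t s \<alpha> \<beta> K"
  shows "sw t t t K (\<lambda>x1 x2. sw t t t K (\<lambda>y1 y2. c x1 y1 * c (x2 \<otimes>\<^bsub>A t t\<^esub> y2) z) y) x =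
    sw t t t K (\<lambda>y1 y2. sw t t t K (\<lambda>z1 z2. c y1 z1 * c x (y2 \<otimes>\<^bsub>A t t\<^esub> z2)) z) y"
proof -
  \<comment> \<open>\<open>\<gamma> z\<close> and \<open>\<delta> x\<close> are the functionals on
    \<open>A s t\<close> with \<sigma>(p, z) = (\<beta> * \<gamma> z)(p) and \<sigma>(x, q) =
    (\<beta> * \<delta> x)(q).\<close>
  define \<gamma> where "\<gamma> z p = sw t s t K (\<lambda>z1 z2. \<beta> z1 * \<alpha> (p \<otimes>\<^bsub>A s t\<^esub> z2)) z" for z p
  define \<delta> where "\<delta> x q = sw t s t K (\<lambda>x1 x2. \<beta> x1 * \<alpha> (x2 \<otimes>\<^bsub>A s t\<^esub> q)) x" for x q
  note am = bilinear_mult_map[OF ab(1)]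
  have b\<gamma>: "(\<lambda>z1 z2. \<beta> z1 * \<alpha> (p \<otimes>\<^bsub>A s t\<^esub> z2)) \<in> bilinear_maps (A t s) (A s t) K" if "p \<in> carrier (A s t)" for p
    using bilinear_mult_comp[OF Kg(1) ab(2) bilinear_right[OF am that]] by simp
  have b\<delta>: "(\<lambda>x1 x2. \<beta> x1 * \<alpha> (x2 \<otimes>\<^bsub>A s t\<^esub> q)) \<in> bilinear_maps (A t s) (A s t) K" if "q \<in> carrier (A s t)" for q
    using bilinear_mult_comp[OF Kg(1) ab(2) bilinear_left[OF am that]] by simp
  have scale: "(\<lambda>r. d * r) \<in> linear_maps K K" for d :: 'k
    by (rule linear_mapsI) (simp_all add: algebra_simps)
  have \<gamma>: "\<gamma> z \<in> linear_maps (A s t) K" if "z \<in> carrier (A t t)" for z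
    unfolding \<gamma>_def[abs_def]
  proof (rule sw_linear_param[OF Kg(2) mod b\<gamma> _ that])
    show "(\<lambda>x. \<beta> a * \<alpha> (x \<otimes>\<^bsub>A s t\<^esub> b)) \<in> linear_maps (A s t) K" if "b \<in> carrier (A s t)" for a b
      by (rule linear_comp[OF bilinear_left[OF am that] scale])
  qed
  have \<delta>: "\<delta> x \<in> linear_maps (A s t) K" if "x \<in> carrier (A t t)" for x
    unfolding \<delta>_def[abs_def]
  proof (rule sw_linear_param[OF Kg(2) mod b\<delta> _ that])
    show "(\<lambda>x. \<beta> a * \<alpha> (b \<otimes>\<^bsub>A s t\<^esub> x)) \<in> linear_maps (A s t) K" if "b \<in> carrier (A s t)" for a b
      by (rule linear_comp[OF bilinear_right[OF am that] scale])
  qed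
  have c1: "c p z = conv t s t K \<beta> (\<gamma> z) p" if p: "p \<in> carrier (A t t)" and z: "z \<in> carrier (A t t)" for p z
  proof -
    have "conv t s t K \<beta> (\<gamma> z) p = sw t s t K (\<lambda>p1 p2. \<beta> p1 * \<gamma> z p2) p" using p by (simp add: conv_def)
    also have "\<dots> = sw t s t K (\<lambda>x1 x2. sw t s t K (\<lambda>y1 y2. \<beta> x1 * \<beta> y1 * \<alpha> (x2 \<otimes>\<^bsub>A s t\<^esub> y2)) z) p"
    proof (rule sw_cong[OF Kg(2) bilinear_mult_comp[OF Kg(1) ab(2) \<gamma>[OF z], simplified] p])
      show "\<beta> a * \<gamma> z b = sw t s t K (\<lambda>y1 y2. \<beta> a * \<beta> y1 * \<alpha> (b \<otimes>\<^bsub>A s t\<^esub> y2)) z" if "b \<in> carrier (A s t)" for a b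
        using linear_sw[OF Kg(2,2) b\<gamma>[OF that] scale z] by (simp add: \<gamma>_def mult.assoc)
    qed
    finally show ?thesis by (simp add: c_def twist_cocycle_sw[OF p z])
  qed
  note lin = linear_add[OF ab(2)] linear_smult[OF ab(2)] linear_add[OF ab(1)] linear_smult[OF ab(1)]
  have bQ1: "(\<lambda>c d. \<beta> a * \<beta> c * \<alpha> (b \<otimes>\<^bsub>A s t\<^esub> d)) \<in> bilinear_maps (A t s) (A s t) K" if "b \<in> carrier (A s t)" for a b
    using that by (intro bilinear_mapsI linear_mapsI) (simp_all add: lin ka_r_distr algebra_simps)
  have bQ2: "(\<lambda>a b. \<beta> a * \<beta> c * \<alpha> (b \<otimes>\<^bsub>A s t\<^esub> d)) \<in> bilinear_maps (A t s) (A s t) K" if "d \<in> carrier (A s t)" for c d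
    using that by (intro bilinear_mapsI linear_mapsI) (simp_all add: lin ka_l_distr algebra_simps)
  have c2: "c x q = conv t s t K \<beta> (\<delta> x) q" if x: "x \<in> carrier (A t t)" and q: "q \<in> carrier (A t t)" for x q
  proof -
    have "conv t s t K \<beta> (\<delta> x) q = sw t s t K (\<lambda>q1 q2. \<beta> q1 * \<delta> x q2) q" using q by (simp add: conv_def)
    also have "\<dots> = sw t s t K (\<lambda>y1 y2. sw t s t K (\<lambda>x1 x2. \<beta> x1 * \<beta> y1 * \<alpha> (x2 \<otimes>\<^bsub>A s t\<^esub> y2)) x) q"
    proof (rule sw_cong[OF Kg(2) bilinear_mult_comp[OF Kg(1) ab(2) \<delta>[OF x], simplified] q])
      show "\<beta> a * \<delta> x b = sw t s t K (\<lambda>x1 x2. \<beta> x1 * \<beta> a * \<alpha> (x2 \<otimes>\<^bsub>A s t\<^esub> b)) x" if "b \<in> carrier (A s t)" for a b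
        using linear_sw[OF Kg(2,2) b\<delta>[OF that] scale x, of "\<beta> a"] by (simp add: \<delta>_def ac_simps)
    qed
    also have "\<dots> = sw t s t K (\<lambda>x1 x2. sw t s t K (\<lambda>y1 y2. \<beta> x1 * \<beta> y1 * \<alpha> (x2 \<otimes>\<^bsub>A s t\<^esub> y2)) q) x"
      by (rule sw_swap[OF Kg(2) q x bQ2 bQ1])
    finally show ?thesis by (simp add: c_def twist_cocycle_sw[OF x q])
  qed
  have cc: "c \<in> bil t t K" unfolding c_def by (rule twist_cocycle_bilinear[OF inv Kg(1)])
  \<comment> \<open>The summand common to both sides; only the bracketing of the triple product
    inside \<alpha> was chosen.\<close>
  define Q where "Q x1 x2 y1 y2 z1 z2 = \<beta> x1 * \<beta> y1 * (\<beta> z1 * \<alpha> (x2 \<otimes>\<^bsub>A s t\<^esub> (y2 \<otimes>\<^bsub>A s t\<^esub> z2)))" for x1 x2 y1 y2 z1 z2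
  have QX: "(\<lambda>x1 x2. Q x1 x2 y1 y2 z1 z2) \<in> bilinear_maps (A t s) (A s t) K" if "y2 \<in> carrier (A s t)" "z2 \<in>
      carrier (A s t)" for y1 y2 z1 z2
    using that by (intro bilinear_mapsI linear_mapsI) (simp_all add: Q_def lin ka_l_distr algebra_simps)
  have QY: "(\<lambda>y1 y2. Q x1 x2 y1 y2 z1 z2) \<in> bilinear_maps (A t s) (A s t) K" if "x2 \<in> carrier (A s t)" "z2 \<in>
      carrier (A s t)" for x1 x2 z1 z2
    using that by (intro bilinear_mapsI linear_mapsI) (simp_all add: Q_def lin ka_l_distr ka_r_distr algebra_simps)
  have QZ: "(\<lambda>z1 z2. Q x1 x2 y1 y2 z1 z2) \<in> bilinear_maps (A t s) (A s t) K" if "x2 \<in> carrier (A s t)" "y2 \<in>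
      carrier (A s t)" for x1 x2 y1 y2
    using that by (intro bilinear_mapsI linear_mapsI) (simp_all add: Q_def lin ka_r_distr algebra_simps)
  have IX: "(\<lambda>x1 x2. sw t s t K (\<lambda>z1 z2. Q x1 x2 y1 y2 z1 z2) z) \<in> bilinear_maps (A t s) (A s t) K" if "y2 \<in>
      carrier (A s t)" for y1 y2
    by (rule sw_bilinear_param[OF Kg(2) mod mod z QZ QX]) (use that in simp_all)
  have IY: "(\<lambda>y1 y2. sw t s t K (\<lambda>z1 z2. Q x1 x2 y1 y2 z1 z2) z) \<in> bilinear_maps (A t s) (A s t) K" if "x2 \<in>
      carrier (A s t)" for x1 x2
    by (rule sw_bilinear_param[OF Kg(2) mod mod z QZ QY]) (use that in simp_all)
  have JX: "(\<lambda>x1 x2. sw t s t K (\<lambda>y1 y2. sw t s t K (\<lambda>z1 z2. Q x1 x2 y1 y2 z1 z2) z) y) \<in> bilinear_maps (A t s) (A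
      s t) K"
    by (rule sw_bilinear_param[OF Kg(2) mod mod y IY IX])
  have "sw t t t K (\<lambda>x1 x2. sw t t t K (\<lambda>y1 y2. c x1 y1 * c (x2 \<otimes>\<^bsub>A t t\<^esub> y2) z) y) x =
      sw t t t K (\<lambda>x1 x2. sw t t t K (\<lambda>y1 y2. c x1 y1 * conv t s t K \<beta> (\<gamma> z) (x2 \<otimes>\<^bsub>A t t\<^esub> y2)) y) x"
    using fun_cong[OF fun_cong[OF conv2_cong[OF Kg(1) cc bilinear_mult_map[OF bilinear_left[OF cc z]], of c "\<lambda>p q.
        conv t s t K \<beta> (\<gamma> z) (p \<otimes>\<^bsub>A t t\<^esub> q)"]], of x y] x y
    by (simp add: c1[OF _ z] conv2_def)
  also have "\<dots> = sw t s t K (\<lambda>x1 x2. sw t s t K (\<lambda>y1 y2. \<beta> x1 * \<beta> y1 * \<gamma> z (x2 \<otimes>\<^bsub>A s t\<^esub> y2)) y) x"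
    unfolding c_def by (rule twist_cocycle_reduce[OF \<gamma>[OF z] x y])
  also have "\<dots> = sw t s t K (\<lambda>x1 x2. sw t s t K (\<lambda>y1 y2. sw t s t K (\<lambda>z1 z2. Q x1 x2 y1 y2 z1 z2) z) y) x"
  proof (rule sym, rule sw_cong[OF Kg(2) JX x], rule sw_cong[OF Kg(2) IY y], assumption)
    fix x1 x2 y1 y2 assume *: "x2 \<in> carrier (A s t)" "y2 \<in> carrier (A s t)"
    then show "sw t s t K (\<lambda>z1 z2. Q x1 x2 y1 y2 z1 z2) z = \<beta> x1 * \<beta> y1 * \<gamma> z (x2 \<otimes>\<^bsub>A s t\<^esub> y2)"
      unfolding \<gamma>_def linear_sw[OF Kg(2,2) b\<gamma>[OF ka_mult_closed[OF alg *]] scale z]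
      by (intro sw_cong[OF Kg(2) QZ z]) (simp_all add: Q_def ka_assoc)
  qed
  also have "\<dots> = sw t s t K (\<lambda>y1 y2. sw t s t K (\<lambda>x1 x2. sw t s t K (\<lambda>z1 z2. Q x1 x2 y1 y2 z1 z2) z) x) y"
    by (rule sw_swap[OF Kg(2) x y IY IX])
  also have "\<dots> = sw t s t K (\<lambda>y1 y2. sw t s t K (\<lambda>z1 z2. \<beta> y1 * \<beta> z1 * \<delta> x (y2 \<otimes>\<^bsub>A s t\<^esub> z2)) z) y"
  proof (rule sw_cong[OF Kg(2) _ y])
    show "(\<lambda>y1 y2. sw t s t K (\<lambda>x1 x2. sw t s t K (\<lambda>z1 z2. Q x1 x2 y1 y2 z1 z2) z) x) \<in> bilinear_maps (A t s) (A s
        t) K"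
      by (rule sw_bilinear_param[OF Kg(2) mod mod x IX IY])
    fix y1 y2 assume y2: "y2 \<in> carrier (A s t)"
    have "sw t s t K (\<lambda>x1 x2. sw t s t K (\<lambda>z1 z2. Q x1 x2 y1 y2 z1 z2) z) x = sw t s t K (\<lambda>z1 z2. sw t s t K (\<lambda>x1
        x2. Q x1 x2 y1 y2 z1 z2) x) z"
      by (rule sw_swap[OF Kg(2) x z QZ QX]) (use y2 in simp_all)
    also have "\<dots> = sw t s t K (\<lambda>z1 z2. \<beta> y1 * \<beta> z1 * \<delta> x (y2 \<otimes>\<^bsub>A s t\<^esub> z2)) z"
    proof (rule sw_cong[OF Kg(2) _ z])
      show "(\<lambda>z1 z2. sw t s t K (\<lambda>x1 x2. Q x1 x2 y1 y2 z1 z2) x) \<in> bilinear_maps (A t s) (A s t) K"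
        by (rule sw_bilinear_param[OF Kg(2) mod mod x QX QZ]) (use y2 in simp_all)
      fix z1 z2 assume z2: "z2 \<in> carrier (A s t)"
      have yz: "y2 \<otimes>\<^bsub>A s t\<^esub> z2 \<in> carrier (A s t)" using y2 z2 by simp
      show "sw t s t K (\<lambda>x1 x2. Q x1 x2 y1 y2 z1 z2) x = \<beta> y1 * \<beta> z1 * \<delta> x (y2 \<otimes>\<^bsub>A s t\<^esub> z2)"
        unfolding \<delta>_def Q_def linear_sw[OF Kg(2,2) b\<delta>[OF yz] scale x] by (simp add: ac_simps)
    qed
    finally show "sw t s t K (\<lambda>x1 x2. sw t s t K (\<lambda>z1 z2. Q x1 x2 y1 y2 z1 z2) z) x = sw t s t K (\<lambda>z1 z2. \<beta> y1 * \<beta>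
        z1 * \<delta> x (y2 \<otimes>\<^bsub>A s t\<^esub> z2)) z" .
  qed
  also have "\<dots> = sw t t t K (\<lambda>y1 y2. sw t t t K (\<lambda>z1 z2. c y1 z1 * conv t s t K \<beta> (\<delta> x) (y2 \<otimes>\<^bsub>A t t\<^esub> z2)) z) y"
    unfolding c_def by (rule twist_cocycle_reduce[OF \<delta>[OF x] y z, symmetric])
  also have "\<dots> = sw t t t K (\<lambda>y1 y2. sw t t t K (\<lambda>z1 z2. c y1 z1 * c x (y2 \<otimes>\<^bsub>A t t\<^esub> z2)) z) y"
    using fun_cong[OF fun_cong[OF conv2_cong[OF Kg(1) cc bilinear_mult_map[OF bilinear_right[OF cc x]], of c "\<lambda>p
        q. conv t s t K \<beta> (\<delta> x) (p \<otimes>\<^bsub>A t t\<^esub> q)"]], of y z] y z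
    by (simp add: c2[OF x] conv2_def)
  finally show ?thesis .
qed

text \<open>The convolution alternates sums over x and sums over y, whereas
  \<open>cocycle_twist\<close> sums over x completely before y. One exchange of an inner x-sum with
  an outer y-sum makes up the difference.\<close>

lemma twist_mult_sw:
  assumes x: "x \<in> carrier (A t t)" and y: "y \<in> carrier (A t t)"
  shows "twist_mult s t \<alpha> \<beta> x y = sw t t t (A t t) (\<lambda>x1 x'. sw t t t (A t t) (\<lambda>x2 x3. sw t t t (A t t) (\<lambda>y1 y'.
     sw t t t (A t t) (\<lambda>y2 y3. (twist_cocycle t s \<alpha> \<beta> K x1 y1 * twist_inverse t s \<alpha> \<beta> K x3 y3) \<odot>\<^bsub>A t t\<^esub> (x2 \<otimes>\<^bsub>A t t\<^esub>
         y2)) y') y) x') x"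
proof -
  let ?H = "A t t" and ?c = "twist_cocycle t s \<alpha> \<beta> K" and ?d = "twist_inverse t s \<alpha> \<beta> K"
  note H = alg[of t t] and Hm = mod[of t t]
  note tc = twist_cocycle_bilinear[OF inv H] and ti = twist_inverse_bilinear[OF inv H] and m = bilinear_mult[OF H]
  note mti = conv2_bilinear[OF H m ti]
  note cu = twist_cocycle_unit_map[OF H]
  define Q where "Q x1 x2 x3 y1 y2 y3 = (?c x1 y1 * ?d x3 y3) \<odot>\<^bsub>?H\<^esub> (x2 \<otimes>\<^bsub>?H\<^esub> y2)" for x1 x2 x3 y1 y2 y3
  note cb = twist_cocycle_bilinear[OF inv Kg(1)] and db = twist_inverse_bilinear[OF inv Kg(1)]
  have Qeq: "Q x1 x2 x3 y1 y2 y3 = twist_cocycle t s \<alpha> \<beta> ?H x1 y1 \<otimes>\<^bsub>?H\<^esub> ((x2 \<otimes>\<^bsub>?H\<^esub> y2) \<otimes>\<^bsub>?H\<^esub> twist_inverse t s \<alpha> \<beta> ?H x3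
      y3)"
    if "x1 \<in> carrier ?H" "y1 \<in> carrier ?H" "x2 \<in> carrier ?H" "y2 \<in> carrier ?H" "x3 \<in> carrier ?H" "y3 \<in> carrier ?H"
        for x1 x2 x3 y1 y2 y3
    using that by (simp add: Q_def cu[symmetric] unit_map_left unit_map_right)
  have Q23: "(\<lambda>y2 y3. Q x1 x2 x3 y1 y2 y3) \<in> bilinear_maps ?H ?H ?H"
    if "x1 \<in> carrier ?H" "x2 \<in> carrier ?H" "x3 \<in> carrier ?H" "y1 \<in> carrier ?H" for x1 x2 x3 y1
    using that by (intro bilinear_mapsI linear_mapsI)
      (simp_all add: Q_def bilinear_add_right[OF db, simplified] bilinear_smult_right[OF db, simplified] ka_r_distr
        km_smult_l_distr km_smult_r_distr algebra_simps)
  have X23: "(\<lambda>x2 x3. Q x1 x2 x3 y1 y2 y3) \<in> bilinear_maps ?H ?H ?H"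
    if "x1 \<in> carrier ?H" "y1 \<in> carrier ?H" "y2 \<in> carrier ?H" "y3 \<in> carrier ?H" for x1 y1 y2 y3
    using that by (intro bilinear_mapsI linear_mapsI)
      (simp_all add: Q_def bilinear_add_left[OF db, simplified] bilinear_smult_left[OF db, simplified] ka_l_distr
        km_smult_l_distr km_smult_r_distr algebra_simps)
  have Y1: "(\<lambda>y1. Q x1 x2 x3 y1 y2 y3) \<in> linear_maps ?H ?H"
    if "x1 \<in> carrier ?H" "x2 \<in> carrier ?H" "x3 \<in> carrier ?H" "y2 \<in> carrier ?H" "y3 \<in> carrier ?H" for x1 x2 x3 y2 y3
    using that by (intro linear_mapsI)
      (simp_all add: Q_def bilinear_add_right[OF cb, simplified] bilinear_smult_right[OF cb, simplified]
        km_smult_l_distr km_smult_r_distr algebra_simps)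
  have I: "(\<lambda>y1 y'. sw t t t ?H (\<lambda>y2 y3. Q x1 x2 x3 y1 y2 y3) y') \<in> bilinear_maps ?H ?H ?H"
    if "x1 \<in> carrier ?H" "x2 \<in> carrier ?H" "x3 \<in> carrier ?H" for x1 x2 x3
    using that by (intro bilinear_mapsI sw_linear_param sw_linear Hm Q23 Y1)
  have I': "(\<lambda>x2 x3. sw t t t ?H (\<lambda>y2 y3. Q x1 x2 x3 y1 y2 y3) y') \<in> bilinear_maps ?H ?H ?H"
    if "x1 \<in> carrier ?H" "y1 \<in> carrier ?H" "y' \<in> carrier ?H" for x1 y1 y'
    using that by (intro sw_bilinear_param Hm Q23 X23)
  have "twist_mult s t \<alpha> \<beta> x y = sw t t t ?H (\<lambda>x1 x'. sw t t t ?H (\<lambda>y1 y'.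
       twist_cocycle t s \<alpha> \<beta> ?H x1 y1 \<otimes>\<^bsub>?H\<^esub> conv2 t t t ?H (\<lambda>x y. x \<otimes>\<^bsub>?H\<^esub> y) (twist_inverse t s \<alpha> \<beta> ?H) x' y') y) x"
    unfolding twist_mult_def[OF inv] by (rule conv2_apply[OF H tc mti x y])
  also have "\<dots> = sw t t t ?H (\<lambda>x1 x'. sw t t t ?H (\<lambda>x2 x3. sw t t t ?H (\<lambda>y1 y'. sw t t t ?H (\<lambda>y2 y3. Q x1 x2 x3 y1
      y2 y3) y') y) x') x"
  proof (rule sw_cong[OF Hm conv2_inner3[OF H tc mti y] x])
    fix x1 x' assume x1: "x1 \<in> carrier ?H" and x': "x' \<in> carrier ?H"
    have "sw t t t ?H (\<lambda>y1 y'. twist_cocycle t s \<alpha> \<beta> ?H x1 y1 \<otimes>\<^bsub>?H\<^esub> conv2 t t t ?H (\<lambda>x y. x \<otimes>\<^bsub>?H\<^esub> y) (twist_inverse t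
        s \<alpha> \<beta> ?H) x' y') y =
        sw t t t ?H (\<lambda>y1 y'. sw t t t ?H (\<lambda>x2 x3. sw t t t ?H (\<lambda>y2 y3. Q x1 x2 x3 y1 y2 y3) y') x') y"
    proof (rule sw_cong[OF Hm conv2_inner1[OF H tc mti x1 x'] y])
      fix y1 y' assume y1: "y1 \<in> carrier ?H" and y': "y' \<in> carrier ?H"
      note R = bilinear_right[OF m bilinear_closed[OF tc x1 y1]]
      have "twist_cocycle t s \<alpha> \<beta> ?H x1 y1 \<otimes>\<^bsub>?H\<^esub> conv2 t t t ?H (\<lambda>x y. x \<otimes>\<^bsub>?H\<^esub> y) (twist_inverse t s \<alpha> \<beta> ?H) x' y' =
          sw t t t ?H (\<lambda>x2 x3. twist_cocycle t s \<alpha> \<beta> ?H x1 y1 \<otimes>\<^bsub>?H\<^esub> sw t t t ?H (\<lambda>y2 y3. (x2 \<otimes>\<^bsub>?H\<^esub> y2) \<otimes>\<^bsub>?H\<^esub>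
              twist_inverse t s \<alpha> \<beta> ?H x3 y3) y') x'"
        unfolding conv2_apply[OF H m ti x' y'] by (rule linear_sw[OF Hm Hm conv2_inner3[OF H m ti y'] R x'])
      also have "\<dots> = sw t t t ?H (\<lambda>x2 x3. sw t t t ?H (\<lambda>y2 y3. Q x1 x2 x3 y1 y2 y3) y') x'"
      proof (rule sym, rule sw_cong[OF Hm I'[OF x1 y1 y'] x'])
        fix x2 x3 assume x23: "x2 \<in> carrier ?H" "x3 \<in> carrier ?H"
        show "sw t t t ?H (\<lambda>y2 y3. Q x1 x2 x3 y1 y2 y3) y' =
          twist_cocycle t s \<alpha> \<beta> ?H x1 y1 \<otimes>\<^bsub>?H\<^esub> sw t t t ?H (\<lambda>y2 y3. (x2 \<otimes>\<^bsub>?H\<^esub> y2) \<otimes>\<^bsub>?H\<^esub> twist_inverse t s \<alpha> \<beta> ?H x3 y3) y'"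
          unfolding linear_sw[OF Hm Hm conv2_inner1[OF H m ti x23] R y']
          by (rule sw_cong[OF Hm Q23[OF x1 x23 y1] y']) (simp add: Qeq x1 y1 x23)
      qed
      finally show "twist_cocycle t s \<alpha> \<beta> ?H x1 y1 \<otimes>\<^bsub>?H\<^esub> conv2 t t t ?H (\<lambda>x y. x \<otimes>\<^bsub>?H\<^esub> y) (twist_inverse t s \<alpha> \<beta> ?H)
          x' y' =
        sw t t t ?H (\<lambda>x2 x3. sw t t t ?H (\<lambda>y2 y3. Q x1 x2 x3 y1 y2 y3) y') x'" .
    qed
    also have "\<dots> = sw t t t ?H (\<lambda>x2 x3. sw t t t ?H (\<lambda>y1 y'. sw t t t ?H (\<lambda>y2 y3. Q x1 x2 x3 y1 y2 y3) y') y) x'"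
      by (rule sw_swap[OF Hm y x' I'[OF x1] I[OF x1]])
    finally show "sw t t t ?H (\<lambda>y1 y'. twist_cocycle t s \<alpha> \<beta> ?H x1 y1 \<otimes>\<^bsub>?H\<^esub> conv2 t t t ?H (\<lambda>x y. x \<otimes>\<^bsub>?H\<^esub> y)
        (twist_inverse t s \<alpha> \<beta> ?H) x' y') y =
      sw t t t ?H (\<lambda>x2 x3. sw t t t ?H (\<lambda>y1 y'. sw t t t ?H (\<lambda>y2 y3. Q x1 x2 x3 y1 y2 y3) y') y) x'" .
  qed
  finally show ?thesis by (simp add: Q_def)
qed

end

end

section \<open>Bigalois extensions and cocycle deformations from cogroupoids\<close>

text \<open>Joins the algebra \<open>A s s\<close> of a cocategory with its comultiplication and
  counit into one bialgebra record. The simplification rules that follow remove the extra fields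
  from every construction that only sees the module.\<close>

definition with_coalgebra ::
  "('k::field, 'a) module \<Rightarrow> ('a \<Rightarrow> ('a \<times> 'a \<Rightarrow>\<^sub>0 'k) set) \<Rightarrow> ('a \<Rightarrow> 'k) \<Rightarrow> ('k, 'a) bialgebra" where
  "with_coalgebra M \<delta> e =
    \<lparr>carrier = carrier M, monoid.mult = monoid.mult M, one = \<one>\<^bsub>M\<^esub>, zero = \<zero>\<^bsub>M\<^esub>,
     add = add M, smult = smult M, comult = \<delta>, counit = e\<rparr>"

lemma with_coalgebra_simps [simp]:
  "carrier (with_coalgebra M \<delta> e) = carrier M"
  "monoid.mult (with_coalgebra M \<delta> e) = monoid.mult M" "\<one>\<^bsub>with_coalgebra M \<delta> e\<^esub> = \<one>\<^bsub>M\<^esub>"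
  "\<zero>\<^bsub>with_coalgebra M \<delta> e\<^esub> = \<zero>\<^bsub>M\<^esub>" "add (with_coalgebra M \<delta> e) = add M"
  "smult (with_coalgebra M \<delta> e) = smult M"
  "comult (with_coalgebra M \<delta> e) = \<delta>" "counit (with_coalgebra M \<delta> e) = e"
  by (simp_all add: with_coalgebra_def)

lemma with_coalgebra_tensor_left [simp]:
  "tensor (with_coalgebra M \<delta> e) B = tensor M B" "pure_tensor (with_coalgebra M \<delta> e) B = pure_tensor M B"
proof -
  have 1: "with_coalgebra M \<delta> e \<times>\<times> B = M \<times>\<times> B" by (simp add: DirProd_def)
  have 2: "bilinear_relators (with_coalgebra M \<delta> e) B = bilinear_relators M B" by (simp add: bilinear_relators_def)
  show "tensor (with_coalgebra M \<delta> e) B = tensor M B" "pure_tensor (with_coalgebra M \<delta> e) B = pure_tensor M B"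
    by (simp_all only: tensor_def pure_tensor_def[abs_def] tensor_null_def 1 2)
qed

lemma with_coalgebra_tensor_right [simp]:
  "tensor A (with_coalgebra M \<delta> e) = tensor A M" "pure_tensor A (with_coalgebra M \<delta> e) = pure_tensor A M"
proof -
  have 1: "A \<times>\<times> with_coalgebra M \<delta> e = A \<times>\<times> M" by (simp add: DirProd_def)
  have 2: "bilinear_relators A (with_coalgebra M \<delta> e) = bilinear_relators A M" by (simp add: bilinear_relators_def)
  show "tensor A (with_coalgebra M \<delta> e) = tensor A M" "pure_tensor A (with_coalgebra M \<delta> e) = pure_tensor A M"
    by (simp_all only: tensor_def pure_tensor_def[abs_def] tensor_null_def 1 2)
qed

lemma with_coalgebra_lift [simp]: "tensor_lift (with_coalgebra M \<delta> e) f = tensor_lift M f"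
  by (simp add: tensor_lift_def[abs_def] finsum_def finprod_def)

lemma with_coalgebra_map_left [simp]: "tensor_map (with_coalgebra M \<delta> e) D f g = tensor_map M D f g"
  by (simp add: tensor_map_def[abs_def])

lemma with_coalgebra_map_right [simp]: "tensor_map C (with_coalgebra M \<delta> e) f g = tensor_map C M f g"
  by (simp add: tensor_map_def[abs_def])

lemma with_coalgebra_assoc1 [simp]: "tensor_assoc (with_coalgebra M \<delta> e) B C = tensor_assoc M B C"
  by (simp add: tensor_assoc_def[abs_def] Let_def)

lemma with_coalgebra_assoc2 [simp]: "tensor_assoc A (with_coalgebra M \<delta> e) C = tensor_assoc A M C"
  by (simp add: tensor_assoc_def[abs_def] Let_def)

lemma with_coalgebra_assoc3 [simp]: "tensor_assoc A B (with_coalgebra M \<delta> e) = tensor_assoc A B M"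
  by (simp add: tensor_assoc_def[abs_def] Let_def)

lemma with_coalgebra_linear_maps_left [simp]: "linear_maps (with_coalgebra M \<delta> e) N = linear_maps M N"
  by (simp only: linear_maps_def with_coalgebra_simps)

lemma with_coalgebra_linear_maps_right [simp]: "linear_maps N (with_coalgebra M \<delta> e) = linear_maps N M"
  by (simp only: linear_maps_def with_coalgebra_simps)

lemma with_coalgebra_algebra_homs_left [simp]: "algebra_homs (with_coalgebra M \<delta> e) N = algebra_homs M N"
  by (simp only: algebra_homs_def ring_hom_def with_coalgebra_simps with_coalgebra_linear_maps_left
    with_coalgebra_linear_maps_right)

lemma with_coalgebra_algebra_homs_right [simp]: "algebra_homs N (with_coalgebra M \<delta> e) = algebra_homs N M"
  by (simp only: algebra_homs_def ring_hom_def with_coalgebra_simps with_coalgebra_linear_maps_left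
    with_coalgebra_linear_maps_right)

lemma with_coalgebra_bilinear_forms [simp]: "bilinear_forms (with_coalgebra M \<delta> e) = bilinear_maps M M ground"
  by (simp only: bilinear_forms_def bilinear_maps_def with_coalgebra_simps with_coalgebra_linear_maps_left)

lemma with_coalgebra_sweedler [simp]: "sweedler (with_coalgebra M \<delta> e) N f x = tensor_lift N f (\<delta> x)"
  by (simp add: sweedler_def)

lemma k_algebra_with_coalgebra: "k_algebra M \<Longrightarrow> k_algebra (with_coalgebra M \<delta> e)"
  by (rule k_algebraI; (rule k_moduleI)?)
    (simp_all add: ka_assoc ka_l_distr ka_r_distr km_a_assoc km_a_comm km_a_lcomm km_smult_l_distr km_smult_r_distr)

text \<open>\<open>hopf_isos\<close> forms tensors over the twisted record, whose product differs
  from that of \<open>B\<close>, so the two tensor algebras are different records. Null space,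
  cosets and linear structure do not depend on the product, and these fields are compared one by
  one.\<close>

lemma tensor_map_mult_update:
  fixes B :: "('k::field, 'a) bialgebra"
  shows "tensor_map (B\<lparr>monoid.mult := \<mu>\<rparr>) (B\<lparr>monoid.mult := \<mu>\<rparr>) f g = tensor_map B B f g"
proof -
  let ?C = "B\<lparr>monoid.mult := \<mu>\<rparr>"
  let ?P = "monoid_algebra (?C \<times>\<times> ?C) :: ('k, 'a \<times> 'a \<Rightarrow>\<^sub>0 'k) module" and ?Q = "monoid_algebra (B \<times>\<times> B) :: ('k, 'a
      \<times> 'a \<Rightarrow>\<^sub>0 'k) module"
  have f: "carrier ?P = carrier ?Q" "add ?P = add ?Q" "\<zero>\<^bsub>?P\<^esub> = \<zero>\<^bsub>?Q\<^esub>" "smult ?P = smult ?Q"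
    by (simp_all add: monoid_algebra_def DirProd_def)
  have r: "a_r_coset ?P = a_r_coset ?Q" "A_RCOSETS ?P = A_RCOSETS ?Q" "set_add ?P = set_add ?Q"
    by (simp_all add: a_r_coset_def[abs_def] A_RCOSETS_def[abs_def] set_add_def[abs_def] f)
  have sub: "submodule H ground ?P \<longleftrightarrow> submodule H ground ?Q" for H
    by (simp add: submodule_def submodule_axioms_def f)
  have "bilinear_relators ?C ?C = bilinear_relators B B"
    by (simp add: bilinear_relators_def)
  then have n: "tensor_null ?C ?C = tensor_null B B"
    by (simp add: tensor_null_def linear_span_def sub)
  have p: "pure_tensor ?C ?C a b = pure_tensor B B a b" for a b
    by (simp add: pure_tensor_def n r)
  have t: "carrier (tensor ?C ?C) = carrier (tensor B B)" "add (tensor ?C ?C) = add (tensor B B)"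
    "\<zero>\<^bsub>tensor ?C ?C\<^esub> = \<zero>\<^bsub>tensor B B\<^esub>" "smult (tensor ?C ?C) = smult (tensor B B)"
    unfolding tensor_def quotient_algebra_def FactRing_def n by (simp_all add: r f)
  have "tensor_lift (tensor ?C ?C) h = tensor_lift (tensor B B) h" for h :: "'x \<Rightarrow> 'y \<Rightarrow> _"
    by (simp add: tensor_lift_def[abs_def] finsum_def t)
  then show ?thesis by (simp add: tensor_map_def[abs_def] p)
qed

context cocategory
begin

abbreviation bialg where "bialg s \<equiv> with_coalgebra (A s s) (\<Delta> s s s) (\<epsilon> s)"

lemma is_bialgebra_bialg: "is_bialgebra (bialg s)"
  unfolding is_bialgebra_def
  by (simp add: k_algebra_with_coalgebra comult_hom counit_hom comult_assoc counit_left counit_right)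

end

context cogroupoid
begin

lemma is_hopf_algebra_bialg: "is_hopf_algebra (bialg s)"
  unfolding is_hopf_algebra_def
  using antipode_linear[of s s] antipode_left[of _ s s] antipode_right[of _ s s]
  by (auto simp: is_bialgebra_bialg)

text \<open>Coassociativity of \<open>\<Delta>\<close> through the middle objects (s, s), (t, t) and
  (s, t) gives the left comodule, the right comodule and the bicomodule axiom. The functional \<phi>
  shows that 1 differs from 0 and makes the coinvariants scalar.\<close>

lemma bigalois_extension_bialg:
  assumes \<phi>: "\<phi> \<in> linear_maps (A s t) ground" and one: "\<phi> \<one>\<^bsub>A s t\<^esub> = 1"
  shows "bigalois_extension (bialg s) (bialg t) (A s t) (\<Delta> s s t) (\<Delta> s t t)"
proof -
  have "carrier (A s t) \<noteq> {\<zero>\<^bsub>A s t\<^esub>}"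
  proof
    assume "carrier (A s t) = {\<zero>\<^bsub>A s t\<^esub>}"
    then have "\<one>\<^bsub>A s t\<^esub> = \<zero>\<^bsub>A s t\<^esub>" using ka_one_closed[OF alg, of s t] by simp
    then show False using one linear_zero[OF mod k_module_ground \<phi>] by simp
  qed
  then show ?thesis
    by (simp add: bigalois_extension_def is_hopf_algebra_bialg bicomodule_algebra_def left_comodule_algebra_def
      right_comodule_algebra_def left_galois_def right_galois_def comult_hom comult_assoc counit_left counit_right
      left_coinvariants[OF \<phi> one] right_coinvariants[OF \<phi> one] left_canonical_bij right_canonical_bij)
qed

lemma cocycle_deformation_bialg:
  assumes inv: "inverse_pair s t \<alpha> \<beta>"
  shows "cocycle_deformation (bialg s) (bialg t)"
proof -
  let ?\<sigma> = "twist_cocycle t s \<alpha> \<beta> (ground :: ('k, 'k) module)" and ?\<tau> = "twist_inverse t s \<alpha> \<beta> (ground :: ('k, 'k)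
      module)"
  let ?h = "transport s t \<alpha> \<beta>"
  note g = k_algebra_ground
  have "two_cocycle (bialg t) ?\<sigma>"
    unfolding two_cocycle_def
    using twist_cocycle_bilinear[OF inv g] twist_cocycle_one[OF inv] twist_cocycle_condition[OF inv]
    by (simp add: sw_def)
  moreover have "convolution_inverse (bialg t) ?\<sigma> ?\<tau>"
  proof -
    have "convolution (bialg t) ?\<sigma> ?\<tau> x y = \<epsilon> t x * \<epsilon> t y" "convolution (bialg t) ?\<tau> ?\<sigma> x y = \<epsilon> t x * \<epsilon> t y"
      if "x \<in> carrier (A t t)" "y \<in> carrier (A t t)" for x y
      using fun_cong[OF fun_cong[OF twist_cocycle_inverse(1)[OF inv g]], of x y]
        fun_cong[OF fun_cong[OF twist_cocycle_inverse(2)[OF inv g]], of x y] that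
      by (simp_all add: conv2_def conv2_unit_def convolution_def sw_def)
    then show ?thesis
      using twist_inverse_bilinear[OF inv g] by (simp add: convolution_inverse_def)
  qed
  moreover have "?h \<in> hopf_isos (bialg s) (cocycle_twist (bialg t) ?\<sigma> ?\<tau>)"
  proof -
    let ?C = "cocycle_twist (bialg t) ?\<sigma> ?\<tau>"
    note h = transport_linear[OF inv]
    have C: "carrier ?C = carrier (A t t)" "\<one>\<^bsub>?C\<^esub> = \<one>\<^bsub>A t t\<^esub>" "add ?C = add (A t t)" "smult ?C = smult (A t t)"
      "comult ?C = \<Delta> t t t" "counit ?C = \<epsilon> t"
      by (simp_all add: cocycle_twist_def fun_eq_iff)
    have mult: "?h (x \<otimes>\<^bsub>A s s\<^esub> y) = ?h x \<otimes>\<^bsub>?C\<^esub> ?h y" if "x \<in> carrier (A s s)" "y \<in> carrier (A s s)" for x y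
      using transport_mult[OF inv that] twist_mult_sw[OF inv linear_closed[OF h that(1)] linear_closed[OF h that(2)]]
      by (simp add: cocycle_twist_def sw_def)
    have "?h \<in> algebra_homs (bialg s) ?C"
      by (rule algebra_homsI; (rule linear_mapsI)?)
        (simp_all add: C mult transport_one[OF inv] linear_add[OF h] linear_smult[OF h] linear_closed[OF h])
    moreover have "tensor_map ?C ?C ?h ?h X = tensor_map (A t t) (A t t) ?h ?h X" for X
      unfolding cocycle_twist_def tensor_map_mult_update by simp
    ultimately show ?thesis
      using transport_bij[OF inv]
      by (simp add: hopf_isos_def C comult_transport[OF inv] counit_transport[OF inv])
  qed
  ultimately show ?thesis
    unfolding cocycle_deformation_def using is_hopf_algebra_bialg by blast
qed

end

lemma presented_bialgebra_with_coalgebra: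
  "presented_bialgebra R = with_coalgebra (presented_algebra R)
     (induced_map (tensor (presented_algebra R) (presented_algebra R))
       (coaction_on_gens (presented_algebra R) (gen_class R) (presented_algebra R) (gen_class R)))
     (induced_map ground (\<lambda>s. if s = Gen_g \<or> s = Gen_g_inv then 1 else 0))"
  by (simp add: presented_bialgebra_def with_coalgebra_def Let_def)

lemma with_coalgebra_coaction_left [simp]:
  "coaction_on_gens (with_coalgebra M \<delta> e) u Q v = coaction_on_gens M u Q v"
  by (rule ext) (simp add: coaction_on_gens_def split: if_split)

lemma with_coalgebra_coaction_right [simp]:
  "coaction_on_gens P u (with_coalgebra M \<delta> e) v = coaction_on_gens P u M v"
  by (rule ext) (simp add: coaction_on_gens_def split: if_split)

section \<open>The Jordanian cogroupoid\<close>

text \<open>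
  The two parameters interpolate between the three presentations: \<open>(0, 0)\<close> is the bosonization, \<open>(1, 1)\<close> is
  \<open>U_jordan\<close> and \<open>(1, 0)\<close> is \<open>U'\<close>.  The first relation is \<open>g x\<^sub>1 = (x\<^sub>1 + s - t g) g\<close>.
\<close>

definition jordan_relators :: "'k::field_char_0 \<Rightarrow> 'k \<Rightarrow> 'k word_poly set" where
  "jordan_relators s t = (let F = free_algebra; g = free_gen Gen_g; g' = free_gen Gen_g_inv; x1 = free_gen Gen_x1;
      x2 = free_gen Gen_x2 in
    group_relators F g g' \<union>
    {g \<otimes>\<^bsub>F\<^esub> x1 \<ominus>\<^bsub>F\<^esub> (x1 \<oplus>\<^bsub>F\<^esub> s \<odot>\<^bsub>F\<^esub> \<one>\<^bsub>F\<^esub> \<ominus>\<^bsub>F\<^esub> t \<odot>\<^bsub>F\<^esub> g) \<otimes>\<^bsub>F\<^esub> g,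
     g \<otimes>\<^bsub>F\<^esub> x2 \<ominus>\<^bsub>F\<^esub> (x2 \<oplus>\<^bsub>F\<^esub> x1) \<otimes>\<^bsub>F\<^esub> g,
     x1 \<otimes>\<^bsub>F\<^esub> x2 \<ominus>\<^bsub>F\<^esub> x2 \<otimes>\<^bsub>F\<^esub> x1 \<ominus>\<^bsub>F\<^esub> (1/2) \<odot>\<^bsub>F\<^esub> (x1 \<otimes>\<^bsub>F\<^esub> x1) \<oplus>\<^bsub>F\<^esub> s \<odot>\<^bsub>F\<^esub> x2 \<oplus>\<^bsub>F\<^esub> (s/2) \<odot>\<^bsub>F\<^esub> x1})"

lemma jordan_relators_instances:
  "bosonization_ideal_gens = jordan_relators 0 0"
  "U_jordan_ideal_gens = jordan_relators 1 1"
  "U'_ideal_gens = jordan_relators 1 0"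
  by (simp_all add: jordan_relators_def Let_def bosonization_ideal_gens_def U_jordan_ideal_gens_def U'_ideal_gens_def
    jordan_bosonization_relators_def U_jordan_relators_def U'_relators_def jordan_plane_relator_def
    k_algebra_free_algebra km_minus)

text \<open>The relations are arranged without subtraction, so that additive rearrangement suffices to verify them.\<close>

definition jordan_relations :: "('k::field_char_0, 'a, 'm) module_scheme \<Rightarrow> 'k \<Rightarrow> 'k \<Rightarrow> (gen \<Rightarrow> 'a) \<Rightarrow> bool" where
  "jordan_relations N s t \<phi> \<longleftrightarrow>
    \<phi> Gen_g \<otimes>\<^bsub>N\<^esub> \<phi> Gen_g_inv = \<one>\<^bsub>N\<^esub> \<and> \<phi> Gen_g_inv \<otimes>\<^bsub>N\<^esub> \<phi> Gen_g = \<one>\<^bsub>N\<^esub> \<and>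
    \<phi> Gen_g \<otimes>\<^bsub>N\<^esub> \<phi> Gen_x1 \<oplus>\<^bsub>N\<^esub> t \<odot>\<^bsub>N\<^esub> (\<phi> Gen_g \<otimes>\<^bsub>N\<^esub> \<phi> Gen_g) = \<phi> Gen_x1 \<otimes>\<^bsub>N\<^esub> \<phi> Gen_g \<oplus>\<^bsub>N\<^esub> s \<odot>\<^bsub>N\<^esub> \<phi> Gen_g \<and>
    \<phi> Gen_g \<otimes>\<^bsub>N\<^esub> \<phi> Gen_x2 = \<phi> Gen_x2 \<otimes>\<^bsub>N\<^esub> \<phi> Gen_g \<oplus>\<^bsub>N\<^esub> \<phi> Gen_x1 \<otimes>\<^bsub>N\<^esub> \<phi> Gen_g \<and>
    \<phi> Gen_x1 \<otimes>\<^bsub>N\<^esub> \<phi> Gen_x2 \<oplus>\<^bsub>N\<^esub> (s \<odot>\<^bsub>N\<^esub> \<phi> Gen_x2 \<oplus>\<^bsub>N\<^esub> (s/2) \<odot>\<^bsub>N\<^esub> \<phi> Gen_x1) =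
      \<phi> Gen_x2 \<otimes>\<^bsub>N\<^esub> \<phi> Gen_x1 \<oplus>\<^bsub>N\<^esub> (1/2) \<odot>\<^bsub>N\<^esub> (\<phi> Gen_x1 \<otimes>\<^bsub>N\<^esub> \<phi> Gen_x1)"

lemma km_move:
  assumes N: "k_module N" and c: "a \<in> carrier N" "b \<in> carrier N" "c \<in> carrier N"
  shows "a \<ominus>\<^bsub>N\<^esub> (b \<ominus>\<^bsub>N\<^esub> c) = \<zero>\<^bsub>N\<^esub> \<longleftrightarrow> a \<oplus>\<^bsub>N\<^esub> c = b" (is ?P)
    and "a \<ominus>\<^bsub>N\<^esub> b \<oplus>\<^bsub>N\<^esub> c = \<zero>\<^bsub>N\<^esub> \<longleftrightarrow> a \<oplus>\<^bsub>N\<^esub> c = b" (is ?Q)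
proof -
  have "a \<ominus>\<^bsub>N\<^esub> (b \<ominus>\<^bsub>N\<^esub> c) = (a \<oplus>\<^bsub>N\<^esub> c) \<ominus>\<^bsub>N\<^esub> b" "a \<ominus>\<^bsub>N\<^esub> b \<oplus>\<^bsub>N\<^esub> c = (a \<oplus>\<^bsub>N\<^esub> c) \<ominus>\<^bsub>N\<^esub> b"
    using N c by (simp_all add: km_minus km_smult_r_distr km_a_assoc km_a_comm km_a_lcomm)
  then show ?P ?Q using km_eq_iff[OF N, of "a \<oplus>\<^bsub>N\<^esub> c" b] N c by simp_all
qed

lemma jordan_relations_iff:
  assumes N: "k_algebra N" and \<phi>: "\<And>x. \<phi> x \<in> carrier N"
  shows "(\<forall>r\<in>jordan_relators s t. free_eval N \<phi> r = \<zero>\<^bsub>N\<^esub>) \<longleftrightarrow> jordan_relations N s t \<phi>"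
proof -
  note h = free_eval_hom[of N \<phi>, OF N \<phi>] and e = free_eval_gen[of N \<phi>, OF N \<phi>]
  note F = k_algebra_free_algebra and Nm = ka_module[OF N]
  note ev = linear_minus[OF ka_module[OF F] Nm algebra_hom_linear[OF h]] linear_add[OF algebra_hom_linear[OF h]]
    linear_smult[OF algebra_hom_linear[OF h]] algebra_hom_mult[OF h] algebra_hom_one[OF h] e
  let ?g = "\<phi> Gen_g" and ?g' = "\<phi> Gen_g_inv" and ?x = "\<phi> Gen_x1" and ?y = "\<phi> Gen_x2"
  have 1: "(?x \<oplus>\<^bsub>N\<^esub> s \<odot>\<^bsub>N\<^esub> \<one>\<^bsub>N\<^esub> \<ominus>\<^bsub>N\<^esub> t \<odot>\<^bsub>N\<^esub> ?g) \<otimes>\<^bsub>N\<^esub> ?g = (?x \<otimes>\<^bsub>N\<^esub> ?g \<oplus>\<^bsub>N\<^esub> s \<odot>\<^bsub>N\<^esub> ?g) \<ominus>\<^bsub>N\<^esub> t \<odot>\<^bsub>N\<^esub> (?g \<otimes>\<^bsub>N\<^esub> ?g)"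
    using N \<phi> by (simp add: km_minus ka_l_distr)
  have 2: "?x \<otimes>\<^bsub>N\<^esub> ?y \<ominus>\<^bsub>N\<^esub> ?y \<otimes>\<^bsub>N\<^esub> ?x \<ominus>\<^bsub>N\<^esub> (1/2) \<odot>\<^bsub>N\<^esub> (?x \<otimes>\<^bsub>N\<^esub> ?x) \<oplus>\<^bsub>N\<^esub> s \<odot>\<^bsub>N\<^esub> ?y \<oplus>\<^bsub>N\<^esub> (s/2) \<odot>\<^bsub>N\<^esub> ?x =
    ?x \<otimes>\<^bsub>N\<^esub> ?y \<ominus>\<^bsub>N\<^esub> (?y \<otimes>\<^bsub>N\<^esub> ?x \<oplus>\<^bsub>N\<^esub> (1/2) \<odot>\<^bsub>N\<^esub> (?x \<otimes>\<^bsub>N\<^esub> ?x)) \<oplus>\<^bsub>N\<^esub> (s \<odot>\<^bsub>N\<^esub> ?y \<oplus>\<^bsub>N\<^esub> (s/2) \<odot>\<^bsub>N\<^esub> ?x)"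
    using N \<phi> by (simp add: km_minus km_smult_r_distr km_a_assoc)
  note eq = km_eq_iff[OF Nm, symmetric]
  show ?thesis
    using N \<phi>
    by (simp add: jordan_relators_def Let_def group_relators_def ball_Un ev 1 2 km_move eq jordan_relations_def
        ka_l_distr) blast
qed

section \<open>The two-parameter family of algebras and their coactions\<close>

definition jordan_alg :: "'k::field_char_0 \<Rightarrow> 'k \<Rightarrow> ('k, 'k word_poly set) module" where
  "jordan_alg s t = presented_algebra (jordan_relators s t)"

definition jordan_gen :: "'k::field_char_0 \<Rightarrow> 'k \<Rightarrow> gen \<Rightarrow> 'k word_poly set" where
  "jordan_gen s t = gen_class (jordan_relators s t)"

lemma k_algebra_jordan [simp]: "k_algebra (jordan_alg s t)"
  by (simp add: jordan_alg_def k_algebra_presented)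

lemma jordan_gen_closed [simp]: "jordan_gen s t x \<in> carrier (jordan_alg s t)"
  by (simp add: jordan_alg_def jordan_gen_def gen_class_closed)

lemma jordan_gen_relations: "jordan_relations (jordan_alg s t) s t (jordan_gen s t)"
  by (subst jordan_relations_iff[symmetric]) (simp_all add: presented_relation jordan_alg_def jordan_gen_def
      k_algebra_presented gen_class_closed)

lemma
  assumes "k_algebra N" "\<And>x. \<phi> x \<in> carrier N" "jordan_relations N s t \<phi>"
  shows jordan_induced_hom: "induced_map N \<phi> \<in> algebra_homs (jordan_alg s t) N"
    and jordan_induced_gen: "induced_map N \<phi> (jordan_gen s t x) = \<phi> x"
  unfolding jordan_alg_def jordan_gen_def
  by (rule induced_map_hom induced_map_gen; use assms jordan_relations_iff[of N \<phi> s t] in blast)+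

lemmas jordan_linear_eqI = presented_linear_eqI[of _ _ "jordan_relators s t" for s t, folded jordan_alg_def
    jordan_gen_def]
lemmas jordan_hom_eqI = presented_hom_eqI[of _ _ "jordan_relators s t" for s t, folded jordan_alg_def jordan_gen_def]

text \<open>
  The third relation for \<open>x\<^sub>i \<otimes> 1 + g \<otimes> y\<^sub>i\<close>, with variables for the pure tensors: \<open>a\<^sub>i\<close> stands for the terms
  in \<open>P \<otimes> 1\<close>, \<open>b\<^sub>i\<close> for those in \<open>P \<otimes> y\<^sub>2\<close>, \<open>c\<^sub>i\<close> and \<open>d\<^sub>i\<close> for those in \<open>P \<otimes> y\<^sub>1\<close>, and \<open>e\<^sub>i\<close> for those in \<open>g\<^sup>2 \<otimes> Q\<close>.
\<close>

lemma jordan_coaction_identity: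
  fixes N :: "('k::field_char_0, 'a, 'm) module_scheme"
  assumes N: "k_module N"
    and c: "a1 \<in> carrier N" "a2 \<in> carrier N" "a3 \<in> carrier N" "a4 \<in> carrier N" "a5 \<in> carrier N"
      "b1 \<in> carrier N" "b2 \<in> carrier N" "b3 \<in> carrier N" "b4 \<in> carrier N"
      "c1 \<in> carrier N" "c2 \<in> carrier N" "c3 \<in> carrier N"
      "d1 \<in> carrier N" "d2 \<in> carrier N" "d3 \<in> carrier N"
      "e1 \<in> carrier N" "e2 \<in> carrier N" "e3 \<in> carrier N"
    and a: "a1 \<oplus>\<^bsub>N\<^esub> (s \<odot>\<^bsub>N\<^esub> a2 \<oplus>\<^bsub>N\<^esub> (s/2) \<odot>\<^bsub>N\<^esub> a3) = a4 \<oplus>\<^bsub>N\<^esub> (1/2) \<odot>\<^bsub>N\<^esub> a5"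
    and b: "b1 \<oplus>\<^bsub>N\<^esub> s \<odot>\<^bsub>N\<^esub> b2 = b3 \<oplus>\<^bsub>N\<^esub> u \<odot>\<^bsub>N\<^esub> b4"
    and cc: "c1 = c2 \<oplus>\<^bsub>N\<^esub> c3"
    and d: "c3 \<oplus>\<^bsub>N\<^esub> s \<odot>\<^bsub>N\<^esub> d1 = d2 \<oplus>\<^bsub>N\<^esub> u \<odot>\<^bsub>N\<^esub> d3"
    and e: "e1 \<oplus>\<^bsub>N\<^esub> (u \<odot>\<^bsub>N\<^esub> b4 \<oplus>\<^bsub>N\<^esub> (u/2) \<odot>\<^bsub>N\<^esub> d3) = e2 \<oplus>\<^bsub>N\<^esub> (1/2) \<odot>\<^bsub>N\<^esub> e3"
  shows "(a1 \<oplus>\<^bsub>N\<^esub> (b1 \<oplus>\<^bsub>N\<^esub> (c1 \<oplus>\<^bsub>N\<^esub> e1))) \<oplus>\<^bsub>N\<^esub> (s \<odot>\<^bsub>N\<^esub> (a2 \<oplus>\<^bsub>N\<^esub> b2) \<oplus>\<^bsub>N\<^esub> (s/2) \<odot>\<^bsub>N\<^esub> (a3 \<oplus>\<^bsub>N\<^esub> d1)) =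
    (a4 \<oplus>\<^bsub>N\<^esub> (c2 \<oplus>\<^bsub>N\<^esub> (b3 \<oplus>\<^bsub>N\<^esub> e2))) \<oplus>\<^bsub>N\<^esub> ((1/2) \<odot>\<^bsub>N\<^esub> (a5 \<oplus>\<^bsub>N\<^esub> (c3 \<oplus>\<^bsub>N\<^esub> (d2 \<oplus>\<^bsub>N\<^esub> e3)))) "
proof -
  note ac = km_a_assoc[OF N] km_a_comm[OF N] km_a_lcomm[OF N] km_smult_r_distr[OF N]
  have half: "c3 = (1/2) \<odot>\<^bsub>N\<^esub> c3 \<oplus>\<^bsub>N\<^esub> (1/2) \<odot>\<^bsub>N\<^esub> c3"
    using km_smult_l_distr[OF N c(12), of "1/2" "1/2"] N c by simp
  \<comment> \<open>The term c3 occurs once on the left of the goal but with coefficient 1/2 on the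
    right. One half is kept, and the other half is converted by half of equation \<open>d\<close>;
    its correction s/2 is just the one present in the goal.\<close>
  have cd: "c3 \<oplus>\<^bsub>N\<^esub> (s/2) \<odot>\<^bsub>N\<^esub> d1 = (1/2) \<odot>\<^bsub>N\<^esub> c3 \<oplus>\<^bsub>N\<^esub> ((1/2) \<odot>\<^bsub>N\<^esub> d2 \<oplus>\<^bsub>N\<^esub> (u/2) \<odot>\<^bsub>N\<^esub> d3)"
  proof -
    have "c3 \<oplus>\<^bsub>N\<^esub> (s/2) \<odot>\<^bsub>N\<^esub> d1 = (1/2) \<odot>\<^bsub>N\<^esub> c3 \<oplus>\<^bsub>N\<^esub> (1/2) \<odot>\<^bsub>N\<^esub> (c3 \<oplus>\<^bsub>N\<^esub> s \<odot>\<^bsub>N\<^esub> d1)"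
      by (subst half) (use N c in \<open>simp add: ac\<close>)
    also have "\<dots> = (1/2) \<odot>\<^bsub>N\<^esub> c3 \<oplus>\<^bsub>N\<^esub> ((1/2) \<odot>\<^bsub>N\<^esub> d2 \<oplus>\<^bsub>N\<^esub> (u/2) \<odot>\<^bsub>N\<^esub> d3)"
      unfolding d using N c by (simp add: ac)
    finally show ?thesis .
  qed
  have "(a1 \<oplus>\<^bsub>N\<^esub> (b1 \<oplus>\<^bsub>N\<^esub> (c1 \<oplus>\<^bsub>N\<^esub> e1))) \<oplus>\<^bsub>N\<^esub> (s \<odot>\<^bsub>N\<^esub> (a2 \<oplus>\<^bsub>N\<^esub> b2) \<oplus>\<^bsub>N\<^esub> (s/2) \<odot>\<^bsub>N\<^esub> (a3 \<oplus>\<^bsub>N\<^esub> d1)) =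
    (a1 \<oplus>\<^bsub>N\<^esub> (s \<odot>\<^bsub>N\<^esub> a2 \<oplus>\<^bsub>N\<^esub> (s/2) \<odot>\<^bsub>N\<^esub> a3)) \<oplus>\<^bsub>N\<^esub> ((b1 \<oplus>\<^bsub>N\<^esub> s \<odot>\<^bsub>N\<^esub> b2) \<oplus>\<^bsub>N\<^esub> (c2 \<oplus>\<^bsub>N\<^esub> ((c3 \<oplus>\<^bsub>N\<^esub> (s/2) \<odot>\<^bsub>N\<^esub> d1) \<oplus>\<^bsub>N\<^esub> e1)))"
    unfolding cc using N c by (simp add: ac)
  also have "\<dots> = (a4 \<oplus>\<^bsub>N\<^esub> (1/2) \<odot>\<^bsub>N\<^esub> a5) \<oplus>\<^bsub>N\<^esub> ((b3 \<oplus>\<^bsub>N\<^esub> u \<odot>\<^bsub>N\<^esub> b4) \<oplus>\<^bsub>N\<^esub> (c2 \<oplus>\<^bsub>N\<^esub> (((1/2) \<odot>\<^bsub>N\<^esub> c3 \<oplus>\<^bsub>N\<^esub> ((1/2) \<odot>\<^bsub>N\<^esub> d2 \<oplus>\<^bsub>N\<^esub> (u/2) \<odot>\<^bsub>N\<^esub> d3))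
      \<oplus>\<^bsub>N\<^esub> e1)))"
    unfolding a b cd ..
  \<comment> \<open>The terms with coefficient u that \<open>b\<close> and \<open>d\<close> leave
    behind are collected: they are the lower-order terms of the third relation in the second
    factor.\<close>
  also have "\<dots> = (a4 \<oplus>\<^bsub>N\<^esub> (1/2) \<odot>\<^bsub>N\<^esub> a5) \<oplus>\<^bsub>N\<^esub> (b3 \<oplus>\<^bsub>N\<^esub> (c2 \<oplus>\<^bsub>N\<^esub> (((1/2) \<odot>\<^bsub>N\<^esub> c3 \<oplus>\<^bsub>N\<^esub> (1/2) \<odot>\<^bsub>N\<^esub> d2) \<oplus>\<^bsub>N\<^esub> (e1 \<oplus>\<^bsub>N\<^esub> (u \<odot>\<^bsub>N\<^esub> b4 \<oplus>\<^bsub>N\<^esub> (u/2) \<odot>\<^bsub>N\<^esub>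
      d3)))))"
    using N c by (simp add: ac)
  also have "\<dots> = (a4 \<oplus>\<^bsub>N\<^esub> (c2 \<oplus>\<^bsub>N\<^esub> (b3 \<oplus>\<^bsub>N\<^esub> e2))) \<oplus>\<^bsub>N\<^esub> ((1/2) \<odot>\<^bsub>N\<^esub> (a5 \<oplus>\<^bsub>N\<^esub> (c3 \<oplus>\<^bsub>N\<^esub> (d2 \<oplus>\<^bsub>N\<^esub> e3))))"
    unfolding e using N c by (simp add: ac)
  finally show ?thesis .
qed

lemma coaction_on_gens_simps:
  "coaction_on_gens P u Q v Gen_g = pure_tensor P Q (u Gen_g) (v Gen_g)"
  "coaction_on_gens P u Q v Gen_g_inv = pure_tensor P Q (u Gen_g_inv) (v Gen_g_inv)"
  "coaction_on_gens P u Q v Gen_x1 = pure_tensor P Q (u Gen_x1) \<one>\<^bsub>Q\<^esub> \<oplus>\<^bsub>tensor P Q\<^esub> pure_tensor P Q (u Gen_g) (v Gen_x1)"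
  "coaction_on_gens P u Q v Gen_x2 = pure_tensor P Q (u Gen_x2) \<one>\<^bsub>Q\<^esub> \<oplus>\<^bsub>tensor P Q\<^esub> pure_tensor P Q (u Gen_g) (v Gen_x2)"
  by (simp_all add: coaction_on_gens_def)

text \<open>The middle parameter telescopes. In the first relation the second factor trades t for u,
  and the first factor then trades u for s; in the third, the lower-order terms in u produced by
  commuting g past x1 in \<open>P\<close> are those required by the relation in
  \<open>Q\<close>.\<close>

lemma jordan_coaction_relations:
  assumes P: "k_algebra P" and Q: "k_algebra Q" and \<phi>: "\<And>x. \<phi> x \<in> carrier P" and \<psi>: "\<And>x. \<psi> x \<in> carrier Q"
    and rP: "jordan_relations P s u \<phi>" and rQ: "jordan_relations Q u t \<psi>"
  shows "jordan_relations (tensor P Q) s t (coaction_on_gens P \<phi> Q \<psi>)"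
proof -
  let ?T = "tensor P Q" and ?p = "pure_tensor P Q"
  note Pm = ka_module[OF P] and Qm = ka_module[OF Q]
  note T = k_algebra_tensor[OF P Q] and Tm = ka_module[OF k_algebra_tensor[OF P Q]]
  note p = bilinear_pure_tensor[OF Pm Qm]
  note pc = pure_tensor_closed[OF Pm Qm]
  note pm = pure_tensor_mult[OF P Q]
  note lin = bilinear_add_left[OF p, symmetric] bilinear_add_right[OF p, symmetric]
    bilinear_smult_left[OF p, symmetric] bilinear_smult_right[OF p, symmetric]
  define g g' x1 x2 where "g = \<phi> Gen_g" "g' = \<phi> Gen_g_inv" "x1 = \<phi> Gen_x1" "x2 = \<phi> Gen_x2"
  define h h' y1 y2 where "h = \<psi> Gen_g" "h' = \<psi> Gen_g_inv" "y1 = \<psi> Gen_x1" "y2 = \<psi> Gen_x2"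
  have c: "g \<in> carrier P" "g' \<in> carrier P" "x1 \<in> carrier P" "x2 \<in> carrier P"
    "h \<in> carrier Q" "h' \<in> carrier Q" "y1 \<in> carrier Q" "y2 \<in> carrier Q"
    by (simp_all add: g_g'_x1_x2_def h_h'_y1_y2_def \<phi> \<psi>)
  note rP' = rP[unfolded jordan_relations_def, folded g_g'_x1_x2_def]
  note rQ' = rQ[unfolded jordan_relations_def, folded h_h'_y1_y2_def]
  note ac = km_a_assoc[OF Tm] km_a_comm[OF Tm] km_a_lcomm[OF Tm]
  note ds = ka_l_distr[OF T] ka_r_distr[OF T]
  have r1: "?p g h \<otimes>\<^bsub>?T\<^esub> (?p x1 \<one>\<^bsub>Q\<^esub> \<oplus>\<^bsub>?T\<^esub> ?p g y1) \<oplus>\<^bsub>?T\<^esub> t \<odot>\<^bsub>?T\<^esub> (?p g h \<otimes>\<^bsub>?T\<^esub> ?p g h) =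
      (?p x1 \<one>\<^bsub>Q\<^esub> \<oplus>\<^bsub>?T\<^esub> ?p g y1) \<otimes>\<^bsub>?T\<^esub> ?p g h \<oplus>\<^bsub>?T\<^esub> s \<odot>\<^bsub>?T\<^esub> ?p g h"
  proof -
    have "?p g h \<otimes>\<^bsub>?T\<^esub> (?p x1 \<one>\<^bsub>Q\<^esub> \<oplus>\<^bsub>?T\<^esub> ?p g y1) \<oplus>\<^bsub>?T\<^esub> t \<odot>\<^bsub>?T\<^esub> (?p g h \<otimes>\<^bsub>?T\<^esub> ?p g h) =
        ?p (g \<otimes>\<^bsub>P\<^esub> x1) h \<oplus>\<^bsub>?T\<^esub> ?p (g \<otimes>\<^bsub>P\<^esub> g) (h \<otimes>\<^bsub>Q\<^esub> y1 \<oplus>\<^bsub>Q\<^esub> t \<odot>\<^bsub>Q\<^esub> (h \<otimes>\<^bsub>Q\<^esub> h))"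
      using P Q c T by (simp add: ds pc pm bilinear_add_right[OF p] bilinear_smult_right[OF p] ac)
    also have "\<dots> = ?p (g \<otimes>\<^bsub>P\<^esub> x1 \<oplus>\<^bsub>P\<^esub> u \<odot>\<^bsub>P\<^esub> (g \<otimes>\<^bsub>P\<^esub> g)) h \<oplus>\<^bsub>?T\<^esub> ?p (g \<otimes>\<^bsub>P\<^esub> g) (y1 \<otimes>\<^bsub>Q\<^esub> h)"
      using P Q c T rQ' by (simp add: pc bilinear_add_right[OF p] bilinear_smult_right[OF p] bilinear_add_left[OF
          p] bilinear_smult_left[OF p] ac)
    also have "\<dots> = (?p x1 \<one>\<^bsub>Q\<^esub> \<oplus>\<^bsub>?T\<^esub> ?p g y1) \<otimes>\<^bsub>?T\<^esub> ?p g h \<oplus>\<^bsub>?T\<^esub> s \<odot>\<^bsub>?T\<^esub> ?p g h"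
      using P Q c T rP' by (simp add: ds pc pm bilinear_add_left[OF p] bilinear_smult_left[OF p] ac)
    finally show ?thesis .
  qed
  have r2: "?p g h \<otimes>\<^bsub>?T\<^esub> (?p x2 \<one>\<^bsub>Q\<^esub> \<oplus>\<^bsub>?T\<^esub> ?p g y2) =
      (?p x2 \<one>\<^bsub>Q\<^esub> \<oplus>\<^bsub>?T\<^esub> ?p g y2) \<otimes>\<^bsub>?T\<^esub> ?p g h \<oplus>\<^bsub>?T\<^esub> (?p x1 \<one>\<^bsub>Q\<^esub> \<oplus>\<^bsub>?T\<^esub> ?p g y1) \<otimes>\<^bsub>?T\<^esub> ?p g h"
    using P Q c T rP' rQ' by (simp add: ds pc pm bilinear_add_left[OF p] bilinear_add_right[OF p] ac)
  have r3: "(?p x1 \<one>\<^bsub>Q\<^esub> \<oplus>\<^bsub>?T\<^esub> ?p g y1) \<otimes>\<^bsub>?T\<^esub> (?p x2 \<one>\<^bsub>Q\<^esub> \<oplus>\<^bsub>?T\<^esub> ?p g y2) \<oplus>\<^bsub>?T\<^esub>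
      (s \<odot>\<^bsub>?T\<^esub> (?p x2 \<one>\<^bsub>Q\<^esub> \<oplus>\<^bsub>?T\<^esub> ?p g y2) \<oplus>\<^bsub>?T\<^esub> (s/2) \<odot>\<^bsub>?T\<^esub> (?p x1 \<one>\<^bsub>Q\<^esub> \<oplus>\<^bsub>?T\<^esub> ?p g y1)) =
      (?p x2 \<one>\<^bsub>Q\<^esub> \<oplus>\<^bsub>?T\<^esub> ?p g y2) \<otimes>\<^bsub>?T\<^esub> (?p x1 \<one>\<^bsub>Q\<^esub> \<oplus>\<^bsub>?T\<^esub> ?p g y1) \<oplus>\<^bsub>?T\<^esub>
      (1/2) \<odot>\<^bsub>?T\<^esub> ((?p x1 \<one>\<^bsub>Q\<^esub> \<oplus>\<^bsub>?T\<^esub> ?p g y1) \<otimes>\<^bsub>?T\<^esub> (?p x1 \<one>\<^bsub>Q\<^esub> \<oplus>\<^bsub>?T\<^esub> ?p g y1))"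
  proof -
    have e: "(?p a \<one>\<^bsub>Q\<^esub> \<oplus>\<^bsub>?T\<^esub> ?p g b) \<otimes>\<^bsub>?T\<^esub> (?p a' \<one>\<^bsub>Q\<^esub> \<oplus>\<^bsub>?T\<^esub> ?p g b') =
        ?p (a \<otimes>\<^bsub>P\<^esub> a') \<one>\<^bsub>Q\<^esub> \<oplus>\<^bsub>?T\<^esub> (?p (a \<otimes>\<^bsub>P\<^esub> g) b' \<oplus>\<^bsub>?T\<^esub> (?p (g \<otimes>\<^bsub>P\<^esub> a') b \<oplus>\<^bsub>?T\<^esub> ?p (g \<otimes>\<^bsub>P\<^esub> g) (b \<otimes>\<^bsub>Q\<^esub> b')))"
      if "a \<in> carrier P" "a' \<in> carrier P" "b \<in> carrier Q" "b' \<in> carrier Q" for a a' b b'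
      using that P Q c T by (simp add: ds pc pm ac)
    note ee = e[OF c(3,4,7,8)] e[OF c(4,3,8,7)] e[OF c(3,3,7,7)]
    show ?thesis unfolding ee
    proof (rule jordan_coaction_identity[OF Tm, where u = u])
      show "?p (x1 \<otimes>\<^bsub>P\<^esub> x2) \<one>\<^bsub>Q\<^esub> \<oplus>\<^bsub>?T\<^esub> (s \<odot>\<^bsub>?T\<^esub> ?p x2 \<one>\<^bsub>Q\<^esub> \<oplus>\<^bsub>?T\<^esub> (s/2) \<odot>\<^bsub>?T\<^esub> ?p x1 \<one>\<^bsub>Q\<^esub>) =
          ?p (x2 \<otimes>\<^bsub>P\<^esub> x1) \<one>\<^bsub>Q\<^esub> \<oplus>\<^bsub>?T\<^esub> (1/2) \<odot>\<^bsub>?T\<^esub> ?p (x1 \<otimes>\<^bsub>P\<^esub> x1) \<one>\<^bsub>Q\<^esub>"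
        using P Q c rP' by (simp only: lin km_closed[OF Pm] ka_closed[OF P] ka_closed[OF Q])
      show "?p (x1 \<otimes>\<^bsub>P\<^esub> g) y2 \<oplus>\<^bsub>?T\<^esub> s \<odot>\<^bsub>?T\<^esub> ?p g y2 = ?p (g \<otimes>\<^bsub>P\<^esub> x1) y2 \<oplus>\<^bsub>?T\<^esub> u \<odot>\<^bsub>?T\<^esub> ?p (g \<otimes>\<^bsub>P\<^esub> g) y2"
        using P Q c rP' by (simp only: bilinear_add_left[OF p, symmetric] bilinear_smult_left[OF p, symmetric]
            km_closed[OF Pm] ka_closed[OF P] ka_closed[OF Q])
      show "?p (g \<otimes>\<^bsub>P\<^esub> x2) y1 = ?p (x2 \<otimes>\<^bsub>P\<^esub> g) y1 \<oplus>\<^bsub>?T\<^esub> ?p (x1 \<otimes>\<^bsub>P\<^esub> g) y1"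
        using P Q c rP' by (simp only: bilinear_add_left[OF p, symmetric] bilinear_smult_left[OF p, symmetric]
            km_closed[OF Pm] ka_closed[OF P] ka_closed[OF Q])
      show "?p (x1 \<otimes>\<^bsub>P\<^esub> g) y1 \<oplus>\<^bsub>?T\<^esub> s \<odot>\<^bsub>?T\<^esub> ?p g y1 = ?p (g \<otimes>\<^bsub>P\<^esub> x1) y1 \<oplus>\<^bsub>?T\<^esub> u \<odot>\<^bsub>?T\<^esub> ?p (g \<otimes>\<^bsub>P\<^esub> g) y1"
        using P Q c rP' by (simp only: bilinear_add_left[OF p, symmetric] bilinear_smult_left[OF p, symmetric]
            km_closed[OF Pm] ka_closed[OF P] ka_closed[OF Q])
      show "?p (g \<otimes>\<^bsub>P\<^esub> g) (y1 \<otimes>\<^bsub>Q\<^esub> y2) \<oplus>\<^bsub>?T\<^esub> (u \<odot>\<^bsub>?T\<^esub> ?p (g \<otimes>\<^bsub>P\<^esub> g) y2 \<oplus>\<^bsub>?T\<^esub> (u/2) \<odot>\<^bsub>?T\<^esub> ?p (g \<otimes>\<^bsub>P\<^esub> g) y1) =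
          ?p (g \<otimes>\<^bsub>P\<^esub> g) (y2 \<otimes>\<^bsub>Q\<^esub> y1) \<oplus>\<^bsub>?T\<^esub> (1/2) \<odot>\<^bsub>?T\<^esub> ?p (g \<otimes>\<^bsub>P\<^esub> g) (y1 \<otimes>\<^bsub>Q\<^esub> y1)"
        using P Q c rQ' by (simp only: bilinear_add_right[OF p, symmetric] bilinear_smult_right[OF p, symmetric]
            km_closed[OF Qm] ka_closed[OF P] ka_closed[OF Q])
    qed (use P Q c in \<open>simp_all add: pc\<close>)
  qed
  show ?thesis
    unfolding jordan_relations_def coaction_on_gens_simps g_g'_x1_x2_def[symmetric] h_h'_y1_y2_def[symmetric]
    using r1 r2 r3 P Q c rP' rQ' by (simp add: pm tensor_one)
qed

section \<open>Antipodes of the family\<close>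

definition opposite :: "('k::field, 'a) module \<Rightarrow> ('k, 'a) module" where
  "opposite A = A\<lparr>monoid.mult := (\<lambda>x y. y \<otimes>\<^bsub>A\<^esub> x)\<rparr>"

lemma opposite_simps [simp]:
  "carrier (opposite A) = carrier A" "x \<otimes>\<^bsub>opposite A\<^esub> y = y \<otimes>\<^bsub>A\<^esub> x" "\<one>\<^bsub>opposite A\<^esub> = \<one>\<^bsub>A\<^esub>"
  "\<zero>\<^bsub>opposite A\<^esub> = \<zero>\<^bsub>A\<^esub>" "add (opposite A) = add A" "smult (opposite A) = smult A"
  by (simp_all add: opposite_def)

lemma k_algebra_opposite: "k_algebra A \<Longrightarrow> k_algebra (opposite A)"
  by (rule k_algebraI; (rule k_moduleI)?)
    (simp_all add: ka_assoc ka_l_distr ka_r_distr km_a_assoc km_a_comm km_a_lcomm km_smult_l_distr km_smult_r_distr)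

lemma linear_maps_opposite: "linear_maps M (opposite A) = linear_maps M A"
  by (simp only: linear_maps_def opposite_simps)

fun antipode_gen :: "('k::field, 'a) module \<Rightarrow> (gen \<Rightarrow> 'a) \<Rightarrow> gen \<Rightarrow> 'a" where
  "antipode_gen A \<phi> Gen_g = \<phi> Gen_g_inv"
| "antipode_gen A \<phi> Gen_g_inv = \<phi> Gen_g"
| "antipode_gen A \<phi> Gen_x1 = (- 1) \<odot>\<^bsub>A\<^esub> (\<phi> Gen_g_inv \<otimes>\<^bsub>A\<^esub> \<phi> Gen_x1)"
| "antipode_gen A \<phi> Gen_x2 = (- 1) \<odot>\<^bsub>A\<^esub> (\<phi> Gen_g_inv \<otimes>\<^bsub>A\<^esub> \<phi> Gen_x2)"

lemma antipode_gen_closed: "k_algebra A \<Longrightarrow> (\<And>x. \<phi> x \<in> carrier A) \<Longrightarrow> antipode_gen A \<phi> x \<in> carrier A"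
  by (cases x) simp_all

text \<open>The third relation for the elements -g' x1 and -g' x2, where g' is the inverse of g.
  With k(z) = g' g' z, the variables a, b, c stand for k(x2 x1), k(x1 x1), k(x1 x2), the variables
  d, e for k(x2), k(x1), and p, q for g' x2, g' x1; the hypothesis is k applied to the relation in
  \<open>A\<close>.\<close>

lemma antipode_identity:
  fixes N :: "('k::field_char_0, 'a, 'm) module_scheme"
  assumes N: "k_module N"
    and c: "a \<in> carrier N" "b \<in> carrier N" "c \<in> carrier N" "d \<in> carrier N" "e \<in> carrier N" "p \<in> carrier N" "q \<in>
        carrier N"
    and eq: "c \<oplus>\<^bsub>N\<^esub> (t \<odot>\<^bsub>N\<^esub> d \<oplus>\<^bsub>N\<^esub> (t/2) \<odot>\<^bsub>N\<^esub> e) = a \<oplus>\<^bsub>N\<^esub> (1/2) \<odot>\<^bsub>N\<^esub> b"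
  shows "(a \<oplus>\<^bsub>N\<^esub> b) \<oplus>\<^bsub>N\<^esub> (s \<odot>\<^bsub>N\<^esub> ((- 1) \<odot>\<^bsub>N\<^esub> p) \<oplus>\<^bsub>N\<^esub> (s/2) \<odot>\<^bsub>N\<^esub> ((- 1) \<odot>\<^bsub>N\<^esub> q)) =
    (c \<oplus>\<^bsub>N\<^esub> (t \<odot>\<^bsub>N\<^esub> d \<oplus>\<^bsub>N\<^esub> (- s) \<odot>\<^bsub>N\<^esub> p)) \<oplus>\<^bsub>N\<^esub> (1/2) \<odot>\<^bsub>N\<^esub> (b \<oplus>\<^bsub>N\<^esub> (t \<odot>\<^bsub>N\<^esub> e \<oplus>\<^bsub>N\<^esub> (- s) \<odot>\<^bsub>N\<^esub> q))"
proof -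
  note ac = km_a_assoc[OF N] km_a_comm[OF N] km_a_lcomm[OF N] km_smult_r_distr[OF N]
  have half: "b = (1/2) \<odot>\<^bsub>N\<^esub> b \<oplus>\<^bsub>N\<^esub> (1/2) \<odot>\<^bsub>N\<^esub> b"
    using km_smult_l_distr[OF N c(2), of "1/2" "1/2"] N c by simp
  have "(c \<oplus>\<^bsub>N\<^esub> (t \<odot>\<^bsub>N\<^esub> d \<oplus>\<^bsub>N\<^esub> (- s) \<odot>\<^bsub>N\<^esub> p)) \<oplus>\<^bsub>N\<^esub> (1/2) \<odot>\<^bsub>N\<^esub> (b \<oplus>\<^bsub>N\<^esub> (t \<odot>\<^bsub>N\<^esub> e \<oplus>\<^bsub>N\<^esub> (- s) \<odot>\<^bsub>N\<^esub> q)) =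
    (c \<oplus>\<^bsub>N\<^esub> (t \<odot>\<^bsub>N\<^esub> d \<oplus>\<^bsub>N\<^esub> (t/2) \<odot>\<^bsub>N\<^esub> e)) \<oplus>\<^bsub>N\<^esub> ((1/2) \<odot>\<^bsub>N\<^esub> b \<oplus>\<^bsub>N\<^esub> ((- s) \<odot>\<^bsub>N\<^esub> p \<oplus>\<^bsub>N\<^esub> (- (s/2)) \<odot>\<^bsub>N\<^esub> q))"
    using N c by (simp add: ac)
  also have "\<dots> = (a \<oplus>\<^bsub>N\<^esub> ((1/2) \<odot>\<^bsub>N\<^esub> b \<oplus>\<^bsub>N\<^esub> (1/2) \<odot>\<^bsub>N\<^esub> b)) \<oplus>\<^bsub>N\<^esub> ((- s) \<odot>\<^bsub>N\<^esub> p \<oplus>\<^bsub>N\<^esub> (- (s/2)) \<odot>\<^bsub>N\<^esub> q)"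
    unfolding eq using N c by (simp add: ac)
  also have "\<dots> = (a \<oplus>\<^bsub>N\<^esub> b) \<oplus>\<^bsub>N\<^esub> (s \<odot>\<^bsub>N\<^esub> ((- 1) \<odot>\<^bsub>N\<^esub> p) \<oplus>\<^bsub>N\<^esub> (s/2) \<odot>\<^bsub>N\<^esub> ((- 1) \<odot>\<^bsub>N\<^esub> q))"
    unfolding half[symmetric] using N c by simp
  finally show ?thesis by simp
qed

lemma km_transpose:
  assumes N: "k_module N" and c: "a \<in> carrier N" "b \<in> carrier N" "c \<in> carrier N" "d \<in> carrier N"
    and eq: "a \<oplus>\<^bsub>N\<^esub> b = c \<oplus>\<^bsub>N\<^esub> d"
  shows "c = a \<oplus>\<^bsub>N\<^esub> (b \<oplus>\<^bsub>N\<^esub> (- 1) \<odot>\<^bsub>N\<^esub> d)" "(- 1) \<odot>\<^bsub>N\<^esub> a \<oplus>\<^bsub>N\<^esub> d = (- 1) \<odot>\<^bsub>N\<^esub> c \<oplus>\<^bsub>N\<^esub> b"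
proof -
  note ac = km_a_assoc[OF N] km_a_comm[OF N] km_a_lcomm[OF N]
  have z: "x \<oplus>\<^bsub>N\<^esub> (- 1) \<odot>\<^bsub>N\<^esub> x = \<zero>\<^bsub>N\<^esub>" if "x \<in> carrier N" for x
    using km_smult_l_distr[OF N that, of 1 "- 1"] N that by simp
  have "c = c \<oplus>\<^bsub>N\<^esub> (d \<oplus>\<^bsub>N\<^esub> (- 1) \<odot>\<^bsub>N\<^esub> d)" using N c z by simp
  also have "\<dots> = (a \<oplus>\<^bsub>N\<^esub> b) \<oplus>\<^bsub>N\<^esub> (- 1) \<odot>\<^bsub>N\<^esub> d" unfolding eq using N c by (simp add: km_a_assoc)
  finally show *: "c = a \<oplus>\<^bsub>N\<^esub> (b \<oplus>\<^bsub>N\<^esub> (- 1) \<odot>\<^bsub>N\<^esub> d)" using N c by (simp add: km_a_assoc)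
  have "(- 1) \<odot>\<^bsub>N\<^esub> c \<oplus>\<^bsub>N\<^esub> b = (- 1) \<odot>\<^bsub>N\<^esub> a \<oplus>\<^bsub>N\<^esub> ((b \<oplus>\<^bsub>N\<^esub> (- 1) \<odot>\<^bsub>N\<^esub> b) \<oplus>\<^bsub>N\<^esub> d)"
    by (subst *) (use N c in \<open>simp add: km_smult_r_distr ac\<close>)
  then show "(- 1) \<odot>\<^bsub>N\<^esub> a \<oplus>\<^bsub>N\<^esub> d = (- 1) \<odot>\<^bsub>N\<^esub> c \<oplus>\<^bsub>N\<^esub> b" using N c z by simp
qed

text \<open>Moving g' from the right of x1 to its left costs terms with both t and s. Those with t
  are absorbed by the relation of \<open>A\<close>, and those with s are the lower-order terms of
  the relation to be proved, so the parameters change places.\<close>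

lemma antipode_relations:
  assumes A: "k_algebra A" and \<phi>: "\<And>x. \<phi> x \<in> carrier A" and rel: "jordan_relations A t s \<phi>"
  shows "jordan_relations (opposite A) s t (antipode_gen A \<phi>)"
proof -
  note Am = ka_module[OF A]
  define g g' x1 x2 where "g = \<phi> Gen_g" "g' = \<phi> Gen_g_inv" "x1 = \<phi> Gen_x1" "x2 = \<phi> Gen_x2"
  have c [simp]: "g \<in> carrier A" "g' \<in> carrier A" "x1 \<in> carrier A" "x2 \<in> carrier A"
    by (simp_all add: g_g'_x1_x2_def \<phi>)
  note r = rel[unfolded jordan_relations_def, folded g_g'_x1_x2_def]
  note as = ka_assoc[OF A] and ds = ka_l_distr[OF A] ka_r_distr[OF A]
  have gg: "g \<otimes>\<^bsub>A\<^esub> g' = \<one>\<^bsub>A\<^esub>" "g' \<otimes>\<^bsub>A\<^esub> g = \<one>\<^bsub>A\<^esub>" using r by auto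
  have ggx: "g \<otimes>\<^bsub>A\<^esub> (g' \<otimes>\<^bsub>A\<^esub> x) = x" "g' \<otimes>\<^bsub>A\<^esub> (g \<otimes>\<^bsub>A\<^esub> x) = x" if "x \<in> carrier A" for x
    using that A gg as[of g g' x] as[of g' g x] by simp_all
  \<comment> \<open>The relation with g is multiplied by g' on both sides, which yields the
    commutation rule of x1 with g'.\<close>
  have x1g: "x1 \<otimes>\<^bsub>A\<^esub> g' \<oplus>\<^bsub>A\<^esub> s \<odot>\<^bsub>A\<^esub> \<one>\<^bsub>A\<^esub> = g' \<otimes>\<^bsub>A\<^esub> x1 \<oplus>\<^bsub>A\<^esub> t \<odot>\<^bsub>A\<^esub> g'"
  proof -
    have "g \<otimes>\<^bsub>A\<^esub> x1 \<oplus>\<^bsub>A\<^esub> s \<odot>\<^bsub>A\<^esub> (g \<otimes>\<^bsub>A\<^esub> g) = x1 \<otimes>\<^bsub>A\<^esub> g \<oplus>\<^bsub>A\<^esub> t \<odot>\<^bsub>A\<^esub> g" using r by blast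
    from arg_cong[OF this, of "\<lambda>z. g' \<otimes>\<^bsub>A\<^esub> (z \<otimes>\<^bsub>A\<^esub> g')"] show ?thesis
      using A by (simp add: ds as ggx gg)
  qed
  have x2g: "x2 \<otimes>\<^bsub>A\<^esub> g' = g' \<otimes>\<^bsub>A\<^esub> x2 \<oplus>\<^bsub>A\<^esub> g' \<otimes>\<^bsub>A\<^esub> x1"
  proof -
    have "g \<otimes>\<^bsub>A\<^esub> x2 = x2 \<otimes>\<^bsub>A\<^esub> g \<oplus>\<^bsub>A\<^esub> x1 \<otimes>\<^bsub>A\<^esub> g" using r by blast
    from arg_cong[OF this, of "\<lambda>z. g' \<otimes>\<^bsub>A\<^esub> (z \<otimes>\<^bsub>A\<^esub> g')"] show ?thesis
      using A by (simp add: ds as ggx gg)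
  qed
  have x1g': "x1 \<otimes>\<^bsub>A\<^esub> g' = g' \<otimes>\<^bsub>A\<^esub> x1 \<oplus>\<^bsub>A\<^esub> (t \<odot>\<^bsub>A\<^esub> g' \<oplus>\<^bsub>A\<^esub> (- s) \<odot>\<^bsub>A\<^esub> \<one>\<^bsub>A\<^esub>)"
    using km_transpose(1)[OF Am _ _ _ _ x1g[symmetric]] A by simp
  have r1: "antipode_gen A \<phi> Gen_x1 \<otimes>\<^bsub>A\<^esub> g' \<oplus>\<^bsub>A\<^esub> t \<odot>\<^bsub>A\<^esub> (g' \<otimes>\<^bsub>A\<^esub> g') = g' \<otimes>\<^bsub>A\<^esub> antipode_gen A \<phi> Gen_x1 \<oplus>\<^bsub>A\<^esub> s \<odot>\<^bsub>A\<^esub> g'"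
  proof -
    have "g' \<otimes>\<^bsub>A\<^esub> (x1 \<otimes>\<^bsub>A\<^esub> g') \<oplus>\<^bsub>A\<^esub> s \<odot>\<^bsub>A\<^esub> g' = g' \<otimes>\<^bsub>A\<^esub> (g' \<otimes>\<^bsub>A\<^esub> x1) \<oplus>\<^bsub>A\<^esub> t \<odot>\<^bsub>A\<^esub> (g' \<otimes>\<^bsub>A\<^esub> g')"
      using arg_cong[OF x1g, of "\<lambda>z. g' \<otimes>\<^bsub>A\<^esub> z"] A by (simp add: ds)
    from km_transpose(2)[OF Am _ _ _ _ this] show ?thesis
      using A by (simp add: g_g'_x1_x2_def[symmetric] as)
  qed
  have r2: "antipode_gen A \<phi> Gen_x2 \<otimes>\<^bsub>A\<^esub> g' = g' \<otimes>\<^bsub>A\<^esub> antipode_gen A \<phi> Gen_x2 \<oplus>\<^bsub>A\<^esub> g' \<otimes>\<^bsub>A\<^esub> antipode_gen A \<phi> Gen_x1"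
    using A by (simp add: g_g'_x1_x2_def[symmetric] as x2g ds km_smult_r_distr)
  have r3: "antipode_gen A \<phi> Gen_x2 \<otimes>\<^bsub>A\<^esub> antipode_gen A \<phi> Gen_x1 \<oplus>\<^bsub>A\<^esub> (s \<odot>\<^bsub>A\<^esub> antipode_gen A \<phi> Gen_x2 \<oplus>\<^bsub>A\<^esub> (s/2) \<odot>\<^bsub>A\<^esub>
      antipode_gen A \<phi> Gen_x1) =
     antipode_gen A \<phi> Gen_x1 \<otimes>\<^bsub>A\<^esub> antipode_gen A \<phi> Gen_x2 \<oplus>\<^bsub>A\<^esub> (1/2) \<odot>\<^bsub>A\<^esub> (antipode_gen A \<phi> Gen_x1 \<otimes>\<^bsub>A\<^esub> antipode_gen A \<phi>
         Gen_x1)"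
  proof -
    let ?k = "\<lambda>z. g' \<otimes>\<^bsub>A\<^esub> (g' \<otimes>\<^bsub>A\<^esub> z)"
    have p1: "(g' \<otimes>\<^bsub>A\<^esub> x1) \<otimes>\<^bsub>A\<^esub> (g' \<otimes>\<^bsub>A\<^esub> z) = ?k (x1 \<otimes>\<^bsub>A\<^esub> z) \<oplus>\<^bsub>A\<^esub> (t \<odot>\<^bsub>A\<^esub> ?k z \<oplus>\<^bsub>A\<^esub> (- s) \<odot>\<^bsub>A\<^esub> (g' \<otimes>\<^bsub>A\<^esub> z))"
      if z: "z \<in> carrier A" for z
    proof -
      have "(g' \<otimes>\<^bsub>A\<^esub> x1) \<otimes>\<^bsub>A\<^esub> (g' \<otimes>\<^bsub>A\<^esub> z) = g' \<otimes>\<^bsub>A\<^esub> ((x1 \<otimes>\<^bsub>A\<^esub> g') \<otimes>\<^bsub>A\<^esub> z)" using A z by (simp add: as)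
      also have "\<dots> = ?k (x1 \<otimes>\<^bsub>A\<^esub> z) \<oplus>\<^bsub>A\<^esub> (t \<odot>\<^bsub>A\<^esub> ?k z \<oplus>\<^bsub>A\<^esub> (- s) \<odot>\<^bsub>A\<^esub> (g' \<otimes>\<^bsub>A\<^esub> z))"
        unfolding x1g' using A z by (simp add: as ds)
      finally show ?thesis .
    qed
    have p2: "(g' \<otimes>\<^bsub>A\<^esub> x2) \<otimes>\<^bsub>A\<^esub> (g' \<otimes>\<^bsub>A\<^esub> x1) = ?k (x2 \<otimes>\<^bsub>A\<^esub> x1) \<oplus>\<^bsub>A\<^esub> ?k (x1 \<otimes>\<^bsub>A\<^esub> x1)"
    proof -
      have "(g' \<otimes>\<^bsub>A\<^esub> x2) \<otimes>\<^bsub>A\<^esub> (g' \<otimes>\<^bsub>A\<^esub> x1) = g' \<otimes>\<^bsub>A\<^esub> ((x2 \<otimes>\<^bsub>A\<^esub> g') \<otimes>\<^bsub>A\<^esub> x1)" using A by (simp add: as)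
      also have "\<dots> = ?k (x2 \<otimes>\<^bsub>A\<^esub> x1) \<oplus>\<^bsub>A\<^esub> ?k (x1 \<otimes>\<^bsub>A\<^esub> x1)"
        unfolding x2g using A by (simp add: as ds)
      finally show ?thesis .
    qed
    have "x1 \<otimes>\<^bsub>A\<^esub> x2 \<oplus>\<^bsub>A\<^esub> (t \<odot>\<^bsub>A\<^esub> x2 \<oplus>\<^bsub>A\<^esub> (t/2) \<odot>\<^bsub>A\<^esub> x1) = x2 \<otimes>\<^bsub>A\<^esub> x1 \<oplus>\<^bsub>A\<^esub> (1/2) \<odot>\<^bsub>A\<^esub> (x1 \<otimes>\<^bsub>A\<^esub> x1)" using r by blast
    from arg_cong[OF this, of ?k]
    have k: "?k (x1 \<otimes>\<^bsub>A\<^esub> x2) \<oplus>\<^bsub>A\<^esub> (t \<odot>\<^bsub>A\<^esub> ?k x2 \<oplus>\<^bsub>A\<^esub> (t/2) \<odot>\<^bsub>A\<^esub> ?k x1) = ?k (x2 \<otimes>\<^bsub>A\<^esub> x1) \<oplus>\<^bsub>A\<^esub> (1/2) \<odot>\<^bsub>A\<^esub> ?k (x1 \<otimes>\<^bsub>A\<^esub> x1)"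
      using A by (simp add: ds)
    have neg: "((- 1) \<odot>\<^bsub>A\<^esub> u) \<otimes>\<^bsub>A\<^esub> ((- 1) \<odot>\<^bsub>A\<^esub> v) = u \<otimes>\<^bsub>A\<^esub> v" if "u \<in> carrier A" "v \<in> carrier A" for u v
      using that A by simp
    show ?thesis
      unfolding antipode_gen.simps g_g'_x1_x2_def[symmetric]
        neg[OF ka_mult_closed[OF A c(2,3)] ka_mult_closed[OF A c(2,3)]] neg[OF ka_mult_closed[OF A c(2,3)]
            ka_mult_closed[OF A c(2,4)]]
        neg[OF ka_mult_closed[OF A c(2,4)] ka_mult_closed[OF A c(2,3)]] p1[OF c(3)] p1[OF c(4)] p2
      by (rule antipode_identity[OF Am _ _ _ _ _ _ _ k]) (use A in simp_all)
  qed
  show ?thesis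
    unfolding jordan_relations_def opposite_simps
    using r1 r2 r3 gg by (simp add: g_g'_x1_x2_def)
qed

definition jordan_comult :: "'k::field_char_0 \<Rightarrow> 'k \<Rightarrow> 'k \<Rightarrow> 'k word_poly set \<Rightarrow> ('k word_poly set \<times> 'k word_poly set
    \<Rightarrow>\<^sub>0 'k) set" where
  "jordan_comult s u t = induced_map (tensor (jordan_alg s u) (jordan_alg u t))
     (coaction_on_gens (jordan_alg s u) (jordan_gen s u) (jordan_alg u t) (jordan_gen u t))"

definition jordan_counit :: "'k::field_char_0 \<Rightarrow> 'k word_poly set \<Rightarrow> 'k" where
  "jordan_counit s = induced_map ground (\<lambda>x. if x = Gen_g \<or> x = Gen_g_inv then 1 else 0)"

text \<open>A presentation only yields homomorphisms; the order-reversing antipode is one into the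
  opposite algebra.\<close>

definition jordan_antipode :: "'k::field_char_0 \<Rightarrow> 'k \<Rightarrow> 'k word_poly set \<Rightarrow> 'k word_poly set" where
  "jordan_antipode s t = induced_map (opposite (jordan_alg t s)) (antipode_gen (jordan_alg t s) (jordan_gen t s))"

lemma coaction_on_gens_closed:
  assumes "k_algebra P" "k_algebra Q" "\<And>x. \<phi> x \<in> carrier P" "\<And>x. \<psi> x \<in> carrier Q"
  shows "coaction_on_gens P \<phi> Q \<psi> x \<in> carrier (tensor P Q)"
  using assms k_module_tensor[OF ka_module[OF assms(1)] ka_module[OF assms(2)]]
  by (cases x) (simp_all add: coaction_on_gens_simps pure_tensor_closed)

context
  fixes s u t :: "'k::field_char_0"
begin

lemma jordan_comult_hom: "jordan_comult s u t \<in> algebra_homs (jordan_alg s t) (tensor (jordan_alg s u) (jordan_alg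
    u t))"
  and jordan_comult_gen: "jordan_comult s u t (jordan_gen s t x) =
    coaction_on_gens (jordan_alg s u) (jordan_gen s u) (jordan_alg u t) (jordan_gen u t) x"
proof -
  note N = k_algebra_tensor[OF k_algebra_jordan[of s u] k_algebra_jordan[of u t]]
  note c = coaction_on_gens_closed[OF k_algebra_jordan k_algebra_jordan jordan_gen_closed[of s u]
      jordan_gen_closed[of u t]]
  note R = jordan_coaction_relations[OF k_algebra_jordan k_algebra_jordan jordan_gen_closed jordan_gen_closed
      jordan_gen_relations[of s u] jordan_gen_relations[of u t]]
  show "jordan_comult s u t \<in> algebra_homs (jordan_alg s t) (tensor (jordan_alg s u) (jordan_alg u t))"
    "jordan_comult s u t (jordan_gen s t x) = coaction_on_gens (jordan_alg s u) (jordan_gen s u) (jordan_alg u t)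
        (jordan_gen u t) x"
    unfolding jordan_comult_def by (rule jordan_induced_hom[OF N c R] jordan_induced_gen[OF N c R])+
qed

lemma jordan_counit_hom: "jordan_counit s \<in> algebra_homs (jordan_alg s s) ground"
  and jordan_counit_gen: "jordan_counit s (jordan_gen s s x) = (if x = Gen_g \<or> x = Gen_g_inv then 1 else 0)"
proof -
  have R: "jordan_relations ground s s (\<lambda>x. if x = Gen_g \<or> x = Gen_g_inv then 1 else 0)"
    by (simp add: jordan_relations_def)
  show "jordan_counit s \<in> algebra_homs (jordan_alg s s) ground"
    "jordan_counit s (jordan_gen s s x) = (if x = Gen_g \<or> x = Gen_g_inv then 1 else 0)"
    unfolding jordan_counit_def
    by (rule jordan_induced_hom[OF k_algebra_ground _ R] jordan_induced_gen[OF k_algebra_ground _ R], simp)+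
qed

lemma jordan_antipode_hom: "jordan_antipode s t \<in> algebra_homs (jordan_alg s t) (opposite (jordan_alg t s))"
  and jordan_antipode_gen: "jordan_antipode s t (jordan_gen s t x) = antipode_gen (jordan_alg t s) (jordan_gen t s) x"
proof -
  note R = antipode_relations[OF k_algebra_jordan jordan_gen_closed jordan_gen_relations[of t s]]
  have c: "antipode_gen (jordan_alg t s) (jordan_gen t s) y \<in> carrier (opposite (jordan_alg t s))" for y
    by (simp add: antipode_gen_closed)
  show "jordan_antipode s t \<in> algebra_homs (jordan_alg s t) (opposite (jordan_alg t s))"
    "jordan_antipode s t (jordan_gen s t x) = antipode_gen (jordan_alg t s) (jordan_gen t s) x"
    unfolding jordan_antipode_def
    by (rule jordan_induced_hom[OF k_algebra_opposite[OF k_algebra_jordan] c R]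
        jordan_induced_gen[OF k_algebra_opposite[OF k_algebra_jordan] c R])+
qed

lemma jordan_antipode_linear: "jordan_antipode s t \<in> linear_maps (jordan_alg s t) (jordan_alg t s)"
  using algebra_hom_linear[OF jordan_antipode_hom] by (simp add: linear_maps_opposite)

lemma jordan_antipode_mult: "x \<in> carrier (jordan_alg s t) \<Longrightarrow> y \<in> carrier (jordan_alg s t) \<Longrightarrow>
    jordan_antipode s t (x \<otimes>\<^bsub>jordan_alg s t\<^esub> y) = jordan_antipode s t y \<otimes>\<^bsub>jordan_alg t s\<^esub> jordan_antipode s t x"
  using algebra_hom_mult[OF jordan_antipode_hom] by simp

lemma jordan_antipode_one: "jordan_antipode s t \<one>\<^bsub>jordan_alg s t\<^esub> = \<one>\<^bsub>jordan_alg t s\<^esub>"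
  using algebra_hom_one[OF jordan_antipode_hom] by simp

end

lemma jordan_gen_simps:
  "jordan_gen s t Gen_g \<otimes>\<^bsub>jordan_alg s t\<^esub> jordan_gen s t Gen_g_inv = \<one>\<^bsub>jordan_alg s t\<^esub>"
  "jordan_gen s t Gen_g_inv \<otimes>\<^bsub>jordan_alg s t\<^esub> jordan_gen s t Gen_g = \<one>\<^bsub>jordan_alg s t\<^esub>"
  "x \<in> carrier (jordan_alg s t) \<Longrightarrow>
    jordan_gen s t Gen_g \<otimes>\<^bsub>jordan_alg s t\<^esub> (jordan_gen s t Gen_g_inv \<otimes>\<^bsub>jordan_alg s t\<^esub> x) = x"
  using jordan_gen_relations[of s t] ka_assoc[of "jordan_alg s t" "jordan_gen s t Gen_g" "jordan_gen s t Gen_g_inv" x]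
  by (auto simp: jordan_relations_def)

lemma km_cancel:
  assumes "k_module N" "x \<in> carrier N"
  shows "x \<oplus>\<^bsub>N\<^esub> (- 1) \<odot>\<^bsub>N\<^esub> x = \<zero>\<^bsub>N\<^esub>" "(- 1) \<odot>\<^bsub>N\<^esub> x \<oplus>\<^bsub>N\<^esub> x = \<zero>\<^bsub>N\<^esub>"
  using km_smult_l_distr[OF assms, of 1 "- 1"] km_smult_l_distr[OF assms, of "- 1" 1] assms by simp_all

text \<open>Both sides of each axiom are algebra maps, so generators suffice. In the counit axioms
  this uses that \<epsilon> is multiplicative with values in the central scalars.\<close>

lemma cocategory_jordan: "cocategory jordan_alg jordan_comult (jordan_counit :: 'k::field_char_0 \<Rightarrow> _)"
proof
  fix s t u v :: 'k and x :: "'k word_poly set"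
  note m = ka_module[OF k_algebra_jordan]
  note T = k_algebra_tensor[OF k_algebra_jordan k_algebra_jordan]
  show "k_algebra (jordan_alg s t)" by simp
  show "jordan_comult s u t \<in> algebra_homs (jordan_alg s t) (tensor (jordan_alg s u) (jordan_alg u t))"
    by (rule jordan_comult_hom)
  show "jordan_counit s \<in> algebra_homs (jordan_alg s s) ground" by (rule jordan_counit_hom)
  assume x: "x \<in> carrier (jordan_alg s t)"
  show "tensor_assoc (jordan_alg s u) (jordan_alg u v) (jordan_alg v t)
      (tensor_map (tensor (jordan_alg s u) (jordan_alg u v)) (jordan_alg v t) (jordan_comult s u v) id
          (jordan_comult s v t x)) =
    tensor_map (jordan_alg s u) (tensor (jordan_alg u v) (jordan_alg v t)) id (jordan_comult u v t) (jordan_comult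
        s u t x)"
  proof -
    let ?A = "jordan_alg s u" and ?B = "jordan_alg u v" and ?C = "jordan_alg v t"
    have idh: "id \<in> algebra_homs A A" for A :: "('k, 'k word_poly set) module"
      using algebra_hom_id[of A] by (simp add: id_def)
    have h1: "tensor_map (tensor ?A ?B) ?C (jordan_comult s u v) id \<in>
        algebra_homs (tensor (jordan_alg s v) (jordan_alg v t)) (tensor (tensor ?A ?B) ?C)"
      by (rule tensor_map_hom[OF k_algebra_jordan k_algebra_jordan T k_algebra_jordan jordan_comult_hom idh])
    have h2: "tensor_map ?A (tensor ?B ?C) id (jordan_comult u v t) \<in>
        algebra_homs (tensor (jordan_alg s u) (jordan_alg u t)) (tensor ?A (tensor ?B ?C))"
      by (rule tensor_map_hom[OF k_algebra_jordan k_algebra_jordan k_algebra_jordan T idh jordan_comult_hom])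
    note l1 = algebra_hom_linear[OF h1] and l2 = algebra_hom_linear[OF h2]
    have as: "tensor_assoc ?A ?B ?C \<in> algebra_homs (tensor (tensor ?A ?B) ?C) (tensor ?A (tensor ?B ?C))"
      by (rule tensor_assoc_hom[OF k_algebra_jordan k_algebra_jordan k_algebra_jordan])
    note asl = algebra_hom_linear[OF as]
    note L = algebra_hom_comp[OF k_algebra_jordan algebra_hom_comp[OF k_algebra_jordan jordan_comult_hom h1] as]
    note R = algebra_hom_comp[OF k_algebra_jordan jordan_comult_hom h2]
    have mp1: "tensor_map (tensor ?A ?B) ?C (jordan_comult s u v) id (pure_tensor (jordan_alg s v) (jordan_alg v
        t) a b) =
        pure_tensor (tensor ?A ?B) ?C (jordan_comult s u v a) b" if "a \<in> carrier (jordan_alg s v)" "b \<in> carrier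
            (jordan_alg v t)" for a b
      using tensor_map_pure[OF m m ka_module[OF T] m algebra_hom_linear[OF jordan_comult_hom]
          algebra_hom_linear[OF idh] that] by simp
    have mp2: "tensor_map ?A (tensor ?B ?C) id (jordan_comult u v t) (pure_tensor (jordan_alg s u) (jordan_alg u
        t) a b) =
        pure_tensor ?A (tensor ?B ?C) a (jordan_comult u v t b)" if "a \<in> carrier (jordan_alg s u)" "b \<in> carrier
            (jordan_alg u t)" for a b
      using tensor_map_pure[OF m m m ka_module[OF T] algebra_hom_linear[OF idh] algebra_hom_linear[OF
          jordan_comult_hom] that] by simp
    show ?thesis
    proof (rule jordan_hom_eqI[OF k_algebra_tensor[OF k_algebra_jordan T] L R _ x])
      fix y
      show "tensor_assoc ?A ?B ?C (tensor_map (tensor ?A ?B) ?C (jordan_comult s u v) id (jordan_comult s v t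
          (jordan_gen s t y))) =
        tensor_map ?A (tensor ?B ?C) id (jordan_comult u v t) (jordan_comult s u t (jordan_gen s t y))"
        by (cases y)
          (simp_all add: jordan_comult_gen coaction_on_gens_simps linear_add[OF l1] linear_add[OF l2]
              linear_add[OF asl]
            mp1 mp2 pure_tensor_closed T tensor_assoc_pure(2) bilinear_add_left[OF bilinear_pure_tensor]
            bilinear_add_right[OF bilinear_pure_tensor] algebra_hom_one[OF jordan_comult_hom] tensor_one km_a_assoc
            k_algebra_tensor)
    qed
  qed
  show "tensor_lift (jordan_alg s t) (\<lambda>a b. jordan_counit s a \<odot>\<^bsub>jordan_alg s t\<^esub> b) (jordan_comult s s t x) = x"
  proof -
    let ?A = "jordan_alg s s" and ?B = "jordan_alg s t"
    note b = bilinear_smult_comp[OF m algebra_hom_linear[OF jordan_counit_hom] linear_id, of s t s]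
    note l = tensor_lift_linear[OF m m m b] and p = tensor_lift_pure[OF m m m b]
    have h: "(\<lambda>X. tensor_lift ?B (\<lambda>a b. jordan_counit s a \<odot>\<^bsub>?B\<^esub> b) X) \<in> algebra_homs (tensor ?A ?B) ?B"
      by (rule tensor_algebra_homI[OF k_algebra_jordan k_algebra_jordan k_algebra_jordan l])
        (simp_all add: p algebra_hom_one[OF jordan_counit_hom] algebra_hom_mult[OF jordan_counit_hom] mult.commute)
    have "tensor_lift ?B (\<lambda>a b. jordan_counit s a \<odot>\<^bsub>?B\<^esub> b) (jordan_comult s s t (jordan_gen s t y)) = jordan_gen s t
        y" for y
      by (cases y) (simp_all add: jordan_comult_gen coaction_on_gens_simps linear_add[OF l] p pure_tensor_closed
          jordan_counit_gen
          algebra_hom_one[OF jordan_counit_hom])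
    then show ?thesis
      using jordan_hom_eqI[OF k_algebra_jordan algebra_hom_comp[OF k_algebra_jordan jordan_comult_hom h]
          algebra_hom_id _ x] by simp
  qed
  show "tensor_lift (jordan_alg s t) (\<lambda>a b. jordan_counit t b \<odot>\<^bsub>jordan_alg s t\<^esub> a) (jordan_comult s t t x) = x"
  proof -
    let ?A = "jordan_alg s t" and ?B = "jordan_alg t t"
    note b = bilinear_flip[OF bilinear_smult_comp[OF m algebra_hom_linear[OF jordan_counit_hom] linear_id, of s t t]]
    note l = tensor_lift_linear[OF m m m b] and p = tensor_lift_pure[OF m m m b]
    have h: "(\<lambda>X. tensor_lift ?A (\<lambda>a b. jordan_counit t b \<odot>\<^bsub>?A\<^esub> a) X) \<in> algebra_homs (tensor ?A ?B) ?A"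
      by (rule tensor_algebra_homI[OF k_algebra_jordan k_algebra_jordan k_algebra_jordan l])
        (simp_all add: p algebra_hom_one[OF jordan_counit_hom] algebra_hom_mult[OF jordan_counit_hom] mult.commute)
    have "tensor_lift ?A (\<lambda>a b. jordan_counit t b \<odot>\<^bsub>?A\<^esub> a) (jordan_comult s t t (jordan_gen s t y)) = jordan_gen s t
        y" for y
      by (cases y) (simp_all add: jordan_comult_gen coaction_on_gens_simps linear_add[OF l] p pure_tensor_closed
          jordan_counit_gen
          algebra_hom_one[OF jordan_counit_hom])
    then show ?thesis
      using jordan_hom_eqI[OF k_algebra_jordan algebra_hom_comp[OF k_algebra_jordan jordan_comult_hom h]
          algebra_hom_id _ x] by simp
  qed
qed

lemmas jordan_induct [consumes 1, case_names one add smult gen] =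
  presented_induct[where R = "jordan_relators s t" for s t, folded jordan_alg_def jordan_gen_def]

text \<open>For evaluations of the comultiplication that are not multiplicative, so that a check on
  generators would not do. The hypothesis concerns a left factor given by the coaction on one
  generator, as in \<open>jordan_induct\<close>. The index i allows a family to be treated at once:
  for the functionals below, multiplication by g changes the index.\<close>

lemma comult_eq_counit_induct:
  fixes s t :: "'k::field_char_0" and N :: "('k, 'n, 'm) module_scheme"
  defines "T \<equiv> tensor (jordan_alg s t) (jordan_alg t s)"
  assumes N: "k_module N" and e: "e \<in> carrier N" and M: "\<And>i. M i \<in> linear_maps T N"
    and one: "\<And>i. M i \<one>\<^bsub>T\<^esub> = e"
    and step: "\<And>i y Z c. Z \<in> carrier T \<Longrightarrow> (\<And>i. M i Z = c \<odot>\<^bsub>N\<^esub> e) \<Longrightarrow>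
      M i (coaction_on_gens (jordan_alg s t) (jordan_gen s t) (jordan_alg t s) (jordan_gen t s) y \<otimes>\<^bsub>T\<^esub> Z) =
      ((if y = Gen_g \<or> y = Gen_g_inv then 1 else 0) * c) \<odot>\<^bsub>N\<^esub> e"
    and x: "x \<in> carrier (jordan_alg s s)"
  shows "M i (jordan_comult s t s x) = jordan_counit s x \<odot>\<^bsub>N\<^esub> e"
proof -
  note D = jordan_comult_hom[of s t s, folded T_def] and D' = algebra_hom_linear[OF jordan_comult_hom[of s t s,
      folded T_def]]
  note E = jordan_counit_hom[of s] and E' = algebra_hom_linear[OF jordan_counit_hom[of s]]
  have "\<forall>i. M i (jordan_comult s t s x) = jordan_counit s x \<odot>\<^bsub>N\<^esub> e"
    using x
  proof (induction rule: jordan_induct)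
    case one
    show ?case using N e by (simp add: algebra_hom_one[OF D] algebra_hom_one[OF E] assms(5))
  next
    case (add x y)
    then show ?case
      using N e by (simp add: linear_add[OF D'] linear_add[OF E'] linear_add[OF M] linear_closed[OF D']
          km_smult_l_distr)
  next
    case (smult c x)
    then show ?case
      using N e by (simp add: linear_smult[OF D'] linear_smult[OF E'] linear_smult[OF M] linear_closed[OF D'])
  next
    case (gen y x)
    then show ?case
      using step[OF linear_closed[OF D' gen(1)], of "jordan_counit s x"]
      by (simp add: algebra_hom_mult[OF D] algebra_hom_mult[OF E] jordan_comult_gen jordan_counit_gen)
  qed
  then show ?thesis by simp
qed

text \<open>Let M(a \<otimes> b) = S(a) b. As S reverses products, M(Y (c \<otimes> d)) = S(c) M(Y)
  d. For Y the coaction on a generator M(Y) is a scalar, which can be moved out, and S(c) d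
  remains.\<close>

lemma jordan_antipode_left:
  fixes s t :: "'k::field_char_0"
  assumes x: "x \<in> carrier (jordan_alg s s)"
  shows "tensor_lift (jordan_alg t s) (\<lambda>a b. jordan_antipode s t a \<otimes>\<^bsub>jordan_alg t s\<^esub> b) (jordan_comult s t s x) =
    jordan_counit s x \<odot>\<^bsub>jordan_alg t s\<^esub> \<one>\<^bsub>jordan_alg t s\<^esub>"
proof -
  let ?A = "jordan_alg s t" and ?B = "jordan_alg t s"
  let ?S = "jordan_antipode s t" and ?\<Gamma> = "coaction_on_gens (jordan_alg s t) (jordan_gen s t) (jordan_alg t s)
      (jordan_gen t s)"
  note m = ka_module[OF k_algebra_jordan]
  note T = k_algebra_tensor[OF k_algebra_jordan[of s t] k_algebra_jordan[of t s]]
  note b = bilinear_mult_comp[OF k_algebra_jordan[of t s] jordan_antipode_linear[of s t] linear_id]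
  let ?M = "\<lambda>X. tensor_lift ?B (\<lambda>a b. ?S a \<otimes>\<^bsub>?B\<^esub> b) X"
  note l = tensor_lift_linear[OF m m m b] and p = tensor_lift_pure[OF m m m b]
  note Sc = linear_closed[OF jordan_antipode_linear]
  \<comment> \<open>For x1 and x2 this is the cancellation of -g' x against S(g) x = g' x, which
    explains the formula for the antipode.\<close>
  have gen: "?M (?\<Gamma> y) = (if y = Gen_g \<or> y = Gen_g_inv then 1 else 0) \<odot>\<^bsub>?B\<^esub> \<one>\<^bsub>?B\<^esub>" for y
    by (cases y)
      (simp_all add: coaction_on_gens_simps linear_add[OF l] p pure_tensor_closed jordan_antipode_gen
          jordan_gen_simps km_cancel)
  have M_mult: "?M (?\<Gamma> y \<otimes>\<^bsub>tensor ?A ?B\<^esub> X) = (if y = Gen_g \<or> y = Gen_g_inv then 1 else 0) \<odot>\<^bsub>?B\<^esub> ?M X"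
    if X: "X \<in> carrier (tensor ?A ?B)" for X y
  proof (rule tensor_linear_eq[OF m m m linear_comp[OF bilinear_right[OF bilinear_mult[OF T]] l]
        linear_comp_right[OF l bilinear_smult[OF m]] _ X])
    show \<Gamma>: "?\<Gamma> y \<in> carrier (tensor ?A ?B)" by (rule coaction_on_gens_closed) simp_all
    fix c d assume cd: "c \<in> carrier ?A" "d \<in> carrier ?B"
    note cdp = pure_tensor_closed[OF m m cd]
    have "?M (Z \<otimes>\<^bsub>tensor ?A ?B\<^esub> pure_tensor ?A ?B c d) = (?S c \<otimes>\<^bsub>?B\<^esub> ?M Z) \<otimes>\<^bsub>?B\<^esub> d"
      if Z: "Z \<in> carrier (tensor ?A ?B)" for Z
      by (rule tensor_linear_eq[OF m m m linear_comp[OF bilinear_left[OF bilinear_mult[OF T] cdp] l]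
            linear_comp_left[OF linear_comp_right[OF l bilinear_mult[OF k_algebra_jordan]] bilinear_mult[OF
                k_algebra_jordan]] _ Z])
        (use cd in \<open>simp_all add: p pure_tensor_mult jordan_antipode_mult Sc ka_assoc\<close>)
    then show "?M (?\<Gamma> y \<otimes>\<^bsub>tensor ?A ?B\<^esub> pure_tensor ?A ?B c d) =
        (if y = Gen_g \<or> y = Gen_g_inv then 1 else 0) \<odot>\<^bsub>?B\<^esub> ?M (pure_tensor ?A ?B c d)"
      using cd by (simp add: \<Gamma> gen p Sc)
  qed simp
  show ?thesis
    by (rule comult_eq_counit_induct[where M = "\<lambda>_::unit. ?M", OF m _ l _ _ x])
      (simp_all add: M_mult tensor_one p jordan_antipode_one)
qed

text \<open>Now M(a \<otimes> b) = a S(b), and M((c \<otimes> d) Z) = c M(Z) S(d): the inner factor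
  is the right one. Since generators enter on the left, it is the induction hypothesis for Z, not
  the value on the generator, that supplies the central scalar.\<close>

lemma jordan_antipode_right:
  fixes s t :: "'k::field_char_0"
  assumes x: "x \<in> carrier (jordan_alg s s)"
  shows "tensor_lift (jordan_alg s t) (\<lambda>a b. a \<otimes>\<^bsub>jordan_alg s t\<^esub> jordan_antipode t s b) (jordan_comult s t s x) =
    jordan_counit s x \<odot>\<^bsub>jordan_alg s t\<^esub> \<one>\<^bsub>jordan_alg s t\<^esub>"
proof -
  let ?A = "jordan_alg s t" and ?B = "jordan_alg t s"
  let ?S = "jordan_antipode t s" and ?\<Gamma> = "coaction_on_gens (jordan_alg s t) (jordan_gen s t) (jordan_alg t s)
      (jordan_gen t s)"
  note m = ka_module[OF k_algebra_jordan]
  note T = k_algebra_tensor[OF k_algebra_jordan[of s t] k_algebra_jordan[of t s]]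
  note b = bilinear_mult_comp[OF k_algebra_jordan[of s t] linear_id jordan_antipode_linear[of t s]]
  let ?M = "\<lambda>X. tensor_lift ?A (\<lambda>a b. a \<otimes>\<^bsub>?A\<^esub> ?S b) X"
  note l = tensor_lift_linear[OF m m m b] and p = tensor_lift_pure[OF m m m b]
  note Sc = linear_closed[OF jordan_antipode_linear]
  have \<Gamma>: "?\<Gamma> y \<in> carrier (tensor ?A ?B)" for y by (rule coaction_on_gens_closed) simp_all
  have gen: "?M (?\<Gamma> y) = (if y = Gen_g \<or> y = Gen_g_inv then 1 else 0) \<odot>\<^bsub>?A\<^esub> \<one>\<^bsub>?A\<^esub>" for y
    by (cases y)
      (simp_all add: coaction_on_gens_simps linear_add[OF l] p pure_tensor_closed jordan_antipode_gen
          jordan_antipode_one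
        jordan_gen_simps km_cancel)
  have M_mult: "?M (Y \<otimes>\<^bsub>tensor ?A ?B\<^esub> X) = e \<odot>\<^bsub>?A\<^esub> ?M Y"
    if Y: "Y \<in> carrier (tensor ?A ?B)" and X: "X \<in> carrier (tensor ?A ?B)" and e: "?M X = e \<odot>\<^bsub>?A\<^esub> \<one>\<^bsub>?A\<^esub>" for X Y e
  proof (rule tensor_linear_eq[OF m m m linear_comp[OF bilinear_left[OF bilinear_mult[OF T] X] l]
        linear_comp_right[OF l bilinear_smult[OF m]] _ Y])
    fix c d assume cd: "c \<in> carrier ?A" "d \<in> carrier ?B"
    note cdp = pure_tensor_closed[OF m m cd]
    have "?M (pure_tensor ?A ?B c d \<otimes>\<^bsub>tensor ?A ?B\<^esub> Z) = (c \<otimes>\<^bsub>?A\<^esub> ?M Z) \<otimes>\<^bsub>?A\<^esub> ?S d"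
      if Z: "Z \<in> carrier (tensor ?A ?B)" for Z
      by (rule tensor_linear_eq[OF m m m linear_comp[OF bilinear_right[OF bilinear_mult[OF T] cdp] l]
            linear_comp_left[OF linear_comp_right[OF l bilinear_mult[OF k_algebra_jordan]] bilinear_mult[OF
                k_algebra_jordan]] _ Z])
        (use cd in \<open>simp_all add: p pure_tensor_mult jordan_antipode_mult Sc ka_assoc\<close>)
    then show "?M (pure_tensor ?A ?B c d \<otimes>\<^bsub>tensor ?A ?B\<^esub> X) = e \<odot>\<^bsub>?A\<^esub> ?M (pure_tensor ?A ?B c d)"
      using cd by (simp add: X e p Sc)
  qed simp
  show ?thesis
    by (rule comult_eq_counit_induct[where M = "\<lambda>_::unit. ?M", OF m _ l _ _ x])
      (simp_all add: M_mult[OF \<Gamma>] gen tensor_one p jordan_antipode_one mult.commute)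
qed

lemma cogroupoid_jordan: "cogroupoid jordan_alg jordan_comult (jordan_counit :: 'k::field_char_0 \<Rightarrow> _) jordan_antipode"
proof -
  interpret cocategory jordan_alg jordan_comult "jordan_counit :: 'k \<Rightarrow> _" by (rule cocategory_jordan)
  show ?thesis
    by unfold_locales (fact jordan_antipode_linear jordan_antipode_left jordan_antipode_right)+
qed

section \<open>A convolution-invertible functional\<close>

definition operators :: "('k::field, ('x \<Rightarrow> 'k) \<Rightarrow> 'x \<Rightarrow> 'k) module" where
  "operators = \<lparr>carrier = {T. (\<forall>f h. T (\<lambda>x. f x + h x) = (\<lambda>x. T f x + T h x)) \<and> (\<forall>c f. T (\<lambda>x. c * f x) = (\<lambda>x. c *
      T f x))},
     monoid.mult = (\<lambda>S T f. S (T f)), one = (\<lambda>f. f), zero = (\<lambda>f x. 0), add = (\<lambda>S T f x. S f x + T f x),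
     smult = (\<lambda>c T f x. c * T f x)\<rparr>"

lemma k_algebra_operators: "k_algebra (operators :: ('k::field, ('x \<Rightarrow> 'k) \<Rightarrow> 'x \<Rightarrow> 'k) module)"
  by (rule k_algebraI; (rule k_moduleI)?; simp add: operators_def; (simp add: fun_eq_iff algebra_simps)?)

text \<open>The third relation of A(1, 0) becomes x2 = (x1^2 - x1)/2 as soon as x1 and x2 commute;
  with x1 acting as n this polynomial is forced. Its increment from n to n + 1 is n, as the relation
  between g and x2 demands.\<close>

definition binomial2 :: "int \<Rightarrow> 'k::field_char_0" where
  "binomial2 n = of_int n * (of_int n - 1) / 2"

text \<open>
  On functions of \<open>n\<close>, where \<open>g\<close> shifts \<open>n\<close>, \<open>A(1, 0)\<close> acts through \<open>x\<^sub>1 = n\<close> and \<open>x\<^sub>2 = n(n - 1)/2\<close>.  The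
      operators for
  \<open>A(0, 1)\<close> are the negatives of these followed by the shift; hence on the diagonal of the functions of \<open>(m, n)\<close> the
  generators \<open>x\<^sub>i\<close> of \<open>A(0, 0)\<close> act by zero, and those of \<open>A(1, 1)\<close> annihilate the constants.
\<close>

fun left_op :: "gen \<Rightarrow> (int \<Rightarrow> 'k::field_char_0) \<Rightarrow> int \<Rightarrow> 'k" where
  "left_op Gen_g f n = f (n + 1)"
| "left_op Gen_g_inv f n = f (n - 1)"
| "left_op Gen_x1 f n = of_int n * f n"
| "left_op Gen_x2 f n = binomial2 n * f n"

fun right_op :: "gen \<Rightarrow> (int \<Rightarrow> 'k::field_char_0) \<Rightarrow> int \<Rightarrow> 'k" where
  "right_op Gen_g f n = f (n + 1)"
| "right_op Gen_g_inv f n = f (n - 1)"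
| "right_op Gen_x1 f n = - of_int n * f (n + 1)"
| "right_op Gen_x2 f n = - binomial2 n * f (n + 1)"

lemma left_op_closed: "left_op x \<in> carrier operators"
  and right_op_closed: "right_op x \<in> carrier operators"
  by (cases x; simp add: operators_def fun_eq_iff algebra_simps)+

lemma left_op_relations: "jordan_relations operators 1 0 left_op"
  by (simp add: jordan_relations_def operators_def fun_eq_iff binomial2_def field_simps)

lemma right_op_relations: "jordan_relations operators 0 1 right_op"
  by (simp add: jordan_relations_def operators_def fun_eq_iff binomial2_def field_simps)

definition left_rep where "left_rep = induced_map operators left_op"
definition right_rep where "right_rep = induced_map operators right_op"

text \<open>Matrix coefficient of the constant function 1 and evaluation at n. Only n = 0 is used in
  the end, but n stays free because g moves it, and the induction closes only for the whole
  family.\<close>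

definition left_form :: "int \<Rightarrow> 'k::field_char_0 word_poly set \<Rightarrow> 'k" where
  "left_form n a = left_rep a (\<lambda>_. 1) n"
definition right_form :: "int \<Rightarrow> 'k::field_char_0 word_poly set \<Rightarrow> 'k" where
  "right_form n a = right_rep a (\<lambda>_. 1) n"

lemma left_rep_hom: "left_rep \<in> algebra_homs (jordan_alg 1 0) operators"
  and left_rep_gen: "left_rep (jordan_gen 1 0 x) = left_op x"
  unfolding left_rep_def
  by (rule jordan_induced_hom[OF k_algebra_operators left_op_closed left_op_relations]
      jordan_induced_gen[OF k_algebra_operators left_op_closed left_op_relations])+

lemma right_rep_hom: "right_rep \<in> algebra_homs (jordan_alg 0 1) operators"
  and right_rep_gen: "right_rep (jordan_gen 0 1 x) = right_op x"
  unfolding right_rep_def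
  by (rule jordan_induced_hom[OF k_algebra_operators right_op_closed right_op_relations]
      jordan_induced_gen[OF k_algebra_operators right_op_closed right_op_relations])+

lemma left_form_linear: "left_form n \<in> linear_maps (jordan_alg 1 0) ground"
  by (rule linear_mapsI)
    (simp_all add: left_form_def linear_add[OF algebra_hom_linear[OF left_rep_hom]] linear_smult[OF
        algebra_hom_linear[OF left_rep_hom]],
     simp_all add: operators_def)

lemma right_form_linear: "right_form n \<in> linear_maps (jordan_alg 0 1) ground"
  by (rule linear_mapsI)
    (simp_all add: right_form_def linear_add[OF algebra_hom_linear[OF right_rep_hom]] linear_smult[OF
        algebra_hom_linear[OF right_rep_hom]],
     simp_all add: operators_def)

lemma left_form_one: "left_form n \<one>\<^bsub>jordan_alg 1 0\<^esub> = 1"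
  and right_form_one: "right_form n \<one>\<^bsub>jordan_alg 0 1\<^esub> = 1"
  by (simp_all add: left_form_def right_form_def algebra_hom_one[OF left_rep_hom] algebra_hom_one[OF right_rep_hom])
    (simp_all add: operators_def)

text \<open>The function n \<mapsto> \<open>left_form n a\<close> is the image of the constant 1
  under \<open>a\<close>, so a generator on the left acts on it through its operator. This turns the
  forms into recursions.\<close>

lemma left_form_gen:
  assumes "a \<in> carrier (jordan_alg 1 0)"
  shows "left_form n (jordan_gen 1 0 x \<otimes>\<^bsub>jordan_alg 1 0\<^esub> a) = left_op x (\<lambda>n. left_form n a) n"
  using algebra_hom_mult[OF left_rep_hom jordan_gen_closed assms, of x]
  by (simp add: left_form_def left_rep_gen) (simp add: operators_def left_form_def[abs_def])

lemma right_form_gen: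
  assumes "a \<in> carrier (jordan_alg 0 1)"
  shows "right_form n (jordan_gen 0 1 x \<otimes>\<^bsub>jordan_alg 0 1\<^esub> a) = right_op x (\<lambda>n. right_form n a) n"
  using algebra_hom_mult[OF right_rep_hom jordan_gen_closed assms, of x]
  by (simp add: right_form_def right_rep_gen) (simp add: operators_def right_form_def[abs_def])

text \<open>When a and b act on the two forms by a scalar and a change of index, multiplying by a
  \<otimes> b does the same to the pairing. With the operators above, this covers each pure tensor
  in the coaction on a generator.\<close>

lemma pairing_mult:
  fixes P :: "('k::field, 'a, 'l) module_scheme" and Q :: "('k, 'b, 'm) module_scheme"
  assumes P: "k_algebra P" and Q: "k_algebra Q"
    and \<alpha>: "\<And>m. \<alpha> m \<in> linear_maps P ground" and \<beta>: "\<And>n. \<beta> n \<in> linear_maps Q ground"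
    and a: "a \<in> carrier P" and b: "b \<in> carrier Q"
    and \<alpha>a: "\<And>c. c \<in> carrier P \<Longrightarrow> \<alpha> m (a \<otimes>\<^bsub>P\<^esub> c) = p * \<alpha> m' c"
    and \<beta>b: "\<And>d. d \<in> carrier Q \<Longrightarrow> \<beta> n (b \<otimes>\<^bsub>Q\<^esub> d) = q * \<beta> n' d"
    and Z: "Z \<in> carrier (tensor P Q)"
  shows "tensor_lift ground (\<lambda>x y. \<alpha> m x * \<beta> n y) (pure_tensor P Q a b \<otimes>\<^bsub>tensor P Q\<^esub> Z) =
    p * q * tensor_lift ground (\<lambda>x y. \<alpha> m' x * \<beta> n' y) Z"
proof -
  note m = ka_module[OF P] ka_module[OF Q]
  note bil = bilinear_mult_comp[OF k_algebra_ground \<alpha> \<beta>, simplified]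
  note l = tensor_lift_linear[OF m k_module_ground bil] and pp = tensor_lift_pure[OF m k_module_ground bil]
  have scale: "(\<lambda>r. d * r) \<in> linear_maps ground ground" for d :: 'k
    by (rule linear_mapsI) (simp_all add: algebra_simps)
  show ?thesis
    by (rule tensor_linear_eq[OF m k_module_ground linear_comp[OF bilinear_right[OF bilinear_mult[OF
        k_algebra_tensor[OF P Q]]] l]
          linear_comp[OF l scale] _ Z])
      (simp_all add: P Q a b pure_tensor_mult pure_tensor_closed pp \<alpha>a \<beta>b)
qed

lemma left_right_counit:
  fixes x :: "'k::field_char_0 word_poly set"
  assumes x: "x \<in> carrier (jordan_alg 1 1)"
  shows "tensor_lift ground (\<lambda>a b. left_form n a * right_form n b) (jordan_comult 1 0 1 x) = jordan_counit 1 x"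
proof -
  let ?P = "jordan_alg 1 0 :: ('k, _) module" and ?Q = "jordan_alg 0 1 :: ('k, _) module"
  note m = ka_module[OF k_algebra_jordan]
  have T: "k_algebra (tensor ?P ?Q)" by (rule k_algebra_tensor) simp_all
  note bil = bilinear_mult_comp[OF k_algebra_ground left_form_linear right_form_linear, simplified]
  let ?\<Psi> = "\<lambda>m n. tensor_lift ground (\<lambda>a b. left_form m a * right_form n b)"
  note l = tensor_lift_linear[OF m m k_module_ground bil] and p = tensor_lift_pure[OF m m k_module_ground bil]
  note pm = pairing_mult[OF k_algebra_jordan k_algebra_jordan left_form_linear right_form_linear]
  have pg: "pure_tensor ?P ?Q a b \<in> carrier (tensor ?P ?Q)" if "a \<in> carrier ?P" "b \<in> carrier ?Q" for a b
    by (rule pure_tensor_closed[OF m m that])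
  have "?\<Psi> n n (jordan_comult 1 0 1 x) = jordan_counit 1 x \<odot>\<^bsub>ground\<^esub> 1"
  proof (rule comult_eq_counit_induct[where M = "\<lambda>n. ?\<Psi> n n", OF k_module_ground _ l _ _ x])
    fix n y Z and c :: 'k
    assume Z: "Z \<in> carrier (tensor ?P ?Q)" and IH: "\<And>n. ?\<Psi> n n Z = c \<odot>\<^bsub>ground\<^esub> 1"
    have "?\<Psi> n n (pure_tensor ?P ?Q (jordan_gen 1 0 Gen_g) (jordan_gen 0 1 Gen_g) \<otimes>\<^bsub>tensor ?P ?Q\<^esub> Z) = 1 * 1 * ?\<Psi> (n
        + 1) (n + 1) Z"
      "?\<Psi> n n (pure_tensor ?P ?Q (jordan_gen 1 0 Gen_g_inv) (jordan_gen 0 1 Gen_g_inv) \<otimes>\<^bsub>tensor ?P ?Q\<^esub> Z) = 1 * 1 *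
          ?\<Psi> (n - 1) (n - 1) Z"
      "?\<Psi> n n (pure_tensor ?P ?Q (jordan_gen 1 0 Gen_x1) \<one>\<^bsub>?Q\<^esub> \<otimes>\<^bsub>tensor ?P ?Q\<^esub> Z) = of_int n * 1 * ?\<Psi> n n Z"
      "?\<Psi> n n (pure_tensor ?P ?Q (jordan_gen 1 0 Gen_x2) \<one>\<^bsub>?Q\<^esub> \<otimes>\<^bsub>tensor ?P ?Q\<^esub> Z) = binomial2 n * 1 * ?\<Psi> n n Z"
      "?\<Psi> n n (pure_tensor ?P ?Q (jordan_gen 1 0 Gen_g) (jordan_gen 0 1 Gen_x1) \<otimes>\<^bsub>tensor ?P ?Q\<^esub> Z) = 1 * - of_int n
          * ?\<Psi> (n + 1) (n + 1) Z"
      "?\<Psi> n n (pure_tensor ?P ?Q (jordan_gen 1 0 Gen_g) (jordan_gen 0 1 Gen_x2) \<otimes>\<^bsub>tensor ?P ?Q\<^esub> Z) = 1 * - binomial2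
          n * ?\<Psi> (n + 1) (n + 1) Z"
      by (rule pm[OF _ _ _ _ Z]; simp add: left_form_gen right_form_gen)+
    \<comment> \<open>For x1 the two terms are n times the diagonal value at n and -n times that at
      n + 1. They cancel because the hypothesis makes the diagonal values independent of n;
      similarly for x2.\<close>
    then show "?\<Psi> n n (coaction_on_gens ?P (jordan_gen 1 0) ?Q (jordan_gen 0 1) y \<otimes>\<^bsub>tensor ?P ?Q\<^esub> Z) =
        ((if y = Gen_g \<or> y = Gen_g_inv then 1 else 0) * c) \<odot>\<^bsub>ground\<^esub> 1"
      using Z T IH by (cases y) (simp_all add: coaction_on_gens_simps ka_l_distr pg linear_add[OF l])
  qed (simp_all add: tensor_one p left_form_one right_form_one)
  then show ?thesis by simp
qed

lemma right_left_counit: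
  fixes x :: "'k::field_char_0 word_poly set"
  assumes x: "x \<in> carrier (jordan_alg 0 0)"
  shows "tensor_lift ground (\<lambda>a b. right_form n a * left_form n b) (jordan_comult 0 1 0 x) = jordan_counit 0 x"
proof -
  let ?P = "jordan_alg 0 1 :: ('k, _) module" and ?Q = "jordan_alg 1 0 :: ('k, _) module"
  note m = ka_module[OF k_algebra_jordan]
  have T: "k_algebra (tensor ?P ?Q)" by (rule k_algebra_tensor) simp_all
  note bil = bilinear_mult_comp[OF k_algebra_ground right_form_linear left_form_linear, simplified]
  let ?\<Psi> = "\<lambda>m n. tensor_lift ground (\<lambda>a b. right_form m a * left_form n b)"
  note l = tensor_lift_linear[OF m m k_module_ground bil] and p = tensor_lift_pure[OF m m k_module_ground bil]
  note pm = pairing_mult[OF k_algebra_jordan k_algebra_jordan right_form_linear left_form_linear]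
  have pg: "pure_tensor ?P ?Q a b \<in> carrier (tensor ?P ?Q)" if "a \<in> carrier ?P" "b \<in> carrier ?Q" for a b
    by (rule pure_tensor_closed[OF m m that])
  have "?\<Psi> n n (jordan_comult 0 1 0 x) = jordan_counit 0 x \<odot>\<^bsub>ground\<^esub> 1"
  proof (rule comult_eq_counit_induct[where M = "\<lambda>n. ?\<Psi> n n", OF k_module_ground _ l _ _ x])
    fix n y Z and c :: 'k
    assume Z: "Z \<in> carrier (tensor ?P ?Q)" and IH: "\<And>n. ?\<Psi> n n Z = c \<odot>\<^bsub>ground\<^esub> 1"
    have "?\<Psi> n n (pure_tensor ?P ?Q (jordan_gen 0 1 Gen_g) (jordan_gen 1 0 Gen_g) \<otimes>\<^bsub>tensor ?P ?Q\<^esub> Z) = 1 * 1 * ?\<Psi> (n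
        + 1) (n + 1) Z"
      "?\<Psi> n n (pure_tensor ?P ?Q (jordan_gen 0 1 Gen_g_inv) (jordan_gen 1 0 Gen_g_inv) \<otimes>\<^bsub>tensor ?P ?Q\<^esub> Z) = 1 * 1 *
          ?\<Psi> (n - 1) (n - 1) Z"
      "?\<Psi> n n (pure_tensor ?P ?Q (jordan_gen 0 1 Gen_x1) \<one>\<^bsub>?Q\<^esub> \<otimes>\<^bsub>tensor ?P ?Q\<^esub> Z) = - of_int n * 1 * ?\<Psi> (n + 1) n Z"
      "?\<Psi> n n (pure_tensor ?P ?Q (jordan_gen 0 1 Gen_x2) \<one>\<^bsub>?Q\<^esub> \<otimes>\<^bsub>tensor ?P ?Q\<^esub> Z) = - binomial2 n * 1 * ?\<Psi> (n + 1) n Z"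
      "?\<Psi> n n (pure_tensor ?P ?Q (jordan_gen 0 1 Gen_g) (jordan_gen 1 0 Gen_x1) \<otimes>\<^bsub>tensor ?P ?Q\<^esub> Z) = 1 * of_int n *
          ?\<Psi> (n + 1) n Z"
      "?\<Psi> n n (pure_tensor ?P ?Q (jordan_gen 0 1 Gen_g) (jordan_gen 1 0 Gen_x2) \<otimes>\<^bsub>tensor ?P ?Q\<^esub> Z) = 1 * binomial2 n
          * ?\<Psi> (n + 1) n Z"
      by (rule pm[OF _ _ _ _ Z]; simp add: left_form_gen right_form_gen)+
    \<comment> \<open>For x1 and x2 both terms involve the same off-diagonal value, at (n + 1, n),
      with opposite coefficients, so they cancel before the hypothesis is used; it is needed only
      for g and its inverse.\<close>
    then show "?\<Psi> n n (coaction_on_gens ?P (jordan_gen 0 1) ?Q (jordan_gen 1 0) y \<otimes>\<^bsub>tensor ?P ?Q\<^esub> Z) =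
        ((if y = Gen_g \<or> y = Gen_g_inv then 1 else 0) * c) \<odot>\<^bsub>ground\<^esub> 1"
      using Z T IH by (cases y) (simp_all add: coaction_on_gens_simps ka_l_distr pg linear_add[OF l])
  qed (simp_all add: tensor_one p left_form_one right_form_one)
  then show ?thesis by simp
qed

theorem proposition4p6:
  shows "bigalois_extension
           (U_jordan :: ('k::field_char_0, 'k word_poly set) bialgebra)
           (jordan_bosonization :: ('k, 'k word_poly set) bialgebra)
           (U' :: ('k, 'k word_poly set) module)
           U'_left_coaction U'_right_coaction
       \<and> cocycle_deformation
           (U_jordan :: ('k, 'k word_poly set) bialgebra)
           (jordan_bosonization :: ('k, 'k word_poly set) bialgebra)"
proof -
  interpret cogroupoid jordan_alg jordan_comult "jordan_counit :: 'k \<Rightarrow> _" jordan_antipode by (rule cogroupoid_jordan)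
  \<comment> \<open>The three presentations have the same relators as members of the family, so the
    algebras are equal and not merely isomorphic.\<close>
  have eqs: "U_jordan = bialg (1 :: 'k)" "jordan_bosonization = bialg (0 :: 'k)" "U' = (jordan_alg 1 0 :: ('k, _)
      module)"
    by (simp_all add: U_jordan_def jordan_bosonization_def U'_def presented_bialgebra_with_coalgebra
        jordan_relators_instances
      jordan_comult_def jordan_counit_def jordan_alg_def jordan_gen_def)
  have co: "U'_left_coaction = jordan_comult 1 1 (0 :: 'k)" "U'_right_coaction = jordan_comult 1 0 (0 :: 'k)"
    by (simp_all add: U'_left_coaction_def U'_right_coaction_def eqs)
      (simp_all add: jordan_relators_instances jordan_comult_def jordan_gen_def)
  have "inverse_pair 1 0 (left_form 0) (right_form 0 :: _ \<Rightarrow> 'k)"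
    by (simp add: inverse_pair_def left_form_linear right_form_linear left_form_one right_form_one
      sw_def left_right_counit right_left_counit)
  \<comment> \<open>\<open>left_form 0\<close> serves twice: in the inverse pair, and as the
    functional with value 1 at 1 that makes A(1, 0) nonzero with scalar coinvariants.\<close>
  from cocycle_deformation_bialg[OF this] bigalois_extension_bialg[OF left_form_linear[of 0] left_form_one]
  show ?thesis by (simp add: eqs co)
qed

end
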